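(* Let $\varepsilon\in\{\pm1\}$. Let $L^\flat$ be an integral quadratic $O_F$-lattice of rank $n-1$ with fundamental invariants $(a_1,\dots,a_{n-1})$. Let $x$ be a vector orthogonal to $L^\flat$ (in an ambient quadratic space) with $(x,x)\ne0$ and $\mathrm{val}((x,x))>a_{n-1}$, and put $L=L^\flat+\langle x\rangle$, $\widetilde L=L^\flat+\langle\varpi^{-1}x\rangle$. Then $$\mathrm{Den}^\varepsilon(X,L)=X^2\,\mathrm{Den}^\varepsilon(X,\widetilde L)+(1-\varepsilon\chi(L^\flat)X)^{-1}(1-X^2)\,\mathrm{Den}^{\flat\varepsilon}(X,L^\flat).$$
   Context: $F$ is a non-archimedean local field of odd residue characteristic, $O_F$, $\varpi$, residue field of size $q$, $\mathrm{val}$ the normalized valuation. For an integral lattice, $L^\vee/L\simeq\oplus O_F/\varpi^{a_i}$ defines the fundamental invariants $a_1\le\dots\le a_r$. $\chi(M)$ is the quadratic residue symbol ($\pm1$ or $0$) of $\mathrm{disc}(M)=(-1)^{r(r-1)/2}\det M$. $H^\varepsilon_r$ = self-dual lattice of rank $r$ with discriminant symbol $\varepsilon$; $\mathrm{Den}(M,L)$ = local representation density. For a lattice $L$ of rank $n$: $\mathrm{Nor}^\varepsilon(X,L)=(1-\mathrm{sgn}(H^\varepsilon_{n+1})q^{-(n+1)/2}X)\prod_{1\le i<(n+1)/2}(1-q^{-2i}X^2)$ with $\mathrm{sgn}(H^\varepsilon_{r})=\varepsilon$ for $r$ even and $0$ for $r$ odd, and $\mathrm{Den}^\varepsilon(X,L)$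 is the unique polynomial with $\mathrm{Den}(H^\varepsilon_{n+1+2k},L)=\mathrm{Nor}^\varepsilon(q^{-k},L)\mathrm{Den}^\varepsilon(q^{-k},L)$ for all $k\ge0$. For a lattice $M$ of rank $r$: $\mathrm{Nor}^{\flat\varepsilon}(X,M)=(1-\mathrm{sgn}(H^\varepsilon_r)q^{-r/2}X)(1-\varepsilon\chi(M)X)^{-1}\prod_{0\le i<r/2}(1-q^{-2i}X^2)$, and $\mathrm{Den}^{\flat\varepsilon}(X,M)$ is the unique polynomial with $\mathrm{Den}(H^\varepsilon_{r+2k},M)=\mathrm{Nor}^{\flat\varepsilon}(q^{-k},M)\mathrm{Den}^{\flat\varepsilon}(q^{-k},M)$ for all $k\ge0$ (here $r=n-1$). *)

theory Defs
  imports
    "Jordan_Normal_Form.Determinant"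
    "HOL-Computational_Algebra.Polynomial_Factorial"
    "HOL-Library.FuncSet"
    "HOL-Library.Function_Algebras"
begin

section \<open>Non-archimedean local fields\<close>

text \<open>The valuation is integer-valued; its value at 0 is irrelevant, since every use goes
  through the fractional ideals \<open>\<pp>\<^sup>k = \<varpi>\<^sup>k O\<^sub>F\<close>, which contain 0 by definition.\<close>

definition frac_ideal :: "('a::field \<Rightarrow> int) \<Rightarrow> int \<Rightarrow> 'a set" where
  "frac_ideal val k = {x. x = 0 \<or> k \<le> val x}"

abbreviation integers :: "('a::field \<Rightarrow> int) \<Rightarrow> 'a set" where
  "integers val \<equiv> frac_ideal val 0"

definition residue_field :: "('a::field \<Rightarrow> int) \<Rightarrow> 'a set set" where
  "residue_field val = integers val //
     {(x, y). x \<in> integers val \<and> y \<in> integers val \<and> x - y \<in> frac_ideal val 1}"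

definition residue_size :: "('a::field \<Rightarrow> int) \<Rightarrow> nat" where
  "residue_size val = card (residue_field val)"

locale nonarch_local_field =
  fixes val :: "'a::field \<Rightarrow> int"
  assumes val_mult: "x \<noteq> 0 \<Longrightarrow> y \<noteq> 0 \<Longrightarrow> val (x * y) = val x + val y"
    and val_add: "x \<noteq> 0 \<Longrightarrow> y \<noteq> 0 \<Longrightarrow> x + y \<noteq> 0 \<Longrightarrow> min (val x) (val y) \<le> val (x + y)"
    and val_normalized: "\<exists>\<pi>. \<pi> \<noteq> 0 \<and> val \<pi> = 1"
    and complete:
      "(\<forall>k. \<exists>N. \<forall>i\<ge>N. \<forall>j\<ge>N. X i - X j \<in> frac_ideal val k) \<Longrightarrow>
       \<exists>l. \<forall>k. \<exists>N. \<forall>i\<ge>N. (X :: nat \<Rightarrow> 'a) i - l \<in> frac_ideal val k"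
    and finite_residue_field: "finite (residue_field val)"

text \<open>Residue characteristic different from 2: the element 2 is nonzero in the residue field.\<close>

locale nonarch_local_field_odd = nonarch_local_field val
  for val :: "'a::field \<Rightarrow> int" +
  assumes two_nonzero: "(2::'a) \<notin> frac_ideal val 1"

text \<open>The quadratic residue symbol on \<open>F\<^sup>\<times>/(F\<^sup>\<times>)\<^sup>2\<close>: it is 0 on odd valuations, and for
  \<open>a = \<varpi>\<^sup>2\<^sup>k u\<close> with a unit \<open>u\<close> it says whether \<open>u\<close> is a square modulo \<open>\<varpi>\<close>, i.e. whether
  \<open>a \<equiv> b\<^sup>2\<close> modulo \<open>\<varpi>\<^sup>2\<^sup>k\<^sup>+\<^sup>1\<close> for some \<open>b\<close>.\<close>

definition residue_symbol :: "('a::field \<Rightarrow> int) \<Rightarrow> 'a \<Rightarrow> int" where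
  "residue_symbol val a =
     (if odd (val a) then 0
      else if \<exists>b. a - b\<^sup>2 \<in> frac_ideal val (val a + 1) then 1 else - 1)"


section \<open>Quadratic lattices\<close>

locale quadratic_space = vector_space scale
  for scale :: "'a::field \<Rightarrow> 'v::ab_group_add \<Rightarrow> 'v" +
  fixes B :: "'v \<Rightarrow> 'v \<Rightarrow> 'a"
  assumes B_sym: "B u v = B v u"
    and B_add: "B (u + v) w = B u w + B v w"
    and B_scale: "B (scale c u) w = c * B u w"

definition lattice_basis ::
  "('a::field \<Rightarrow> int) \<Rightarrow> ('a \<Rightarrow> 'v::ab_group_add \<Rightarrow> 'v) \<Rightarrow> nat \<Rightarrow> (nat \<Rightarrow> 'v) \<Rightarrow> 'v set \<Rightarrow> bool" where
  "lattice_basis val scale r b L \<longleftrightarrow>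
     inj_on b {..<r} \<and> \<not> Modules.module.dependent scale (b ` {..<r}) \<and>
     L = {\<Sum>i<r. scale (c i) (b i) | c. \<forall>i<r. c i \<in> integers val}"

definition quadratic_lattice ::
  "('a::field \<Rightarrow> int) \<Rightarrow> ('a \<Rightarrow> 'v::ab_group_add \<Rightarrow> 'v) \<Rightarrow> ('v \<Rightarrow> 'v \<Rightarrow> 'a) \<Rightarrow> nat \<Rightarrow> 'v set \<Rightarrow> bool" where
  "quadratic_lattice val scale B r L \<longleftrightarrow>
     (\<exists>b. lattice_basis val scale r b L) \<and> (\<forall>u\<in>L. (\<forall>v\<in>L. B u v = 0) \<longrightarrow> u = 0)"

definition dual_lattice ::
  "('a::field \<Rightarrow> int) \<Rightarrow> ('a \<Rightarrow> 'v::ab_group_add \<Rightarrow> 'v) \<Rightarrow> ('v \<Rightarrow> 'v \<Rightarrow> 'a) \<Rightarrow> 'v set \<Rightarrow> 'v set" where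
  "dual_lattice val scale B L =
     {v \<in> Modules.module.span scale L. \<forall>u\<in>L. B v u \<in> integers val}"

definition integral_lattice ::
  "('a::field \<Rightarrow> int) \<Rightarrow> ('a \<Rightarrow> 'v::ab_group_add \<Rightarrow> 'v) \<Rightarrow> ('v \<Rightarrow> 'v \<Rightarrow> 'a) \<Rightarrow> 'v set \<Rightarrow> bool" where
  "integral_lattice val scale B L \<longleftrightarrow> L \<subseteq> dual_lattice val scale B L"

text \<open>An isomorphism \<open>L\<^sup>\<or>/L \<simeq> \<Oplus>\<^sub>i O\<^sub>F/\<varpi>\<^sup>a\<^sup>i\<close> of \<open>O\<^sub>F\<close>-modules is the same as a surjective linear
  map from \<open>L\<^sup>\<or>\<close> onto the right-hand side with kernel \<open>L\<close>; \<open>f v i\<close> is a representative in \<open>O\<^sub>F\<close> of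
  the \<open>i\<close>-th component of the image of \<open>v\<close>. The index \<open>i\<close> runs from 1 to \<open>r\<close>.\<close>

definition fundamental_invariants ::
  "('a::field \<Rightarrow> int) \<Rightarrow> ('a \<Rightarrow> 'v::ab_group_add \<Rightarrow> 'v) \<Rightarrow> ('v \<Rightarrow> 'v \<Rightarrow> 'a) \<Rightarrow> nat \<Rightarrow> 'v set \<Rightarrow>
     (nat \<Rightarrow> nat) \<Rightarrow> bool" where
  "fundamental_invariants val scale B r L a \<longleftrightarrow>
     mono_on {1..r} a \<and>
     (\<exists>f :: 'v \<Rightarrow> nat \<Rightarrow> 'a. let D = dual_lattice val scale B L in
        (\<forall>v\<in>D. \<forall>i\<in>{1..r}. f v i \<in> integers val) \<and>
        (\<forall>u\<in>D. \<forall>v\<in>D. \<forall>i\<in>{1..r}. f (u + v) i - (f u i + f v i) \<in> frac_ideal val (int (a i))) \<and>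
        (\<forall>c\<in>integers val. \<forall>v\<in>D. \<forall>i\<in>{1..r}.
           f (scale c v) i - c * f v i \<in> frac_ideal val (int (a i))) \<and>
        (\<forall>v\<in>D. (\<forall>i\<in>{1..r}. f v i \<in> frac_ideal val (int (a i))) \<longleftrightarrow> v \<in> L) \<and>
        (\<forall>c. (\<forall>i\<in>{1..r}. c i \<in> integers val) \<longrightarrow>
           (\<exists>v\<in>D. \<forall>i\<in>{1..r}. f v i - c i \<in> frac_ideal val (int (a i)))))"

definition basis_disc :: "('v \<Rightarrow> 'v \<Rightarrow> 'a::field) \<Rightarrow> nat \<Rightarrow> (nat \<Rightarrow> 'v) \<Rightarrow> 'a" where
  "basis_disc B r b =
     (- 1) ^ (r * (r - 1) div 2) * Determinant.det (Matrix.mat r r (\<lambda>(i, j). B (b i) (b j)))"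

text \<open>Changing the basis multiplies the discriminant by the square of a unit, so the choice of a
  basis does not affect \<open>\<chi>(L)\<close>.\<close>

definition lattice_chi ::
  "('a::field \<Rightarrow> int) \<Rightarrow> ('a \<Rightarrow> 'v::ab_group_add \<Rightarrow> 'v) \<Rightarrow> ('v \<Rightarrow> 'v \<Rightarrow> 'a) \<Rightarrow> nat \<Rightarrow> 'v set \<Rightarrow> int" where
  "lattice_chi val scale B r L =
     residue_symbol val (basis_disc B r (SOME b. lattice_basis val scale r b L))"

definition add_vector ::
  "('a::field \<Rightarrow> int) \<Rightarrow> ('a \<Rightarrow> 'v::ab_group_add \<Rightarrow> 'v) \<Rightarrow> 'v set \<Rightarrow> 'v \<Rightarrow> 'v set" where
  "add_vector val scale L x = {u + scale c x | u c. u \<in> L \<and> c \<in> integers val}"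


section \<open>Local densities\<close>

text \<open>\<open>M/\<varpi>\<^sup>N M\<close>\<close>

definition lattice_mod ::
  "('a::field \<Rightarrow> int) \<Rightarrow> ('a \<Rightarrow> 'w::ab_group_add \<Rightarrow> 'w) \<Rightarrow> 'w set \<Rightarrow> nat \<Rightarrow> 'w set set" where
  "lattice_mod val scale M N =
     M // {(w, w'). w \<in> M \<and> w' \<in> M \<and>
             (\<exists>c\<in>frac_ideal val (int N). \<exists>z\<in>M. w' - w = scale c z)}"

text \<open>The set \<open>Rep\<^sub>M\<^sub>,\<^sub>L(O\<^sub>F/\<varpi>\<^sup>N)\<close>. A linear map \<open>L/\<varpi>\<^sup>N L \<rightarrow> M/\<varpi>\<^sup>N M\<close> is given by the linear map
  \<open>g : L \<rightarrow> M/\<varpi>\<^sup>N M\<close> it induces, the values of \<open>g\<close> being cosets. If \<open>M\<close> is integral and \<open>L\<close> is not,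
  then there is no such \<open>g\<close>, so the density of a non-integral lattice is 0.\<close>

definition Rep ::
  "('a::field \<Rightarrow> int) \<Rightarrow> ('a \<Rightarrow> 'w::ab_group_add \<Rightarrow> 'w) \<Rightarrow> ('w \<Rightarrow> 'w \<Rightarrow> 'a) \<Rightarrow> 'w set \<Rightarrow>
     ('a \<Rightarrow> 'v::ab_group_add \<Rightarrow> 'v) \<Rightarrow> ('v \<Rightarrow> 'v \<Rightarrow> 'a) \<Rightarrow> 'v set \<Rightarrow> nat \<Rightarrow> ('v \<Rightarrow> 'w set) set" where
  "Rep val scaleM BM M scaleL BL L N =
     {g \<in> L \<rightarrow>\<^sub>E lattice_mod val scaleM M N.
        (\<forall>u\<in>L. \<forall>v\<in>L. \<forall>x\<in>g u. \<forall>y\<in>g v. x + y \<in> g (u + v)) \<and>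
        (\<forall>c\<in>integers val. \<forall>u\<in>L. \<forall>x\<in>g u. scaleM c x \<in> g (scaleL c u)) \<and>
        (\<forall>u\<in>L. \<forall>v\<in>L. \<forall>x\<in>g u. \<forall>y\<in>g v. BM x y - BL u v \<in> frac_ideal val (int N))}"

text \<open>Here \<open>m\<close> and \<open>n\<close> are the ranks of \<open>M\<close> and \<open>L\<close>, with \<open>n \<le> m\<close>; the exponent is \<open>N\<close> times
  \<open>dim O\<^sub>m - dim O\<^sub>m\<^sub>-\<^sub>n\<close>, the dimension of the generic fibre of \<open>Rep\<^sub>M\<^sub>,\<^sub>L\<close>.\<close>

definition Den ::
  "('a::field \<Rightarrow> int) \<Rightarrow> ('a \<Rightarrow> 'w::ab_group_add \<Rightarrow> 'w) \<Rightarrow> ('w \<Rightarrow> 'w \<Rightarrow> 'a) \<Rightarrow> nat \<Rightarrow> 'w set \<Rightarrow>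
     ('a \<Rightarrow> 'v::ab_group_add \<Rightarrow> 'v) \<Rightarrow> ('v \<Rightarrow> 'v \<Rightarrow> 'a) \<Rightarrow> nat \<Rightarrow> 'v set \<Rightarrow> real" where
  "Den val scaleM BM m M scaleL BL n L =
     lim (\<lambda>N. real (card (Rep val scaleM BM M scaleL BL L N)) /
               real (residue_size val) ^ (N * (m * n - (n * (n + 1)) div 2)))"

text \<open>\<open>M\<close> is a copy of \<open>H\<^sup>\<epsilon>\<^sub>r\<close>, realized in the space of sequences with entries in \<open>F\<close>, in which
  lattices of every rank occur. Such lattices are unique up to isometry, and exist for \<open>r \<ge> 1\<close>.\<close>

definition fun_scale :: "'a::field \<Rightarrow> (nat \<Rightarrow> 'a) \<Rightarrow> (nat \<Rightarrow> 'a)" where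
  "fun_scale c x = (\<lambda>i. c * x i)"

definition self_dual_lattice ::
  "('a::field \<Rightarrow> int) \<Rightarrow> int \<Rightarrow> nat \<Rightarrow> ((nat \<Rightarrow> 'a) \<Rightarrow> (nat \<Rightarrow> 'a) \<Rightarrow> 'a) \<Rightarrow> (nat \<Rightarrow> 'a) set \<Rightarrow> bool" where
  "self_dual_lattice val \<epsilon> r BM M \<longleftrightarrow>
     quadratic_space fun_scale BM \<and>
     quadratic_lattice val fun_scale BM r M \<and>
     M = dual_lattice val fun_scale BM M \<and>
     lattice_chi val fun_scale BM r M = \<epsilon>"


section \<open>Normalizing factors and density polynomials\<close>

definition sgn_H :: "int \<Rightarrow> nat \<Rightarrow> int" where
  "sgn_H \<epsilon> r = (if even r then \<epsilon> else 0)"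

definition Nor :: "nat \<Rightarrow> int \<Rightarrow> nat \<Rightarrow> real poly" where
  "Nor q \<epsilon> n =
     [:1, - (real_of_int (sgn_H \<epsilon> (n + 1)) * real q powr (- (real (n + 1) / 2))):] *
     (\<Prod>i | 1 \<le> i \<and> 2 * i < n + 1. [:1, 0, - (1 / real q ^ (2 * i)):])"

text \<open>For \<open>r \<ge> 1\<close>, \<open>\<epsilon> = \<plusminus>1\<close> and \<open>\<chi> \<in> {0, 1, -1}\<close>, \<open>1 - \<epsilon>\<chi>X\<close> divides the factor \<open>1 - X\<^sup>2\<close> (\<open>i = 0\<close>) of the
  product, so the division of polynomials is exact. It has to be carried out before evaluating,
  because \<open>1 - \<epsilon>\<chi>X\<close> may vanish at \<open>X = 1\<close>.\<close>

definition Nor_flat :: "nat \<Rightarrow> int \<Rightarrow> int \<Rightarrow> nat \<Rightarrow> real poly" where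
  "Nor_flat q \<epsilon> \<chi> r =
     ([:1, - (real_of_int (sgn_H \<epsilon> r) * real q powr (- (real r / 2))):] *
      (\<Prod>i | 2 * i < r. [:1, 0, - (1 / real q ^ (2 * i)):]))
     div [:1, - real_of_int (\<epsilon> * \<chi>):]"

definition Den_poly ::
  "('a::field \<Rightarrow> int) \<Rightarrow> ('a \<Rightarrow> 'v::ab_group_add \<Rightarrow> 'v) \<Rightarrow> ('v \<Rightarrow> 'v \<Rightarrow> 'a) \<Rightarrow> int \<Rightarrow> nat \<Rightarrow> 'v set \<Rightarrow>
     real poly" where
  "Den_poly val scale B \<epsilon> n L =
     (let q = residue_size val in
      THE P. \<forall>k BM M. self_dual_lattice val \<epsilon> (n + 1 + 2 * k) BM M \<longrightarrow>
        Den val fun_scale BM (n + 1 + 2 * k) M scale B n L =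
          poly (Nor q \<epsilon> n) (1 / real q ^ k) * poly P (1 / real q ^ k))"

definition Den_flat_poly ::
  "('a::field \<Rightarrow> int) \<Rightarrow> ('a \<Rightarrow> 'v::ab_group_add \<Rightarrow> 'v) \<Rightarrow> ('v \<Rightarrow> 'v \<Rightarrow> 'a) \<Rightarrow> int \<Rightarrow> nat \<Rightarrow> 'v set \<Rightarrow>
     real poly" where
  "Den_flat_poly val scale B \<epsilon> r L =
     (let q = residue_size val in
      THE P. \<forall>k BM M. self_dual_lattice val \<epsilon> (r + 2 * k) BM M \<longrightarrow>
        Den val fun_scale BM (r + 2 * k) M scale B r L =
          poly (Nor_flat q \<epsilon> (lattice_chi val scale B r L) r) (1 / real q ^ k) *
          poly P (1 / real q ^ k))"

end

theory Submission
  imports Defs "HOL-Library.Product_Plus"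
begin

text \<open>The representation density is a limit of normalized counts, over \<open>M/\<varpi>\<^sup>N M\<close>, of tuples whose Gram matrix is
  congruent to that of \<open>L\<close>. The tuples are split according to whether the image of \<open>x\<close> is divisible by \<open>\<varpi>\<close>
  in \<open>M\<close>. If it is, the tuple represents \<open>L\<^sup>~ = L\<^sup>\<flat> + \<langle>\<varpi>\<^sup>-\<^sup>1 x\<rangle>\<close>, and the change of normalization is the factor
  \<open>X\<^sup>2\<close>. Otherwise the image \<open>v\<close> of \<open>x\<close> is one of the primitive vectors of norm \<open>(x, x)\<close>, and it lies in a
  hyperbolic plane \<open>\<langle>v, w\<rangle>\<close>. The image of \<open>L\<^sup>\<flat>\<close> is orthogonal to \<open>v\<close>, and its projection to \<open>\<langle>v, w\<rangle>\<^sup>\<bottom>\<close> has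
  Gram matrix \<open>T + c (x, x) \<alpha> \<alpha>\<^sup>T\<close>, where \<open>T\<close> is the Gram matrix of \<open>L\<^sup>\<flat>\<close>. Since \<open>\<varpi>\<^sup>a T\<^sup>-\<^sup>1\<close> is integral for
  \<open>a = a\<^sub>n\<^sub>-\<^sub>1 < val (x, x)\<close>, this matrix is equivalent to \<open>T\<close>, so that these tuples contribute the density of
  \<open>L\<^sup>\<flat>\<close> in a self-dual lattice of rank two less, times the density of primitive isotropic vectors.

  The density polynomials exist by the same reductions: every density is a combination of densities of tuples that are
  independent modulo \<open>\<varpi>\<close>, which are computed by splitting off a unimodular line or a hyperbolic plane.\<close>

section \<open>Averages over finite quotients of abelian groups\<close>

text \<open>Counts are replaced throughout by averages over finite quotients, so that changing the
  level, splitting off a summand or reparametrizing tuples is an identity of averages. The main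
  obstacle is the definite description behind the density polynomials: a polynomial has to be
  exhibited, and the interpolated density has to be divisible by the normalizing factor. For this
  the split on divisibility is repeated for every vector of the tuple and for every lattice that
  arises by enlarging. The process ends because each enlargement lowers the valuation of the Gram
  determinant by 2, and nonintegral lattices have density 0. Divisibility is then proved for the
  primitive densities, which are products of explicit factors. Two choices are forced by this plan.
  Every reduction passes to an orthogonal complement that depends on the chosen vectors, so
  unimodularity and the sign are defined by counting, and the sign is matched with the discriminant
  only afterwards. Dividing one vector by \<open>\<pi>\<close> loses precision only in the Gram
  entries that involve it, so densities carry a precision for each entry.\<close>

definition subgrp :: "'g::ab_group_add set \<Rightarrow> bool" where
  "subgrp K \<longleftrightarrow> 0 \<in> K \<and> (\<forall>x\<in>K. \<forall>y\<in>K. x - y \<in> K)"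

text \<open>The choice depends only on the coset of \<open>x\<close>, since congruent elements
  satisfy the same predicate. Congruence modulo \<open>K\<close> thus becomes equality of
  representatives, and the ambient group does not enter.\<close>

definition coset_rep :: "'g::ab_group_add set \<Rightarrow> 'g \<Rightarrow> 'g" where
  "coset_rep K x = (SOME y. x - y \<in> K)"

definition quot_reps :: "'g::ab_group_add set \<Rightarrow> 'g set \<Rightarrow> 'g set" where
  "quot_reps G K = coset_rep K ` G"

definition fin_quot :: "'g::ab_group_add set \<Rightarrow> 'g set \<Rightarrow> bool" where
  "fin_quot G K \<longleftrightarrow> subgrp G \<and> subgrp K \<and> K \<subseteq> G \<and> finite (quot_reps G K)"

definition grp_index :: "'g::ab_group_add set \<Rightarrow> 'g set \<Rightarrow> nat" where
  "grp_index G K = card (quot_reps G K)"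

text \<open>No quotient type is formed: a function on \<open>G/K\<close> is a
  \<open>periodic\<close> function on \<open>G\<close>, evaluated at representatives. Division by
  the index makes the value independent of the level at which the function is viewed.\<close>

definition avg :: "'g::ab_group_add set \<Rightarrow> 'g set \<Rightarrow> ('g \<Rightarrow> real) \<Rightarrow> real" where
  "avg G K f = (\<Sum>x\<in>quot_reps G K. f x) / real (grp_index G K)"

definition periodic :: "'g::ab_group_add set \<Rightarrow> 'g set \<Rightarrow> ('g \<Rightarrow> 'b) \<Rightarrow> bool" where
  "periodic G K f \<longleftrightarrow> (\<forall>x\<in>G. \<forall>y\<in>G. x - y \<in> K \<longrightarrow> f x = f y)"

lemma subgrpD:
  assumes "subgrp K"
  shows "0 \<in> K" "x \<in> K \<Longrightarrow> y \<in> K \<Longrightarrow> x - y \<in> K" "x \<in> K \<Longrightarrow> - x \<in> K"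
    "x \<in> K \<Longrightarrow> y \<in> K \<Longrightarrow> x + y \<in> K"
proof -
  show 0: "0 \<in> K" and d: "x \<in> K \<Longrightarrow> y \<in> K \<Longrightarrow> x - y \<in> K" for x y
    using assms unfolding subgrp_def by auto
  show m: "x \<in> K \<Longrightarrow> - x \<in> K" for x using d[OF 0, of x] by simp
  show "x \<in> K \<Longrightarrow> y \<in> K \<Longrightarrow> x + y \<in> K" using d[OF _ m, of x y] by simp
qed

lemma subgrp_diff_cong:
  assumes "subgrp K" "x - y \<in> K"
  shows "x - z \<in> K \<longleftrightarrow> y - z \<in> K" "z - x \<in> K \<longleftrightarrow> z - y \<in> K" "y - x \<in> K"
proof -
  show "y - x \<in> K" using subgrpD(3)[OF assms] by simp
  show "x - z \<in> K \<longleftrightarrow> y - z \<in> K"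
    using subgrpD(2)[OF assms(1), of "x - z" "x - y"] subgrpD(4)[OF assms, of "y - z"] assms(2)
    by (auto simp: algebra_simps)
  show "z - x \<in> K \<longleftrightarrow> z - y \<in> K"
    using subgrpD(2)[OF assms(1), of "z - y" "x - y"] subgrpD(4)[OF assms(1), of "z - x" "x - y"] assms(2)
    by (auto simp: algebra_simps)
qed

lemma coset_rep_diff: "subgrp K \<Longrightarrow> x - coset_rep K x \<in> K"
  unfolding coset_rep_def by (rule someI[of "\<lambda>y. x - y \<in> K" x]) (simp add: subgrpD)

lemma coset_rep_eq_iff:
  assumes "subgrp K" shows "coset_rep K x = coset_rep K y \<longleftrightarrow> x - y \<in> K"
proof
  assume "coset_rep K x = coset_rep K y"
  then show "x - y \<in> K"
    using subgrpD(2)[OF assms coset_rep_diff[OF assms, of x] coset_rep_diff[OF assms, of y]] by simp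
next
  assume "x - y \<in> K"
  then have "\<And>z. x - z \<in> K \<longleftrightarrow> y - z \<in> K" by (rule subgrp_diff_cong[OF assms])
  then show "coset_rep K x = coset_rep K y" unfolding coset_rep_def by simp
qed

lemma coset_rep_in:
  assumes "subgrp G" "subgrp K" "K \<subseteq> G" "x \<in> G" shows "coset_rep K x \<in> G"
  using subgrpD(2)[OF assms(1), of x "x - coset_rep K x"] coset_rep_diff[OF assms(2), of x] assms
  by auto

lemma fin_quotD:
  assumes "fin_quot G K"
  shows "subgrp G" "subgrp K" "K \<subseteq> G" "finite (quot_reps G K)" "quot_reps G K \<subseteq> G"
    "grp_index G K > 0"
proof -
  show *: "subgrp G" "subgrp K" "K \<subseteq> G" "finite (quot_reps G K)"
    using assms unfolding fin_quot_def by auto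
  show "quot_reps G K \<subseteq> G" using coset_rep_in[OF *(1-3)] unfolding quot_reps_def by auto
  show "grp_index G K > 0" using * unfolding grp_index_def quot_reps_def
    by (auto simp: card_gt_0_iff subgrp_def)
qed

text \<open>Images, sums and products of the chosen representatives are again representatives, but
  no longer the chosen ones; \<open>transversal_avg\<close> shows that every transversal computes
  the same average.\<close>

definition transversal :: "'g::ab_group_add set \<Rightarrow> 'g set \<Rightarrow> 'g set \<Rightarrow> bool" where
  "transversal G K R \<longleftrightarrow> R \<subseteq> G \<and> (\<forall>x\<in>G. \<exists>r\<in>R. x - r \<in> K) \<and>
     (\<forall>r\<in>R. \<forall>s\<in>R. r - s \<in> K \<longrightarrow> r = s)"

lemma transversal_quot_reps:
  assumes "fin_quot G K" shows "transversal G K (quot_reps G K)"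
proof -
  note f = fin_quotD[OF assms]
  have "r = s" if "r \<in> quot_reps G K" "s \<in> quot_reps G K" "r - s \<in> K" for r s
  proof -
    obtain x y where xy: "r = coset_rep K x" "s = coset_rep K y"
      using \<open>r \<in> _\<close> \<open>s \<in> _\<close> unfolding quot_reps_def by auto
    have "x - s \<in> K" using subgrpD(4)[OF f(2) coset_rep_diff[OF f(2), of x] \<open>r - s \<in> K\<close>] xy by simp
    then have "x - y \<in> K"
      using subgrpD(2)[OF f(2), of "x - s" "y - s"] coset_rep_diff[OF f(2), of y] xy by simp
    then show ?thesis using xy coset_rep_eq_iff[OF f(2)] by simp
  qed
  then show ?thesis
    using f(5) coset_rep_diff[OF f(2)] unfolding transversal_def quot_reps_def by blast
qed

lemma transversal_avg:
  assumes "subgrp G" "subgrp K" "K \<subseteq> G" "transversal G K R" "finite R"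
  shows "fin_quot G K" "grp_index G K = card R"
    "periodic G K f \<Longrightarrow> avg G K f = (\<Sum>x\<in>R. f x) / real (card R)"
proof -
  have im: "quot_reps G K = coset_rep K ` R"
  proof
    show "coset_rep K ` R \<subseteq> quot_reps G K" using assms(4) unfolding quot_reps_def transversal_def by auto
    show "quot_reps G K \<subseteq> coset_rep K ` R"
    proof
      fix z assume "z \<in> quot_reps G K"
      then obtain x where x: "x \<in> G" "z = coset_rep K x" unfolding quot_reps_def by auto
      obtain r where r: "r \<in> R" "x - r \<in> K" using assms(4) x unfolding transversal_def by auto
      then show "z \<in> coset_rep K ` R" using x coset_rep_eq_iff[OF assms(2), of x r] by auto
    qed
  qed
  have inj: "inj_on (coset_rep K) R"
    using assms(4) unfolding inj_on_def coset_rep_eq_iff[OF assms(2)] transversal_def by auto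
  show "fin_quot G K" unfolding fin_quot_def im using assms by auto
  show ind: "grp_index G K = card R" unfolding grp_index_def im using card_image[OF inj] .
  show "avg G K f = (\<Sum>x\<in>R. f x) / real (card R)" if per: "periodic G K f"
  proof -
    have "(\<Sum>x\<in>coset_rep K ` R. f x) = (\<Sum>x\<in>R. f (coset_rep K x))"
      using sum.reindex[OF inj, of f] by simp
    also have "\<dots> = (\<Sum>x\<in>R. f x)"
    proof (rule sum.cong[OF refl])
      fix x assume "x \<in> R"
      then have "x \<in> G" using assms(4) unfolding transversal_def by auto
      then show "f (coset_rep K x) = f x"
        using coset_rep_in[OF assms(1-3)] coset_rep_diff[OF assms(2), of x] per
        unfolding periodic_def by metis
    qed
    finally show ?thesis unfolding avg_def ind im by simp
  qed
qed

lemma avg_cong: "fin_quot G K \<Longrightarrow> (\<And>x. x \<in> G \<Longrightarrow> f x = g x) \<Longrightarrow> avg G K f = avg G K g"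
  unfolding avg_def using fin_quotD(5)[of G K] by (metis (no_types, lifting) subsetD sum.cong)

lemma avg_const: "fin_quot G K \<Longrightarrow> avg G K (\<lambda>x. c) = c"
  unfolding avg_def using fin_quotD(6)[of G K] by (simp add: grp_index_def)

lemma avg_const_on: "fin_quot G K \<Longrightarrow> (\<And>x. x \<in> G \<Longrightarrow> f x = c) \<Longrightarrow> avg G K f = c"
  using avg_cong[of G K f "\<lambda>x. c"] avg_const[of G K c] by simp

lemma avg_add: "avg G K (\<lambda>x. f x + g x) = avg G K f + avg G K g"
  unfolding avg_def by (simp add: sum.distrib add_divide_distrib)

lemma avg_diff: "avg G K (\<lambda>x. f x - g x) = avg G K f - avg G K g"
  unfolding avg_def by (simp add: sum_subtractf diff_divide_distrib)

lemma avg_cmult: "avg G K (\<lambda>x. c * f x) = c * avg G K f"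
  unfolding avg_def by (simp add: sum_distrib_left)

lemma avg_multc: "avg G K (\<lambda>x. f x * c) = avg G K f * c"
  unfolding avg_def by (simp add: sum_distrib_right)

lemma avg_sum: "avg G K (\<lambda>x. \<Sum>i\<in>I. f i x) = (\<Sum>i\<in>I. avg G K (f i))"
  unfolding avg_def by (simp add: sum.swap[of _ I] sum_divide_distrib)

lemma avg_swap: "avg G K (\<lambda>x. avg H J (\<lambda>y. f x y)) = avg H J (\<lambda>y. avg G K (\<lambda>x. f x y))"
  unfolding avg_def
  by (simp add: sum_divide_distrib sum.swap[of _ "quot_reps H J"] mult.commute)

lemma avg_pos:
  assumes "fin_quot G K" "periodic G K f" "\<And>x. f x \<ge> 0" "x \<in> G" "f x > 0"
  shows "avg G K f > 0"
proof -
  note f = fin_quotD[OF assms(1)]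
  obtain r where r: "r \<in> quot_reps G K" "x - r \<in> K"
    using transversal_quot_reps[OF assms(1)] assms(4) unfolding transversal_def by auto
  then have "f r > 0" using assms(2,4,5) f(5) unfolding periodic_def by (metis subsetD)
  then have "(\<Sum>x\<in>quot_reps G K. f x) > 0" using r f(4) assms(3) by (meson sum_pos2)
  then show ?thesis unfolding avg_def using f(6) by simp
qed

lemma avg_zero_imp:
  assumes "fin_quot G K" "periodic G K f" "\<And>x. x \<in> G \<Longrightarrow> f x \<ge> 0" "avg G K f = 0" "x \<in> G"
  shows "f x = 0"
proof (rule ccontr)
  assume "f x \<noteq> 0"
  have p: "periodic G K (\<lambda>x. \<bar>f x\<bar>)" using assms(2) unfolding periodic_def by metis
  have "avg G K (\<lambda>x. \<bar>f x\<bar>) > 0"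
    by (rule avg_pos[OF assms(1) p _ assms(5)]) (use \<open>f x \<noteq> 0\<close> in auto)
  moreover have "avg G K (\<lambda>x. \<bar>f x\<bar>) = avg G K f"
    by (rule avg_cong[OF assms(1)]) (use assms(3) in auto)
  ultimately show False using assms(4) by simp
qed

text \<open>Change of variables. The map \<open>h\<close> is not assumed to be a homomorphism, only
  to respect and reflect the congruences and to be surjective up to \<open>K'\<close>; this admits
  nonlinear substitutions such as the one in \<open>dens_bump\<close>.\<close>

lemma avg_iso:
  assumes "fin_quot G K" "subgrp G'" "subgrp K'" "K' \<subseteq> G'"
    and "\<forall>x\<in>G. h x \<in> G'"
    and "\<forall>x\<in>G. \<forall>y\<in>G. h x - h y \<in> K' \<longleftrightarrow> x - y \<in> K"
    and "\<forall>z\<in>G'. \<exists>x\<in>G. z - h x \<in> K'"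
  shows "fin_quot G' K'" "grp_index G' K' = grp_index G K"
    "periodic G' K' f \<Longrightarrow> avg G' K' f = avg G K (\<lambda>x. f (h x))"
proof -
  note f = fin_quotD[OF assms(1)]
  note t = transversal_quot_reps[OF assms(1)]
  have inj: "inj_on h (quot_reps G K)"
  proof (rule inj_onI)
    fix x y assume "x \<in> quot_reps G K" "y \<in> quot_reps G K" "h x = h y"
    then have "x - y \<in> K" using assms(6)[rule_format, of x y] f(5) subgrpD(1)[OF assms(3)] by auto
    then show "x = y" using t \<open>x \<in> _\<close> \<open>y \<in> _\<close> unfolding transversal_def by auto
  qed
  have tr: "transversal G' K' (h ` quot_reps G K)"
    unfolding transversal_def
  proof (intro conjI ballI impI)
    show "h ` quot_reps G K \<subseteq> G'" using f(5) assms(5) by auto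
    fix z assume "z \<in> G'"
    then obtain x where x: "x \<in> G" "z - h x \<in> K'" using assms(7) by blast
    obtain r where r: "r \<in> quot_reps G K" "x - r \<in> K" using t x unfolding transversal_def by auto
    have "h x - h r \<in> K'" using assms(6)[rule_format, of x r] x r f(5) by auto
    then have "z - h r \<in> K'" using subgrpD(4)[OF assms(3) x(2), of "h x - h r"] by simp
    then show "\<exists>r\<in>h ` quot_reps G K. z - r \<in> K'" using r by auto
  next
    fix r s assume "r \<in> h ` quot_reps G K" "s \<in> h ` quot_reps G K" "r - s \<in> K'"
    then obtain x y where "x \<in> quot_reps G K" "y \<in> quot_reps G K" "r = h x" "s = h y" by auto
    moreover from this have "x - y \<in> K" using assms(6)[rule_format, of x y] f(5) \<open>r - s \<in> K'\<close> by auto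
    ultimately show "r = s" using t unfolding transversal_def by auto
  qed
  note ta = transversal_avg[OF assms(2-4) tr finite_imageI[OF f(4)]]
  show "fin_quot G' K'" by (rule ta)
  show "grp_index G' K' = grp_index G K" using ta(2) card_image[OF inj] by (simp add: grp_index_def)
  show "avg G' K' f = avg G K (\<lambda>x. f (h x))" if "periodic G' K' f"
    using ta(3)[OF that] card_image[OF inj] sum.reindex[OF inj, of f]
    by (simp add: avg_def grp_index_def)
qed

lemma subgrp_Times: "subgrp G \<Longrightarrow> subgrp H \<Longrightarrow> subgrp (G \<times> H)"
  unfolding subgrp_def by (auto simp: zero_prod_def)

lemma avg_prod:
  assumes "fin_quot G K" "fin_quot H J"
  shows "fin_quot (G \<times> H) (K \<times> J)" "grp_index (G \<times> H) (K \<times> J) = grp_index G K * grp_index H J"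
    "periodic (G \<times> H) (K \<times> J) f \<Longrightarrow> avg (G \<times> H) (K \<times> J) f = avg G K (\<lambda>x. avg H J (\<lambda>y. f (x, y)))"
proof -
  note f = fin_quotD[OF assms(1)] and g = fin_quotD[OF assms(2)]
  have t: "transversal (G \<times> H) (K \<times> J) (quot_reps G K \<times> quot_reps H J)"
  proof -
    note tt = transversal_quot_reps[OF assms(1), unfolded transversal_def]
      transversal_quot_reps[OF assms(2), unfolded transversal_def]
    show ?thesis unfolding transversal_def
    proof (intro conjI ballI impI)
      fix x assume "x \<in> G \<times> H"
      then obtain r s where "r \<in> quot_reps G K" "s \<in> quot_reps H J" "fst x - r \<in> K" "snd x - s \<in> J"
        using tt by (auto simp: mem_Times_iff) metis
      then show "\<exists>r\<in>quot_reps G K \<times> quot_reps H J. x - r \<in> K \<times> J"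
        by (intro bexI[of _ "(r, s)"]) (auto simp: mem_Times_iff)
    qed (use tt in \<open>auto simp: mem_Times_iff prod_eq_iff\<close>)
  qed
  note ta = transversal_avg[OF subgrp_Times[OF f(1) g(1)] subgrp_Times[OF f(2) g(2)] _ t]
  have sub: "K \<times> J \<subseteq> G \<times> H" and fin: "finite (quot_reps G K \<times> quot_reps H J)" using f g by auto
  show "fin_quot (G \<times> H) (K \<times> J)" using ta(1)[OF sub fin] .
  show "grp_index (G \<times> H) (K \<times> J) = grp_index G K * grp_index H J"
    using ta(2)[OF sub fin] by (simp add: card_cartesian_product grp_index_def)
  show "avg (G \<times> H) (K \<times> J) f = avg G K (\<lambda>x. avg H J (\<lambda>y. f (x, y)))"
    if "periodic (G \<times> H) (K \<times> J) f"
    using ta(3)[OF sub fin that] sum.cartesian_product[of "\<lambda>x y. f (x, y)" "quot_reps H J" "quot_reps G K"]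
    by (simp add: avg_def card_cartesian_product grp_index_def mult.commute
        flip: sum_divide_distrib)
qed

text \<open>Sums of representatives of \<open>G/H\<close> and of \<open>H/K\<close> represent
  \<open>G/K\<close>. The third fact says that refining the level changes no average; the fourth
  restricts an average to a subgroup that supports the function, at the price of the index.\<close>

lemma avg_tower:
  assumes "fin_quot G H" "fin_quot H K"
  shows "fin_quot G K" "grp_index G K = grp_index G H * grp_index H K"
    "periodic G H f \<Longrightarrow> avg G K f = avg G H f"
    "periodic G K f \<Longrightarrow> (\<forall>x\<in>G. x \<notin> H \<longrightarrow> f x = 0) \<Longrightarrow> avg G K f = avg H K f / real (grp_index G H)"
proof -
  note f = fin_quotD[OF assms(1)] and g = fin_quotD[OF assms(2)]
  let ?R = "quot_reps G H" and ?S = "quot_reps H K"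
  note tR = transversal_quot_reps[OF assms(1)] and tS = transversal_quot_reps[OF assms(2)]
  let ?h = "\<lambda>(r, s). r + s"
  have GH: "r + s \<in> G" if "r \<in> ?R" "s \<in> ?S" for r s
    using that f g subgrpD(4)[OF f(1), of r s] by auto
  have eq: "r = r' \<and> s = s'"
    if "r \<in> ?R" "s \<in> ?S" "r' \<in> ?R" "s' \<in> ?S" "(r + s) - (r' + s') \<in> K" for r s r' s'
  proof -
    have sH: "s \<in> H" "s' \<in> H" using that g by auto
    have "(r + s) - (r' + s') - (s - s') \<in> H"
      using subgrpD(2)[OF f(2), of "(r + s) - (r' + s')" "s - s'"] subgrpD(2)[OF f(2) sH] that(5) g(3) by auto
    then have "r - r' \<in> H" by (simp add: algebra_simps)
    then have "r = r'" using tR that unfolding transversal_def by auto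
    moreover from this have "s - s' \<in> K" using that(5) by simp
    ultimately show ?thesis using tS that unfolding transversal_def by auto
  qed
  have inj: "inj_on ?h (?R \<times> ?S)"
  proof (rule inj_onI)
    fix x y assume *: "x \<in> ?R \<times> ?S" "y \<in> ?R \<times> ?S" "?h x = ?h y"
    then have "(fst x + snd x) - (fst y + snd y) \<in> K"
      using subgrpD(1)[OF g(2)] by (simp add: case_prod_unfold)
    then show "x = y" using eq[of "fst x" "snd x" "fst y" "snd y"] * by (auto simp: prod_eq_iff)
  qed
  have t: "transversal G K (?h ` (?R \<times> ?S))"
    unfolding transversal_def
  proof (intro conjI ballI impI)
    show "?h ` (?R \<times> ?S) \<subseteq> G" using GH by auto
    fix x assume "x \<in> G"
    then obtain r where r: "r \<in> ?R" "x - r \<in> H" using tR unfolding transversal_def by auto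
    then obtain s where s: "s \<in> ?S" "x - r - s \<in> K" using tS unfolding transversal_def by auto
    then show "\<exists>r\<in>?h ` (?R \<times> ?S). x - r \<in> K"
      by (intro bexI[of _ "r + s"]) (use r in \<open>auto simp: algebra_simps\<close>)
  next
    fix x y assume "x \<in> ?h ` (?R \<times> ?S)" "y \<in> ?h ` (?R \<times> ?S)" "x - y \<in> K"
    then show "x = y" using eq by auto
  qed
  have sub: "K \<subseteq> G" using f g by auto
  have fin: "finite (?h ` (?R \<times> ?S))" using f g by auto
  note ta = transversal_avg[OF f(1) g(2) sub t fin]
  have c: "card (?h ` (?R \<times> ?S)) = grp_index G H * grp_index H K"
    using card_image[OF inj] by (simp add: card_cartesian_product grp_index_def)
  show "fin_quot G K" by (rule ta)
  show "grp_index G K = grp_index G H * grp_index H K" using ta(2) c by simp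
  have s: "(\<Sum>x\<in>?h ` (?R \<times> ?S). f x) = (\<Sum>r\<in>?R. \<Sum>s\<in>?S. f (r + s))"
    using sum.reindex[OF inj, of f] by (simp add: sum.cartesian_product case_prod_unfold)
  show "avg G K f = avg G H f" if "periodic G H f"
  proof -
    have p: "periodic G K f" using that g(3) unfolding periodic_def by blast
    have "f (r + s) = f r" if "r \<in> ?R" "s \<in> ?S" for r s
      using \<open>periodic G H f\<close> GH[OF that] that f g unfolding periodic_def by (auto simp: subset_iff)
    then have "(\<Sum>r\<in>?R. \<Sum>s\<in>?S. f (r + s)) = (\<Sum>r\<in>?R. f r) * real (card ?S)"
      by (simp add: sum_distrib_right mult.commute)
    then show ?thesis unfolding ta(3)[OF p] s c using g(6) by (simp add: avg_def grp_index_def)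
  qed
  show "avg G K f = avg H K f / real (grp_index G H)"
    if p: "periodic G K f" and z: "\<forall>x\<in>G. x \<notin> H \<longrightarrow> f x = 0"
  proof -
    have H0: "0 \<in> H" using subgrpD(1)[OF f(2)] .
    \<comment> \<open>The representative chosen for \<open>H\<close> itself may be nonzero, so the
      only contributing coset is \<open>r0 + H\<close>, which is translated back to \<open>H\<close>
      below.\<close>
    obtain r0 where r0: "r0 \<in> ?R" "0 - r0 \<in> H" using tR f(3) H0 unfolding transversal_def by blast
    have r0H: "r0 \<in> H" using subgrpD(3)[OF f(2) r0(2)] by simp
    have other: "f (r + s) = 0" if "r \<in> ?R" "r \<noteq> r0" "s \<in> ?S" for r s
    proof (rule z[rule_format, OF GH[OF that(1,3)]])
      show "r + s \<notin> H"
      proof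
        assume "r + s \<in> H"
        then have "r + s - s - r0 \<in> H" using subgrpD(2)[OF f(2)] r0H that(3) g(5) by blast
        then have "r - r0 \<in> H" by simp
        then show False using tR r0 that unfolding transversal_def by auto
      qed
    qed
    have "(\<Sum>r\<in>?R. \<Sum>s\<in>?S. f (r + s)) = (\<Sum>r\<in>{r0}. \<Sum>s\<in>?S. f (r + s))"
      by (rule sum.mono_neutral_right) (use f r0 other in \<open>auto intro!: sum.neutral\<close>)
    also have "\<dots> = (\<Sum>s\<in>?S. f (r0 + s))" by simp
    finally have e: "(\<Sum>r\<in>?R. \<Sum>s\<in>?S. f (r + s)) = (\<Sum>s\<in>?S. f (r0 + s))" .
    have pH: "periodic H K f" using p f(3) unfolding periodic_def by blast
    have "avg H K f = avg H K (\<lambda>s. f (r0 + s))"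
    proof (rule avg_iso(3)[OF assms(2) g(1-3) _ _ _ pH])
      show "\<forall>z\<in>H. \<exists>x\<in>H. z - (r0 + x) \<in> K"
      proof
        fix z assume "z \<in> H"
        then show "\<exists>x\<in>H. z - (r0 + x) \<in> K"
          by (intro bexI[of _ "z - r0"]) (use subgrpD[OF g(2)] subgrpD(2)[OF f(2)] r0H in auto)
      qed
    qed (use r0H subgrpD(4)[OF f(2)] in auto)
    then have "(\<Sum>s\<in>?S. f (r0 + s)) = (\<Sum>s\<in>?S. f s)"
      using g(6) by (simp add: avg_def)
    then show ?thesis unfolding ta(3)[OF p] s c e by (simp add: avg_def grp_index_def mult.commute)
  qed
qed

text \<open>Tuples are total functions that vanish from \<open>n\<close> on, so they form a subgroup
  of a function type and may be compared by plain equality.\<close>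

definition tup :: "nat \<Rightarrow> 'g::ab_group_add set \<Rightarrow> (nat \<Rightarrow> 'g) set" where
  "tup n G = {\<phi>. (\<forall>i<n. \<phi> i \<in> G) \<and> (\<forall>i\<ge>n. \<phi> i = 0)}"

lemma subgrp_tup: "subgrp G \<Longrightarrow> subgrp (tup n G)"
  unfolding subgrp_def tup_def by auto

lemma tupD: "\<phi> \<in> tup n G \<Longrightarrow> i < n \<Longrightarrow> \<phi> i \<in> G" "\<phi> \<in> tup n G \<Longrightarrow> i \<ge> n \<Longrightarrow> \<phi> i = 0"
  unfolding tup_def by auto

lemma tup_mono: "K \<subseteq> G \<Longrightarrow> tup n K \<subseteq> tup n G"
  unfolding tup_def by auto

lemma case_nat_tup: "v \<in> G \<Longrightarrow> \<phi> \<in> tup n G \<Longrightarrow> case_nat v \<phi> \<in> tup (Suc n) G"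
  unfolding tup_def by (auto split: nat.split)

lemma tup_Suc_cases:
  assumes "\<phi> \<in> tup (Suc n) G"
  obtains v \<psi> where "v \<in> G" "\<psi> \<in> tup n G" "\<phi> = case_nat v \<psi>"
proof
  show "\<phi> 0 \<in> G" "(\<lambda>i. \<phi> (Suc i)) \<in> tup n G" using assms unfolding tup_def by auto
  show "\<phi> = case_nat (\<phi> 0) (\<lambda>i. \<phi> (Suc i))" by (auto split: nat.split)
qed

lemma case_nat_diff: "case_nat v \<phi> - case_nat w \<psi> = case_nat (v - w) (\<phi> - \<psi> :: nat \<Rightarrow> 'g::ab_group_add)"
  by (auto split: nat.split)

lemma case_nat_tup_iff: "case_nat v \<phi> \<in> tup (Suc n) G \<longleftrightarrow> v \<in> G \<and> \<phi> \<in> tup n G"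
proof
  assume *: "case_nat v \<phi> \<in> tup (Suc n) G"
  show "v \<in> G \<and> \<phi> \<in> tup n G" using tupD(1)[OF *, of 0] tupD(1)[OF *, of "Suc _"] tupD(2)[OF *, of "Suc _"]
    by (auto simp: tup_def)
qed (auto intro: case_nat_tup)

lemma tup_0: "tup 0 G = {0}" unfolding tup_def by auto

lemma avg_tup_0: "fin_quot (tup 0 G) (tup 0 K)" "grp_index (tup 0 G) (tup 0 K) = 1" "avg (tup 0 G) (tup 0 K) f = f 0"
proof -
  have q: "quot_reps (tup 0 G) (tup 0 K) = {0}"
    unfolding quot_reps_def tup_0 coset_rep_def by auto
  show "fin_quot (tup 0 G) (tup 0 K)" unfolding fin_quot_def q by (auto simp: tup_0 subgrp_def)
  show "grp_index (tup 0 G) (tup 0 K) = 1" unfolding grp_index_def q by simp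
  then show "avg (tup 0 G) (tup 0 K) f = f 0" unfolding avg_def q by simp
qed

lemma avg_tup_Suc_aux:
  assumes "fin_quot G K" "fin_quot (tup n G) (tup n K)"
  shows "fin_quot (tup (Suc n) G) (tup (Suc n) K)"
    "grp_index (tup (Suc n) G) (tup (Suc n) K) = grp_index G K * grp_index (tup n G) (tup n K)"
    "periodic (tup (Suc n) G) (tup (Suc n) K) f \<Longrightarrow>
      avg (tup (Suc n) G) (tup (Suc n) K) f =
      avg G K (\<lambda>v. avg (tup n G) (tup n K) (\<lambda>\<phi>. f (case_nat v \<phi>)))"
proof -
  note f = fin_quotD[OF assms(1)]
  let ?h = "\<lambda>p. case_nat (fst p) (snd p)"
  note P = avg_prod[OF assms]
  have m: "\<forall>x\<in>G \<times> tup n G. ?h x \<in> tup (Suc n) G"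
    using case_nat_tup by auto
  have d: "\<forall>x\<in>G \<times> tup n G. \<forall>y\<in>G \<times> tup n G. ?h x - ?h y \<in> tup (Suc n) K \<longleftrightarrow> x - y \<in> K \<times> tup n K"
    unfolding case_nat_diff case_nat_tup_iff by (auto simp: mem_Times_iff)
  have s: "\<forall>z\<in>tup (Suc n) G. \<exists>x\<in>G \<times> tup n G. z - ?h x \<in> tup (Suc n) K"
  proof
    fix z assume z: "z \<in> tup (Suc n) G"
    obtain v \<psi> where "v \<in> G" "\<psi> \<in> tup n G" "z = case_nat v \<psi>" using z by (rule tup_Suc_cases)
    then show "\<exists>x\<in>G \<times> tup n G. z - ?h x \<in> tup (Suc n) K" using subgrpD(1)[OF subgrp_tup[OF f(2)]]
      by (intro bexI[of _ "(v, \<psi>)"]) auto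
  qed
  note I = avg_iso[OF P(1) subgrp_tup[OF f(1)] subgrp_tup[OF f(2)] tup_mono[OF f(3)] m d s]
  show "fin_quot (tup (Suc n) G) (tup (Suc n) K)" by (rule I(1))
  show "grp_index (tup (Suc n) G) (tup (Suc n) K) = grp_index G K * grp_index (tup n G) (tup n K)"
    using I(2) P(2) by simp
  assume pf: "periodic (tup (Suc n) G) (tup (Suc n) K) f"
  have "periodic (G \<times> tup n G) (K \<times> tup n K) (\<lambda>x. f (?h x))"
    unfolding periodic_def
  proof (intro ballI impI)
    fix x y assume *: "x \<in> G \<times> tup n G" "y \<in> G \<times> tup n G" "x - y \<in> K \<times> tup n K"
    then have "?h x - ?h y \<in> tup (Suc n) K"
      using d[rule_format, OF *(1,2)] by simp
    then show "f (?h x) = f (?h y)"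
      using pf m[rule_format, OF *(1)] m[rule_format, OF *(2)] unfolding periodic_def by simp
  qed
  then show "avg (tup (Suc n) G) (tup (Suc n) K) f =
      avg G K (\<lambda>v. avg (tup n G) (tup n K) (\<lambda>\<phi>. f (case_nat v \<phi>)))"
    using I(3)[OF pf] P(3)[of "\<lambda>x. f (?h x)"] by simp
qed

lemma fin_quot_tup: "fin_quot G K \<Longrightarrow> fin_quot (tup n G) (tup n K)"
  by (induction n) (auto intro: avg_tup_Suc_aux(1) avg_tup_0(1))

lemma grp_index_tup: "fin_quot G K \<Longrightarrow> grp_index (tup n G) (tup n K) = grp_index G K ^ n"
  by (induction n) (auto simp: avg_tup_Suc_aux(2) fin_quot_tup avg_tup_0(2)[simplified])

lemmas avg_tup_Suc = avg_tup_Suc_aux(3)[OF _ fin_quot_tup]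

text \<open>The numeral 1 occurs below as a level, in \<open>pp 1\<close> and
  \<open>mul 1 M\<close>; rewriting it to \<open>Suc 0\<close> would keep facts about these from
  matching.\<close>

declare One_nat_def [simp del]

lemma avg_single:
  assumes "fin_quot G K" "a \<in> G"
  shows "avg G K (\<lambda>x. of_bool (x - a \<in> K)) = 1 / real (grp_index G K)"
proof -
  note f = fin_quotD[OF assms(1)] and t = transversal_quot_reps[OF assms(1), unfolded transversal_def]
  obtain r where r: "r \<in> quot_reps G K" "a - r \<in> K" using t assms(2) by blast
  have "x - a \<in> K \<longleftrightarrow> x = r" if "x \<in> quot_reps G K" for x
    using subgrp_diff_cong(2)[OF f(2) r(2), of x] t r that subgrpD(1)[OF f(2)] by auto
  then have "(\<Sum>x\<in>quot_reps G K. of_bool (x - a \<in> K)) = (\<Sum>x\<in>quot_reps G K. of_bool (x = r) :: real)"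
    by (intro sum.cong) auto
  also have "\<dots> = 1" using r(1) f(4) by (simp add: of_bool_def sum.delta)
  finally show ?thesis unfolding avg_def by simp
qed

lemma avg_shift:
  assumes "fin_quot G K" "periodic G K f" "a \<in> G"
  shows "avg G K (\<lambda>x. f (x + a)) = avg G K f"
proof (rule sym, rule avg_iso(3)[OF assms(1) _ _ _ _ _ _ assms(2)])
  note f = fin_quotD[OF assms(1)]
  show "\<forall>z\<in>G. \<exists>x\<in>G. z - (x + a) \<in> K"
  proof
    fix z assume "z \<in> G"
    then show "\<exists>x\<in>G. z - (x + a) \<in> K"
      by (intro bexI[of _ "z - a"]) (use subgrpD[OF f(2)] subgrpD(2)[OF f(1)] assms(3) in auto)
  qed
qed (use fin_quotD[OF assms(1)] subgrpD(4)[of G] assms(3) in auto)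

section \<open>The ring of integers\<close>

text \<open>With a fixed uniformizer, membership in a power of the maximal ideal becomes
  divisibility by a concrete element, see \<open>pp_E\<close> and
  \<open>pi_power_mult_iff\<close>.\<close>

locale odd_local_field = nonarch_local_field_odd val for val :: "'a::field \<Rightarrow> int" +
  fixes \<pi> :: 'a
  assumes pi_nonzero: "\<pi> \<noteq> 0" and val_pi: "val \<pi> = 1"
begin

definition pp :: "nat \<Rightarrow> 'a set" where "pp k = frac_ideal val (int k)"

abbreviation q :: nat where "q \<equiv> residue_size val"

lemma pp_iff: "x \<in> pp k \<longleftrightarrow> x = 0 \<or> int k \<le> val x"
  unfolding pp_def frac_ideal_def by simp

lemma pp_0: "pp 0 = integers val" unfolding pp_def by simp

lemma val_1: "val 1 = 0" using val_mult[of 1 1] by simp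

lemma val_minus: "x \<noteq> 0 \<Longrightarrow> val (- x) = val x"
proof -
  have "val (- 1) = 0" using val_mult[of "- 1" "- 1"] val_1 by simp
  then show "x \<noteq> 0 \<Longrightarrow> val (- x) = val x" using val_mult[of "- 1" x] by simp
qed

lemma val_inverse: "x \<noteq> 0 \<Longrightarrow> val (inverse x) = - val x"
  using val_mult[of x "inverse x"] val_1 by simp

lemma val_power: "x \<noteq> 0 \<Longrightarrow> val (x ^ k) = int k * val x"
  by (induction k) (auto simp: val_1 val_mult algebra_simps)

lemma frac_ideal_add: "x \<in> frac_ideal val k \<Longrightarrow> y \<in> frac_ideal val k \<Longrightarrow> x + y \<in> frac_ideal val k"
  unfolding frac_ideal_def using val_add[of x y] by (cases "x = 0"; cases "y = 0"; cases "x + y = 0") auto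

lemma pp_zero [simp]: "0 \<in> pp k" by (simp add: pp_iff)

lemma pp_add: "x \<in> pp k \<Longrightarrow> y \<in> pp k \<Longrightarrow> x + y \<in> pp k"
  unfolding pp_def by (rule frac_ideal_add)

lemma pp_uminus: "x \<in> pp k \<Longrightarrow> - x \<in> pp k"
  unfolding pp_iff using val_minus[of x] by (cases "x = 0") auto

lemma pp_uminus_iff [simp]: "- x \<in> pp k \<longleftrightarrow> x \<in> pp k"
  using pp_uminus[of x k] pp_uminus[of "- x" k] by auto

lemma pp_diff: "x \<in> pp k \<Longrightarrow> y \<in> pp k \<Longrightarrow> x - y \<in> pp k"
  using pp_add[of x k "- y"] pp_uminus by simp

lemma pp_minus_commute: "x - y \<in> pp k \<longleftrightarrow> y - x \<in> pp k"
  using pp_uminus_iff[of "x - y" k] by simp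

lemma pp_mult: "x \<in> pp i \<Longrightarrow> y \<in> pp j \<Longrightarrow> x * y \<in> pp (i + j)"
  unfolding pp_iff using val_mult[of x y] by (cases "x = 0"; cases "y = 0") auto

lemma pp_mono: "i \<le> j \<Longrightarrow> x \<in> pp j \<Longrightarrow> x \<in> pp i"
  unfolding pp_iff by auto

lemma pp_subset_0: "x \<in> pp k \<Longrightarrow> x \<in> pp 0" using pp_mono[of 0 k] by simp

lemma pp_mult_left: "x \<in> pp 0 \<Longrightarrow> y \<in> pp k \<Longrightarrow> x * y \<in> pp k" using pp_mult[of x 0 y k] by simp

lemma pp_mult_right: "x \<in> pp k \<Longrightarrow> y \<in> pp 0 \<Longrightarrow> x * y \<in> pp k" using pp_mult[of x k y 0] by simp

lemma pp_mult_Suc: "x \<in> pp 1 \<Longrightarrow> y \<in> pp k \<Longrightarrow> x * y \<in> pp (Suc k)" using pp_mult[of x 1 y k] by (simp add: One_nat_def)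

lemma pp_one [simp]: "1 \<in> pp 0" by (simp add: pp_iff val_1)

lemma pp_sum: "(\<And>i. i \<in> I \<Longrightarrow> f i \<in> pp k) \<Longrightarrow> (\<Sum>i\<in>I. f i) \<in> pp k"
  by (induction I rule: infinite_finite_induct) (auto intro: pp_add)

lemma pp_prod: "(\<And>i. i \<in> I \<Longrightarrow> f i \<in> pp 0) \<Longrightarrow> (\<Prod>i\<in>I. f i) \<in> pp 0"
  by (induction I rule: infinite_finite_induct) (auto intro: pp_mult_left)

lemma pp_of_nat: "of_nat m \<in> pp 0" by (induction m) (auto intro: pp_add)

lemma pp_power: "x \<in> pp 0 \<Longrightarrow> x ^ m \<in> pp 0" by (induction m) (auto intro: pp_mult_left)

lemma one_notin_pp1 [simp]: "1 \<notin> pp 1" by (simp add: pp_iff val_1)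

lemma pi_power_mult_iff: "\<pi> ^ k * x \<in> pp (k + j) \<longleftrightarrow> x \<in> pp j"
  unfolding pp_iff using val_mult[of "\<pi> ^ k" x] pi_nonzero val_power[of \<pi> k] val_pi by (cases "x = 0") auto

lemma pi_mult_iff: "\<pi> * x \<in> pp (Suc j) \<longleftrightarrow> x \<in> pp j"
  using pi_power_mult_iff[of 1 x j] by (simp add: One_nat_def)

lemma pi_power_in: "\<pi> ^ k \<in> pp k" using pi_power_mult_iff[of k 1 0] by simp

lemma pi_in: "\<pi> \<in> pp 1" "\<pi> \<in> pp 0" using pi_power_in[of 1] pp_subset_0 by auto

lemma pp_E: assumes "x \<in> pp k" obtains y where "y \<in> pp 0" "x = \<pi> ^ k * y"
proof
  show "x = \<pi> ^ k * (x / \<pi> ^ k)" using pi_nonzero by simp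
  then show "x / \<pi> ^ k \<in> pp 0" using pi_power_mult_iff[of k "x / \<pi> ^ k" 0] assms by simp
qed

definition unit :: "'a \<Rightarrow> bool" where "unit x \<longleftrightarrow> x \<in> pp 0 \<and> x \<notin> pp 1"

lemma unit_iff_val: "unit x \<longleftrightarrow> x \<noteq> 0 \<and> val x = 0"
  unfolding unit_def pp_iff by auto

lemma unitD: "unit x \<Longrightarrow> x \<noteq> 0" "unit x \<Longrightarrow> x \<in> pp 0" "unit x \<Longrightarrow> inverse x \<in> pp 0"
  "unit x \<Longrightarrow> unit (inverse x)" "unit x \<Longrightarrow> unit (- x)"
  by (auto simp: unit_iff_val pp_iff val_inverse val_minus)

lemma unit_mult: "unit x \<Longrightarrow> unit y \<Longrightarrow> unit (x * y)"
  by (auto simp: unit_iff_val val_mult)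

lemma unit_mult_pp_iff: "unit u \<Longrightarrow> u * x \<in> pp k \<longleftrightarrow> x \<in> pp k"
  by (cases "x = 0") (auto simp: unit_iff_val pp_iff val_mult)

lemma unit_mult_iff: "unit u \<Longrightarrow> unit (u * x) \<longleftrightarrow> unit x"
  by (simp add: unit_def unit_mult_pp_iff)

lemma unit_2: "unit 2" using two_nonzero pp_of_nat[of 2] by (simp add: unit_def pp_def)

lemma unit_1: "unit 1" by (simp add: unit_def)

lemma unit_add_pp1: "unit x \<Longrightarrow> y \<in> pp 1 \<Longrightarrow> unit (x + y)"
  unfolding unit_def using pp_add[of x 0 y] pp_subset_0[of y 1] pp_diff[of "x + y" 1 y] by auto

lemma unit_cong: "x - y \<in> pp 1 \<Longrightarrow> unit x \<longleftrightarrow> unit y"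
  using unit_add_pp1[of x "y - x"] unit_add_pp1[of y "x - y"] pp_minus_commute[of x y 1] by auto

lemma subgrp_pp: "subgrp (pp k)"
  unfolding subgrp_def by (auto intro: pp_diff)

lemma pp_prime: "x \<in> pp 0 \<Longrightarrow> y \<in> pp 0 \<Longrightarrow> x * y \<in> pp 1 \<Longrightarrow> x \<in> pp 1 \<or> y \<in> pp 1"
  using unit_mult[of x y] unfolding unit_def by auto

lemma pp_cong_mult: "x - y \<in> pp k \<Longrightarrow> x' - y' \<in> pp k \<Longrightarrow> x' \<in> pp 0 \<Longrightarrow> y \<in> pp 0 \<Longrightarrow> x * x' - y * y' \<in> pp k"
  using pp_add[OF pp_mult_right[of "x - y" k x'] pp_mult_left[of y "x' - y'" k]]
  by (simp add: algebra_simps)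

lemma pp_cong_iff: "x - y \<in> pp k \<Longrightarrow> x \<in> pp k \<longleftrightarrow> y \<in> pp k"
  using pp_add[of "x - y" k y] pp_diff[of x k "x - y"] by auto

text \<open>The residue field is a set of classes, whereas averages run over representatives;
  \<open>g\<close> matches the two. This is where finiteness of the residue field and the definition
  of \<open>q\<close> enter.\<close>

lemma fin_quot_pp1: "fin_quot (pp 0) (pp 1)" and index_pp1: "grp_index (pp 0) (pp 1) = q"
proof -
  let ?r = "{(x, y). x \<in> integers val \<and> y \<in> integers val \<and> x - y \<in> frac_ideal val 1}"
  have r: "?r = {(x, y). x \<in> pp 0 \<and> y \<in> pp 0 \<and> x - y \<in> pp 1}" by (simp add: pp_def)
  define c where "c = (\<lambda>x. {y \<in> pp 0. x - y \<in> pp 1})"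
  have cls: "?r `` {x} = c x" if "x \<in> pp 0" for x
    using that unfolding r c_def by auto
  have sub: "pp 1 \<subseteq> pp 0" using pp_subset_0 by auto
  have mem: "x \<in> c x" if "x \<in> pp 0" for x using that by (simp add: c_def)
  have c_eq: "c x = c y \<longleftrightarrow> x - y \<in> pp 1" if "x \<in> pp 0" "y \<in> pp 0" for x y
  proof
    assume "c x = c y"
    then have "y \<in> c x" using mem[OF that(2)] by simp
    then show "x - y \<in> pp 1" by (simp add: c_def)
  qed (use subgrp_diff_cong(1)[OF subgrp_pp, of x y] in \<open>auto simp: c_def\<close>)
  have eq: "residue_field val = c ` pp 0"
    unfolding residue_field_def quotient_def pp_0[symmetric] using cls by (auto simp: pp_0)
  define g where "g = (\<lambda>C::'a set. coset_rep (pp 1) (SOME z. z \<in> C))"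
  have g: "g (c x) = coset_rep (pp 1) x" if "x \<in> pp 0" for x
  proof -
    have "(SOME z. z \<in> c x) \<in> c x" using mem[OF that] by (rule someI)
    then show ?thesis unfolding g_def coset_rep_eq_iff[OF subgrp_pp]
      using pp_minus_commute by (auto simp: c_def)
  qed
  have bij: "bij_betw g (residue_field val) (quot_reps (pp 0) (pp 1))"
    unfolding bij_betw_def eq
  proof
    show "inj_on g (c ` pp 0)"
      unfolding inj_on_def by (auto simp: g c_eq coset_rep_eq_iff[OF subgrp_pp])
    show "g ` c ` pp 0 = quot_reps (pp 0) (pp 1)"
      unfolding quot_reps_def image_image using g by (intro image_cong) auto
  qed
  show "fin_quot (pp 0) (pp 1)"
    unfolding fin_quot_def using bij_betw_finite[OF bij] finite_residue_field subgrp_pp sub by auto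
  show "grp_index (pp 0) (pp 1) = q"
    unfolding grp_index_def residue_size_def using bij_betw_same_card[OF bij] by simp
qed

lemma q_gt_1: "q > 1"
proof -
  have "card {coset_rep (pp 1) 0, coset_rep (pp 1) 1} \<le> grp_index (pp 0) (pp 1)"
    unfolding grp_index_def by (rule card_mono) (use fin_quotD(4)[OF fin_quot_pp1] in \<open>auto simp: quot_reps_def\<close>)
  moreover have "coset_rep (pp 1) 0 \<noteq> coset_rep (pp 1) 1"
    unfolding coset_rep_eq_iff[OF subgrp_pp] by simp
  ultimately show ?thesis unfolding index_pp1 by simp
qed

lemma q_pos: "real q > 0" "real q \<noteq> 0" "q > 0" using q_gt_1 by auto

section \<open>The quadratic residue character and its averages\<close>

abbreviation avgO :: "('a \<Rightarrow> real) \<Rightarrow> real" where "avgO \<equiv> avg (pp 0) (pp 1)"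

text \<open>The quadratic residue character, real-valued because it enters point counts. Outside
  \<open>pp 0\<close> its value is -1 by default.\<close>

definition eta :: "'a \<Rightarrow> real" where
  "eta t = (if t \<in> pp 1 then 0 else if \<exists>y\<in>pp 0. y * y - t \<in> pp 1 then 1 else - 1)"

lemma eta_cong: "t - s \<in> pp 1 \<Longrightarrow> eta t = eta s"
  unfolding eta_def using pp_cong_iff[of t s 1] subgrp_diff_cong(2)[OF subgrp_pp, of t s 1] by auto

lemma periodicI: "(\<And>x y. x \<in> G \<Longrightarrow> y \<in> G \<Longrightarrow> x - y \<in> K \<Longrightarrow> f x = f y) \<Longrightarrow> periodic G K f"
  unfolding periodic_def by blast

lemma avgO_single: "a \<in> pp 0 \<Longrightarrow> avgO (\<lambda>x. of_bool (x - a \<in> pp 1)) = 1 / q"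
  using avg_single[OF fin_quot_pp1] index_pp1 by simp

lemma avgO_pp1: "avgO (\<lambda>x. of_bool (x \<in> pp 1)) = 1 / q"
  using avgO_single[of 0] by simp

lemma avg_unit_scale:
  assumes "unit u" "periodic (pp 0) (pp 1) f"
  shows "avgO (\<lambda>x. f (u * x)) = avgO f"
proof (rule sym, rule avg_iso(3)[OF fin_quot_pp1 _ _ _ _ _ _ assms(2)])
  show "\<forall>z\<in>pp 0. \<exists>x\<in>pp 0. z - u * x \<in> pp 1"
  proof
    fix z assume "z \<in> pp 0"
    then show "\<exists>x\<in>pp 0. z - u * x \<in> pp 1"
      using unitD(1)[OF assms(1)]
      by (intro bexI[of _ "inverse u * z"])
        (auto simp: mult.assoc[symmetric] intro: pp_mult_left unitD(3)[OF assms(1)])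
  qed
  show "\<forall>x\<in>pp 0. \<forall>y\<in>pp 0. u * x - u * y \<in> pp 1 \<longleftrightarrow> x - y \<in> pp 1"
    using unit_mult_pp_iff[OF assms(1)] by (metis right_diff_distrib)
qed (use unitD[OF assms(1)] in \<open>auto intro: pp_mult_left subgrp_pp pp_subset_0\<close>)

text \<open>A nonzero square modulo \<open>\<pi>\<close> has exactly two roots, which are distinct
  because 2 is a unit; modulo \<open>\<pi>\<close>, zero has exactly one.\<close>

lemma square_count:
  assumes "a \<in> pp 0"
  shows "avgO (\<lambda>x. of_bool (x * x - a \<in> pp 1)) = (1 + eta a) / q"
proof -
  consider "a \<in> pp 1" | "a \<notin> pp 1" "\<exists>y\<in>pp 0. y * y - a \<in> pp 1"
    | "a \<notin> pp 1" "\<not> (\<exists>y\<in>pp 0. y * y - a \<in> pp 1)" by blast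
  then show ?thesis
  proof cases
    case 1
    have "avgO (\<lambda>x. of_bool (x * x - a \<in> pp 1)) = avgO (\<lambda>x. of_bool (x \<in> pp 1))"
    proof (rule avg_cong[OF fin_quot_pp1])
      fix x assume x: "x \<in> pp 0"
      have "x * x - a \<in> pp 1 \<longleftrightarrow> x * x \<in> pp 1" using pp_cong_iff[of "x * x - a" "x * x" 1] 1 by simp
      also have "\<dots> \<longleftrightarrow> x \<in> pp 1" using pp_prime[OF x x] pp_mult_left[OF x, of x 1] by auto
      finally show "of_bool (x * x - a \<in> pp 1) = (of_bool (x \<in> pp 1) :: real)" by simp
    qed
    then show ?thesis using 1 avgO_pp1 by (simp add: eta_def)
  next
    case 2
    then obtain y where y: "y \<in> pp 0" "y * y - a \<in> pp 1" by auto
    have y1: "y \<notin> pp 1" using pp_mult_left[OF y(1), of y 1] y(2) 2(1) pp_cong_iff by auto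
    then have uy: "unit (2 * y)" using y(1) unit_2 by (simp add: unit_mult unit_def[of y])
    have "avgO (\<lambda>x. of_bool (x * x - a \<in> pp 1)) = avgO (\<lambda>x. of_bool (x - y \<in> pp 1) + of_bool (x - (- y) \<in> pp 1))"
    proof (rule avg_cong[OF fin_quot_pp1])
      fix x assume x: "x \<in> pp 0"
      have "x * x - a \<in> pp 1 \<longleftrightarrow> x * x - y * y \<in> pp 1"
        using subgrp_diff_cong(2)[OF subgrp_pp y(2)] by simp
      also have "\<dots> \<longleftrightarrow> (x - y) * (x + y) \<in> pp 1" by (simp add: algebra_simps)
      also have "\<dots> \<longleftrightarrow> x - y \<in> pp 1 \<or> x + y \<in> pp 1"
        using pp_prime[of "x - y" "x + y"] pp_mult_left[of "x - y" "x + y" 1] pp_mult_right[of "x - y" 1 "x + y"]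
          pp_add[OF x y(1)] pp_diff[OF x y(1)] by auto
      finally have e: "x * x - a \<in> pp 1 \<longleftrightarrow> x - y \<in> pp 1 \<or> x + y \<in> pp 1" .
      have "\<not> (x - y \<in> pp 1 \<and> x + y \<in> pp 1)"
        using pp_diff[of "x + y" 1 "x - y"] uy by (auto simp: unit_def algebra_simps)
      then show "of_bool (x * x - a \<in> pp 1) = (of_bool (x - y \<in> pp 1) + of_bool (x - (- y) \<in> pp 1) :: real)"
        using e by auto
    qed
    also have "\<dots> = 2 / q"
      unfolding avg_add avgO_single[OF y(1)] avgO_single[OF pp_uminus[OF y(1)]] by simp
    finally show ?thesis using 2 by (simp add: eta_def)
  next
    case 3
    then have "avgO (\<lambda>x. of_bool (x * x - a \<in> pp 1)) = 0"
      by (intro avg_const_on[OF fin_quot_pp1]) auto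
    then show ?thesis using 3 by (simp add: eta_def)
  qed
qed

text \<open>The pairs with \<open>x * x\<close> congruent to \<open>a\<close> are counted twice: for
  fixed \<open>x\<close> there is exactly one class of \<open>a\<close>, for fixed \<open>a\<close>
  the number is given by \<open>square_count\<close>.\<close>

lemma avg_eta: "avgO eta = 0"
proof -
  have "avgO (\<lambda>a. avgO (\<lambda>x. of_bool (x * x - a \<in> pp 1))) = avgO (\<lambda>x. avgO (\<lambda>a. of_bool (a - x * x \<in> pp 1)))"
    by (subst avg_swap) (simp add: pp_minus_commute)
  also have "\<dots> = 1 / q"
    by (rule avg_const_on[OF fin_quot_pp1]) (rule avgO_single, rule pp_mult_left)
  also have "avgO (\<lambda>a. avgO (\<lambda>x. of_bool (x * x - a \<in> pp 1))) = avgO (\<lambda>a. (1 + eta a) / q)"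
    by (rule avg_cong[OF fin_quot_pp1 square_count])
  also have "\<dots> = avgO (\<lambda>a. (1 / q) * (1 + eta a))" by simp
  also have "\<dots> = (1 + avgO eta) / q" unfolding avg_cmult avg_add avg_const[OF fin_quot_pp1] by simp
  finally show ?thesis using q_pos by (simp add: field_simps)
qed

lemma eta_pp1: "t \<in> pp 1 \<Longrightarrow> eta t = 0" by (simp add: eta_def)

lemma eta_unit: "unit t \<Longrightarrow> eta t = 1 \<or> eta t = - 1" by (auto simp: eta_def unit_def)

lemma eta_square: "unit y \<Longrightarrow> eta (y * y) = 1"
  using unit_mult[of y y] by (auto simp: eta_def unit_def intro!: bexI[of _ y])

lemma eta_square_mult:
  assumes "unit y" shows "eta (y * y * t) = eta t"
proof -
  have u: "unit (y * y)" using unit_mult[OF assms assms] .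
  have "(\<exists>z\<in>pp 0. z * z - y * y * t \<in> pp 1) \<longleftrightarrow> (\<exists>z\<in>pp 0. z * z - t \<in> pp 1)"
  proof (intro iffI; elim bexE)
    fix z assume z: "z \<in> pp 0" "z * z - y * y * t \<in> pp 1"
    have "y * y * ((inverse y * z) * (inverse y * z) - t) = z * z - y * y * t"
      using unitD(1)[OF assms] by (simp add: field_simps)
    then have "(inverse y * z) * (inverse y * z) - t \<in> pp 1" using unit_mult_pp_iff[OF u] z by metis
    then show "\<exists>z\<in>pp 0. z * z - t \<in> pp 1" using pp_mult_left[OF unitD(3)[OF assms] z(1)] by blast
  next
    fix z assume z: "z \<in> pp 0" "z * z - t \<in> pp 1"
    have "y * y * (z * z - t) = (y * z) * (y * z) - y * y * t" by (simp add: algebra_simps)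
    then have "(y * z) * (y * z) - y * y * t \<in> pp 1" using unit_mult_pp_iff[OF u] z by metis
    then show "\<exists>z\<in>pp 0. z * z - y * y * t \<in> pp 1" using pp_mult_left[OF unitD(2)[OF assms] z(1)] by blast
  qed
  then show ?thesis unfolding eta_def unit_mult_pp_iff[OF u] by simp
qed

text \<open>For a non-square unit \<open>n\<close> the function \<open>a \<mapsto> \<eta> a + \<eta> (n a)\<close> has average 0 and is never
  positive, so it vanishes identically.\<close>

lemma eta_mult: assumes "s \<in> pp 0" "t \<in> pp 0" shows "eta (s * t) = eta s * eta t"
proof (cases "s \<in> pp 1 \<or> t \<in> pp 1")
  case True
  then have "s * t \<in> pp 1" using pp_mult_left[OF assms(1)] pp_mult_right[OF _ assms(2)] by auto
  then show ?thesis using True by (auto simp: eta_pp1)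
next
  case False
  then have us: "unit s" and ut: "unit t" using assms by (auto simp: unit_def)
  have sq: "eta (x * y) = eta y" if x: "unit x" "eta x = 1" for x y
  proof -
    obtain z where z: "z \<in> pp 0" "z * z - x \<in> pp 1" using x unfolding eta_def by (auto split: if_splits)
    have uz: "unit z" using unit_cong[OF z(2)] x pp_mult_left[OF z(1), of z 1] z(1) unfolding unit_def by auto
    show ?thesis
    proof (cases "y \<in> pp 0")
      case True
      have "z * z * y - x * y \<in> pp 1" using pp_mult_right[OF z(2) True] by (simp add: algebra_simps)
      then show ?thesis using eta_cong[of "z * z * y" "x * y"] eta_square_mult[OF uz] by simp
    next
      case False
      have n: "eta w = - 1" if w: "w \<notin> pp 0" for w
      proof -
        have "w \<in> pp 0" if "z \<in> pp 0" "z * z - w \<in> pp 1" for z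
          using pp_diff[OF pp_mult_left[OF that(1,1)] pp_subset_0[OF that(2)]] by simp
        then show ?thesis using w pp_subset_0[of w 1] unfolding eta_def by auto
      qed
      show ?thesis using n[of y] n[of "x * y"] False unit_mult_pp_iff[OF x(1), of y 0] by simp
    qed
  qed
  show ?thesis
  proof (cases "eta s = 1")
    case True then show ?thesis using sq[OF us] by simp
  next
    case f: False
    then have es: "eta s = - 1" using eta_unit[OF us] by auto
    have per: "periodic (pp 0) (pp 1) (\<lambda>a. - (eta a + eta (s * a)))"
    proof (rule periodicI)
      fix x y assume "x \<in> pp 0" "y \<in> pp 0" "x - y \<in> pp 1"
      then show "- (eta x + eta (s * x)) = - (eta y + eta (s * y))"
        using eta_cong[of x y] eta_cong[of "s * x" "s * y"] pp_mult_left[OF assms(1), of "x - y" 1]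
        by (simp add: right_diff_distrib)
    qed
    have "periodic (pp 0) (pp 1) eta" by (rule periodicI) (rule eta_cong)
    then have "avgO (\<lambda>a. eta (s * a)) = 0" using avg_unit_scale[OF us] avg_eta by simp
    then have a0: "avgO (\<lambda>a. - (eta a + eta (s * a))) = 0"
      using avg_cmult[of "pp 0" "pp 1" "- 1" "\<lambda>a. eta a + eta (s * a)"] avg_eta avg_add[of "pp 0" "pp 1" eta] by simp
    \<comment> \<open>For a unit \<open>a\<close> with \<open>eta a = 1\<close>, the square case
      gives \<open>eta (s * a) = eta s = - 1\<close>; so the sum of the two values is 0 or
      -2.\<close>
    have nn: "0 \<le> - (eta a + eta (s * a))" if a: "a \<in> pp 0" for a
    proof -
      consider "a \<in> pp 1" | "unit a" using a by (auto simp: unit_def)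
      then show ?thesis
      proof cases
        case 1
        then show ?thesis using pp_mult_left[OF assms(1), of a 1] by (simp add: eta_pp1)
      next
        case 2
        then show ?thesis using eta_unit[OF 2] eta_unit[OF unit_mult[OF us 2]] sq[OF 2, of s] es
          by (auto simp: mult.commute)
      qed
    qed
    have "- (eta t + eta (s * t)) = 0"
      by (rule avg_zero_imp[OF fin_quot_pp1 per nn a0 assms(2)])
    then show ?thesis using es by simp
  qed
qed

lemma eta_inverse: "unit u \<Longrightarrow> eta (inverse u) = eta u"
  using eta_mult[of u "inverse u"] unitD[of u] eta_unit[of u] eta_unit[of "inverse u"] eta_square[of 1] unit_1 by auto

text \<open>Both sides of the hyperbola \<open>x\<^sup>2 - y\<^sup>2 = d\<close> are counted: once for fixed \<open>x\<close>, and once in the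
  coordinates \<open>x - y\<close>, \<open>x + y\<close>.\<close>

lemma avg_eta_square_minus:
  assumes "d \<in> pp 0"
  shows "avgO (\<lambda>x. eta (x * x - d)) = (if d \<in> pp 1 then 1 - 1 / q else - 1 / q)"
proof (cases "d \<in> pp 1")
  case True
  have "avgO (\<lambda>x. eta (x * x - d)) = avgO (\<lambda>x. 1 - of_bool (x \<in> pp 1))"
  proof (rule avg_cong[OF fin_quot_pp1])
    fix x assume x: "x \<in> pp 0"
    have "eta (x * x - d) = eta (x * x)" by (rule eta_cong) (use True in simp)
    also have "\<dots> = 1 - of_bool (x \<in> pp 1)"
      using eta_square[of x] x pp_mult_left[OF x, of x 1] by (auto simp: unit_def eta_pp1)
    finally show "eta (x * x - d) = 1 - of_bool (x \<in> pp 1)" .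
  qed
  then show ?thesis using True avgO_pp1 by (simp add: avg_diff avg_const[OF fin_quot_pp1])
next
  case False
  then have ud: "unit d" using assms by (simp add: unit_def)
  let ?f = "\<lambda>p. of_bool (fst p * fst p - snd p * snd p - d \<in> pp 1) :: real"
  let ?g = "\<lambda>p. of_bool (fst p * snd p - d \<in> pp 1) :: real"
  let ?G = "pp 0 \<times> pp 0" and ?K = "pp 1 \<times> pp 1"
  note P = avg_prod[OF fin_quot_pp1 fin_quot_pp1]
  note fP = fin_quotD[OF P(1)]
  have pf: "periodic ?G ?K ?f"
  proof (rule periodicI)
    fix x y assume xy: "x \<in> ?G" "y \<in> ?G" "x - y \<in> ?K"
    then have "(fst x * fst x - snd x * snd x - d) - (fst y * fst y - snd y * snd y - d) \<in> pp 1"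
      using pp_diff[OF pp_cong_mult[of "fst x" "fst y" 1 "fst x" "fst y"] pp_cong_mult[of "snd x" "snd y" 1 "snd x" "snd y"]]
      by (simp add: mem_Times_iff) (simp add: algebra_simps)
    then show "?f x = ?f y" using pp_cong_iff[of "fst x * fst x - snd x * snd x - d" "fst y * fst y - snd y * snd y - d" 1] by simp
  qed
  have pg: "periodic ?G ?K ?g"
  proof (rule periodicI)
    fix x y assume xy: "x \<in> ?G" "y \<in> ?G" "x - y \<in> ?K"
    then have "(fst x * snd x - d) - (fst y * snd y - d) \<in> pp 1"
      using pp_cong_mult[of "fst x" "fst y" 1 "snd x" "snd y"] by (auto simp: mem_Times_iff)
    then show "?g x = ?g y" using pp_cong_iff[of "fst x * snd x - d" "fst y * snd y - d" 1] by simp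
  qed
  let ?h = "\<lambda>p::'a \<times> 'a. (fst p - snd p, fst p + snd p)"
  have "avg ?G ?K ?g = avg ?G ?K (\<lambda>x. ?g (?h x))"
  proof (rule avg_iso(3)[OF P(1) fP(1-3) _ _ _ pg])
    show "\<forall>x\<in>?G. ?h x \<in> ?G" by (auto intro: pp_add pp_diff)
    show "\<forall>x\<in>?G. \<forall>y\<in>?G. ?h x - ?h y \<in> ?K \<longleftrightarrow> x - y \<in> ?K"
    proof (intro ballI)
      fix x y :: "'a \<times> 'a"
      define s where "s = fst x - fst y" define t where "t = snd x - snd y"
      have e: "?h x - ?h y = (s - t, s + t)" by (simp add: s_def t_def)
      have "s \<in> pp 1 \<and> t \<in> pp 1" if "s - t \<in> pp 1" "s + t \<in> pp 1"
        using pp_add[OF that] pp_diff[OF that(2,1)] unit_mult_pp_iff[OF unit_2, of s 1] unit_mult_pp_iff[OF unit_2, of t 1]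
        by simp
      then show "?h x - ?h y \<in> ?K \<longleftrightarrow> x - y \<in> ?K"
        unfolding e using pp_add[of s 1 t] pp_diff[of s 1 t] by (auto simp: mem_Times_iff s_def t_def)
    qed
    show "\<forall>z\<in>?G. \<exists>x\<in>?G. z - ?h x \<in> ?K"
    proof
      fix z assume z: "z \<in> ?G"
      define c where "c = inverse (2::'a)"
      have c: "c \<in> pp 0" using unitD(3)[OF unit_2] by (simp add: c_def)
      have "2 * c = 1" using unitD(1)[OF unit_2] by (simp add: c_def)
      then have cc: "c + c = 1" by (simp flip: mult_2)
      let ?x = "(c * (fst z + snd z), c * (snd z - fst z))"
      have i: "?x \<in> ?G" using z c by (auto simp: mem_Times_iff intro!: pp_mult_left pp_add pp_diff)
      have "fst (?h ?x) = (c + c) * fst z" "snd (?h ?x) = (c + c) * snd z" by (simp_all add: algebra_simps)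
      then have "z - ?h ?x = 0" using cc by (simp add: prod_eq_iff)
      then show "\<exists>x\<in>?G. z - ?h x \<in> ?K" using i by (intro bexI[of _ ?x]) (simp_all add: zero_prod_def)
    qed
  qed
  also have "(\<lambda>x. ?g (?h x)) = ?f" by (auto simp: fun_eq_iff algebra_simps)
  finally have gf: "avg ?G ?K ?g = avg ?G ?K ?f" .
  have "avg ?G ?K ?g = avgO (\<lambda>a. avgO (\<lambda>c. of_bool (a * c - d \<in> pp 1)))" using P(3)[OF pg] by simp
  also have "\<dots> = avgO (\<lambda>a. (1 / q) * (1 - of_bool (a \<in> pp 1)))"
  proof (rule avg_cong[OF fin_quot_pp1])
    fix a assume a: "a \<in> pp 0"
    show "avgO (\<lambda>c. of_bool (a * c - d \<in> pp 1)) = (1 / q) * (1 - of_bool (a \<in> pp 1))"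
    proof (cases "a \<in> pp 1")
      case True
      have "a * c - d \<notin> pp 1" if "c \<in> pp 0" for c
        using pp_mult_right[OF True that] pp_cong_iff[of "a * c" d 1] False by auto
      then have "avgO (\<lambda>c. of_bool (a * c - d \<in> pp 1)) = 0" by (intro avg_const_on[OF fin_quot_pp1]) auto
      then show ?thesis using True by simp
    next
      case na: False
      then have ua: "unit a" using a by (simp add: unit_def)
      have "a * c - d \<in> pp 1 \<longleftrightarrow> c - inverse a * d \<in> pp 1" for c
        using unit_mult_pp_iff[OF ua, of "c - inverse a * d" 1] unitD(1)[OF ua]
          by (simp add: right_diff_distrib mult.assoc[symmetric])
      then show ?thesis using avgO_single[OF pp_mult_left[OF unitD(3)[OF ua] assms]] na by simp
    qed
  qed
  also have "\<dots> = (1 / q) * (1 - 1 / q)"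
    unfolding avg_cmult avg_diff avg_const[OF fin_quot_pp1] avgO_pp1 by simp
  finally have 1: "avg ?G ?K ?g = (1 / q) * (1 - 1 / q)" .
  have "avg ?G ?K ?f = avgO (\<lambda>x. avgO (\<lambda>y. of_bool (x * x - y * y - d \<in> pp 1)))" using P(3)[OF pf] by simp
  also have "\<dots> = avgO (\<lambda>x. (1 + eta (x * x - d)) / q)"
  proof (rule avg_cong[OF fin_quot_pp1])
    fix x assume x: "x \<in> pp 0"
    have "x * x - y * y - d \<in> pp 1 \<longleftrightarrow> y * y - (x * x - d) \<in> pp 1" for y
      using pp_minus_commute[of "y * y" "x * x - d" 1] by (simp add: algebra_simps)
    then show "avgO (\<lambda>y. of_bool (x * x - y * y - d \<in> pp 1)) = (1 + eta (x * x - d)) / q"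
      using square_count[OF pp_diff[OF pp_mult_left[OF x x] assms]] by simp
  qed
  also have "\<dots> = avgO (\<lambda>x. (1 / q) * (1 + eta (x * x - d)))" by simp
  also have "\<dots> = (1 / q) * (1 + avgO (\<lambda>x. eta (x * x - d)))"
    unfolding avg_cmult avg_add avg_const[OF fin_quot_pp1] by simp
  finally show ?thesis using gf 1 False q_pos by (simp add: field_simps)
qed

end

section \<open>Finiteness of subquotients, chains, and coordinates on tuples\<close>

lemma fin_quot_sub:
  assumes "fin_quot G K" "subgrp G'" "subgrp K'" "G' \<subseteq> G" "K' \<subseteq> G'"
    and "\<And>x. x \<in> G' \<Longrightarrow> x \<in> K \<Longrightarrow> x \<in> K'"
  shows "fin_quot G' K'"
proof -
  note f = fin_quotD[OF assms(1)]
  let ?F = "\<lambda>r. coset_rep K' (SOME x. x \<in> G' \<and> coset_rep K x = r)"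
  have "quot_reps G' K' \<subseteq> ?F ` quot_reps G K"
  proof
    fix r assume "r \<in> quot_reps G' K'"
    then obtain x where x: "x \<in> G'" "r = coset_rep K' x" unfolding quot_reps_def by auto
    let ?y = "SOME y. y \<in> G' \<and> coset_rep K y = coset_rep K x"
    have "?y \<in> G' \<and> coset_rep K ?y = coset_rep K x"
      by (rule someI[of _ x]) (use x in auto)
    then have y: "?y \<in> G'" "?y - x \<in> K" using coset_rep_eq_iff[OF f(2)] by auto
    then have "?y - x \<in> K'" using assms(6) subgrpD(2)[OF assms(2)] x by auto
    then have "r = ?F (coset_rep K x)" using coset_rep_eq_iff[OF assms(3)] x by metis
    then show "r \<in> ?F ` quot_reps G K" using x assms(4) unfolding quot_reps_def by auto
  qed
  then have "finite (quot_reps G' K')" using f(4) finite_subset by blast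
  then show ?thesis using assms unfolding fin_quot_def by auto
qed

lemma fin_quot_chain:
  assumes "\<And>k. fin_quot (G k) (G (Suc k))" "\<And>k. grp_index (G k) (G (Suc k)) = c" "subgrp (G 0)"
  shows "fin_quot (G 0) (G k)" "grp_index (G 0) (G k) = c ^ k"
proof -
  have "fin_quot (G 0) (G k) \<and> grp_index (G 0) (G k) = c ^ k"
  proof (induction k)
    case 0
    have t: "transversal (G 0) (G 0) {0}"
      unfolding transversal_def using subgrpD[OF assms(3)] by auto
    show ?case using transversal_avg(1,2)[OF assms(3,3) _ t] by auto
  next
    case (Suc k)
    then show ?case using avg_tower(1,2)[of "G 0" "G k" "G (Suc k)"] assms by auto
  qed
  then show "fin_quot (G 0) (G k)" "grp_index (G 0) (G k) = c ^ k" by auto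
qed

text \<open>Coordinates \<open>h\<close> on the group are applied entry by entry, which turns an
  average over tuples into an iterated one over tuples of coordinates. The condition
  \<open>h 0 = 0\<close> preserves the zero padding from \<open>n\<close> on.\<close>

lemma avg_tup_split:
  assumes "fin_quot G1 K1" "fin_quot G2 K2" "subgrp G" "subgrp K" "K \<subseteq> G"
    and "\<forall>x\<in>G1 \<times> G2. h x \<in> G"
    and "\<forall>x\<in>G1 \<times> G2. \<forall>y\<in>G1 \<times> G2. h x - h y \<in> K \<longleftrightarrow> x - y \<in> K1 \<times> K2"
    and "\<forall>z\<in>G. \<exists>x\<in>G1 \<times> G2. z = h x" and "h 0 = 0"
    and per: "periodic (tup n G) (tup n K) F"
  shows "avg (tup n G) (tup n K) F =
    avg (tup n G1) (tup n K1) (\<lambda>\<alpha>. avg (tup n G2) (tup n K2) (\<lambda>z. F (\<lambda>i. h (\<alpha> i, z i))))"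
proof -
  note f1 = fin_quotD[OF fin_quot_tup[OF assms(1), of n]] and f2 = fin_quotD[OF fin_quot_tup[OF assms(2), of n]]
  note P = avg_prod[OF fin_quot_tup[OF assms(1), of n] fin_quot_tup[OF assms(2), of n]]
  let ?G = "tup n G1 \<times> tup n G2" and ?K = "tup n K1 \<times> tup n K2"
  let ?h = "\<lambda>p i. h (fst p i, snd p i)"
  have h0: "h (0, 0) = 0" using assms(9) by (simp add: zero_prod_def)
  have a: "?h x \<in> tup n G" if x: "x \<in> ?G" for x
    using x assms(6) h0 by (auto simp: tup_def)
  have c: "?h x - ?h y \<in> tup n K \<longleftrightarrow> x - y \<in> ?K" if x: "x \<in> ?G" and y: "y \<in> ?G" for x y
  proof -
    have "h (fst x i, snd x i) - h (fst y i, snd y i) \<in> K \<longleftrightarrow> fst x i - fst y i \<in> K1 \<and> snd x i - snd y i \<in> K2"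
      if "i < n" for i
      using assms(7)[rule_format, of "(fst x i, snd x i)" "(fst y i, snd y i)"] x y that
      by (auto simp: tup_def mem_Times_iff)
    moreover have "?h x i = 0" "?h y i = 0" "fst x i = 0" "fst y i = 0" "snd x i = 0" "snd y i = 0" if "i \<ge> n" for i
      using x y that h0 by (auto simp: tup_def mem_Times_iff)
    ultimately show ?thesis by (auto simp: tup_def mem_Times_iff)
  qed
  have d: "\<exists>x\<in>?G. z - ?h x \<in> tup n K" if z: "z \<in> tup n G" for z
  proof -
    have "\<forall>i. \<exists>p. (i < n \<longrightarrow> p \<in> G1 \<times> G2 \<and> z i = h p) \<and> (i \<ge> n \<longrightarrow> p = 0)"
      using assms(8) tupD(1)[OF z] by (metis leD)
    then obtain p where p: "\<And>i. i < n \<Longrightarrow> p i \<in> G1 \<times> G2 \<and> z i = h (p i)" "\<And>i. i \<ge> n \<Longrightarrow> p i = 0"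
      by metis
    have "(\<lambda>i. fst (p i), \<lambda>i. snd (p i)) \<in> ?G"
      using p by (auto simp: tup_def mem_Times_iff)
    moreover have "z - ?h (\<lambda>i. fst (p i), \<lambda>i. snd (p i)) = 0"
    proof
      fix i show "(z - ?h (\<lambda>i. fst (p i), \<lambda>i. snd (p i))) i = 0 i"
        using p[of i] tupD(2)[OF z, of i] assms(9) by (cases "i < n") auto
    qed
    ultimately show ?thesis using subgrpD(1)[OF subgrp_tup[OF assms(4)]] by metis
  qed
  have pF: "periodic ?G ?K (\<lambda>x. F (?h x))"
    unfolding periodic_def
  proof (intro ballI impI)
    fix x y assume *: "x \<in> ?G" "y \<in> ?G" "x - y \<in> ?K"
    then show "F (?h x) = F (?h y)"
      using per a[OF *(1)] a[OF *(2)] c[OF *(1,2)] unfolding periodic_def by (metis (no_types))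
  qed
  have "avg (tup n G) (tup n K) F = avg ?G ?K (\<lambda>x. F (?h x))"
  proof (rule avg_iso(3)[OF P(1) subgrp_tup[OF assms(3)] subgrp_tup[OF assms(4)] tup_mono[OF assms(5)] _ _ _ per])
    show "\<forall>x\<in>?G. ?h x \<in> tup n G" by (intro ballI) (rule a)
    show "\<forall>x\<in>?G. \<forall>y\<in>?G. ?h x - ?h y \<in> tup n K \<longleftrightarrow> x - y \<in> ?K" by (intro ballI) (rule c)
    show "\<forall>z\<in>tup n G. \<exists>x\<in>?G. z - ?h x \<in> tup n K" by (intro ballI) (rule d)
  qed
  also have "\<dots> = avg (tup n G1) (tup n K1) (\<lambda>\<alpha>. avg (tup n G2) (tup n K2) (\<lambda>z. F (\<lambda>i. h (\<alpha> i, z i))))"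
    using P(3)[OF pF] by simp
  finally show ?thesis .
qed

text \<open>Multiplication by \<open>\<pi> ^ k\<close> identifies each quotient
  \<open>pp k / pp (Suc k)\<close> with the residue field.\<close>

lemma (in odd_local_field) fin_quot_pp: "fin_quot (pp 0) (pp k)"
  and index_pp: "grp_index (pp 0) (pp k) = q ^ k"
proof -
  have "fin_quot (pp k) (pp (Suc k)) \<and> grp_index (pp k) (pp (Suc k)) = q" for k
  proof -
    have sub: "pp (Suc k) \<subseteq> pp k" using pp_mono[of k "Suc k"] by auto
    have a: "\<forall>x\<in>pp 0. \<pi> ^ k * x \<in> pp k" using pi_power_mult_iff[of k _ 0] by simp
    have b: "\<forall>x\<in>pp 0. \<forall>y\<in>pp 0. \<pi> ^ k * x - \<pi> ^ k * y \<in> pp (Suc k) \<longleftrightarrow> x - y \<in> pp 1"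
      using pi_power_mult_iff[of k _ 1] by (simp add: One_nat_def flip: right_diff_distrib)
    have c: "\<forall>z\<in>pp k. \<exists>x\<in>pp 0. z - \<pi> ^ k * x \<in> pp (Suc k)"
    proof
      fix z assume "z \<in> pp k"
      then obtain y where "y \<in> pp 0" "z = \<pi> ^ k * y" by (rule pp_E)
      then show "\<exists>x\<in>pp 0. z - \<pi> ^ k * x \<in> pp (Suc k)" by (intro bexI[of _ y]) auto
    qed
    show ?thesis
      using avg_iso(1,2)[OF fin_quot_pp1 subgrp_pp subgrp_pp sub a b c] index_pp1 by simp
  qed
  then show "fin_quot (pp 0) (pp k)" "grp_index (pp 0) (pp k) = q ^ k"
    using fin_quot_chain[of pp q k] subgrp_pp by auto
qed

section \<open>Unimodular lattices\<close>

text \<open>The ambient space is arbitrary, possibly infinite-dimensional and degenerate. Lattices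
  are just submodules of it, so orthogonal complements stay in the same space and the same
  type.\<close>

locale quadratic_lattices = odd_local_field val \<pi> + quadratic_space scale b
  for val :: "'a::field \<Rightarrow> int" and \<pi> :: 'a and scale :: "'a \<Rightarrow> 'w::ab_group_add \<Rightarrow> 'w" and b
begin

lemma B_add_right: "b w (u + v) = b w u + b w v" using B_sym B_add by metis
lemma B_scale_right: "b w (scale c u) = c * b w u" using B_sym B_scale by metis
lemma B_zero [simp]: "b 0 w = 0" "b w 0 = 0"
  using B_scale[of 0 0 w] B_scale_right[of w 0 0] by auto
lemma B_uminus: "b (- u) w = - b u w" "b w (- u) = - b w u"
  using B_add[of u "- u" w] B_add_right[of w u "- u"] by (simp_all add: eq_neg_iff_add_eq_0 add.commute)
lemma B_diff: "b (u - v) w = b u w - b v w" "b w (u - v) = b w u - b w v"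
  using B_add[of u "- v" w] B_add_right[of w u "- v"] B_uminus by auto
lemma B_sum: "b (\<Sum>i\<in>I. f i) w = (\<Sum>i\<in>I. b (f i) w)"
  by (induction I rule: infinite_finite_induct) (auto simp: B_add)
lemma B_sum_right: "b w (\<Sum>i\<in>I. f i) = (\<Sum>i\<in>I. b w (f i))"
  by (induction I rule: infinite_finite_induct) (auto simp: B_add_right)

lemmas B_simps = B_add B_add_right B_scale B_scale_right B_uminus B_diff B_sum B_sum_right

definition omod :: "'w set \<Rightarrow> bool" where
  "omod M \<longleftrightarrow> 0 \<in> M \<and> (\<forall>x\<in>M. \<forall>y\<in>M. x + y \<in> M) \<and> (\<forall>c\<in>pp 0. \<forall>x\<in>M. scale c x \<in> M)"

definition mul :: "nat \<Rightarrow> 'w set \<Rightarrow> 'w set" where "mul k M = scale (\<pi> ^ k) ` M"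

lemma omodD:
  assumes "omod M"
  shows "0 \<in> M" "x \<in> M \<Longrightarrow> y \<in> M \<Longrightarrow> x + y \<in> M" "c \<in> pp 0 \<Longrightarrow> x \<in> M \<Longrightarrow> scale c x \<in> M"
    "x \<in> M \<Longrightarrow> - x \<in> M" "x \<in> M \<Longrightarrow> y \<in> M \<Longrightarrow> x - y \<in> M" "subgrp M"
proof -
  show *: "0 \<in> M" and a: "\<And>x y. x \<in> M \<Longrightarrow> y \<in> M \<Longrightarrow> x + y \<in> M"
    and s: "\<And>c x. c \<in> pp 0 \<Longrightarrow> x \<in> M \<Longrightarrow> scale c x \<in> M" using assms unfolding omod_def by auto
  show m: "- x \<in> M" if "x \<in> M" for x using s[of "- 1" x] that by simp
  show d: "x - y \<in> M" if "x \<in> M" "y \<in> M" for x y using a[OF that(1) m[OF that(2)]] by simp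
  show "subgrp M" unfolding subgrp_def using * d by auto
qed

lemma omod_sum: "omod M \<Longrightarrow> (\<And>i. i \<in> I \<Longrightarrow> f i \<in> M) \<Longrightarrow> (\<Sum>i\<in>I. f i) \<in> M"
  by (induction I rule: infinite_finite_induct) (auto intro: omodD)

lemma scale_pi_mem_iff: "scale (\<pi> ^ k) x \<in> mul k M \<longleftrightarrow> x \<in> M"
  unfolding mul_def using pi_nonzero by (auto simp: scale_left_imp_eq)

lemma omod_mul: assumes "omod M" shows "omod (mul k M)"
  unfolding omod_def
proof (intro conjI ballI)
  show "0 \<in> mul k M" unfolding mul_def using omodD(1)[OF assms] by force
  show "x + y \<in> mul k M" if "x \<in> mul k M" "y \<in> mul k M" for x y
    using that omodD(2)[OF assms] unfolding mul_def by (auto simp flip: scale_right_distrib)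
  show "scale c x \<in> mul k M" if c: "c \<in> pp 0" and x: "x \<in> mul k M" for c x
  proof -
    obtain y where "y \<in> M" "x = scale (\<pi> ^ k) y" using x unfolding mul_def by auto
    moreover from this have "scale c x = scale (\<pi> ^ k) (scale c y)" by (simp add: mult.commute)
    ultimately show ?thesis using omodD(3)[OF assms c] scale_pi_mem_iff by metis
  qed
qed

lemma mul_0 [simp]: "mul 0 M = M" unfolding mul_def by simp

lemma mul_mul: "mul i (mul j M) = mul (i + j) M"
  unfolding mul_def by (auto simp: image_image power_add)

lemma mul_subset: "omod M \<Longrightarrow> mul k M \<subseteq> M"
  unfolding mul_def using omodD(3) pp_subset_0[OF pi_power_in] by auto

lemma mul_anti: "omod M \<Longrightarrow> i \<le> j \<Longrightarrow> mul j M \<subseteq> mul i M"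
  using image_mono[OF mul_subset[of M "j - i"], of "scale (\<pi> ^ i)"] mul_mul[of i "j - i" M]
  by (simp add: mul_def[of i])

lemma scale_pp_mem:
  assumes "omod M" "c \<in> pp k" "x \<in> M" shows "scale c x \<in> mul k M"
proof -
  obtain d where "d \<in> pp 0" "c = \<pi> ^ k * d" using assms(2) by (rule pp_E)
  then show ?thesis using omodD(3)[OF assms(1) _ assms(3)] unfolding mul_def
    by (auto simp flip: scale_scale)
qed

lemma scale_mem_mul: "omod M \<Longrightarrow> c \<in> pp 0 \<Longrightarrow> x \<in> mul k M \<Longrightarrow> scale c x \<in> mul k M"
  using omodD(3)[OF omod_mul] by blast

lemma fin_quot_mul:
  assumes "omod M" "fin_quot M (mul 1 M)"
  shows "fin_quot M (mul k M)" "grp_index M (mul k M) = grp_index M (mul 1 M) ^ k"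
proof -
  have "fin_quot (mul k M) (mul (Suc k) M) \<and> grp_index (mul k M) (mul (Suc k) M) = grp_index M (mul 1 M)" for k
  proof -
    have a: "\<forall>x\<in>M. scale (\<pi> ^ k) x \<in> mul k M" by (simp add: scale_pi_mem_iff)
    have d: "\<forall>x\<in>M. \<forall>y\<in>M. scale (\<pi> ^ k) x - scale (\<pi> ^ k) y \<in> mul (Suc k) M \<longleftrightarrow> x - y \<in> mul 1 M"
      using scale_pi_mem_iff[of k _ "mul 1 M"] unfolding mul_mul
      by (simp add: One_nat_def flip: scale_right_diff_distrib)
    have z0: "0 \<in> mul (Suc k) M" using omodD(1)[OF omod_mul[OF assms(1)]] .
    have c: "\<forall>z\<in>mul k M. \<exists>x\<in>M. z - scale (\<pi> ^ k) x \<in> mul (Suc k) M"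
    proof
      fix z assume "z \<in> mul k M"
      then obtain x where "x \<in> M" "z = scale (\<pi> ^ k) x" unfolding mul_def by auto
      then show "\<exists>x\<in>M. z - scale (\<pi> ^ k) x \<in> mul (Suc k) M" using z0 by (intro bexI[of _ x]) auto
    qed
    have sub: "mul (Suc k) M \<subseteq> mul k M" using mul_anti[OF assms(1)] by simp
    show ?thesis
      using avg_iso(1,2)[OF assms(2) omodD(6)[OF omod_mul[OF assms(1)]] omodD(6)[OF omod_mul[OF assms(1)]] sub a d c] by simp
  qed
  then show "fin_quot M (mul k M)" "grp_index M (mul k M) = grp_index M (mul 1 M) ^ k"
    using fin_quot_chain[of "\<lambda>k. mul k M" "grp_index M (mul 1 M)" k] omodD(6)[OF assms(1)] by auto
qed

text \<open>Self-duality without a basis: the form is nondegenerate modulo \<open>\<pi>\<close>, and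
  the rank is read off from the index of \<open>\<pi> M\<close>. Both conditions pass directly to
  orthogonal complements.\<close>

definition unimodular :: "nat \<Rightarrow> 'w set \<Rightarrow> bool" where
  "unimodular m M \<longleftrightarrow> omod M \<and> (\<forall>x\<in>M. \<forall>y\<in>M. b x y \<in> pp 0) \<and>
     (\<forall>x\<in>M. (\<forall>y\<in>M. b x y \<in> pp 1) \<longrightarrow> x \<in> mul 1 M) \<and>
     fin_quot M (mul 1 M) \<and> grp_index M (mul 1 M) = q ^ m"

lemma unimodularD:
  assumes "unimodular m M"
  shows "omod M" "x \<in> M \<Longrightarrow> y \<in> M \<Longrightarrow> b x y \<in> pp 0"
    "x \<in> M \<Longrightarrow> (\<And>y. y \<in> M \<Longrightarrow> b x y \<in> pp 1) \<Longrightarrow> x \<in> mul 1 M"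
    "fin_quot M (mul k M)" "grp_index M (mul 1 M) = q ^ m" "grp_index M (mul k M) = q ^ (m * k)"
proof -
  show *: "omod M" "x \<in> M \<Longrightarrow> y \<in> M \<Longrightarrow> b x y \<in> pp 0"
    "x \<in> M \<Longrightarrow> (\<And>y. y \<in> M \<Longrightarrow> b x y \<in> pp 1) \<Longrightarrow> x \<in> mul 1 M" "grp_index M (mul 1 M) = q ^ m"
    using assms unfolding unimodular_def by auto
  have f: "fin_quot M (mul 1 M)" using assms unfolding unimodular_def by auto
  show "fin_quot M (mul k M)" "grp_index M (mul k M) = q ^ (m * k)"
    using fin_quot_mul[OF *(1) f, of k] *(4) by (auto simp: power_mult)
qed

lemma B_mul:
  assumes "unimodular m M" "x \<in> mul k M" "y \<in> M" shows "b x y \<in> pp k" "b y x \<in> pp k"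
proof -
  obtain z where z: "z \<in> M" "x = scale (\<pi> ^ k) z" using assms(2) unfolding mul_def by auto
  show "b x y \<in> pp k" using unimodularD(2)[OF assms(1) z(1) assms(3)] pp_mult_right[OF pi_power_in]
    by (simp add: z B_simps)
  then show "b y x \<in> pp k" using B_sym by simp
qed

lemma B_cong:
  assumes "unimodular m M" "x \<in> M" "y \<in> M" "x' \<in> M" "y' \<in> M" "x - y \<in> mul k M" "x' - y' \<in> mul k M"
  shows "b x x' - b y y' \<in> pp k"
proof -
  have "b x x' - b y y' = b (x - y) x' + b y (x' - y')" by (simp add: B_simps)
  then show ?thesis using pp_add B_mul[OF assms(1) assms(6,4)] B_mul(2)[OF assms(1) assms(7,3)] by simp
qed

lemma B_cong_iff:
  assumes "unimodular m M" "x \<in> M" "y \<in> M" "x' \<in> M" "y' \<in> M" "x - y \<in> mul k M" "x' - y' \<in> mul k M" "j \<le> k"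
  shows "b x x' - t \<in> pp j \<longleftrightarrow> b y y' - t \<in> pp j"
  using pp_cong_iff[of "b x x' - t" "b y y' - t" j] pp_mono[OF assms(8) B_cong[OF assms(1-7)]] by simp

text \<open>Taking \<open>v = w\<close> gives the complement of a line, so one definition serves for
  unimodular lines and for hyperbolic planes.\<close>

definition perp :: "'w set \<Rightarrow> 'w \<Rightarrow> 'w \<Rightarrow> 'w set" where
  "perp M v w = {z \<in> M. b z v = 0 \<and> b z w = 0}"

lemma perp_mul_iff: "x \<in> mul k (perp M v w) \<longleftrightarrow> x \<in> mul k M \<and> b x v = 0 \<and> b x w = 0"
  unfolding mul_def perp_def using pi_nonzero by (auto simp: B_simps)

text \<open>By the decomposition \<open>dec\<close>, a vector of the complement pairs with
  \<open>M\<close> as it pairs with the complement, so nondegeneracy modulo \<open>\<pi>\<close> is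
  inherited.\<close>

lemma perp_aux:
  assumes "unimodular m M" "v \<in> M" "w \<in> M"
    and dec: "\<And>y. y \<in> M \<Longrightarrow> \<exists>\<alpha>\<in>pp 0. \<exists>\<beta>\<in>pp 0. \<exists>z\<in>perp M v w. y = scale \<alpha> v + scale \<beta> w + z"
  shows "omod (perp M v w)" "fin_quot (perp M v w) (mul k (perp M v w))"
    "grp_index (perp M v w) (mul 1 (perp M v w)) = q ^ m' \<Longrightarrow> unimodular m' (perp M v w)"
proof -
  note U = unimodularD[OF assms(1)] and O = omodD[OF unimodularD(1)[OF assms(1)]]
  let ?P = "perp M v w"
  show o: "omod ?P" using O unfolding omod_def perp_def by (auto simp: B_simps)
  show f: "fin_quot ?P (mul k ?P)" for k
  proof (rule fin_quot_sub[OF U(4)[of k] omodD(6)[OF o] omodD(6)[OF omod_mul[OF o]] _ mul_subset[OF o]])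
    show "?P \<subseteq> M" unfolding perp_def by auto
    show "x \<in> mul k ?P" if "x \<in> ?P" "x \<in> mul k M" for x
      using that unfolding perp_mul_iff by (simp add: perp_def)
  qed
  show "unimodular m' ?P" if "grp_index ?P (mul 1 ?P) = q ^ m'"
    unfolding unimodular_def
  proof (intro conjI ballI impI o that f)
    show "b x y \<in> pp 0" if "x \<in> ?P" "y \<in> ?P" for x y using that U(2) unfolding perp_def by auto
    fix x assume x: "x \<in> ?P" "\<forall>y\<in>?P. b x y \<in> pp 1"
    have "x \<in> mul 1 M"
    proof (rule U(3))
      show "x \<in> M" using x unfolding perp_def by auto
      fix y assume "y \<in> M"
      then obtain \<alpha> \<beta> z where "z \<in> ?P" "y = scale \<alpha> v + scale \<beta> w + z" using dec by blast
      then show "b x y \<in> pp 1" using x by (simp add: B_simps perp_def)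
    qed
    then show "x \<in> mul 1 ?P" unfolding perp_mul_iff using x(1) by (simp add: perp_def)
  qed
qed

text \<open>Extracts the rank of a complement from the multiplicativity of the index, and shows at
  the same time that the rank of \<open>M\<close> was at least \<open>j\<close>.\<close>

lemma power_eq_q_power:
  assumes "q ^ m = q ^ j * i" shows "j \<le> m" "i = q ^ (m - j)"
proof -
  show "j \<le> m"
  proof (rule ccontr)
    assume "\<not> j \<le> m"
    then have "q ^ m < q ^ j" using q_gt_1 by (intro power_strict_increasing) auto
    moreover have "i > 0" using assms q_pos(3) by (cases i) auto
    then have "q ^ j \<le> q ^ j * i" by simp
    ultimately show False using assms by linarith
  qed
  then have "q ^ j * i = q ^ j * q ^ (m - j)" using assms by (simp flip: power_add)
  then show "i = q ^ (m - j)" using q_pos(3) by simp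
qed

abbreviation uperp :: "'w set \<Rightarrow> 'w \<Rightarrow> 'w set" where "uperp M v \<equiv> perp M v v"

text \<open>Division by the unit \<open>b v v\<close> makes the orthogonal projection to the line of
  \<open>v\<close> integral. Thus \<open>M\<close> is an orthogonal sum, compatibly with every level
  \<open>mul k\<close>.\<close>

lemma unit_split:
  assumes "unimodular m M" "v \<in> M" "unit (b v v)"
  shows "\<forall>x\<in>pp 0 \<times> uperp M v. scale (fst x) v + snd x \<in> M"
    "\<forall>x\<in>pp 0 \<times> uperp M v. \<forall>y\<in>pp 0 \<times> uperp M v.
      (scale (fst x) v + snd x) - (scale (fst y) v + snd y) \<in> mul k M \<longleftrightarrow> x - y \<in> pp k \<times> mul k (uperp M v)"
    "\<forall>z\<in>M. \<exists>x\<in>pp 0 \<times> uperp M v. z = scale (fst x) v + snd x"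
    "m \<ge> 1" "unimodular (m - 1) (uperp M v)"
proof -
  note U = unimodularD[OF assms(1)] and O = omodD[OF unimodularD(1)[OF assms(1)]]
  let ?P = "uperp M v" and ?h = "\<lambda>x. scale (fst x) v + snd x"
  show 1: "\<forall>x\<in>pp 0 \<times> ?P. ?h x \<in> M"
    using O assms(2) unfolding perp_def by auto
  have "\<exists>x\<in>pp 0 \<times> ?P. z = ?h x" if "z \<in> M" for z
  proof -
    let ?a = "inverse (b v v) * b z v"
    have a: "?a \<in> pp 0" using unitD(3)[OF assms(3)] U(2)[OF that assms(2)] by (rule pp_mult_left)
    have "z - scale ?a v \<in> ?P"
      using O(3)[OF a assms(2)] O(5) that unitD(1)[OF assms(3)] by (simp add: perp_def B_simps)
    then show ?thesis using a by (intro bexI[of _ "(?a, z - scale ?a v)"]) auto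
  qed
  then show 3: "\<forall>z\<in>M. \<exists>x\<in>pp 0 \<times> ?P. z = ?h x" by blast
  have dec: "\<exists>\<alpha>\<in>pp 0. \<exists>\<beta>\<in>pp 0. \<exists>z\<in>?P. y = scale \<alpha> v + scale \<beta> v + z" if y: "y \<in> M" for y
  proof -
    obtain x where x: "x \<in> pp 0 \<times> ?P" "y = ?h x" using 3 y by blast
    then show ?thesis
      by (intro bexI[of _ "fst x"] bexI[of _ 0] bexI[of _ "snd x"]) (auto simp: mem_Times_iff)
  qed
  note A = perp_aux[OF assms(1,2,2) dec]
  have 2: "?h x - ?h y \<in> mul k M \<longleftrightarrow> x - y \<in> pp k \<times> mul k ?P" if xy: "x \<in> pp 0 \<times> ?P" "y \<in> pp 0 \<times> ?P" for x y k
  proof -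
    define a where "a = fst x - fst y"
    define z where "z = snd x - snd y"
    have z: "z \<in> ?P" "b z v = 0" using xy omodD(5)[OF A(1)] unfolding z_def by (auto simp: perp_def B_simps)
    have e: "?h x - ?h y = scale a v + z" by (simp add: a_def z_def scale_left_diff_distrib)
    have "scale a v + z \<in> mul k M \<longleftrightarrow> a \<in> pp k \<and> z \<in> mul k ?P"
    proof
      assume *: "scale a v + z \<in> mul k M"
      have "b (scale a v + z) v \<in> pp k" using B_mul(1)[OF assms(1) * assms(2)] .
      then have ak: "a \<in> pp k" using unit_mult_pp_iff[OF assms(3)] z by (simp add: B_simps mult.commute)
      then have "z \<in> mul k M"
        using omodD(5)[OF omod_mul[OF U(1)] * scale_pp_mem[OF U(1) ak assms(2)]] by simp
      then show "a \<in> pp k \<and> z \<in> mul k ?P" using ak z by (simp add: perp_mul_iff)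
    next
      assume "a \<in> pp k \<and> z \<in> mul k ?P"
      then show "scale a v + z \<in> mul k M"
        using omodD(2)[OF omod_mul[OF U(1)] scale_pp_mem[OF U(1) _ assms(2)]] by (simp add: perp_mul_iff)
    qed
    then show ?thesis unfolding e by (auto simp: a_def z_def mem_Times_iff)
  qed
  show "\<forall>x\<in>pp 0 \<times> ?P. \<forall>y\<in>pp 0 \<times> ?P. ?h x - ?h y \<in> mul k M \<longleftrightarrow> x - y \<in> pp k \<times> mul k ?P"
    by (intro ballI) (rule 2)
  have h3: "\<forall>z\<in>M. \<exists>x\<in>pp 0 \<times> ?P. z - ?h x \<in> mul 1 M"
  proof
    fix z assume "z \<in> M"
    then obtain x where "x \<in> pp 0 \<times> ?P" "z = ?h x" using 3 by blast
    then show "\<exists>x\<in>pp 0 \<times> ?P. z - ?h x \<in> mul 1 M"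
      using omodD(1)[OF omod_mul[OF U(1)]] by (intro bexI[of _ x]) auto
  qed
  have h2: "\<forall>x\<in>pp 0 \<times> ?P. \<forall>y\<in>pp 0 \<times> ?P. ?h x - ?h y \<in> mul 1 M \<longleftrightarrow> x - y \<in> pp 1 \<times> mul 1 ?P"
    by (intro ballI) (rule 2)
  have "grp_index M (mul 1 M) = q * grp_index ?P (mul 1 ?P)"
    using avg_iso(2)[OF avg_prod(1)[OF fin_quot_pp1 A(2)] O(6) omodD(6)[OF omod_mul[OF U(1)]] mul_subset[OF U(1)] 1 h2 h3]
      avg_prod(2)[OF fin_quot_pp1 A(2)] index_pp1 by simp
  then have "q ^ m = q ^ 1 * grp_index ?P (mul 1 ?P)" using U(5) by simp
  from power_eq_q_power[OF this] show "m \<ge> 1" "unimodular (m - 1) ?P" using A(3) by auto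
qed

text \<open>The plane of \<open>v\<close> and \<open>w\<close> has Gram determinant
  \<open>t * s - 1\<close>, which is a unit because \<open>t = b v v\<close> lies in
  \<open>pp 1\<close>. Cramer's rule then gives integral coordinates for the projection to this
  plane.\<close>

lemma iso_split:
  assumes "unimodular m M" "v \<in> M" "w \<in> M" "b v v \<in> pp 1" "b v w = 1"
  defines "h \<equiv> \<lambda>x. scale (fst (fst x)) v + scale (snd (fst x)) w + snd x"
  shows "\<forall>x\<in>(pp 0 \<times> pp 0) \<times> perp M v w. h x \<in> M"
    "\<forall>x\<in>(pp 0 \<times> pp 0) \<times> perp M v w. \<forall>y\<in>(pp 0 \<times> pp 0) \<times> perp M v w.
      h x - h y \<in> mul k M \<longleftrightarrow> x - y \<in> (pp k \<times> pp k) \<times> mul k (perp M v w)"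
    "\<forall>z\<in>M. \<exists>x\<in>(pp 0 \<times> pp 0) \<times> perp M v w. z = h x"
    "m \<ge> 2" "unimodular (m - 2) (perp M v w)"
proof -
  note U = unimodularD[OF assms(1)] and O = omodD[OF unimodularD(1)[OF assms(1)]]
  let ?P = "perp M v w"
  define t where "t = b v v"
  define s where "s = b w w"
  define d where "d = 1 - t * s"
  have s0: "s \<in> pp 0" and t0: "t \<in> pp 0" using U(2) assms unfolding s_def t_def by auto
  have bwv: "b w v = 1" using assms B_sym by metis
  have "unit d" using unit_add_pp1[OF unit_1, of "- (t * s)"] pp_mult_right[OF assms(4) s0] by (simp add: d_def t_def)
  note ud = this unitD[OF this]
  show 1: "\<forall>x\<in>(pp 0 \<times> pp 0) \<times> ?P. h x \<in> M"
    using O assms(2,3) unfolding perp_def h_def by (auto intro!: O(2) O(3))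
  have "\<exists>x\<in>(pp 0 \<times> pp 0) \<times> ?P. z = h x" if z: "z \<in> M" for z
  proof -
    define \<alpha> where "\<alpha> = inverse d * (b z w - s * b z v)"
    define \<beta> where "\<beta> = inverse d * (b z v - t * b z w)"
    have b0: "b z v \<in> pp 0" "b z w \<in> pp 0" using U(2) z assms by auto
    have ab: "\<alpha> \<in> pp 0" "\<beta> \<in> pp 0" unfolding \<alpha>_def \<beta>_def
      using ud(4) b0 s0 t0 by (auto intro!: pp_mult_left pp_diff)
    have d1: "inverse d * d = 1" using ud(2) by simp
    have "\<alpha> * t + \<beta> = inverse d * d * b z v" "\<alpha> + \<beta> * s = inverse d * d * b z w"
      unfolding \<alpha>_def \<beta>_def d_def by (simp_all add: algebra_simps)
    then have "\<alpha> * t + \<beta> = b z v" "\<alpha> + \<beta> * s = b z w" using d1 by simp_all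
    then have "z - (scale \<alpha> v + scale \<beta> w) \<in> ?P"
      using O(5)[OF z O(2)[OF O(3)[OF ab(1) assms(2)] O(3)[OF ab(2) assms(3)]]]
      by (simp add: perp_def B_simps assms(5) bwv flip: t_def s_def)
    then show ?thesis using ab
      by (intro bexI[of _ "((\<alpha>, \<beta>), z - (scale \<alpha> v + scale \<beta> w))"]) (auto simp: h_def)
  qed
  then show 3: "\<forall>z\<in>M. \<exists>x\<in>(pp 0 \<times> pp 0) \<times> ?P. z = h x" by blast
  have dec: "\<exists>\<alpha>\<in>pp 0. \<exists>\<beta>\<in>pp 0. \<exists>z\<in>?P. y = scale \<alpha> v + scale \<beta> w + z" if y: "y \<in> M" for y
  proof -
    obtain x where x: "x \<in> (pp 0 \<times> pp 0) \<times> ?P" "y = h x" using 3 y by blast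
    then show ?thesis
      by (intro bexI[of _ "fst (fst x)"] bexI[of _ "snd (fst x)"] bexI[of _ "snd x"]) (auto simp: h_def mem_Times_iff)
  qed
  note A = perp_aux[OF assms(1,2,3) dec]
  have 2: "h x - h y \<in> mul k M \<longleftrightarrow> x - y \<in> (pp k \<times> pp k) \<times> mul k ?P"
    if xy: "x \<in> (pp 0 \<times> pp 0) \<times> ?P" "y \<in> (pp 0 \<times> pp 0) \<times> ?P" for x y k
  proof -
    define \<alpha> where "\<alpha> = fst (fst x) - fst (fst y)"
    define \<beta> where "\<beta> = snd (fst x) - snd (fst y)"
    define z where "z = snd x - snd y"
    have z: "z \<in> ?P" "b z v = 0" "b z w = 0"
      using xy omodD(5)[OF A(1)] unfolding z_def by (auto simp: perp_def B_simps)
    have e: "h x - h y = scale \<alpha> v + scale \<beta> w + z"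
      by (simp add: h_def \<alpha>_def \<beta>_def z_def scale_left_diff_distrib)
    have "scale \<alpha> v + scale \<beta> w + z \<in> mul k M \<longleftrightarrow> (\<alpha> \<in> pp k \<and> \<beta> \<in> pp k) \<and> z \<in> mul k ?P"
    proof
      assume *: "scale \<alpha> v + scale \<beta> w + z \<in> mul k M"
      have e1: "\<alpha> * t + \<beta> \<in> pp k" and e2: "\<alpha> + \<beta> * s \<in> pp k"
        using B_mul(1)[OF assms(1) * assms(2)] B_mul(1)[OF assms(1) * assms(3)] z
        by (simp_all add: B_simps assms(5) bwv flip: t_def s_def)
      have "d * \<alpha> = (\<alpha> + \<beta> * s) - (\<alpha> * t + \<beta>) * s" "d * \<beta> = (\<alpha> * t + \<beta>) - (\<alpha> + \<beta> * s) * t"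
        by (simp_all add: d_def algebra_simps)
      then have "d * \<alpha> \<in> pp k" "d * \<beta> \<in> pp k"
        using pp_diff[OF e2 pp_mult_right[OF e1 s0]] pp_diff[OF e1 pp_mult_right[OF e2 t0]] by simp_all
      then have ab: "\<alpha> \<in> pp k" "\<beta> \<in> pp k" using unit_mult_pp_iff[OF ud(1)] by simp_all
      have "scale \<alpha> v + scale \<beta> w \<in> mul k M"
        using omodD(2)[OF omod_mul[OF U(1)] scale_pp_mem[OF U(1) ab(1) assms(2)] scale_pp_mem[OF U(1) ab(2) assms(3)]] .
      then have "z \<in> mul k M" using omodD(5)[OF omod_mul[OF U(1)] *] by fastforce
      then show "(\<alpha> \<in> pp k \<and> \<beta> \<in> pp k) \<and> z \<in> mul k ?P" using ab z by (simp add: perp_mul_iff)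
    next
      assume *: "(\<alpha> \<in> pp k \<and> \<beta> \<in> pp k) \<and> z \<in> mul k ?P"
      show "scale \<alpha> v + scale \<beta> w + z \<in> mul k M"
        by (intro omodD(2)[OF omod_mul[OF U(1)]] scale_pp_mem[OF U(1)]) (use * assms in \<open>auto simp: perp_mul_iff\<close>)
    qed
    then show ?thesis unfolding e by (auto simp: \<alpha>_def \<beta>_def z_def mem_Times_iff)
  qed
  show "\<forall>x\<in>(pp 0 \<times> pp 0) \<times> ?P. \<forall>y\<in>(pp 0 \<times> pp 0) \<times> ?P. h x - h y \<in> mul k M \<longleftrightarrow> x - y \<in> (pp k \<times> pp k) \<times> mul k ?P"
    by (intro ballI) (rule 2)
  have h3: "\<forall>z\<in>M. \<exists>x\<in>(pp 0 \<times> pp 0) \<times> ?P. z - h x \<in> mul 1 M"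
  proof
    fix z assume "z \<in> M"
    then obtain x where "x \<in> (pp 0 \<times> pp 0) \<times> ?P" "z = h x" using 3 by blast
    then show "\<exists>x\<in>(pp 0 \<times> pp 0) \<times> ?P. z - h x \<in> mul 1 M"
      using omodD(1)[OF omod_mul[OF U(1)]] by (intro bexI[of _ x]) auto
  qed
  have h2: "\<forall>x\<in>(pp 0 \<times> pp 0) \<times> ?P. \<forall>y\<in>(pp 0 \<times> pp 0) \<times> ?P. h x - h y \<in> mul 1 M \<longleftrightarrow> x - y \<in> (pp 1 \<times> pp 1) \<times> mul 1 ?P"
    by (intro ballI) (rule 2)
  note P1 = avg_prod[OF fin_quot_pp1 fin_quot_pp1]
  note P2 = avg_prod[OF P1(1) A(2)]
  have "grp_index M (mul 1 M) = q * q * grp_index ?P (mul 1 ?P)"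
    using avg_iso(2)[OF P2(1) O(6) omodD(6)[OF omod_mul[OF U(1)]] mul_subset[OF U(1)] 1 h2 h3]
      P2(2) P1(2) index_pp1 by simp
  then have "q ^ m = q ^ 2 * grp_index ?P (mul 1 ?P)" using U(5) by (simp add: power2_eq_square)
  from power_eq_q_power[OF this] show "m \<ge> 2" "unimodular (m - 2) ?P" using A(3) by auto
qed


section \<open>The sign of a unimodular lattice\<close>

definition qd :: "'w set \<Rightarrow> 'a \<Rightarrow> real" where
  "qd M t = avg M (mul 1 M) (\<lambda>x. of_bool (b x x - t \<in> pp 1))"

text \<open>The even-rank counterpart of \<open>eta\<close>: it also has mean 0 over the residue
  field, and averaging along a line exchanges the two, see \<open>avg_nu\<close> and
  \<open>avg_eta_quadratic\<close>.\<close>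

definition nu :: "'a \<Rightarrow> real" where "nu t = (if t \<in> pp 1 then real q - 1 else - 1)"

text \<open>The classical number of vectors of norm \<open>t\<close> in a nondegenerate quadratic
  space of rank \<open>m\<close> and sign \<open>e\<close> over the residue field, divided by
  \<open>q ^ m\<close>.\<close>

definition qform :: "nat \<Rightarrow> real \<Rightarrow> 'a \<Rightarrow> real" where
  "qform m e t = 1 / q + (if even m then e * nu t / q ^ (m div 2 + 1) else e * eta t / q ^ ((m + 1) div 2))"

text \<open>The sign is defined through the number of solutions of \<open>b x x \<equiv> t\<close>, so that no basis is needed;
  for \<open>\<epsilon> = \<chi>(M)\<close> this is the classical formula.\<close>

definition signed :: "nat \<Rightarrow> real \<Rightarrow> 'w set \<Rightarrow> bool" where
  "signed m e M \<longleftrightarrow> unimodular m M \<and> e \<in> {1, - 1} \<and> (\<forall>t\<in>pp 0. qd M t = qform m e t)"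

lemma qd_cong: "t - s \<in> pp 1 \<Longrightarrow> qd M t = qd M s"
  unfolding qd_def using subgrp_diff_cong(2)[OF subgrp_pp, of t s 1] by simp

lemma qd_periodic:
  assumes "unimodular m M" shows "periodic M (mul k M) (\<lambda>x. b x x - t \<in> pp k)"
  using B_cong_iff[OF assms, of _ _ _ _ k k t] by (auto intro!: periodicI)

lemma periodic_of_bool: "periodic G K P \<Longrightarrow> periodic G K (\<lambda>x. of_bool (P x))"
  unfolding periodic_def by fastforce

text \<open>For \<open>x = a v + z\<close> with \<open>z\<close> orthogonal to \<open>v\<close>, the
  norm is the sum of the norms of \<open>a v\<close> and \<open>z\<close>; so the count is a
  convolution along the line.\<close>

lemma qd_unit_split:
  assumes "unimodular m M" "v \<in> M" "unit (b v v)"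
  shows "qd M t = avgO (\<lambda>a. qd (uperp M v) (t - b v v * (a * a)))"
proof -
  note U = unimodularD[OF assms(1)] and S = unit_split[OF assms] and U' = unimodularD[OF unit_split(5)[OF assms]]
  let ?P = "uperp M v" and ?h = "\<lambda>x. scale (fst x) v + snd x"
  let ?f = "\<lambda>x. of_bool (b x x - t \<in> pp 1) :: real"
  have pf: "periodic M (mul 1 M) ?f" by (rule periodic_of_bool[OF qd_periodic[OF assms(1)]])
  note AP = avg_prod[OF fin_quot_pp1 U'(4)[of 1]]
  have ph: "periodic (pp 0 \<times> ?P) (pp 1 \<times> mul 1 ?P) (\<lambda>x. ?f (?h x))"
  proof (rule periodicI)
    fix x y assume xy: "x \<in> pp 0 \<times> ?P" "y \<in> pp 0 \<times> ?P" "x - y \<in> pp 1 \<times> mul 1 ?P"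
    have "?h x \<in> M" "?h y \<in> M" "?h x - ?h y \<in> mul 1 M"
      using S(1)[rule_format, OF xy(1)] S(1)[rule_format, OF xy(2)] S(2)[rule_format, OF xy(1,2), of 1] xy(3) by simp_all
    then show "?f (?h x) = ?f (?h y)" using pf unfolding periodic_def by metis
  qed
  have "qd M t = avg (pp 0 \<times> ?P) (pp 1 \<times> mul 1 ?P) (\<lambda>x. ?f (?h x))"
    unfolding qd_def
  proof (rule avg_iso(3)[OF AP(1) omodD(6)[OF U(1)] omodD(6)[OF omod_mul[OF U(1)]] mul_subset[OF U(1)] S(1,2) _ pf])
    show "\<forall>z\<in>M. \<exists>x\<in>pp 0 \<times> ?P. z - ?h x \<in> mul 1 M"
    proof
      fix z assume "z \<in> M"
      then obtain x where "x \<in> pp 0 \<times> ?P" "z = ?h x" using S(3) by blast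
      then show "\<exists>x\<in>pp 0 \<times> ?P. z - ?h x \<in> mul 1 M"
        using omodD(1)[OF omod_mul[OF U(1)]] by (intro bexI[of _ x]) auto
    qed
  qed
  also have "\<dots> = avgO (\<lambda>a. avg ?P (mul 1 ?P) (\<lambda>z. ?f (?h (a, z))))" by (rule AP(3)[OF ph])
  also have "\<dots> = avgO (\<lambda>a. qd ?P (t - b v v * (a * a)))"
    unfolding qd_def
  proof (intro avg_cong[OF fin_quot_pp1] avg_cong[OF U'(4)])
    fix a z assume "z \<in> ?P"
    then have "b z v = 0" "b v z = 0" using B_sym by (auto simp: perp_def)
    then have "b (?h (a, z)) (?h (a, z)) - t = b z z - (t - b v v * (a * a))"
      by (simp add: B_simps algebra_simps)
    then show "?f (?h (a, z)) = of_bool (b z z - (t - b v v * (a * a)) \<in> pp 1)" by (simp only:)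
  qed
  finally show ?thesis .
qed

lemma nu_eq: "nu t = real q * of_bool (t \<in> pp 1) - 1" by (simp add: nu_def)

text \<open>The summand -1 in \<open>nu_eq\<close> cancels the main term of
  \<open>square_count\<close>, and only the character survives.\<close>

lemma avg_nu:
  assumes "unit u" "t \<in> pp 0"
  shows "avgO (\<lambda>a. nu (t - u * (a * a))) = eta (u * t)"
proof -
  have "avgO (\<lambda>a. nu (t - u * (a * a))) = avgO (\<lambda>a. real q * of_bool (a * a - inverse u * t \<in> pp 1) - 1)"
  proof (rule avg_cong[OF fin_quot_pp1])
    fix a
    have "t - u * (a * a) = (- u) * (a * a - inverse u * t)"
      using unitD(1)[OF assms(1)] by (simp add: algebra_simps)
    then show "nu (t - u * (a * a)) = real q * of_bool (a * a - inverse u * t \<in> pp 1) - 1"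
      unfolding nu_eq using unit_mult_pp_iff[OF unitD(5)[OF assms(1)], of "a * a - inverse u * t" 1] by simp
  qed
  also have "\<dots> = eta (inverse u * t)"
    unfolding avg_diff avg_cmult avg_const[OF fin_quot_pp1]
      square_count[OF pp_mult_left[OF unitD(3)[OF assms(1)] assms(2)]] using q_pos by simp
  also have "\<dots> = eta (u * t)"
    using eta_mult[OF unitD(3)[OF assms(1)] assms(2)] eta_mult[OF unitD(2)[OF assms(1)] assms(2)]
      eta_inverse[OF assms(1)] by simp
  finally show ?thesis .
qed

text \<open>Extracting \<open>- u\<close> by multiplicativity reduces this to the hyperbola count of
  \<open>avg_eta_square_minus\<close>.\<close>

lemma avg_eta_quadratic:
  assumes "unit u" "t \<in> pp 0"
  shows "avgO (\<lambda>a. eta (t - u * (a * a))) = eta (- u) * nu t / q"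
proof -
  have iu: "inverse u * t \<in> pp 0" using unitD(3)[OF assms(1)] assms(2) by (rule pp_mult_left)
  have "avgO (\<lambda>a. eta (t - u * (a * a))) = avgO (\<lambda>a. eta (- u) * eta (a * a - inverse u * t))"
  proof (rule avg_cong[OF fin_quot_pp1])
    fix a assume a: "a \<in> pp 0"
    have e: "t - u * (a * a) = (- u) * (a * a - inverse u * t)"
      using unitD(1)[OF assms(1)] by (simp add: algebra_simps)
    show "eta (t - u * (a * a)) = eta (- u) * eta (a * a - inverse u * t)"
      unfolding e using unitD(2)[OF assms(1)] pp_diff[OF pp_mult_left[OF a a] iu] by (intro eta_mult) auto
  qed
  also have "\<dots> = eta (- u) * nu t / q"
    unfolding avg_cmult avg_eta_square_minus[OF iu] nu_def
    using unit_mult_pp_iff[OF unitD(4)[OF assms(1)], of t 1] q_pos by (auto simp: field_simps)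
  finally show ?thesis .
qed

text \<open>Adding a line alternates between the two shapes of \<open>qform\<close>. The sign picks
  up \<open>eta u\<close> or \<open>eta (- u)\<close> according to parity, in accordance with the
  power of -1 that normalizes discriminants.\<close>

lemma qform_step:
  assumes "unit u" "t \<in> pp 0"
  shows "avgO (\<lambda>a. qform m e (t - u * (a * a))) = qform (Suc m) (e * eta (if even m then u else - u)) t"
proof (cases "even m")
  case True
  then have "avgO (\<lambda>a. qform m e (t - u * (a * a))) = 1 / q + (e / q ^ (m div 2 + 1)) * avgO (\<lambda>a. nu (t - u * (a * a)))"
    unfolding qform_def by (subst avg_cmult[symmetric]) (simp add: avg_add avg_const[OF fin_quot_pp1])
  then show ?thesis unfolding avg_nu[OF assms] using True eta_mult[of u t] assms(2) unitD(2)[OF assms(1)]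
    by (simp add: qform_def mult.assoc power_add)
next
  case False
  then have "avgO (\<lambda>a. qform m e (t - u * (a * a))) = 1 / q + (e / q ^ ((m + 1) div 2)) * avgO (\<lambda>a. eta (t - u * (a * a)))"
    unfolding qform_def by (subst avg_cmult[symmetric]) (simp add: avg_add avg_const[OF fin_quot_pp1])
  then show ?thesis unfolding avg_eta_quadratic[OF assms] using False
    by (simp add: qform_def) (simp add: mult.commute mult.left_commute)
qed

lemma signed_extend:
  assumes "unimodular m M" "v \<in> M" "unit (b v v)" "signed (m - 1) e (uperp M v)"
  shows "signed m (e * eta (if even m then - b v v else b v v)) M"
proof -
  have m: "Suc (m - 1) = m" using unit_split(4)[OF assms(1-3)] by (simp add: One_nat_def)
  have "qd M t = qform m (e * eta (if even m then - b v v else b v v)) t" if t: "t \<in> pp 0" for t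
  proof -
    have "qd M t = avgO (\<lambda>a. qform (m - 1) e (t - b v v * (a * a)))"
      unfolding qd_unit_split[OF assms(1-3)]
      using assms(4) pp_diff[OF t pp_mult_left[OF unitD(2)[OF assms(3)]]]
      unfolding signed_def by (intro avg_cong[OF fin_quot_pp1]) (auto intro: pp_mult_left)
    also have "\<dots> = qform (Suc (m - 1)) (e * eta (if even (m - 1) then b v v else - b v v)) t"
      by (rule qform_step[OF assms(3) t])
    also have "even (m - 1) \<longleftrightarrow> odd m" using unit_split(4)[OF assms(1-3)] by simp
    finally show ?thesis using m by (simp add: if_distrib)
  qed
  then show ?thesis using assms eta_unit[OF assms(3)] eta_unit[OF unitD(5)[OF assms(3)]]
    unfolding signed_def by auto
qed

text \<open>If all norms were in \<open>pp 1\<close>, so would be all products, by polarization and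
  because 2 is a unit. Nondegeneracy would then give \<open>mul 1 M = M\<close>, against the index
  \<open>q ^ m\<close>.\<close>

lemma exists_unit_vector:
  assumes "unimodular m M" "m \<ge> 1" shows "\<exists>v\<in>M. unit (b v v)"
proof (rule ccontr)
  note U = unimodularD[OF assms(1)] and O = omodD[OF unimodularD(1)[OF assms(1)]]
  assume "\<not> ?thesis"
  then have n: "b v v \<in> pp 1" if "v \<in> M" for v using that U(2) unfolding unit_def by auto
  have "b x y \<in> pp 1" if "x \<in> M" "y \<in> M" for x y
  proof -
    have "2 * b x y = b (x + y) (x + y) - b x x - b y y" using B_sym[of x y] by (simp add: B_simps)
    then show ?thesis using n that O(2) unit_mult_pp_iff[OF unit_2] by (metis pp_diff)
  qed
  then have "M \<subseteq> mul 1 M" using U(3) by blast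
  then have M: "mul 1 M = M" using mul_subset[OF U(1)] by blast
  have t: "transversal M M {0}" unfolding transversal_def using O by auto
  have "grp_index M M = 1" using transversal_avg(2)[OF O(6,6) _ t] by simp
  then have "q ^ m = 1" using U(5) M by simp
  then show False using q_gt_1 assms(2) by (simp add: One_nat_def)
qed

text \<open>Induction on the rank, splitting off one vector of unit norm at a time; in effect the
  form is diagonalized.\<close>

lemma signed_exists: "unimodular m M \<Longrightarrow> \<exists>e. signed m e M"
proof (induction m arbitrary: M)
  case 0
  note U = unimodularD[OF 0]
  have "x \<in> mul 1 M" if x: "x \<in> M" for x
  proof -
    have "card (quot_reps M (mul 1 M)) = 1" using U(5) unfolding grp_index_def by simp
    then obtain r where "quot_reps M (mul 1 M) = {r}" by (rule card_1_singletonE)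
    then have "coset_rep (mul 1 M) x = r" "coset_rep (mul 1 M) 0 = r" using x omodD(1)[OF U(1)]
      unfolding quot_reps_def by auto
    then have "x - 0 \<in> mul 1 M" using coset_rep_eq_iff[OF omodD(6)[OF omod_mul[OF U(1)]]] by metis
    then show ?thesis by simp
  qed
  then have b1: "b x x \<in> pp 1" if "x \<in> M" for x using B_mul(1)[OF 0, of x 1 x] that by auto
  have "qd M t = qform 0 1 t" for t
  proof -
    have "qd M t = of_bool (t \<in> pp 1)"
      unfolding qd_def by (rule avg_const_on[OF U(4)]) (use b1 pp_cong_iff[of "b _ _ - t" "- t" 1] in auto)
    then show ?thesis using q_pos by (simp add: qform_def nu_def field_simps)
  qed
  then show ?case using 0 unfolding signed_def by auto
next
  case (Suc m)
  obtain v where v: "v \<in> M" "unit (b v v)" using exists_unit_vector[OF Suc.prems] by (auto simp: One_nat_def)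
  have "unimodular m (uperp M v)" using unit_split(5)[OF Suc.prems v] by (simp add: One_nat_def)
  then obtain e where "signed m e (uperp M v)" using Suc.IH by blast
  then show ?case using signed_extend[OF Suc.prems v, of e] by (auto simp: One_nat_def)
qed

text \<open>The coefficient of the sign in \<open>qform\<close> is nonzero at \<open>t = 0\<close>
  in even rank and at \<open>t = 1\<close> in odd rank.\<close>

lemma signed_unique: assumes "signed m e M" "signed m e' M" shows "e = e'"
proof -
  have *: "qform m e t = qform m e' t" if "t \<in> pp 0" for t using assms that unfolding signed_def by metis
  show ?thesis
  proof (cases "even m")
    case True
    then have "e * (real q - 1) = e' * (real q - 1)" using *[of 0] q_pos by (simp add: qform_def nu_def)
    then show ?thesis using q_gt_1 by simp
  next
    case False
    have "eta 1 = 1" using eta_square[OF unit_1] by simp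
    then show ?thesis using False *[of 1] q_pos by (simp add: qform_def)
  qed
qed

text \<open>\<open>signed_extend\<close> goes from the complement to \<open>M\<close>; uniqueness of
  the sign reverses it, because \<open>eta\<close> of a unit is its own inverse.\<close>

lemma signed_uperp:
  assumes "signed m e M" "v \<in> M" "unit (b v v)"
  shows "signed (m - 1) (e * eta (if even m then - b v v else b v v)) (uperp M v)"
proof -
  have U: "unimodular m M" using assms(1) unfolding signed_def by simp
  obtain e' where e': "signed (m - 1) e' (uperp M v)" using signed_exists[OF unit_split(5)[OF U assms(2,3)]] by blast
  have "e = e' * eta (if even m then - b v v else b v v)"
    by (rule signed_unique[OF assms(1) signed_extend[OF U assms(2,3) e']])
  moreover have "eta (if even m then - b v v else b v v) \<in> {1, - 1}"
    using eta_unit[OF assms(3)] eta_unit[OF unitD(5)[OF assms(3)]] by auto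
  ultimately show ?thesis using e' by auto
qed

lemma avg_qd:
  assumes "unimodular m M" "t \<in> pp 0" shows "avgO (\<lambda>c. qd M (t - c)) = 1 / q"
proof -
  note U = unimodularD[OF assms(1)]
  have "avgO (\<lambda>c. qd M (t - c)) = avg M (mul 1 M) (\<lambda>z. avgO (\<lambda>c. of_bool (c - (t - b z z) \<in> pp 1)))"
    unfolding qd_def by (subst avg_swap) (simp add: algebra_simps)
  also have "\<dots> = 1 / q"
    by (rule avg_const_on[OF U(4)]) (rule avgO_single, rule pp_diff[OF assms(2) U(2)])
  finally show ?thesis .
qed

text \<open>In coordinates \<open>x\<close>, \<open>y\<close> along \<open>v\<close>,
  \<open>w\<close> the plane contributes \<open>2 x y + s y^2\<close> modulo \<open>\<pi>\<close>.
  For \<open>y\<close> in \<open>pp 1\<close> this vanishes; for other \<open>y\<close> it is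
  equidistributed as \<open>x\<close> varies, whence the mean value \<open>1 / q\<close>.\<close>

lemma qd_iso_split:
  assumes "unimodular m M" "v \<in> M" "w \<in> M" "b v v \<in> pp 1" "b v w = 1" "t \<in> pp 0"
  shows "qd M t = (qd (perp M v w) t + (1 - 1 / q)) / q"
proof -
  note S = iso_split[OF assms(1-5)]
  note U = unimodularD[OF assms(1)] and U' = unimodularD[OF S(5)]
  let ?P = "perp M v w" and ?h = "\<lambda>x. scale (fst (fst x)) v + scale (snd (fst x)) w + snd x"
  let ?f = "\<lambda>x. of_bool (b x x - t \<in> pp 1) :: real"
  define s where "s = b w w"
  have s: "s \<in> pp 0" using U(2) assms(3) by (simp add: s_def)
  have bwv: "b w v = 1" using assms(5) B_sym by metis
  have pf: "periodic M (mul 1 M) ?f" by (rule periodic_of_bool[OF qd_periodic[OF assms(1)]])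
  note P1 = avg_prod[OF fin_quot_pp1 fin_quot_pp1]
  note AP = avg_prod[OF P1(1) U'(4)[of 1]]
  let ?G = "(pp 0 \<times> pp 0) \<times> ?P" and ?K = "(pp 1 \<times> pp 1) \<times> mul 1 ?P"
  have ph: "periodic ?G ?K (\<lambda>x. ?f (?h x))"
  proof (rule periodicI)
    fix x y assume xy: "x \<in> ?G" "y \<in> ?G" "x - y \<in> ?K"
    have "?h x \<in> M" "?h y \<in> M" "?h x - ?h y \<in> mul 1 M"
      using S(1)[rule_format, OF xy(1)] S(1)[rule_format, OF xy(2)] S(2)[rule_format, OF xy(1,2), of 1] xy(3) by simp_all
    then show "?f (?h x) = ?f (?h y)" using pf unfolding periodic_def by metis
  qed
  have q1: "periodic (pp 0) (pp 1) (\<lambda>c. qd ?P (t - c))"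
    by (rule periodicI) (rule qd_cong, simp add: pp_minus_commute)
  let ?g = "\<lambda>p. qd ?P (t - (2 * fst p * snd p + s * (snd p * snd p)))"
  have pg: "periodic (pp 0 \<times> pp 0) (pp 1 \<times> pp 1) ?g"
  proof (rule periodicI)
    fix x y :: "'a \<times> 'a"
    assume xy: "x \<in> pp 0 \<times> pp 0" "y \<in> pp 0 \<times> pp 0" "x - y \<in> pp 1 \<times> pp 1"
    then have "fst x * snd x - fst y * snd y \<in> pp 1" "snd x * snd x - snd y * snd y \<in> pp 1"
      by (auto simp: mem_Times_iff intro!: pp_cong_mult)
    then have "2 * (fst x * snd x - fst y * snd y) + s * (snd x * snd x - snd y * snd y) \<in> pp 1"
      using s unitD(2)[OF unit_2] by (intro pp_add pp_mult_left)
    then show "?g x = ?g y"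
      by (intro qd_cong) (subst pp_minus_commute, simp add: algebra_simps)
  qed
  have "qd M t = avg ?G ?K (\<lambda>x. ?f (?h x))"
    unfolding qd_def
  proof (rule avg_iso(3)[OF AP(1) omodD(6)[OF U(1)] omodD(6)[OF omod_mul[OF U(1)]] mul_subset[OF U(1)] S(1,2) _ pf])
    show "\<forall>z\<in>M. \<exists>x\<in>?G. z - ?h x \<in> mul 1 M"
    proof
      fix z assume "z \<in> M"
      then obtain x where "x \<in> ?G" "z = ?h x" using S(3) by blast
      then show "\<exists>x\<in>?G. z - ?h x \<in> mul 1 M"
        using omodD(1)[OF omod_mul[OF U(1)]] by (intro bexI[of _ x]) auto
    qed
  qed
  also have "\<dots> = avg (pp 0 \<times> pp 0) (pp 1 \<times> pp 1) (\<lambda>p. avg ?P (mul 1 ?P) (\<lambda>z. ?f (?h (p, z))))"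
    by (rule AP(3)[OF ph])
  also have "\<dots> = avg (pp 0 \<times> pp 0) (pp 1 \<times> pp 1) ?g"
    unfolding qd_def
  proof (intro avg_cong[OF P1(1)] avg_cong[OF U'(4)])
    fix p z assume p: "p \<in> pp 0 \<times> pp 0" and "z \<in> ?P"
    then have "b z v = 0" "b v z = 0" "b z w = 0" "b w z = 0" using B_sym by (auto simp: perp_def)
    then have "(b (?h (p, z)) (?h (p, z)) - t) - (b z z - (t - (2 * fst p * snd p + s * (snd p * snd p)))) = b v v * (fst p * fst p)"
      by (simp add: B_simps assms(5) bwv s_def[symmetric] algebra_simps)
    moreover have "b v v * (fst p * fst p) \<in> pp 1"
      using p by (intro pp_mult_right[OF assms(4)] pp_mult_left) auto
    ultimately have "b (?h (p, z)) (?h (p, z)) - t \<in> pp 1 \<longleftrightarrow> b z z - (t - (2 * fst p * snd p + s * (snd p * snd p))) \<in> pp 1"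
      by (intro pp_cong_iff) simp
    then show "?f (?h (p, z)) = of_bool (b z z - (t - (2 * fst p * snd p + s * (snd p * snd p))) \<in> pp 1)"
      by simp
  qed
  also have "\<dots> = avgO (\<lambda>x. avgO (\<lambda>y. ?g (x, y)))" by (rule P1(3)[OF pg])
  also have "\<dots> = avgO (\<lambda>y. avgO (\<lambda>x. ?g (x, y)))" by (rule avg_swap)
  also have "\<dots> = avgO (\<lambda>y. (qd ?P t - 1 / q) * of_bool (y \<in> pp 1) + 1 / q)"
  proof (rule avg_cong[OF fin_quot_pp1])
    fix y assume y: "y \<in> pp 0"
    show "avgO (\<lambda>x. ?g (x, y)) = (qd ?P t - 1 / q) * of_bool (y \<in> pp 1) + 1 / q"
    proof (cases "y \<in> pp 1")
      case True
      have "?g (x, y) = qd ?P t" if "x \<in> pp 0" for x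
      proof (rule qd_cong)
        have "2 * x * y + s * (y * y) \<in> pp 1"
          using True y s that unitD(2)[OF unit_2] by (intro pp_add pp_mult_left)
        moreover have "t - (2 * fst (x, y) * snd (x, y) + s * (snd (x, y) * snd (x, y))) - t = - (2 * x * y + s * (y * y))"
          by simp
        ultimately show "t - (2 * fst (x, y) * snd (x, y) + s * (snd (x, y) * snd (x, y))) - t \<in> pp 1"
          by (metis pp_uminus)
      qed
      then show ?thesis using True by (intro avg_const_on[OF fin_quot_pp1]) auto
    next
      case False
      then have u: "unit (2 * y)" using y unit_mult[OF unit_2, of y] by (simp add: unit_def[of y])
      have "periodic (pp 0) (pp 1) (\<lambda>x. qd ?P (t - (x + s * (y * y))))"
        by (rule periodicI) (rule qd_cong, simp add: pp_minus_commute)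
      then have "avgO (\<lambda>x. ?g (x, y)) = avgO (\<lambda>x. qd ?P (t - (x + s * (y * y))))"
        using avg_unit_scale[OF u, of "\<lambda>x. qd ?P (t - (x + s * (y * y)))"] by (simp add: ac_simps)
      also have "\<dots> = avgO (\<lambda>x. qd ?P (t - x))"
        using y s by (intro avg_shift[OF fin_quot_pp1 q1] pp_mult_left)
      finally show ?thesis using False avg_qd[OF S(5) assms(6)] by simp
    qed
  qed
  also have "\<dots> = (qd ?P t - 1 / q) * (1 / q) + 1 / q"
    unfolding avg_add avg_cmult avgO_pp1 avg_const[OF fin_quot_pp1] ..
  finally show ?thesis by (simp add: add_divide_distrib diff_divide_distrib)
qed

text \<open>The relation of \<open>qd_iso_split\<close> is solved for the complement: a hyperbolic
  plane does not change the sign.\<close>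

lemma signed_perp:
  assumes "signed m e M" "v \<in> M" "w \<in> M" "b v v \<in> pp 1" "b v w = 1"
  shows "signed (m - 2) e (perp M v w)"
proof -
  have U: "unimodular m M" using assms(1) unfolding signed_def by simp
  note S = iso_split[OF U assms(2-5)]
  obtain k where k: "m = k + 2" using S(4) by (metis le_iff_add add.commute)
  have "qd (perp M v w) t = qform (m - 2) e t" if t: "t \<in> pp 0" for t
  proof -
    have "qform m e t = (qd (perp M v w) t + (1 - 1 / q)) / q"
      using qd_iso_split[OF U assms(2-5) t] assms(1) t unfolding signed_def by auto
    then have "qd (perp M v w) t = q * qform m e t - 1 + 1 / q" using q_pos by (simp add: field_simps)
    also have "\<dots> = qform (m - 2) e t"
      using q_pos by (simp add: qform_def k field_simps)
    finally show ?thesis .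
  qed
  then show ?thesis using assms(1) S(5) unfolding signed_def by auto
qed


section \<open>Densities of tuples with prescribed Gram matrix\<close>

text \<open>The precision \<open>\<kappa>\<close> varies with the entry, because dividing one vector
  by \<open>\<pi>\<close> costs precision only in its own row and column.\<close>

definition gram :: "nat \<Rightarrow> (nat \<Rightarrow> nat \<Rightarrow> nat) \<Rightarrow> (nat \<Rightarrow> nat \<Rightarrow> 'a) \<Rightarrow> (nat \<Rightarrow> 'w) \<Rightarrow> bool" where
  "gram n \<kappa> T \<phi> \<longleftrightarrow> (\<forall>d<n. \<forall>c\<le>d. b (\<phi> c) (\<phi> d) - T c d \<in> pp (\<kappa> c d))"

text \<open>Linear independence, over the residue field, of the first \<open>j\<close> vectors in
  \<open>M / \<pi> M\<close>.\<close>

definition indep :: "'w set \<Rightarrow> nat \<Rightarrow> (nat \<Rightarrow> 'w) \<Rightarrow> bool" where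
  "indep M j \<phi> \<longleftrightarrow> (\<forall>c. (\<forall>i<j. c i \<in> pp 0) \<longrightarrow> (\<Sum>i<j. scale (c i) (\<phi> i)) \<in> mul 1 M \<longrightarrow> (\<forall>i<j. c i \<in> pp 1))"

text \<open>The parameter \<open>j\<close> interpolates between the full density,
  \<open>j = 0\<close>, and the primitive one, \<open>j = n\<close>. The level \<open>k\<close> is
  separate from the precision: it only has to be fine enough for the condition to be periodic, see
  \<open>dens_level\<close>.\<close>

definition dens :: "'w set \<Rightarrow> nat \<Rightarrow> (nat \<Rightarrow> nat \<Rightarrow> nat) \<Rightarrow> (nat \<Rightarrow> nat \<Rightarrow> 'a) \<Rightarrow> nat \<Rightarrow> nat \<Rightarrow> real" where
  "dens M n \<kappa> T j k = avg (tup n M) (tup n (mul k M)) (\<lambda>\<phi>. of_bool (gram n \<kappa> T \<phi> \<and> indep M j \<phi>))"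

lemma gram_Suc:
  "gram (Suc n) \<kappa> T (case_nat v \<phi>) \<longleftrightarrow> b v v - T 0 0 \<in> pp (\<kappa> 0 0) \<and>
     (\<forall>i<n. b v (\<phi> i) - T 0 (Suc i) \<in> pp (\<kappa> 0 (Suc i))) \<and>
     gram n (\<lambda>i l. \<kappa> (Suc i) (Suc l)) (\<lambda>i l. T (Suc i) (Suc l)) \<phi>"
proof -
  have *: "(\<forall>d<Suc n. \<forall>c\<le>d. P c d) \<longleftrightarrow> P 0 0 \<and> (\<forall>i<n. P 0 (Suc i)) \<and> (\<forall>d<n. \<forall>c\<le>d. P (Suc c) (Suc d))"
    for P :: "nat \<Rightarrow> nat \<Rightarrow> bool"
    by (auto simp: All_less_Suc2) (metis Suc_le_mono not0_implies_Suc)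
  show ?thesis unfolding gram_def * by simp
qed

lemma gram_cong:
  assumes "unimodular m M" "\<phi> \<in> tup n M" "\<psi> \<in> tup n M" "\<phi> - \<psi> \<in> tup n (mul k M)"
    and "\<And>c d. c \<le> d \<Longrightarrow> d < n \<Longrightarrow> \<kappa> c d \<le> k"
  shows "gram n \<kappa> T \<phi> \<longleftrightarrow> gram n \<kappa> T \<psi>"
proof -
  have "b (\<phi> c) (\<phi> d) - T c d \<in> pp (\<kappa> c d) \<longleftrightarrow> b (\<psi> c) (\<psi> d) - T c d \<in> pp (\<kappa> c d)" if "c \<le> d" "d < n" for c d
    by (rule B_cong_iff[OF assms(1) _ _ _ _ _ _ assms(5)[OF that]])
      (use that tupD(1)[OF assms(2)] tupD(1)[OF assms(3)] tupD(1)[OF assms(4)] in auto)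
  then show ?thesis unfolding gram_def by blast
qed

lemma gram_cong_entries:
  "(\<And>c d. c \<le> d \<Longrightarrow> d < n \<Longrightarrow> T c d - T' c d \<in> pp (\<kappa> c d)) \<Longrightarrow> gram n \<kappa> T \<phi> \<longleftrightarrow> gram n \<kappa> T' \<phi>"
  unfolding gram_def by (metis subgrp_diff_cong(2)[OF subgrp_pp])

lemma dens_cong_entries:
  "(\<And>c d. c \<le> d \<Longrightarrow> d < n \<Longrightarrow> T c d - T' c d \<in> pp (\<kappa> c d)) \<Longrightarrow> dens M n \<kappa> T j k = dens M n \<kappa> T' j k"
proof -
  assume "\<And>c d. c \<le> d \<Longrightarrow> d < n \<Longrightarrow> T c d - T' c d \<in> pp (\<kappa> c d)"
  then have "gram n \<kappa> T = gram n \<kappa> T'" by (intro ext gram_cong_entries)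
  then show ?thesis by (simp only: dens_def)
qed

lemma indep_cong:
  assumes "omod M" "\<And>i. i < j \<Longrightarrow> \<phi> i - \<psi> i \<in> mul 1 M"
  shows "indep M j \<phi> \<longleftrightarrow> indep M j \<psi>"
proof -
  have "(\<Sum>i<j. scale (c i) (\<phi> i)) \<in> mul 1 M \<longleftrightarrow> (\<Sum>i<j. scale (c i) (\<psi> i)) \<in> mul 1 M"
    if "\<forall>i<j. c i \<in> pp 0" for c
  proof -
    have "(\<Sum>i<j. scale (c i) (\<phi> i)) - (\<Sum>i<j. scale (c i) (\<psi> i)) = (\<Sum>i<j. scale (c i) (\<phi> i - \<psi> i))"
      by (simp add: sum_subtractf scale_right_diff_distrib)
    also have "\<dots> \<in> mul 1 M"
      by (rule omod_sum[OF omod_mul[OF assms(1)]]) (use that assms scale_mem_mul in auto)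
    finally show ?thesis
      using subgrp_diff_cong(1)[OF omodD(6)[OF omod_mul[OF assms(1)]], of _ _ 1 0] by fastforce
  qed
  then show ?thesis unfolding indep_def by blast
qed

lemma periodic_gram_indep:
  assumes "unimodular m M" "\<And>c d. c \<le> d \<Longrightarrow> d < n \<Longrightarrow> \<kappa> c d \<le> k" "k \<ge> 1" "j \<le> n"
  shows "periodic (tup n M) (tup n (mul k M)) (\<lambda>\<phi>. gram n \<kappa> T \<phi> \<and> indep M j \<phi>)"
proof (rule periodicI)
  fix x y assume xy: "x \<in> tup n M" "y \<in> tup n M" "x - y \<in> tup n (mul k M)"
  have "indep M j x \<longleftrightarrow> indep M j y"
  proof (rule indep_cong[OF unimodularD(1)[OF assms(1)]])
    fix i assume "i < j"
    then show "x i - y i \<in> mul 1 M"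
      using tupD(1)[OF xy(3), of i] mul_anti[OF unimodularD(1)[OF assms(1)] assms(3)] assms(4) by auto
  qed
  then show "(gram n \<kappa> T x \<and> indep M j x) = (gram n \<kappa> T y \<and> indep M j y)"
    using gram_cong[OF assms(1) xy assms(2)] by simp
qed

text \<open>Components along \<open>v\<close> are absorbed into the coefficient of \<open>v\<close>,
  so only the components in \<open>P\<close> matter. The congruence assumed for
  \<open>\<phi>\<close> leaves room for an additional component divisible by \<open>\<pi>\<close>,
  as occurs in \<open>dens_isotropic\<close>.\<close>

lemma indep_split:
  assumes "omod M" "omod P" "v \<in> M" "P \<subseteq> M"
    and D: "\<And>a z. a \<in> pp 0 \<Longrightarrow> z \<in> P \<Longrightarrow> scale a v + z \<in> mul 1 M \<longleftrightarrow> a \<in> pp 1 \<and> z \<in> mul 1 P"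
    and \<alpha>: "\<And>i. i < j \<Longrightarrow> \<alpha> i \<in> pp 0" and z: "\<And>i. i < j \<Longrightarrow> z i \<in> P"
    and \<phi>: "\<And>i. i < j \<Longrightarrow> \<phi> i - (scale (\<alpha> i) v + z i) \<in> mul 1 M"
  shows "indep M (Suc j) (case_nat v \<phi>) \<longleftrightarrow> indep P j z"
proof -
  let ?\<psi> = "case_nat v (\<lambda>i. scale (\<alpha> i) v + z i)"
  have "indep M (Suc j) (case_nat v \<phi>) \<longleftrightarrow> indep M (Suc j) ?\<psi>"
    by (rule indep_cong[OF assms(1)])
      (use \<phi> omodD(1)[OF omod_mul[OF assms(1)]] in \<open>auto split: nat.split\<close>)
  also have "\<dots> \<longleftrightarrow> indep P j z"
  proof -
    have s: "(\<Sum>i<Suc j. scale (c i) (?\<psi> i)) =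
        scale (c 0 + (\<Sum>i<j. c (Suc i) * \<alpha> i)) v + (\<Sum>i<j. scale (c (Suc i)) (z i))" for c
      by (simp add: sum.lessThan_Suc_shift scale_right_distrib scale_left_distrib sum.distrib scale_sum_left algebra_simps
          del: sum.lessThan_Suc)
    have m: "(\<Sum>i<Suc j. scale (c i) (?\<psi> i)) \<in> mul 1 M \<longleftrightarrow>
        c 0 + (\<Sum>i<j. c (Suc i) * \<alpha> i) \<in> pp 1 \<and> (\<Sum>i<j. scale (c (Suc i)) (z i)) \<in> mul 1 P"
      if "\<forall>i<Suc j. c i \<in> pp 0" for c
      unfolding s by (rule D) (use that \<alpha> z assms(2) in \<open>auto intro!: pp_add pp_sum pp_mult_left omod_sum omodD\<close>)
    show ?thesis
    proof
      assume L: "indep M (Suc j) ?\<psi>"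
      show "indep P j z"
        unfolding indep_def
      proof (intro allI impI)
        fix c i assume c: "\<forall>i<j. c i \<in> pp 0" "(\<Sum>i<j. scale (c i) (z i)) \<in> mul 1 P" "i < j"
        let ?c = "case_nat (- (\<Sum>i<j. c i * \<alpha> i)) c"
        have c0: "\<forall>i<Suc j. ?c i \<in> pp 0"
          using c \<alpha> by (auto split: nat.split intro!: pp_sum pp_mult_left)
        have "(\<Sum>i<Suc j. scale (?c i) (?\<psi> i)) \<in> mul 1 M" unfolding m[OF c0] using c by simp
        then have "?c (Suc i) \<in> pp 1" using L c0 c(3) unfolding indep_def by blast
        then show "c i \<in> pp 1" by simp
      qed
    next
      assume R: "indep P j z"
      show "indep M (Suc j) ?\<psi>"
        unfolding indep_def
      proof (intro allI impI)
        fix c i assume c: "\<forall>i<Suc j. c i \<in> pp 0" "(\<Sum>i<Suc j. scale (c i) (?\<psi> i)) \<in> mul 1 M" "i < Suc j"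
        have *: "c 0 + (\<Sum>i<j. c (Suc i) * \<alpha> i) \<in> pp 1" "(\<Sum>i<j. scale (c (Suc i)) (z i)) \<in> mul 1 P"
          using c(2) unfolding m[OF c(1)] by auto
        have "\<forall>i<j. c (Suc i) \<in> pp 0" using c(1) by auto
        then have s1: "\<forall>i<j. c (Suc i) \<in> pp 1" using R[unfolded indep_def, rule_format, of "\<lambda>i. c (Suc i)"] *(2) by blast
        then have "(\<Sum>i<j. c (Suc i) * \<alpha> i) \<in> pp 1" using \<alpha> by (intro pp_sum pp_mult_right) auto
        then have "c 0 \<in> pp 1" using pp_diff[OF *(1), of "\<Sum>i<j. c (Suc i) * \<alpha> i"] by simp
        then show "c i \<in> pp 1" using s1 c(3) by (cases i) auto
      qed
    qed
  qed
  finally show ?thesis .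
qed

lemma dens_Suc:
  assumes "unimodular m M" "\<And>c d. c \<le> d \<Longrightarrow> d < Suc n \<Longrightarrow> \<kappa> c d \<le> k" "k \<ge> 1" "j \<le> Suc n"
  shows "dens M (Suc n) \<kappa> T j k = avg M (mul k M) (\<lambda>v. avg (tup n M) (tup n (mul k M))
    (\<lambda>\<phi>. of_bool (gram (Suc n) \<kappa> T (case_nat v \<phi>) \<and> indep M j (case_nat v \<phi>))))"
  unfolding dens_def
  by (rule avg_tup_Suc[OF unimodularD(4)[OF assms(1)] unimodularD(4)[OF assms(1)]])
    (rule periodic_of_bool, rule periodic_gram_indep[OF assms])

lemma periodic_case_nat:
  assumes "periodic (tup (Suc n) M) (tup (Suc n) K) F" "v \<in> M" "0 \<in> K"
  shows "periodic (tup n M) (tup n K) (\<lambda>\<phi>. F (case_nat v \<phi>))"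
proof (rule periodicI)
  fix x y assume "x \<in> tup n M" "y \<in> tup n M" "x - y \<in> tup n K"
  then show "F (case_nat v x) = F (case_nat v y)"
    using assms(1) case_nat_tup[OF assms(2), of x n] case_nat_tup[OF assms(2), of y n]
      case_nat_tup[OF assms(3), of "x - y" n] case_nat_diff[of v x v y] unfolding periodic_def by simp
qed

lemma avg_tup_single:
  assumes "a \<in> tup n (pp 0)"
  shows "avg (tup n (pp 0)) (tup n (pp k)) (\<lambda>x. of_bool (\<forall>i<n. x i - a i \<in> pp k)) = 1 / q ^ (n * k)"
proof -
  have "avg (tup n (pp 0)) (tup n (pp k)) (\<lambda>x. of_bool (\<forall>i<n. x i - a i \<in> pp k)) =
      avg (tup n (pp 0)) (tup n (pp k)) (\<lambda>x. of_bool (x - a \<in> tup n (pp k)))"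
    by (rule avg_cong[OF fin_quot_tup[OF fin_quot_pp]])
      (use tupD(2)[OF assms] in \<open>auto simp: tup_def\<close>)
  also have "\<dots> = 1 / q ^ (n * k)"
    using avg_single[OF fin_quot_tup[OF fin_quot_pp] assms, of k] grp_index_tup[OF fin_quot_pp, of n k] index_pp
    by (simp add: power_mult mult.commute flip: power_mult)
  finally show ?thesis .
qed

text \<open>The Schur complement of \<open>T 0 0\<close>: the Gram matrix of the projections of the
  remaining vectors to the orthogonal complement of the first one.\<close>

definition schur :: "(nat \<Rightarrow> nat \<Rightarrow> 'a) \<Rightarrow> nat \<Rightarrow> nat \<Rightarrow> 'a" where
  "schur T i l = T (Suc i) (Suc l) - T 0 (Suc i) * T 0 (Suc l) / T 0 0"

abbreviation one :: "nat \<Rightarrow> nat \<Rightarrow> nat" where "one \<equiv> \<lambda>_ _. 1"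

text \<open>Once the image \<open>v\<close> of the first vector is chosen, the Gram condition fixes
  the components of the others along \<open>v\<close> modulo \<open>\<pi>\<close>, which costs the
  factor \<open>q ^ n\<close>. Their orthogonal components have Gram matrix
  \<open>schur T\<close>.\<close>

lemma dens_unit:
  assumes U: "unimodular m M" and T0: "unit (T 0 0)" and Ti: "\<And>i. i < n \<Longrightarrow> T 0 (Suc i) \<in> pp 0"
    and w: "\<And>v. v \<in> M \<Longrightarrow> b v v - T 0 0 \<in> pp 1 \<Longrightarrow> dens (uperp M v) n one (schur T) n 1 = w"
  shows "dens M (Suc n) one T (Suc n) 1 = qd M (T 0 0) * w / q ^ n"
proof -
  note UM = unimodularD[OF U]
  have per: "periodic (tup (Suc n) M) (tup (Suc n) (mul 1 M)) (\<lambda>\<phi>. gram (Suc n) one T \<phi> \<and> indep M (Suc n) \<phi>)"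
    by (rule periodic_gram_indep[OF U]) auto
  define a where "a = (\<lambda>i. if i < n then T 0 (Suc i) / T 0 0 else 0)"
  have a: "a \<in> tup n (pp 0)"
    using Ti pp_mult_right[OF _ unitD(3)[OF T0]] by (simp add: tup_def a_def divide_inverse)
  have Ta: "T 0 (Suc i) = a i * T 0 0" if "i < n" for i
    using that unitD(1)[OF T0] by (simp add: a_def)
  have Sa: "schur T c d = T (Suc c) (Suc d) - a c * a d * T 0 0" if "c < n" "d < n" for c d
    using that unitD(1)[OF T0] by (simp add: a_def schur_def)
  have main: "avg (tup n M) (tup n (mul 1 M)) (\<lambda>\<phi>. of_bool (gram (Suc n) one T (case_nat v \<phi>) \<and> indep M (Suc n) (case_nat v \<phi>)))
      = of_bool (b v v - T 0 0 \<in> pp 1) * (w / q ^ n)" (is "?A = _") if v: "v \<in> M" for v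
  proof (cases "b v v - T 0 0 \<in> pp 1")
    case False
    have "?A = 0" by (rule avg_const_on[OF fin_quot_tup[OF UM(4)]]) (use False in \<open>simp add: gram_Suc\<close>)
    then show ?thesis using False by simp
  next
    case True
    define u where "u = b v v"
    have u: "unit (b v v)" using unit_cong[OF True] T0 by simp
    let ?P = "uperp M v" and ?h = "\<lambda>x. scale (fst x) v + snd x"
    note S = unit_split[OF U v u] and U' = unimodularD[OF unit_split(5)[OF U v u]]
    have z0: "0 \<in> mul 1 M" by (rule omodD(1)[OF omod_mul[OF UM(1)]])
    have "?A = avg (tup n (pp 0)) (tup n (pp 1)) (\<lambda>\<alpha>. avg (tup n ?P) (tup n (mul 1 ?P))
       (\<lambda>z. of_bool (gram (Suc n) one T (case_nat v (\<lambda>i. ?h (\<alpha> i, z i))) \<and> indep M (Suc n) (case_nat v (\<lambda>i. ?h (\<alpha> i, z i))))))"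
      by (rule avg_tup_split[OF fin_quot_pp1 U'(4) omodD(6)[OF UM(1)] omodD(6)[OF omod_mul[OF UM(1)]] mul_subset[OF UM(1)] S(1,2,3) _
            periodic_of_bool[OF periodic_case_nat[OF per v z0]]]) simp
    also have "\<dots> = avg (tup n (pp 0)) (tup n (pp 1)) (\<lambda>\<alpha>. of_bool (\<forall>i<n. \<alpha> i - a i \<in> pp 1) * w)"
    proof (rule avg_cong[OF fin_quot_tup[OF fin_quot_pp1]])
      fix \<alpha> assume \<alpha>: "\<alpha> \<in> tup n (pp 0)"
      have eq: "gram (Suc n) one T (case_nat v (\<lambda>i. ?h (\<alpha> i, z i))) \<and> indep M (Suc n) (case_nat v (\<lambda>i. ?h (\<alpha> i, z i)))
        \<longleftrightarrow> (\<forall>i<n. \<alpha> i - a i \<in> pp 1) \<and> (gram n one (schur T) z \<and> indep ?P n z)" if z: "z \<in> tup n ?P" for z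
      proof -
        have zi: "z i \<in> ?P" "b (z i) v = 0" "b v (z i) = 0" if "i < n" for i
          using tupD(1)[OF z that] B_sym by (auto simp: perp_def)
        have i1: "indep M (Suc n) (case_nat v (\<lambda>i. ?h (\<alpha> i, z i))) \<longleftrightarrow> indep ?P n z"
        proof (rule indep_split[OF UM(1) U'(1) v, where \<alpha> = \<alpha>])
          show "scale a v + z \<in> mul 1 M \<longleftrightarrow> a \<in> pp 1 \<and> z \<in> mul 1 ?P" if "a \<in> pp 0" "z \<in> ?P" for a z
            using S(2)[of 1, rule_format, of "(a, z)" 0] that U'(1) omodD(1)[OF U'(1)] by (simp add: mem_Times_iff)
        qed (use \<alpha> z z0 in \<open>auto simp: tup_def perp_def\<close>)
        have ai: "b v (?h (\<alpha> i, z i)) - T 0 (Suc i) \<in> pp 1 \<longleftrightarrow> \<alpha> i - a i \<in> pp 1" if i: "i < n" for i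
        proof -
          have "b v (?h (\<alpha> i, z i)) - T 0 (Suc i) - u * (\<alpha> i - a i) = (u - T 0 0) * a i"
            using zi[OF i] Ta[OF i] by (simp add: B_simps flip: u_def) (simp add: algebra_simps)
          also have "\<dots> \<in> pp 1" using True tupD(1)[OF a i] unfolding u_def by (rule pp_mult_right)
          finally have "b v (?h (\<alpha> i, z i)) - T 0 (Suc i) \<in> pp 1 \<longleftrightarrow> u * (\<alpha> i - a i) \<in> pp 1" by (rule pp_cong_iff)
          then show ?thesis using unit_mult_pp_iff[OF u] by (simp add: u_def)
        qed
        have g: "gram n one (\<lambda>i l. T (Suc i) (Suc l)) (\<lambda>i. ?h (\<alpha> i, z i)) \<longleftrightarrow> gram n one (schur T) z"
          if A: "\<forall>i<n. \<alpha> i - a i \<in> pp 1"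
        proof -
          have "b (?h (\<alpha> c, z c)) (?h (\<alpha> d, z d)) - T (Suc c) (Suc d) \<in> pp 1 \<longleftrightarrow> b (z c) (z d) - schur T c d \<in> pp 1"
            if "c \<le> d" "d < n" for c d
          proof (rule pp_cong_iff)
            have cd: "c < n" "d < n" using that by auto
            have "b (?h (\<alpha> c, z c)) (?h (\<alpha> d, z d)) - T (Suc c) (Suc d) - (b (z c) (z d) - schur T c d)
              = \<alpha> c * \<alpha> d * u - a c * a d * T 0 0"
              using zi[OF cd(1)] zi[OF cd(2)] Sa[OF cd]
              by (simp add: B_simps flip: u_def)
            also have "\<dots> \<in> pp 1"
              using A cd True tupD(1)[OF a] tupD(1)[OF \<alpha>] UM(2)[OF v v] unitD(2)[OF T0]
              unfolding u_def by (intro pp_cong_mult pp_mult_left) auto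
            finally show "b (?h (\<alpha> c, z c)) (?h (\<alpha> d, z d)) - T (Suc c) (Suc d) - (b (z c) (z d) - schur T c d) \<in> pp 1" .
          qed
          then show ?thesis unfolding gram_def by auto
        qed
        show ?thesis
        proof (cases "\<forall>i<n. \<alpha> i - a i \<in> pp 1")
          case A: True
          then have "\<forall>i<n. b v (?h (\<alpha> i, z i)) - T 0 (Suc i) \<in> pp 1" using ai by simp
          then show ?thesis unfolding gram_Suc i1 using True A g[OF A] by simp
        next
          case A: False
          then have "\<not> (\<forall>i<n. b v (?h (\<alpha> i, z i)) - T 0 (Suc i) \<in> pp 1)" using ai by simp
          then show ?thesis unfolding gram_Suc using A by blast
        qed
      qed
      have "avg (tup n ?P) (tup n (mul 1 ?P))
         (\<lambda>z. of_bool (gram (Suc n) one T (case_nat v (\<lambda>i. ?h (\<alpha> i, z i))) \<and> indep M (Suc n) (case_nat v (\<lambda>i. ?h (\<alpha> i, z i))))) =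
         avg (tup n ?P) (tup n (mul 1 ?P)) (\<lambda>z. of_bool (\<forall>i<n. \<alpha> i - a i \<in> pp 1) * of_bool (gram n one (schur T) z \<and> indep ?P n z))"
        by (rule avg_cong[OF fin_quot_tup[OF U'(4)]]) (simp only: eq of_bool_conj)
      also have "\<dots> = of_bool (\<forall>i<n. \<alpha> i - a i \<in> pp 1) * w"
        unfolding avg_cmult using w[OF v True] by (simp add: dens_def)
      finally show "avg (tup n ?P) (tup n (mul 1 ?P))
         (\<lambda>z. of_bool (gram (Suc n) one T (case_nat v (\<lambda>i. ?h (\<alpha> i, z i))) \<and> indep M (Suc n) (case_nat v (\<lambda>i. ?h (\<alpha> i, z i))))) =
         of_bool (\<forall>i<n. \<alpha> i - a i \<in> pp 1) * w" .
    qed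
    also have "\<dots> = w / q ^ n" unfolding avg_multc avg_tup_single[OF a] by simp
    finally show ?thesis using True by simp
  qed
  have "dens M (Suc n) one T (Suc n) 1 = avg M (mul 1 M) (\<lambda>v. avg (tup n M) (tup n (mul 1 M))
      (\<lambda>\<phi>. of_bool (gram (Suc n) one T (case_nat v \<phi>) \<and> indep M (Suc n) (case_nat v \<phi>))))"
    by (rule dens_Suc[OF U]) auto
  also have "\<dots> = avg M (mul 1 M) (\<lambda>v. of_bool (b v v - T 0 0 \<in> pp 1) * (w / q ^ n))"
    by (rule avg_cong[OF UM(4) main])
  finally show ?thesis unfolding avg_multc qd_def by simp
qed

lemma exists_dual_vector:
  assumes "unimodular m M" "v \<in> M" "v \<notin> mul 1 M" shows "\<exists>w\<in>M. b v w = 1"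
proof -
  note U = unimodularD[OF assms(1)]
  obtain y where y: "y \<in> M" "b v y \<notin> pp 1" using U(3)[OF assms(2)] assms(3) by blast
  then have u: "unit (b v y)" using U(2)[OF assms(2)] by (simp add: unit_def)
  show ?thesis
    by (rule bexI[of _ "scale (inverse (b v y)) y"])
      (use unitD[OF u] omodD(3)[OF U(1)] y in \<open>auto simp: B_simps\<close>)
qed

text \<open>Writing \<open>\<phi>\<^sub>i = \<alpha>\<^sub>i v + \<beta>\<^sub>i w + z\<^sub>i\<close> with \<open>z\<^sub>i\<close> orthogonal to \<open>v\<close> and \<open>w\<close>, orthogonality of \<open>\<phi>\<^sub>i\<close> to \<open>v\<close> means
  \<open>\<beta>\<^sub>i = - (b v v) \<alpha>\<^sub>i\<close>, so that \<open>\<phi>\<close> and \<open>z\<close> have Gram matrices differing by a multiple of \<open>\<alpha> \<alpha>\<^sup>T\<close>.\<close>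

lemma dens_isotropic:
  assumes U: "unimodular m M" and T0: "T 0 0 \<in> pp 1" and N: "N \<ge> 1" and j: "j \<le> n"
    and Ti: "\<And>i. i < n \<Longrightarrow> T 0 (Suc i) \<in> pp N"
    and w: "\<And>v w \<alpha>. v \<in> M \<Longrightarrow> w \<in> M \<Longrightarrow> b v v - T 0 0 \<in> pp N \<Longrightarrow> b v w = 1 \<Longrightarrow> \<alpha> \<in> tup n (pp 0) \<Longrightarrow>
      dens (perp M v w) n (\<lambda>_ _. N) (\<lambda>i l. T (Suc i) (Suc l) + b v v * (1 - b v v * b w w) * (\<alpha> i * \<alpha> l)) j N = W"
  shows "dens M (Suc n) (\<lambda>_ _. N) T (Suc j) N =
    avg M (mul N M) (\<lambda>v. of_bool (b v v - T 0 0 \<in> pp N \<and> v \<notin> mul 1 M)) * W / q ^ (n * N)"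
proof -
  note UM = unimodularD[OF U]
  let ?\<kappa> = "\<lambda>_ _. N"
  have per: "periodic (tup (Suc n) M) (tup (Suc n) (mul N M)) (\<lambda>\<phi>. gram (Suc n) ?\<kappa> T \<phi> \<and> indep M (Suc j) \<phi>)"
    by (rule periodic_gram_indep[OF U]) (use N j in auto)
  have main: "avg (tup n M) (tup n (mul N M)) (\<lambda>\<phi>. of_bool (gram (Suc n) ?\<kappa> T (case_nat v \<phi>) \<and> indep M (Suc j) (case_nat v \<phi>)))
      = of_bool (b v v - T 0 0 \<in> pp N \<and> v \<notin> mul 1 M) * (W / q ^ (n * N))" (is "?A = _") if v: "v \<in> M" for v
  proof (cases "b v v - T 0 0 \<in> pp N \<and> v \<notin> mul 1 M")
    case False
    have "\<not> (gram (Suc n) ?\<kappa> T (case_nat v \<phi>) \<and> indep M (Suc j) (case_nat v \<phi>))" for \<phi>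
    proof (cases "v \<in> mul 1 M")
      case True
      have "\<not> indep M (Suc j) (case_nat v \<phi>)"
      proof
        let ?c = "\<lambda>i::nat. if i = 0 then 1 else 0 :: 'a"
        assume L: "indep M (Suc j) (case_nat v \<phi>)"
        have s: "(\<Sum>i<Suc j. scale (?c i) (case_nat v \<phi> i)) = v"
          by (simp add: sum.lessThan_Suc_shift del: sum.lessThan_Suc)
        have "(\<forall>i<Suc j. ?c i \<in> pp 0) \<longrightarrow> (\<Sum>i<Suc j. scale (?c i) (case_nat v \<phi> i)) \<in> mul 1 M \<longrightarrow> (\<forall>i<Suc j. ?c i \<in> pp 1)"
          using L unfolding indep_def by (rule spec)
        then have "\<forall>i<Suc j. ?c i \<in> pp 1" unfolding s using True by simp
        then have "?c 0 \<in> pp 1" by blast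
        then show False by simp
      qed
      then show ?thesis by simp
    qed (use False in \<open>auto simp: gram_Suc\<close>)
    then have "?A = 0" by (intro avg_const_on[OF fin_quot_tup[OF UM(4)]]) simp
    then show ?thesis using False by simp
  next
    case True
    define t where "t = b v v"
    have t1: "b v v \<in> pp 1" using pp_cong_iff[OF pp_mono[OF N conjunct1[OF True]]] T0 by simp
    obtain w where wM: "w \<in> M" and vw: "b v w = 1" using exists_dual_vector[OF U v] True by blast
    have wv: "b w v = 1" using vw B_sym by metis
    define s where "s = b w w"
    have ts0: "t \<in> pp 0" "s \<in> pp 0" using UM(2) v wM unfolding t_def s_def by auto
    let ?P = "perp M v w" and ?h = "\<lambda>x. scale (fst (fst x)) v + scale (snd (fst x)) w + snd x"
    note S = iso_split[OF U v wM t1 vw] and U' = unimodularD[OF iso_split(5)[OF U v wM t1 vw]]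
    note O2 = avg_prod(1)[OF fin_quot_pp fin_quot_pp]
    have z0: "0 \<in> mul N M" by (rule omodD(1)[OF omod_mul[OF UM(1)]])
    let ?T = "\<lambda>\<alpha> i l. T (Suc i) (Suc l) + t * (1 - t * s) * (\<alpha> i * \<alpha> l)"
    let ?F = "\<lambda>\<phi>. of_bool (gram (Suc n) ?\<kappa> T (case_nat v \<phi>) \<and> indep M (Suc j) (case_nat v \<phi>)) :: real"
    have eq: "?F (\<lambda>i. ?h (p i, z i)) = of_bool (\<forall>i<n. snd (p i) - (- t * fst (p i)) \<in> pp N) *
        of_bool (gram n ?\<kappa> (?T (\<lambda>i. fst (p i))) z \<and> indep ?P j z)"
      if p: "p \<in> tup n (pp 0 \<times> pp 0)" and z: "z \<in> tup n ?P" for p z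
    proof -
      define \<alpha> where "\<alpha> = (\<lambda>i. fst (p i))"
      define \<beta> where "\<beta> = (\<lambda>i. snd (p i))"
      have ab: "\<alpha> i \<in> pp 0" "\<beta> i \<in> pp 0" if "i < n" for i using tupD(1)[OF p that] by (auto simp: \<alpha>_def \<beta>_def)
      have zi: "z i \<in> ?P" "b (z i) v = 0" "b v (z i) = 0" "b (z i) w = 0" "b w (z i) = 0" if "i < n" for i
        using tupD(1)[OF z that] B_sym by (auto simp: perp_def)
      let ?\<phi> = "\<lambda>i. ?h (p i, z i)"
      have h: "?h (p i, z i) = scale (\<alpha> i) v + scale (\<beta> i) w + z i" for i by (simp add: \<alpha>_def \<beta>_def)
      have ai: "b v (?\<phi> i) - T 0 (Suc i) \<in> pp N \<longleftrightarrow> \<beta> i - (- t * \<alpha> i) \<in> pp N" if i: "i < n" for i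
      proof (rule pp_cong_iff)
        have "b v (?\<phi> i) - T 0 (Suc i) - (\<beta> i - (- t * \<alpha> i)) = - T 0 (Suc i)"
          unfolding h using zi[OF i] by (simp add: B_simps vw t_def algebra_simps)
        then show "b v (?\<phi> i) - T 0 (Suc i) - (\<beta> i - (- t * \<alpha> i)) \<in> pp N"
          using Ti[OF i] by (simp only: pp_uminus_iff)
      qed
      have g: "gram n ?\<kappa> (\<lambda>i l. T (Suc i) (Suc l)) ?\<phi> \<longleftrightarrow> gram n ?\<kappa> (?T \<alpha>) z"
        if A: "\<forall>i<n. \<beta> i - (- t * \<alpha> i) \<in> pp N"
      proof -
        have "b (?\<phi> c) (?\<phi> d) - T (Suc c) (Suc d) \<in> pp N \<longleftrightarrow> b (z c) (z d) - ?T \<alpha> c d \<in> pp N"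
          if "c \<le> d" "d < n" for c d
        proof (rule pp_cong_iff)
          have cd: "c < n" "d < n" using that by auto
          \<comment> \<open>\<open>x\<close> and \<open>y\<close> measure the deviation from the
            exact relation between the coordinates; each term of the difference below contains one
            of them.\<close>
          define x where "x = \<beta> c - (- t * \<alpha> c)"
          define y where "y = \<beta> d - (- t * \<alpha> d)"
          have xy: "x \<in> pp N" "y \<in> pp N" using A cd by (auto simp: x_def y_def)
          have bx: "\<beta> c = x - t * \<alpha> c" "\<beta> d = y - t * \<alpha> d" by (simp_all add: x_def y_def)
          have "b (?\<phi> c) (?\<phi> d) - T (Suc c) (Suc d) - (b (z c) (z d) - ?T \<alpha> c d)
            = x * (\<alpha> d + s * (y - t * \<alpha> d)) + y * (\<alpha> c - s * t * \<alpha> c)"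
            unfolding h using zi[OF cd(1)] zi[OF cd(2)]
            by (simp add: B_simps vw wv bx flip: t_def s_def) (simp add: algebra_simps)
          also have "\<dots> \<in> pp N"
            using xy ts0 ab[OF cd(1)] ab[OF cd(2)] pp_subset_0[OF xy(2)]
            by (intro pp_add pp_mult_right pp_diff pp_mult_left) auto
          finally show "b (?\<phi> c) (?\<phi> d) - T (Suc c) (Suc d) - (b (z c) (z d) - ?T \<alpha> c d) \<in> pp N" .
        qed
        then show ?thesis unfolding gram_def by auto
      qed
      have i1: "indep M (Suc j) (case_nat v ?\<phi>) \<longleftrightarrow> indep ?P j z"
        if A: "\<forall>i<n. \<beta> i - (- t * \<alpha> i) \<in> pp N"
      proof (rule indep_split[OF UM(1) U'(1) v, where \<alpha> = \<alpha>])
        show "scale a v + z \<in> mul 1 M \<longleftrightarrow> a \<in> pp 1 \<and> z \<in> mul 1 ?P" if "a \<in> pp 0" "z \<in> ?P" for a z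
          using S(2)[of 1, rule_format, of "((a, 0), z)" 0] that omodD(1)[OF U'(1)] by (simp add: mem_Times_iff)
        fix i assume "i < j"
        then have i: "i < n" using j by simp
        \<comment> \<open>Since \<open>t\<close> lies in \<open>pp 1\<close>, the coordinate along
          \<open>w\<close> is divisible by \<open>\<pi>\<close> and does not affect
          independence.\<close>
        have "\<beta> i - (- t * \<alpha> i) \<in> pp 1" using A i pp_mono[OF N] by blast
        then have "\<beta> i \<in> pp 1"
          using pp_cong_iff[of "\<beta> i" "- t * \<alpha> i" 1] pp_mult_right[OF t1 ab(1)[OF i]] by (simp add: t_def)
        then show "?\<phi> i - (scale (\<alpha> i) v + z i) \<in> mul 1 M"
          unfolding h using scale_pp_mem[OF UM(1) _ wM] by simp
      qed (use ab zi j in \<open>auto simp: perp_def\<close>)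
      have "gram (Suc n) ?\<kappa> T (case_nat v ?\<phi>) \<and> indep M (Suc j) (case_nat v ?\<phi>) \<longleftrightarrow>
        (\<forall>i<n. \<beta> i - (- t * \<alpha> i) \<in> pp N) \<and> (gram n ?\<kappa> (?T \<alpha>) z \<and> indep ?P j z)"
      proof (cases "\<forall>i<n. \<beta> i - (- t * \<alpha> i) \<in> pp N")
        case A: True
        then have "\<forall>i<n. b v (?\<phi> i) - T 0 (Suc i) \<in> pp N" using ai by blast
        then show ?thesis unfolding gram_Suc i1[OF A] using True A g[OF A] by simp
      next
        case A: False
        then have "\<not> (\<forall>i<n. b v (?\<phi> i) - T 0 (Suc i) \<in> pp N)" using ai by blast
        then show ?thesis unfolding gram_Suc using A by blast
      qed
      then show ?thesis unfolding \<alpha>_def \<beta>_def by (simp only: of_bool_conj)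
    qed
    have pF: "periodic (tup n M) (tup n (mul N M)) ?F"
      by (rule periodic_of_bool[OF periodic_case_nat[OF per v z0]])
    let ?I = "\<lambda>p. avg (tup n ?P) (tup n (mul N ?P)) (\<lambda>z. ?F (\<lambda>i. ?h (p i, z i)))"
    have I: "?I p = of_bool (\<forall>i<n. snd (p i) - (- t * fst (p i)) \<in> pp N) * W"
      if p: "p \<in> tup n (pp 0 \<times> pp 0)" for p
    proof -
      have "?I p = avg (tup n ?P) (tup n (mul N ?P)) (\<lambda>z. of_bool (\<forall>i<n. snd (p i) - (- t * fst (p i)) \<in> pp N) *
        of_bool (gram n ?\<kappa> (?T (\<lambda>i. fst (p i))) z \<and> indep ?P j z))"
        by (rule avg_cong[OF fin_quot_tup[OF U'(4)]]) (rule eq[OF p])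
      also have "\<dots> = of_bool (\<forall>i<n. snd (p i) - (- t * fst (p i)) \<in> pp N) * dens ?P n ?\<kappa> (?T (\<lambda>i. fst (p i))) j N"
        unfolding avg_cmult dens_def ..
      also have "dens ?P n ?\<kappa> (?T (\<lambda>i. fst (p i))) j N = W"
        unfolding t_def s_def
        by (rule w[OF v wM _ vw]) (use True p in \<open>auto simp: tup_def mem_Times_iff\<close>)
      finally show ?thesis .
    qed
    have "?A = avg (tup n (pp 0 \<times> pp 0)) (tup n (pp N \<times> pp N)) ?I"
      by (rule avg_tup_split[OF O2 U'(4) omodD(6)[OF UM(1)] omodD(6)[OF omod_mul[OF UM(1)]] mul_subset[OF UM(1)] S(1,2,3) _ pF])
        simp
    also have "\<dots> = avg (tup n (pp 0 \<times> pp 0)) (tup n (pp N \<times> pp N))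
        (\<lambda>p. of_bool (\<forall>i<n. snd (p i) - (- t * fst (p i)) \<in> pp N) * W)"
      by (rule avg_cong[OF fin_quot_tup[OF O2] I])
    \<comment> \<open>The pairs of coordinates are separated into two tuples, so that
      \<open>\<beta>\<close> can be averaged for fixed \<open>\<alpha>\<close>, where a single class
      contributes.\<close>
    also have "\<dots> = avg (tup n (pp 0)) (tup n (pp N)) (\<lambda>\<alpha>. avg (tup n (pp 0)) (tup n (pp N))
        (\<lambda>\<beta>. of_bool (\<forall>i<n. snd (\<alpha> i, \<beta> i) - (- t * fst (\<alpha> i, \<beta> i)) \<in> pp N) * W))"
    proof (rule avg_tup_split[OF fin_quot_pp fin_quot_pp fin_quotD(1-3)[OF O2], where h = "\<lambda>x. x"])
      show "periodic (tup n (pp 0 \<times> pp 0)) (tup n (pp N \<times> pp N)) (\<lambda>p. of_bool (\<forall>i<n. snd (p i) - (- t * fst (p i)) \<in> pp N) * W)"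
      proof (rule periodicI)
        fix x y assume "x - y \<in> tup n (pp N \<times> pp N)"
        then have xy: "fst (x i) - fst (y i) \<in> pp N" "snd (x i) - snd (y i) \<in> pp N" if "i < n" for i
          using that by (auto simp: tup_def mem_Times_iff)
        have "snd (x i) - (- t * fst (x i)) \<in> pp N \<longleftrightarrow> snd (y i) - (- t * fst (y i)) \<in> pp N" if i: "i < n" for i
        proof (rule pp_cong_iff)
          have e: "snd (x i) - (- t * fst (x i)) - (snd (y i) - (- t * fst (y i))) = (snd (x i) - snd (y i)) + t * (fst (x i) - fst (y i))"
            by (simp add: algebra_simps)
          show "snd (x i) - (- t * fst (x i)) - (snd (y i) - (- t * fst (y i))) \<in> pp N"
            unfolding e by (rule pp_add[OF xy(2)[OF i] pp_mult_left[OF ts0(1) xy(1)[OF i]]])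
        qed
        then have "(\<forall>i<n. snd (x i) - (- t * fst (x i)) \<in> pp N) \<longleftrightarrow> (\<forall>i<n. snd (y i) - (- t * fst (y i)) \<in> pp N)" by blast
        then show "of_bool (\<forall>i<n. snd (x i) - (- t * fst (x i)) \<in> pp N) * W = of_bool (\<forall>i<n. snd (y i) - (- t * fst (y i)) \<in> pp N) * W"
          by (simp only:)
      qed
    qed auto
    also have "\<dots> = W / q ^ (n * N)"
    proof (rule avg_const_on[OF fin_quot_tup[OF fin_quot_pp]])
      fix \<alpha> assume \<alpha>: "\<alpha> \<in> tup n (pp 0)"
      have "(\<lambda>i. - t * \<alpha> i) \<in> tup n (pp 0)" using \<alpha> ts0 by (auto simp: tup_def intro: pp_mult_left)
      from avg_tup_single[OF this, of N]
      show "avg (tup n (pp 0)) (tup n (pp N)) (\<lambda>\<beta>. of_bool (\<forall>i<n. snd (\<alpha> i, \<beta> i) - (- t * fst (\<alpha> i, \<beta> i)) \<in> pp N) * W) = W / q ^ (n * N)"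
        unfolding avg_multc by simp
    qed
    finally show ?thesis using True by simp
  qed
  have "dens M (Suc n) ?\<kappa> T (Suc j) N = avg M (mul N M) (\<lambda>v. avg (tup n M) (tup n (mul N M))
      (\<lambda>\<phi>. of_bool (gram (Suc n) ?\<kappa> T (case_nat v \<phi>) \<and> indep M (Suc j) (case_nat v \<phi>))))"
    by (rule dens_Suc[OF U]) (use N j in auto)
  also have "\<dots> = avg M (mul N M) (\<lambda>v. of_bool (b v v - T 0 0 \<in> pp N \<and> v \<notin> mul 1 M) * (W / q ^ (n * N)))"
    by (rule avg_cong[OF UM(4) main])
  finally show ?thesis unfolding avg_multc by simp
qed

end

lemma fin_quot_mid:
  assumes "fin_quot G K" "subgrp H" "K \<subseteq> H" "H \<subseteq> G"
  shows "fin_quot G H" "fin_quot H K"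
proof -
  note f = fin_quotD[OF assms(1)]
  have "quot_reps G H \<subseteq> coset_rep H ` quot_reps G K"
  proof
    fix r assume "r \<in> quot_reps G H"
    then obtain x where x: "x \<in> G" "r = coset_rep H x" unfolding quot_reps_def by auto
    have "x - coset_rep K x \<in> H" using coset_rep_diff[OF f(2)] assms(3) by blast
    then have "r = coset_rep H (coset_rep K x)" using coset_rep_eq_iff[OF assms(2)] x by simp
    then show "r \<in> coset_rep H ` quot_reps G K" using x unfolding quot_reps_def by blast
  qed
  then have "finite (quot_reps G H)" using f(4) finite_subset by blast
  then show "fin_quot G H" using f assms by (simp add: fin_quot_def)
  show "fin_quot H K" by (rule fin_quot_sub[OF assms(1,2) f(2) assms(4,3)])
qed

context quadratic_lattices begin

lemma dens_level:
  assumes "unimodular m M" "\<And>c d. c \<le> d \<Longrightarrow> d < n \<Longrightarrow> \<kappa> c d \<le> k" "1 \<le> k" "k \<le> k'" "j \<le> n"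
  shows "dens M n \<kappa> T j k' = dens M n \<kappa> T j k"
proof -
  note U = unimodularD[OF assms(1)]
  note mid = fin_quot_mid[OF fin_quot_tup[OF U(4)] subgrp_tup[OF omodD(6)[OF omod_mul[OF U(1)]]]
      tup_mono[OF mul_anti[OF U(1) assms(4)]] tup_mono[OF mul_subset[OF U(1)]]]
  show ?thesis unfolding dens_def
    by (rule avg_tower(3)[OF mid]) (rule periodic_of_bool, rule periodic_gram_indep[OF assms(1,2,3,5)])
qed

subsection \<open>Change of basis\<close>

text \<open>In matrix notation: the transpose of \<open>A\<close>, times \<open>T\<close>, times
  \<open>A\<close>.\<close>

definition congr :: "nat \<Rightarrow> (nat \<Rightarrow> nat \<Rightarrow> 'a) \<Rightarrow> (nat \<Rightarrow> nat \<Rightarrow> 'a) \<Rightarrow> nat \<Rightarrow> nat \<Rightarrow> 'a" where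
  "congr n A T c d = (\<Sum>i<n. \<Sum>l<n. A i c * T i l * A l d)"

definition act :: "nat \<Rightarrow> (nat \<Rightarrow> nat \<Rightarrow> 'a) \<Rightarrow> (nat \<Rightarrow> 'w) \<Rightarrow> nat \<Rightarrow> 'w" where
  "act n A \<phi> = (\<lambda>l. if l < n then \<Sum>i<n. scale (A i l) (\<phi> i) else 0)"

text \<open>Integrality is required of the first matrix only, and only one product is prescribed;
  invertibility over the ring of integers is expressed by assuming the relation in both
  orders.\<close>

definition inverse_mats :: "nat \<Rightarrow> (nat \<Rightarrow> nat \<Rightarrow> 'a) \<Rightarrow> (nat \<Rightarrow> nat \<Rightarrow> 'a) \<Rightarrow> bool" where
  "inverse_mats n A A' \<longleftrightarrow> (\<forall>i<n. \<forall>l<n. A i l \<in> pp 0 \<and> (\<Sum>k<n. A i k * A' k l) = of_bool (i = l))"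

lemma act_tup: "omod M \<Longrightarrow> \<phi> \<in> tup n M \<Longrightarrow> (\<And>i l. i < n \<Longrightarrow> l < n \<Longrightarrow> A i l \<in> pp 0) \<Longrightarrow> act n A \<phi> \<in> tup n M"
  unfolding act_def tup_def by (auto intro!: omod_sum omodD(3))

lemma act_inverse:
  assumes "inverse_mats n A A'" "\<phi> \<in> tup n M" shows "act n A' (act n A \<phi>) = \<phi>"
proof
  fix c
  show "act n A' (act n A \<phi>) c = \<phi> c"
  proof (cases "c < n")
    case True
    have "act n A' (act n A \<phi>) c = (\<Sum>l<n. \<Sum>i<n. scale (A i l * A' l c) (\<phi> i))"
      using True by (simp add: act_def scale_sum_right mult.commute)
    also have "\<dots> = (\<Sum>i<n. scale (\<Sum>l<n. A i l * A' l c) (\<phi> i))"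
      by (subst sum.swap) (simp add: scale_sum_left)
    also have "\<dots> = (\<Sum>i<n. if i = c then \<phi> i else 0)"
      by (rule sum.cong) (use assms(1) True in \<open>auto simp: inverse_mats_def\<close>)
    finally show ?thesis using True by (simp add: sum.delta)
  next
    case False
    then show ?thesis using tupD(2)[OF assms(2), of c] by (simp add: act_def)
  qed
qed

lemma act_diff: "act n A x - act n A y = act n A (x - y)"
  unfolding act_def by (auto simp: fun_eq_iff sum_subtractf scale_right_diff_distrib)

lemma gram_const_iff:
  assumes "\<And>c d. c < n \<Longrightarrow> d < n \<Longrightarrow> T c d = T d c"
  shows "gram n (\<lambda>_ _. N) T \<phi> \<longleftrightarrow> (\<forall>c<n. \<forall>d<n. b (\<phi> c) (\<phi> d) - T c d \<in> pp N)"
proof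
  assume g: "gram n (\<lambda>_ _. N) T \<phi>"
  show "\<forall>c<n. \<forall>d<n. b (\<phi> c) (\<phi> d) - T c d \<in> pp N"
  proof (intro allI impI)
    fix c d assume "c < n" "d < n"
    then show "b (\<phi> c) (\<phi> d) - T c d \<in> pp N"
      using g assms B_sym unfolding gram_def by (cases "c \<le> d") (metis, metis nat_le_linear)
  qed
qed (auto simp: gram_def)

lemma gram_act:
  assumes "\<And>c d. c < n \<Longrightarrow> d < n \<Longrightarrow> T c d = T d c" "\<And>i l. i < n \<Longrightarrow> l < n \<Longrightarrow> A i l \<in> pp 0"
    and "gram n (\<lambda>_ _. N) T \<phi>"
  shows "gram n (\<lambda>_ _. N) (congr n A T) (act n A \<phi>)"
  unfolding gram_def
proof (intro allI impI)
  fix d c assume "d < n" "c \<le> d"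
  then have cd: "c < n" "d < n" by auto
  have "b (act n A \<phi> c) (act n A \<phi> d) - congr n A T c d = (\<Sum>i<n. \<Sum>l<n. A i c * A l d * (b (\<phi> i) (\<phi> l) - T i l))"
  proof -
    have "b (act n A \<phi> c) (act n A \<phi> d) = (\<Sum>i<n. A i c * b (\<phi> i) (act n A \<phi> d))"
      using cd(1) unfolding act_def[of n A \<phi>] by (simp add: B_sum B_scale)
    also have "\<dots> = (\<Sum>i<n. \<Sum>l<n. A i c * A l d * b (\<phi> i) (\<phi> l))"
      using cd(2) by (simp add: act_def B_sum_right B_scale_right sum_distrib_left mult.assoc)
    finally show ?thesis unfolding congr_def by (simp add: sum_subtractf right_diff_distrib mult_ac)
  qed
  also have "\<dots> \<in> pp N"
    by (intro pp_sum pp_mult_left) (use assms cd in \<open>auto simp: gram_const_iff[OF assms(1)]\<close>)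
  finally show "b (act n A \<phi> c) (act n A \<phi> d) - congr n A T c d \<in> pp N" .
qed

lemma congr_congr:
  assumes "inverse_mats n A A'" "c < n" "d < n" shows "congr n A' (congr n A T) c d = T c d"
proof -
  have a: "(\<Sum>i<n. A x i * A' i e) = of_bool (x = e)" if "x < n" "e < n" for x e
    using assms(1) that unfolding inverse_mats_def by blast
  have "congr n A' (congr n A T) c d = (\<Sum>i<n. \<Sum>l<n. \<Sum>x<n. \<Sum>y<n. (A x i * A' i c) * T x y * (A y l * A' l d))"
    unfolding congr_def by (simp add: sum_distrib_left sum_distrib_right mult_ac)
  also have "\<dots> = (\<Sum>i<n. \<Sum>x<n. \<Sum>l<n. \<Sum>y<n. (A x i * A' i c) * T x y * (A y l * A' l d))"
    by (rule sum.cong[OF refl], rule sum.swap)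
  also have "\<dots> = (\<Sum>x<n. \<Sum>i<n. \<Sum>l<n. \<Sum>y<n. (A x i * A' i c) * T x y * (A y l * A' l d))"
    by (rule sum.swap)
  also have "\<dots> = (\<Sum>x<n. \<Sum>i<n. \<Sum>y<n. \<Sum>l<n. (A x i * A' i c) * T x y * (A y l * A' l d))"
    by (rule sum.cong[OF refl], rule sum.cong[OF refl], rule sum.swap)
  also have "\<dots> = (\<Sum>x<n. \<Sum>y<n. \<Sum>i<n. \<Sum>l<n. (A x i * A' i c) * T x y * (A y l * A' l d))"
    by (rule sum.cong[OF refl], rule sum.swap)
  also have "\<dots> = (\<Sum>x<n. \<Sum>y<n. (\<Sum>i<n. A x i * A' i c) * T x y * (\<Sum>l<n. A y l * A' l d))"
    by (simp add: sum_distrib_left sum_distrib_right mult_ac)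
  also have "\<dots> = (\<Sum>x<n. \<Sum>y<n. if y = d then (if x = c then T x y else 0) else 0)"
    by (intro sum.cong[OF refl]) (simp add: a assms)
  also have "\<dots> = T c d" using assms(2,3) by (simp add: sum.delta)
  finally show ?thesis .
qed

lemma congr_sym:
  assumes "\<And>c d. c < n \<Longrightarrow> d < n \<Longrightarrow> T c d = T d c" shows "congr n A T c d = congr n A T d c"
proof -
  have "congr n A T c d = (\<Sum>l<n. \<Sum>i<n. A i c * T i l * A l d)" unfolding congr_def by (rule sum.swap)
  also have "\<dots> = congr n A T d c" unfolding congr_def
    by (intro sum.cong[OF refl]) (use assms in \<open>simp add: mult_ac\<close>)
  finally show ?thesis .
qed

lemma indep_act:
  assumes "inverse_mats n A A'" "inverse_mats n A' A" "indep M n \<phi>"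
  shows "indep M n (act n A \<phi>)"
  unfolding indep_def
proof (intro allI impI)
  fix c i assume c: "\<forall>i<n. c i \<in> pp 0" "(\<Sum>i<n. scale (c i) (act n A \<phi> i)) \<in> mul 1 M" "i < n"
  define c' where "c' = (\<lambda>x. \<Sum>l<n. A x l * c l)"
  have "(\<Sum>l<n. scale (c l) (act n A \<phi> l)) = (\<Sum>l<n. \<Sum>i<n. scale (A i l * c l) (\<phi> i))"
    by (simp add: act_def scale_sum_right mult.commute)
  also have "\<dots> = (\<Sum>i<n. scale (c' i) (\<phi> i))" unfolding c'_def
    by (subst sum.swap) (simp add: scale_sum_left)
  finally have "(\<Sum>i<n. scale (c' i) (\<phi> i)) \<in> mul 1 M" using c(2) by simp
  moreover have "\<forall>i<n. c' i \<in> pp 0"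
    using assms(1) c unfolding c'_def inverse_mats_def by (auto intro!: pp_sum pp_mult_left)
  ultimately have c': "\<forall>i<n. c' i \<in> pp 1" using assms(3) unfolding indep_def by blast
  have "(\<Sum>x<n. A' i x * c' x) = (\<Sum>x<n. \<Sum>l<n. A' i x * A x l * c l)"
    unfolding c'_def by (simp add: sum_distrib_left mult.assoc)
  also have "\<dots> = (\<Sum>l<n. (\<Sum>x<n. A' i x * A x l) * c l)"
    by (subst sum.swap) (simp add: sum_distrib_right)
  also have "\<dots> = (\<Sum>l<n. if l = i then c l else 0)"
    by (rule sum.cong[OF refl]) (use assms(2) c(3) in \<open>auto simp: inverse_mats_def\<close>)
  also have "\<dots> = c i" using c(3) by (simp add: sum.delta)
  finally have "c i = (\<Sum>x<n. A' i x * c' x)" by simp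
  also have "\<dots> \<in> pp 1"
    using c' assms(2) c(3) unfolding inverse_mats_def by (intro pp_sum pp_mult_left) auto
  finally show "c i \<in> pp 1" .
qed

lemma indep_0: "indep M 0 \<phi>" unfolding indep_def by simp

text \<open>An invertible integral base change permutes the tuples modulo every level. Independence
  of an intermediate number of vectors would depend on the basis, hence the restriction on
  \<open>j\<close>.\<close>

lemma dens_congruence:
  assumes U: "unimodular m M" and N: "N \<ge> 1" and j: "j = 0 \<or> j = n"
    and A: "inverse_mats n A A'" and A': "inverse_mats n A' A"
    and sym: "\<And>c d. c < n \<Longrightarrow> d < n \<Longrightarrow> T c d = T d c"
  shows "dens M n (\<lambda>_ _. N) (congr n A T) j N = dens M n (\<lambda>_ _. N) T j N"
proof -
  note UM = unimodularD[OF U]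
  let ?G = "tup n M" and ?K = "tup n (mul N M)"
  have A0: "A i l \<in> pp 0" "A' i l \<in> pp 0" if "i < n" "l < n" for i l
    using A A' that unfolding inverse_mats_def by blast+
  have aG: "act n A \<phi> \<in> ?G" "act n A' \<phi> \<in> ?G" if "\<phi> \<in> ?G" for \<phi>
    using act_tup[OF UM(1) that] A0 by auto
  have aK: "act n A \<phi> \<in> ?K" "act n A' \<phi> \<in> ?K" if "\<phi> \<in> ?K" for \<phi>
    using act_tup[OF omod_mul[OF UM(1)] that] A0 by auto
  have G: "gram n (\<lambda>_ _. N) (congr n A T) (act n A \<phi>) \<longleftrightarrow> gram n (\<lambda>_ _. N) T \<phi>" if \<phi>: "\<phi> \<in> ?G" for \<phi>
  proof
    assume "gram n (\<lambda>_ _. N) (congr n A T) (act n A \<phi>)"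
    then have "gram n (\<lambda>_ _. N) (congr n A' (congr n A T)) (act n A' (act n A \<phi>))"
      by (rule gram_act[rotated 2]) (use A0 congr_sym[OF sym] in auto)
    then have "gram n (\<lambda>_ _. N) (congr n A' (congr n A T)) \<phi>" unfolding act_inverse[OF A \<phi>] .
    moreover have "gram n (\<lambda>_ _. N) (congr n A' (congr n A T)) \<phi> \<longleftrightarrow> gram n (\<lambda>_ _. N) T \<phi>"
      by (rule gram_cong_entries) (simp add: congr_congr[OF A])
    ultimately show "gram n (\<lambda>_ _. N) T \<phi>" by simp
  next
    assume "gram n (\<lambda>_ _. N) T \<phi>"
    then show "gram n (\<lambda>_ _. N) (congr n A T) (act n A \<phi>)" by (rule gram_act[rotated 2]) (use A0 sym in auto)
  qed
  have I: "indep M j (act n A \<phi>) \<longleftrightarrow> indep M j \<phi>" if \<phi>: "\<phi> \<in> ?G" for \<phi>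
    using j indep_act[OF A A', of M \<phi>] indep_act[OF A' A, of M "act n A \<phi>"] act_inverse[OF A \<phi>] indep_0 by auto
  have "dens M n (\<lambda>_ _. N) (congr n A T) j N =
    avg ?G ?K (\<lambda>\<phi>. of_bool (gram n (\<lambda>_ _. N) (congr n A T) (act n A \<phi>) \<and> indep M j (act n A \<phi>)))"
    unfolding dens_def
  proof (rule avg_iso(3)[OF fin_quot_tup[OF UM(4)] subgrp_tup[OF omodD(6)[OF UM(1)]]
        subgrp_tup[OF omodD(6)[OF omod_mul[OF UM(1)]]] tup_mono[OF mul_subset[OF UM(1)]]])
    show "\<forall>x\<in>?G. act n A x \<in> ?G" using aG by blast
    show "\<forall>x\<in>?G. \<forall>y\<in>?G. act n A x - act n A y \<in> ?K \<longleftrightarrow> x - y \<in> ?K"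
    proof (intro ballI iffI)
      fix x y assume xy: "x \<in> ?G" "y \<in> ?G"
      { assume "x - y \<in> ?K" then show "act n A x - act n A y \<in> ?K" unfolding act_diff by (rule aK) }
      assume "act n A x - act n A y \<in> ?K"
      then have "act n A' (act n A x - act n A y) \<in> ?K" by (rule aK)
      then show "x - y \<in> ?K" unfolding act_diff[symmetric] act_inverse[OF A xy(1)] act_inverse[OF A xy(2)] .
    qed
    show "\<forall>z\<in>?G. \<exists>x\<in>?G. z - act n A x \<in> ?K"
    proof
      fix z assume z: "z \<in> ?G"
      show "\<exists>x\<in>?G. z - act n A x \<in> ?K"
        by (rule bexI[OF _ aG(2)[OF z]])
          (use act_inverse[OF A' z] subgrpD(1)[OF subgrp_tup[OF omodD(6)[OF omod_mul[OF UM(1)]]]] in auto)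
    qed
    show "periodic ?G ?K (\<lambda>\<phi>. of_bool (gram n (\<lambda>_ _. N) (congr n A T) \<phi> \<and> indep M j \<phi>))"
      by (rule periodic_of_bool, rule periodic_gram_indep[OF U]) (use N j in auto)
  qed
  also have "\<dots> = dens M n (\<lambda>_ _. N) T j N"
    unfolding dens_def
  proof (rule avg_cong[OF fin_quot_tup[OF UM(4)]])
    fix \<phi> assume \<phi>: "\<phi> \<in> ?G"
    show "of_bool (gram n (\<lambda>_ _. N) (congr n A T) (act n A \<phi>) \<and> indep M j (act n A \<phi>)) = (of_bool (gram n (\<lambda>_ _. N) T \<phi> \<and> indep M j \<phi>) :: real)"
      unfolding G[OF \<phi>] I[OF \<phi>] ..
  qed
  finally show ?thesis .
qed

subsection \<open>Change of precision\<close>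

definition bump :: "nat \<Rightarrow> nat \<Rightarrow> 'a \<Rightarrow> (nat \<Rightarrow> nat \<Rightarrow> 'a) \<Rightarrow> nat \<Rightarrow> nat \<Rightarrow> 'a" where
  "bump a d x T = (\<lambda>c e. if (c = a \<and> e = d) \<or> (c = d \<and> e = a) then T c e + x else T c e)"

definition raise :: "nat \<Rightarrow> nat \<Rightarrow> (nat \<Rightarrow> nat \<Rightarrow> nat) \<Rightarrow> nat \<Rightarrow> nat \<Rightarrow> nat" where
  "raise a d \<kappa> = (\<lambda>c e. if c = a \<and> e = d then Suc (\<kappa> c e) else \<kappa> c e)"

lemma bump_cases:
  obtains "bump a d x T c e = T c e + x" "bump a d x T e c = T e c + x"
  | "bump a d x T c e = T c e" "bump a d x T e c = T e c"
  unfolding bump_def by metis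

text \<open>A congruence modulo \<open>pp N\<close> is the disjoint union of the \<open>q\<close>
  congruences modulo \<open>pp (Suc N)\<close> that refine it; the factor \<open>q\<close> turns the
  average over these lifts into their sum.\<close>

lemma dens_raise:
  assumes U: "unimodular m M" and ad: "a \<le> d" "d < n" and k: "\<And>c e. c \<le> e \<Longrightarrow> e < n \<Longrightarrow> \<kappa> c e \<le> k"
    and k': "\<kappa> a d < k" and j: "j \<le> n"
  shows "dens M n \<kappa> T j k = q * avgO (\<lambda>r. dens M n (raise a d \<kappa>) (bump a d (\<pi> ^ \<kappa> a d * r) T) j k)"
proof -
  note UM = unimodularD[OF U]
  let ?N = "\<kappa> a d"
  let ?T = "\<lambda>r. bump a d (\<pi> ^ ?N * r) T"
  have g: "gram n (raise a d \<kappa>) (?T r) \<phi> \<longleftrightarrow> gram n \<kappa> T \<phi> \<and> b (\<phi> a) (\<phi> d) - T a d - \<pi> ^ ?N * r \<in> pp (Suc ?N)"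
    if r: "r \<in> pp 0" for r \<phi>
  proof -
    have pr: "\<pi> ^ ?N * r \<in> pp ?N" using pi_power_mult_iff[of ?N r 0] r by simp
    have L: "gram n (raise a d \<kappa>) (?T r) \<phi> \<longleftrightarrow>
      (\<forall>e<n. \<forall>c\<le>e. (c, e) \<noteq> (a, d) \<longrightarrow> b (\<phi> c) (\<phi> e) - T c e \<in> pp (\<kappa> c e)) \<and>
      b (\<phi> a) (\<phi> d) - T a d - \<pi> ^ ?N * r \<in> pp (Suc ?N)"
    proof -
      have "b (\<phi> c) (\<phi> e) - ?T r c e \<in> pp (raise a d \<kappa> c e) \<longleftrightarrow> b (\<phi> c) (\<phi> e) - T c e \<in> pp (\<kappa> c e)"
        if "c \<le> e" "(c, e) \<noteq> (a, d)" for c e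
        using that ad by (auto simp: bump_def raise_def)
      moreover have "b (\<phi> a) (\<phi> d) - ?T r a d \<in> pp (raise a d \<kappa> a d) \<longleftrightarrow> b (\<phi> a) (\<phi> d) - T a d - \<pi> ^ ?N * r \<in> pp (Suc ?N)"
        by (simp add: bump_def raise_def diff_diff_add)
      ultimately show ?thesis unfolding gram_def using ad by (metis prod.inject)
    qed
    have R: "gram n \<kappa> T \<phi> \<longleftrightarrow> (\<forall>e<n. \<forall>c\<le>e. (c, e) \<noteq> (a, d) \<longrightarrow> b (\<phi> c) (\<phi> e) - T c e \<in> pp (\<kappa> c e)) \<and>
        b (\<phi> a) (\<phi> d) - T a d \<in> pp ?N"
      unfolding gram_def using ad by (metis prod.inject)
    have "b (\<phi> a) (\<phi> d) - T a d \<in> pp ?N" if "b (\<phi> a) (\<phi> d) - T a d - \<pi> ^ ?N * r \<in> pp (Suc ?N)"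
      using pp_add[OF pp_mono[OF _ that, of ?N] pr] by simp
    then show ?thesis unfolding L R by blast
  qed
  have pt: "avgO (\<lambda>r. of_bool (gram n (raise a d \<kappa>) (?T r) \<phi> \<and> indep M j \<phi>)) = of_bool (gram n \<kappa> T \<phi> \<and> indep M j \<phi>) * (1 / q)" for \<phi>
  proof (cases "gram n \<kappa> T \<phi> \<and> indep M j \<phi>")
    case True
    then have "b (\<phi> a) (\<phi> d) - T a d \<in> pp ?N" using ad unfolding gram_def by blast
    then obtain r0 where r0: "r0 \<in> pp 0" "b (\<phi> a) (\<phi> d) - T a d = \<pi> ^ ?N * r0" by (rule pp_E)
    have "avgO (\<lambda>r. of_bool (gram n (raise a d \<kappa>) (?T r) \<phi> \<and> indep M j \<phi>)) = avgO (\<lambda>r. of_bool (r - r0 \<in> pp 1))"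
    proof (rule avg_cong[OF fin_quot_pp1])
      fix r assume r: "r \<in> pp 0"
      have "gram n (raise a d \<kappa>) (?T r) \<phi> \<and> indep M j \<phi> \<longleftrightarrow> \<pi> ^ ?N * (r0 - r) \<in> pp (?N + 1)"
        unfolding g[OF r] r0(2) using True by (simp add: right_diff_distrib flip: Suc_eq_plus1)
      also have "\<dots> \<longleftrightarrow> r - r0 \<in> pp 1" unfolding pi_power_mult_iff by (rule pp_minus_commute)
      finally show "of_bool (gram n (raise a d \<kappa>) (?T r) \<phi> \<and> indep M j \<phi>) = (of_bool (r - r0 \<in> pp 1) :: real)" by simp
    qed
    then show ?thesis using True avgO_single[OF r0(1)] by simp
  next
    case False
    have "avgO (\<lambda>r. of_bool (gram n (raise a d \<kappa>) (?T r) \<phi> \<and> indep M j \<phi>)) = 0"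
      by (rule avg_const_on[OF fin_quot_pp1]) (use g False in auto)
    then show ?thesis using False by simp
  qed
  have "avgO (\<lambda>r. dens M n (raise a d \<kappa>) (?T r) j k) = dens M n \<kappa> T j k * (1 / q)"
    unfolding dens_def by (subst avg_swap) (simp only: pt avg_multc)
  then show ?thesis using q_pos by simp
qed

text \<open>The expected codimension of the Gram condition: multiplication by
  \<open>q ^ prec n \<kappa>\<close> is what makes densities at different precisions comparable. It
  also serves as the measure for inductions on \<open>\<kappa>\<close>.\<close>

definition prec :: "nat \<Rightarrow> (nat \<Rightarrow> nat \<Rightarrow> nat) \<Rightarrow> nat" where "prec n \<kappa> = (\<Sum>e<n. \<Sum>c\<le>e. \<kappa> c e)"

lemma prec_raise: assumes "a \<le> d" "d < n" shows "prec n (raise a d \<kappa>) = Suc (prec n \<kappa>)"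
proof -
  have "(\<Sum>c\<le>e. raise a d \<kappa> c e) = (\<Sum>c\<le>e. \<kappa> c e) + (if e = d then 1 else 0)" for e
  proof -
    have "(\<Sum>c\<le>e. raise a d \<kappa> c e) = (\<Sum>c\<le>e. \<kappa> c e + (if c = a then (if e = d then 1 else 0) else 0))"
      by (rule sum.cong) (auto simp: raise_def)
    also have "\<dots> = (\<Sum>c\<le>e. \<kappa> c e) + (\<Sum>c\<le>e. if c = a then (if e = d then 1 else 0) else 0)" by (rule sum.distrib)
    also have "(\<Sum>c\<le>e. if c = a then (if e = d then 1 else 0) else 0) = (if e = d then 1 else 0 :: nat)"
      using assms(1) by (auto simp: sum.delta)
    finally show ?thesis .
  qed
  then show ?thesis using assms(2) by (simp add: prec_def sum.distrib sum.delta)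
qed

lemma prec_const: "prec n (\<lambda>_ _. N) = N * prec n one"
  unfolding prec_def by (simp only: sum_distrib_left mult_1_right)

lemma prec_eq_imp:
  assumes "prec n \<kappa> \<ge> prec n \<kappa>'" "\<And>c e. c \<le> e \<Longrightarrow> e < n \<Longrightarrow> \<kappa> c e \<le> \<kappa>' c e" "c \<le> e" "e < n"
  shows "\<kappa> c e = \<kappa>' c e"
proof (rule ccontr)
  assume "\<kappa> c e \<noteq> \<kappa>' c e"
  then have "\<kappa> c e < \<kappa>' c e" using assms(2)[OF assms(3,4)] by simp
  then have "(\<Sum>c\<le>e. \<kappa> c e) < (\<Sum>c\<le>e. \<kappa>' c e)"
    by (intro sum_strict_mono_ex1) (use assms in auto)
  then have "prec n \<kappa> < prec n \<kappa>'"
    unfolding prec_def by (intro sum_strict_mono_ex1) (use assms in \<open>auto intro: sum_mono\<close>)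
  then show False using assms(1) by simp
qed

text \<open>The entries are raised one at a time until the precision is the constant
  \<open>N\<close>. All lifts met on the way stay congruent to \<open>T\<close> modulo
  \<open>pp N0\<close>, so the same value \<open>w\<close> is reached along every path.\<close>

lemma dens_refine:
  assumes U: "unimodular m M" and N: "N \<ge> 1" and j: "j \<le> n"
    and w: "\<And>T'. (\<And>c e. c < n \<Longrightarrow> e < n \<Longrightarrow> T' c e = T' e c) \<Longrightarrow> (\<And>c e. c < n \<Longrightarrow> e < n \<Longrightarrow> T' c e - T c e \<in> pp N0) \<Longrightarrow>
      dens M n (\<lambda>_ _. N) T' j N * q ^ prec n (\<lambda>_ _. N) = w"
    and \<kappa>: "\<And>c e. c \<le> e \<Longrightarrow> e < n \<Longrightarrow> N0 \<le> \<kappa> c e \<and> \<kappa> c e \<le> N"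
    and T': "\<And>c e. c < n \<Longrightarrow> e < n \<Longrightarrow> T' c e = T' e c" "\<And>c e. c < n \<Longrightarrow> e < n \<Longrightarrow> T' c e - T c e \<in> pp N0"
  shows "dens M n \<kappa> T' j N * q ^ prec n \<kappa> = w"
  using \<kappa> T'
proof (induction "prec n (\<lambda>_ _. N) - prec n \<kappa>" arbitrary: \<kappa> T' rule: less_induct)
  case less
  show ?case
  proof (cases "\<exists>a d. a \<le> d \<and> d < n \<and> \<kappa> a d < N")
    case False
    then have e: "\<kappa> c e = N" if "c \<le> e" "e < n" for c e using less.prems(1)[OF that] that by force
    then have "gram n \<kappa> T' = gram n (\<lambda>_ _. N) T'" unfolding gram_def by (auto simp: fun_eq_iff)
    then have "dens M n \<kappa> T' j N = dens M n (\<lambda>_ _. N) T' j N" unfolding dens_def by simp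
    moreover have "prec n \<kappa> = prec n (\<lambda>_ _. N)" unfolding prec_def using e by (intro sum.cong) auto
    ultimately show ?thesis using w[of T'] less.prems(2,3) by simp
  next
    case True
    then obtain a d where ad: "a \<le> d" "d < n" "\<kappa> a d < N" by blast
    let ?\<kappa> = "raise a d \<kappa>"
    have \<kappa>': "N0 \<le> ?\<kappa> c e \<and> ?\<kappa> c e \<le> N" if "c \<le> e" "e < n" for c e
      using less.prems(1)[OF that] ad by (auto simp: raise_def)
    have "prec n \<kappa> < prec n (\<lambda>_ _. N)"
    proof (rule ccontr)
      assume "\<not> ?thesis"
      then have "\<kappa> a d = N" using prec_eq_imp[of n "\<lambda>_ _. N" \<kappa> a d] less.prems(1) ad by force
      then show False using ad by simp
    qed
    then have lt: "prec n (\<lambda>_ _. N) - prec n ?\<kappa> < prec n (\<lambda>_ _. N) - prec n \<kappa>" using prec_raise[OF ad(1,2), of \<kappa>] by simp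
    have r: "dens M n ?\<kappa> (bump a d (\<pi> ^ \<kappa> a d * r) T') j N = w / q ^ prec n ?\<kappa>" if "r \<in> pp 0" for r
    proof -
      have pr: "\<pi> ^ \<kappa> a d * r \<in> pp N0"
        using pp_mono[of N0 "\<kappa> a d"] less.prems(1)[OF ad(1,2)] pi_power_mult_iff[of "\<kappa> a d" r 0] that by simp
      have "dens M n ?\<kappa> (bump a d (\<pi> ^ \<kappa> a d * r) T') j N * q ^ prec n ?\<kappa> = w"
      proof (rule less.hyps[OF lt \<kappa>'])
        show "bump a d (\<pi> ^ \<kappa> a d * r) T' c e = bump a d (\<pi> ^ \<kappa> a d * r) T' e c" if "c < n" "e < n" for c e
          using less.prems(2)[OF that] by (rule_tac bump_cases[of a d "\<pi> ^ \<kappa> a d * r" T' c e]) simp_all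
        show "bump a d (\<pi> ^ \<kappa> a d * r) T' c e - T c e \<in> pp N0" if "c < n" "e < n" for c e
        proof -
          have "(T' c e - T c e) + \<pi> ^ \<kappa> a d * r \<in> pp N0" by (rule pp_add[OF less.prems(3)[OF that] pr])
          then show ?thesis using less.prems(3)[OF that]
            by (rule_tac bump_cases[of a d "\<pi> ^ \<kappa> a d * r" T' c e]) (simp_all add: add_diff_eq diff_add_eq)
        qed
      qed
      then show ?thesis using q_pos by (simp add: field_simps)
    qed
    have "dens M n \<kappa> T' j N = q * avgO (\<lambda>r. dens M n ?\<kappa> (bump a d (\<pi> ^ \<kappa> a d * r) T') j N)"
      by (rule dens_raise[where \<kappa> = \<kappa>, OF U ad(1,2) _ ad(3) j]) (use less.prems(1) in auto)
    also have "\<dots> = q * (w / q ^ prec n ?\<kappa>)"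
      by (subst avg_const_on[OF fin_quot_pp1 r]) auto
    finally show ?thesis unfolding prec_raise[OF ad(1,2)] using q_pos by simp
  qed
qed

subsection \<open>Lifting primitive representations\<close>

text \<open>Gram-Schmidt modulo \<open>\<pi>\<close>: the component of the new vector off the
  earlier ones is primitive by independence, so some \<open>u\<close> pairs to 1 with it. Removing
  from \<open>u\<close> its products with the earlier vectors gives the new dual vector.\<close>

lemma dual_vectors:
  assumes U: "unimodular m M" and "\<And>i. i < n \<Longrightarrow> \<phi> i \<in> M" "indep M n \<phi>"
  shows "\<exists>\<psi>. (\<forall>i<n. \<psi> i \<in> M) \<and> (\<forall>i<n. \<forall>l<n. b (\<phi> i) (\<psi> l) - of_bool (i = l) \<in> pp 1)"
  using assms(2,3)
proof (induction n)
  case 0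
  then show ?case by simp
next
  case (Suc n)
  note UM = unimodularD[OF U]
  have ind: "indep M n \<phi>" unfolding indep_def
  proof (intro allI impI)
    fix c i assume c: "\<forall>i<n. c i \<in> pp 0" "(\<Sum>i<n. scale (c i) (\<phi> i)) \<in> mul 1 M" "i < n"
    let ?c = "\<lambda>i. if i < n then c i else 0"
    have "(\<Sum>i<Suc n. scale (?c i) (\<phi> i)) = (\<Sum>i<n. scale (c i) (\<phi> i))" by simp
    then have "(\<Sum>i<Suc n. scale (?c i) (\<phi> i)) \<in> mul 1 M" using c(2) by simp
    moreover have "\<forall>i<Suc n. ?c i \<in> pp 0" using c(1) by simp
    ultimately have "\<forall>i<Suc n. ?c i \<in> pp 1" using Suc.prems(2)[unfolded indep_def, THEN spec, of ?c] by blast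
    then have "?c i \<in> pp 1" using c(3) less_Suc_eq by blast
    then show "c i \<in> pp 1" using c(3) by simp
  qed
  obtain \<psi> where \<psi>: "\<And>i. i < n \<Longrightarrow> \<psi> i \<in> M" "\<And>i l. i < n \<Longrightarrow> l < n \<Longrightarrow> b (\<phi> i) (\<psi> l) - of_bool (i = l) \<in> pp 1"
    using Suc.IH[OF _ ind] Suc.prems(1) by (metis less_SucI)
  have \<phi>M: "\<phi> i \<in> M" if "i \<le> n" for i using Suc.prems(1)[of i] that by simp
  define x where "x = \<phi> n - (\<Sum>i<n. scale (b (\<phi> n) (\<psi> i)) (\<phi> i))"
  have xM: "x \<in> M" unfolding x_def
    using \<phi>M \<psi>(1) UM(2) by (intro omodD(5)[OF UM(1)] omod_sum[OF UM(1)] omodD(3)[OF UM(1)]) auto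
  have "x \<notin> mul 1 M"
  proof
    assume x: "x \<in> mul 1 M"
    let ?c = "\<lambda>i. if i < n then - b (\<phi> n) (\<psi> i) else 1"
    have "(\<Sum>i<Suc n. scale (?c i) (\<phi> i)) = x" by (simp add: x_def sum_negf)
    moreover have "\<forall>i<Suc n. ?c i \<in> pp 0" using UM(2) \<phi>M \<psi>(1) by auto
    ultimately have "\<forall>i<Suc n. ?c i \<in> pp 1" using x Suc.prems(2)[unfolded indep_def, THEN spec, of ?c] by metis
    then have "?c n \<in> pp 1" by blast
    then show False by simp
  qed
  then obtain u where u: "u \<in> M" "b x u = 1" using exists_dual_vector[OF U xM] by blast
  define y where "y = u - (\<Sum>i<n. scale (b (\<phi> i) u) (\<psi> i))"
  have yM: "y \<in> M" unfolding y_def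
    using \<phi>M \<psi>(1) UM(2) u by (intro omodD(5)[OF UM(1)] omod_sum[OF UM(1)] omodD(3)[OF UM(1)]) auto
  have yn: "b (\<phi> n) y = 1"
    using u(2) by (simp add: y_def x_def B_simps mult.commute)
  have yl: "b (\<phi> l) y \<in> pp 1" if l: "l < n" for l
  proof -
    have e: "b (\<phi> l) u = (\<Sum>i<n. b (\<phi> i) u * of_bool (l = i))"
      using l by (simp add: of_bool_def sum.delta if_distrib cong: if_cong)
    have "b (\<phi> l) y = b (\<phi> l) u - (\<Sum>i<n. b (\<phi> i) u * b (\<phi> l) (\<psi> i))"
      by (simp add: y_def B_simps)
    also have "\<dots> = - (\<Sum>i<n. b (\<phi> i) u * (b (\<phi> l) (\<psi> i) - of_bool (l = i)))"
      by (subst e) (simp only: right_diff_distrib sum_subtractf minus_diff_eq)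
    also have "\<dots> \<in> pp 1" using \<psi>(2)[OF l] UM(2)[OF \<phi>M u(1)] by (intro pp_uminus pp_sum pp_mult_left) auto
    finally show ?thesis .
  qed
  \<comment> \<open>The earlier dual vectors are corrected by multiples of \<open>y\<close> so that
    they become orthogonal to \<open>\<phi> n\<close> as well.\<close>
  let ?\<psi> = "\<lambda>i. if i < n then \<psi> i - scale (b (\<phi> n) (\<psi> i)) y else y"
  have "?\<psi> i \<in> M" if "i < Suc n" for i
    using \<psi>(1) yM UM(2)[OF \<phi>M \<psi>(1), of n] by (auto intro!: omodD(5)[OF UM(1)] omodD(3)[OF UM(1)])
  moreover have "b (\<phi> i) (?\<psi> l) - of_bool (i = l) \<in> pp 1" if il: "i < Suc n" "l < Suc n" for i l
  proof (cases "l < n")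
    case True
    have pl: "b (\<phi> n) (\<psi> l) \<in> pp 0" using UM(2)[OF \<phi>M \<psi>(1)[OF True], of n] by simp
    show ?thesis
    proof (cases "i < n")
      case i: True
      have e: "b (\<phi> i) (?\<psi> l) - of_bool (i = l) = (b (\<phi> i) (\<psi> l) - of_bool (i = l)) - b (\<phi> n) (\<psi> l) * b (\<phi> i) y"
        using True by (simp add: B_simps)
      show ?thesis unfolding e by (rule pp_diff[OF \<psi>(2)[OF i True] pp_mult_left[OF pl yl[OF i]]])
    next
      case False
      then have "i = n" using il by simp
      then show ?thesis using True yn by (simp add: B_simps)
    qed
  next
    case False
    then have "l = n" using il by simp
    then show ?thesis using il yn yl by (cases "i = n") auto
  qed
  ultimately show ?case by (intro exI[of _ ?\<psi>]) blast
qed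

text \<open>The vectors are chosen for the representative of \<open>\<phi>\<close> modulo
  \<open>mul 1 M\<close>. They are therefore constant on classes, which makes the substitution in
  \<open>dens_bump\<close> invertible and compatible with congruences.\<close>

definition dualvec :: "'w set \<Rightarrow> nat \<Rightarrow> (nat \<Rightarrow> 'w) \<Rightarrow> nat \<Rightarrow> 'w" where
  "dualvec M n \<phi> = (let \<rho> = coset_rep (tup n (mul 1 M)) \<phi> in
     if indep M n \<rho>
     then SOME \<psi>. (\<forall>i<n. \<psi> i \<in> M) \<and> (\<forall>i<n. \<forall>l<n. b (\<rho> i) (\<psi> l) - of_bool (i = l) \<in> pp 1)
     else (\<lambda>_. 0))"

lemma dualvec_cong:
  assumes "omod M" "\<phi> - \<phi>' \<in> tup n (mul 1 M)" shows "dualvec M n \<phi> = dualvec M n \<phi>'"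
proof -
  have "coset_rep (tup n (mul 1 M)) \<phi> = coset_rep (tup n (mul 1 M)) \<phi>'"
    using coset_rep_eq_iff[OF subgrp_tup[OF omodD(6)[OF omod_mul[OF assms(1)]]]] assms(2) by blast
  then show ?thesis unfolding dualvec_def by simp
qed

lemma dualvec_props:
  assumes "unimodular m M" "\<phi> \<in> tup n M"
  shows "i < n \<Longrightarrow> dualvec M n \<phi> i \<in> M"
    "indep M n \<phi> \<Longrightarrow> i < n \<Longrightarrow> l < n \<Longrightarrow> b (\<phi> i) (dualvec M n \<phi> l) - of_bool (i = l) \<in> pp 1"
proof -
  note U = unimodularD[OF assms(1)]
  note sg = subgrp_tup[OF omodD(6)[OF omod_mul[OF U(1), of 1]], of n]
  define \<rho> where "\<rho> = coset_rep (tup n (mul 1 M)) \<phi>"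
  have \<rho>: "\<rho> \<in> tup n M"
    unfolding \<rho>_def by (rule coset_rep_in[OF subgrp_tup[OF omodD(6)[OF U(1)]] sg tup_mono[OF mul_subset[OF U(1)]] assms(2)])
  have d: "\<phi> - \<rho> \<in> tup n (mul 1 M)" unfolding \<rho>_def by (rule coset_rep_diff[OF sg])
  have ind: "indep M n \<phi> \<longleftrightarrow> indep M n \<rho>"
    by (rule indep_cong[OF U(1)]) (use tupD(1)[OF d] in auto)
  let ?P = "\<lambda>\<psi>. (\<forall>i<n. \<psi> i \<in> M) \<and> (\<forall>i<n. \<forall>l<n. b (\<rho> i) (\<psi> l) - of_bool (i = l) \<in> pp 1)"
  have P: "?P (dualvec M n \<phi>)" if "indep M n \<rho>"
  proof -
    have "\<exists>\<psi>. ?P \<psi>" by (rule dual_vectors[OF assms(1) _ that]) (use tupD(1)[OF \<rho>] in auto)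
    then have "?P (SOME \<psi>. ?P \<psi>)" by (rule someI_ex)
    then show ?thesis using that unfolding dualvec_def \<rho>_def[symmetric] Let_def by simp
  qed
  show mem: "dualvec M n \<phi> i \<in> M" if "i < n" for i
    using P that omodD(1)[OF U(1)] by (cases "indep M n \<rho>") (auto simp: dualvec_def \<rho>_def[symmetric] Let_def)
  show "b (\<phi> i) (dualvec M n \<phi> l) - of_bool (i = l) \<in> pp 1" if "indep M n \<phi>" "i < n" "l < n" for i l
  proof -
    have "b (\<phi> i) (dualvec M n \<phi> l) - of_bool (i = l) = b (\<phi> i - \<rho> i) (dualvec M n \<phi> l) + (b (\<rho> i) (dualvec M n \<phi> l) - of_bool (i = l))"
      by (simp only: B_diff) simp
    also have "\<dots> \<in> pp 1"
      by (rule pp_add) (use B_mul(1)[OF assms(1) _ mem[OF that(3)], of "\<phi> i - \<rho> i" 1] tupD(1)[OF d that(2)] P ind that in auto)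
    finally show ?thesis .
  qed
qed

text \<open>One step of Hensel lifting: moving vector \<open>d\<close> by a multiple of
  \<open>\<pi> ^ N\<close> along the dual vector of \<open>a\<close> realizes the prescribed change
  of the entry at \<open>a\<close>, \<open>d\<close> and alters the other products only by elements
  of \<open>pp (Suc N)\<close>, which no precision in \<open>\<kappa>\<close> detects.\<close>

lemma dens_bump:
  assumes U: "unimodular m M" and ad: "a \<le> d" "d < n" and N: "1 \<le> N" "Suc N \<le> k"
    and \<kappa>: "\<And>c e. c \<le> e \<Longrightarrow> e < n \<Longrightarrow> \<kappa> c e \<le> Suc N" and r: "r \<in> pp 0"
  shows "dens M n \<kappa> (bump a d (\<pi> ^ N * r) T) n k = dens M n \<kappa> T n k"
proof -
  note UM = unimodularD[OF U]
  let ?G = "tup n M" and ?K = "tup n (mul k M)" and ?T = "bump a d (\<pi> ^ N * r) T"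
  have \<kappa>k: "\<kappa> c e \<le> k" if "c \<le> e" "e < n" for c e using \<kappa>[OF that] N by simp
  \<comment> \<open>On the diagonal the movement enters the product twice, hence the division by
    2.\<close>
  define s where "s = (if a = d then r * inverse 2 else r)"
  have "r * inverse 2 \<in> pp 0" by (rule pp_mult_left[OF r unitD(3)[OF unit_2]])
  then have s: "s \<in> pp 0" using r unfolding s_def by metis
  define H where "H = (\<lambda>x \<phi> i. if i = d then \<phi> i + scale x (dualvec M n \<phi> a) else \<phi> i)"
  let ?x = "\<pi> ^ N * s"
  have xN: "?x \<in> pp N" using pi_power_mult_iff[of N s 0] s by simp
  have an: "a < n" using ad by simp
  have dM: "dualvec M n \<phi> a \<in> M" if "\<phi> \<in> ?G" for \<phi> using dualvec_props(1)[OF U that an] .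
  have HG: "H x \<phi> \<in> ?G" if "\<phi> \<in> ?G" "x \<in> pp N" for x \<phi>
    using that ad omodD(2)[OF UM(1) _ omodD(3)[OF UM(1) pp_subset_0[OF that(2)] dM[OF that(1)]]]
    by (auto simp: tup_def H_def)
  have Hd: "H x \<phi> - \<phi> \<in> tup n (mul N M)" if "\<phi> \<in> ?G" "x \<in> pp N" for x \<phi>
    using that ad scale_pp_mem[OF UM(1) that(2) dM[OF that(1)]] omodD(1)[OF omod_mul[OF UM(1)]]
    by (auto simp: tup_def H_def)
  have Hd1: "H x \<phi> - \<phi> \<in> tup n (mul 1 M)" if "\<phi> \<in> ?G" "x \<in> pp N" for x \<phi>
    using Hd[OF that] tup_mono[OF mul_anti[OF UM(1) N(1)]] by blast
  have dvH: "dualvec M n (H x \<phi>) = dualvec M n \<phi>" if "\<phi> \<in> ?G" "x \<in> pp N" for x \<phi>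
    by (rule dualvec_cong[OF UM(1) Hd1[OF that]])
  have HH: "H (- x) (H x \<phi>) = \<phi>" if "\<phi> \<in> ?G" "x \<in> pp N" for x \<phi>
    using dvH[OF that] by (auto simp: H_def fun_eq_iff)
  have indH: "indep M n (H x \<phi>) \<longleftrightarrow> indep M n \<phi>" if "\<phi> \<in> ?G" "x \<in> pp N" for x \<phi>
    by (rule indep_cong[OF UM(1)]) (use tupD(1)[OF Hd1[OF that]] in auto)
  have sub: "tup n (mul k M) \<subseteq> tup n (mul 1 M)" by (rule tup_mono[OF mul_anti[OF UM(1)]]) (use N in simp)
  have HK: "H x \<phi> - H x \<phi>' = \<phi> - \<phi>'" if "\<phi> - \<phi>' \<in> tup n (mul 1 M)" for x \<phi> \<phi>'
    using dualvec_cong[OF UM(1) that] by (auto simp: H_def fun_eq_iff)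
  have gramH: "gram n \<kappa> ?T (H ?x \<phi>) \<longleftrightarrow> gram n \<kappa> T \<phi>" if \<phi>: "\<phi> \<in> ?G" and ind: "indep M n \<phi>" for \<phi>
  proof -
    let ?\<psi> = "dualvec M n \<phi> a"
    have dl: "b (\<phi> i) ?\<psi> - of_bool (i = a) \<in> pp 1" if "i < n" for i using dualvec_props(2)[OF U \<phi> ind that an] .
    have xd: "?x * (b (\<phi> i) ?\<psi> - of_bool (i = a)) \<in> pp (Suc N)" if "i < n" for i
      using pp_mult[OF xN dl[OF that]] by (simp only: Suc_eq_plus1)
    \<comment> \<open>The quadratic term of the movement is negligible because
      \<open>N + N \<ge> Suc N\<close>.\<close>
    have xx: "?x * ?x * b ?\<psi> ?\<psi> \<in> pp (Suc N)"
      using pp_mono[of "Suc N" "N + N" "?x * ?x"] pp_mult[OF xN xN] N(1) pp_mult_right UM(2)[OF dM[OF \<phi>] dM[OF \<phi>]] by simp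
    have ch: "b (H ?x \<phi> c) (H ?x \<phi> e) - ?T c e - (b (\<phi> c) (\<phi> e) - T c e) \<in> pp (Suc N)" if ce: "c \<le> e" "e < n" for c e
    proof (cases "e = d")
      case False
      show ?thesis
      proof (cases "c = d")
        case True
        have cn: "e < n" "e \<noteq> a" using ce True False ad by auto
        have "b (H ?x \<phi> c) (H ?x \<phi> e) - ?T c e - (b (\<phi> c) (\<phi> e) - T c e) = ?x * (b (\<phi> e) ?\<psi> - of_bool (e = a))"
          using True False cn B_sym[of ?\<psi> "\<phi> e"] by (simp add: H_def bump_def B_simps)
        then show ?thesis using xd[OF cn(1)] by simp
      next
        case c: False
        then show ?thesis using False by (simp add: H_def bump_def)
      qed
    next
      case True
      show ?thesis
      proof (cases "c = d")
        case c: False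
        have "b (H ?x \<phi> c) (H ?x \<phi> e) - ?T c e - (b (\<phi> c) (\<phi> e) - T c e) = ?x * (b (\<phi> c) ?\<psi> - of_bool (c = a))"
          using True c by (cases "a = d") (auto simp: H_def bump_def B_simps s_def algebra_simps)
        then show ?thesis using xd[of c] ce by simp
      next
        case c: True
        have bd: "?T d d = T d d + 2 * ?x * of_bool (d = a)"
          using unitD(1)[OF unit_2] by (auto simp: s_def bump_def)
        have "b (H ?x \<phi> c) (H ?x \<phi> e) - ?T c e - (b (\<phi> c) (\<phi> e) - T c e)
          = 2 * (?x * (b (\<phi> d) ?\<psi> - of_bool (d = a))) + ?x * ?x * b ?\<psi> ?\<psi>"
          using True c B_sym[of ?\<psi> "\<phi> d"] by (simp add: H_def bd B_simps) (simp add: algebra_simps)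
        then show ?thesis using xd[OF ad(2)] xx pp_mult_left[OF unitD(2)[OF unit_2]] pp_add by simp
      qed
    qed
    have "b (H ?x \<phi> c) (H ?x \<phi> e) - ?T c e \<in> pp (\<kappa> c e) \<longleftrightarrow> b (\<phi> c) (\<phi> e) - T c e \<in> pp (\<kappa> c e)" if "c \<le> e" "e < n" for c e
      by (rule pp_cong_iff[OF pp_mono[OF \<kappa>[OF that] ch[OF that]]])
    then show ?thesis unfolding gram_def by blast
  qed
  have "dens M n \<kappa> ?T n k = avg ?G ?K (\<lambda>\<phi>. of_bool (gram n \<kappa> ?T (H ?x \<phi>) \<and> indep M n (H ?x \<phi>)))"
    unfolding dens_def
  proof (rule avg_iso(3)[OF fin_quot_tup[OF UM(4)] subgrp_tup[OF omodD(6)[OF UM(1)]]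
        subgrp_tup[OF omodD(6)[OF omod_mul[OF UM(1)]]] tup_mono[OF mul_subset[OF UM(1)]]])
    show "\<forall>x\<in>?G. H ?x x \<in> ?G" using HG xN by blast
    show "\<forall>x\<in>?G. \<forall>y\<in>?G. H ?x x - H ?x y \<in> ?K \<longleftrightarrow> x - y \<in> ?K"
    proof (intro ballI iffI)
      fix x y assume xy: "x \<in> ?G" "y \<in> ?G"
      { assume "x - y \<in> ?K" then show "H ?x x - H ?x y \<in> ?K" using HK sub by auto }
      assume *: "H ?x x - H ?x y \<in> ?K"
      have "H (- ?x) (H ?x x) - H (- ?x) (H ?x y) = H ?x x - H ?x y" by (rule HK) (use * sub in blast)
      then show "x - y \<in> ?K" using * unfolding HH[OF xy(1) xN] HH[OF xy(2) xN] by simp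
    qed
    show "\<forall>z\<in>?G. \<exists>x\<in>?G. z - H ?x x \<in> ?K"
    proof
      fix z assume z: "z \<in> ?G"
      have nx: "- ?x \<in> pp N" using xN by simp
      show "\<exists>x\<in>?G. z - H ?x x \<in> ?K"
        by (rule bexI[OF _ HG[OF z nx]])
          (use HH[OF z nx] subgrpD(1)[OF subgrp_tup[OF omodD(6)[OF omod_mul[OF UM(1)]]]] in auto)
    qed
    show "periodic ?G ?K (\<lambda>\<phi>. of_bool (gram n \<kappa> ?T \<phi> \<and> indep M n \<phi>))"
      by (rule periodic_of_bool, rule periodic_gram_indep[OF U \<kappa>k]) (use N in auto)
  qed
  also have "\<dots> = dens M n \<kappa> T n k"
    unfolding dens_def
  proof (rule avg_cong[OF fin_quot_tup[OF UM(4)]])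
    fix \<phi> assume \<phi>: "\<phi> \<in> ?G"
    have "gram n \<kappa> ?T (H ?x \<phi>) \<and> indep M n (H ?x \<phi>) \<longleftrightarrow> gram n \<kappa> T \<phi> \<and> indep M n \<phi>"
      using gramH[OF \<phi>] indH[OF \<phi> xN] by blast
    then show "of_bool (gram n \<kappa> ?T (H ?x \<phi>) \<and> indep M n (H ?x \<phi>)) = (of_bool (gram n \<kappa> T \<phi> \<and> indep M n \<phi>) :: real)"
      by (simp only:)
  qed
  finally show ?thesis .
qed

text \<open>By \<open>dens_bump\<close> all lifts in \<open>dens_raise\<close> have the same
  density, so each additional digit of one entry divides the density by exactly
  \<open>q\<close>.\<close>

lemma dens_primitive:
  assumes U: "unimodular m M" and "\<And>c e. c \<le> e \<Longrightarrow> e < n \<Longrightarrow> 1 \<le> \<kappa> c e \<and> \<kappa> c e \<le> k" "1 \<le> k"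
  shows "dens M n \<kappa> T n k * q ^ prec n \<kappa> = dens M n one T n 1 * q ^ prec n one"
  using assms(2)
proof (induction "prec n \<kappa>" arbitrary: \<kappa> rule: less_induct)
  case less
  show ?case
  proof (cases "\<exists>a d. a \<le> d \<and> d < n \<and> \<kappa> a d > 1")
    case False
    then have e: "\<kappa> c e = 1" if "c \<le> e" "e < n" for c e using less.prems(1)[OF that] that by force
    then have "gram n \<kappa> T = gram n one T" unfolding gram_def by (auto simp: fun_eq_iff)
    then have "dens M n \<kappa> T n k = dens M n one T n k" unfolding dens_def by simp
    also have "\<dots> = dens M n one T n 1" by (rule dens_level[OF U]) (use assms(3) in auto)
    finally show ?thesis using e by (simp add: prec_def)
  next
    case True
    let ?S = "{p. fst p \<le> snd p \<and> snd p < n}"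
    have "?S \<subseteq> {..n} \<times> {..n}" by auto
    then have fS: "finite ?S" using finite_subset by blast
    \<comment> \<open>An entry of maximal precision is lowered, so that the precisions of all others
      are at most \<open>Suc N\<close>, as \<open>dens_bump\<close> requires.\<close>
    let ?V = "(\<lambda>p. \<kappa> (fst p) (snd p)) ` ?S"
    have "?V \<noteq> {}" using True by auto
    then have "Max ?V \<in> ?V" using fS by (intro Max_in) auto
    then obtain a d where ad: "a \<le> d" "d < n" "Max ?V = \<kappa> a d" by auto
    have mx: "\<kappa> c e \<le> \<kappa> a d" if "c \<le> e" "e < n" for c e
    proof -
      have "\<kappa> c e \<in> ?V" by (rule image_eqI[of _ _ "(c, e)"]) (use that in auto)
      then show ?thesis using Max_ge[of ?V "\<kappa> c e"] fS ad(3) by auto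
    qed
    then have gt: "\<kappa> a d > 1" using True by (meson le_trans not_le)
    define N where "N = \<kappa> a d - 1"
    have N: "1 \<le> N" "\<kappa> a d = Suc N" using gt unfolding N_def by auto
    define \<kappa>' where "\<kappa>' = (\<lambda>c e. if c = a \<and> e = d then N else \<kappa> c e)"
    have r: "raise a d \<kappa>' = \<kappa>" using N by (auto simp: raise_def \<kappa>'_def fun_eq_iff)
    have \<kappa>'ad: "\<kappa>' a d = N" by (simp add: \<kappa>'_def)
    have p: "prec n \<kappa> = Suc (prec n \<kappa>')" using prec_raise[OF ad(1,2), of \<kappa>'] unfolding r .
    have b': "1 \<le> \<kappa>' c e \<and> \<kappa>' c e \<le> k" if "c \<le> e" "e < n" for c e
      using less.prems[OF that] less.prems[OF ad(1,2)] N by (auto simp: \<kappa>'_def)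
    have Nk: "Suc N \<le> k" using less.prems[OF ad(1,2)] N by simp
    have "dens M n \<kappa>' T n k = q * avgO (\<lambda>r. dens M n (raise a d \<kappa>') (bump a d (\<pi> ^ \<kappa>' a d * r) T) n k)"
      by (rule dens_raise[where \<kappa> = \<kappa>', OF U ad(1,2)]) (use b' \<kappa>'ad Nk in auto)
    also have "\<dots> = q * dens M n \<kappa> T n k"
      unfolding r \<kappa>'ad
      by (subst avg_const_on[OF fin_quot_pp1 dens_bump[OF U ad(1,2) N(1) Nk]]) (use mx N in auto)
    finally have "dens M n \<kappa>' T n k = q * dens M n \<kappa> T n k" .
    moreover have "dens M n \<kappa>' T n k * q ^ prec n \<kappa>' = dens M n one T n 1 * q ^ prec n one"
      by (rule less.hyps) (use p b' in auto)
    ultimately show ?thesis unfolding p by (simp add: mult_ac)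
  qed
qed

subsection \<open>Enlarging the lattice\<close>

text \<open>Base change to an enlarged lattice: column \<open>j\<close> holds the coordinates of the
  new generator \<open>\<pi>^{-1} (e_j - \<Sum> c_i e_i)\<close>, with the sum over
  \<open>i < j\<close>, and the other basis vectors are kept.\<close>

definition step :: "nat \<Rightarrow> (nat \<Rightarrow> 'a) \<Rightarrow> nat \<Rightarrow> nat \<Rightarrow> 'a" where
  "step j c i l = (if l = j then (if i = j then inverse \<pi> else if i < j then - (inverse \<pi> * c i) else 0) else of_bool (i = l))"

text \<open>Division of vector \<open>j\<close> by \<open>\<pi>\<close> costs one digit for each
  occurrence of \<open>j\<close> among the two indices.\<close>

definition lower :: "nat \<Rightarrow> nat \<Rightarrow> nat \<Rightarrow> nat \<Rightarrow> nat" where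
  "lower j N c d = N - (of_bool (c = j) + of_bool (d = j))"

lemma congr_step:
  assumes "j < n" "\<And>c d. c < n \<Longrightarrow> d < n \<Longrightarrow> T c d = T d c" "a < n" "d < n"
  shows "a \<noteq> j \<Longrightarrow> d \<noteq> j \<Longrightarrow> congr n (step j c) T a d = T a d"
    "a \<noteq> j \<Longrightarrow> congr n (step j c) T a j = inverse \<pi> * (T a j - (\<Sum>i<j. c i * T a i))"
    "d \<noteq> j \<Longrightarrow> congr n (step j c) T j d = inverse \<pi> * (T d j - (\<Sum>i<j. c i * T d i))"
    "congr n (step j c) T j j = inverse \<pi> * inverse \<pi> * (T j j - 2 * (\<Sum>i<j. c i * T i j) + (\<Sum>i<j. \<Sum>l<j. c i * c l * T i l))"
proof -
  have col: "(\<Sum>l<n. f l * step j c l j) = inverse \<pi> * (f j - (\<Sum>i<j. c i * f i))" for f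
  proof -
    have "(\<Sum>l<n. f l * step j c l j) = (\<Sum>l<n. inverse \<pi> * ((if l = j then f l else 0) - (if l < j then c l * f l else 0)))"
      by (rule sum.cong) (auto simp: step_def)
    also have "\<dots> = inverse \<pi> * ((\<Sum>l<n. if l = j then f l else 0) - (\<Sum>l<n. if l < j then c l * f l else 0))"
      by (simp only: sum_distrib_left[symmetric] sum_subtractf)
    also have "(\<Sum>l<n. if l < j then c l * f l else 0) = (\<Sum>i<j. c i * f i)"
      using assms(1) by (subst sum.inter_filter[symmetric]) (auto intro!: sum.cong)
    finally show ?thesis using assms(1) by (simp add: sum.delta)
  qed
  have other: "(\<Sum>l<n. f l * step j c l e) = f e" if "e < n" "e \<noteq> j" for f e
  proof -
    have "(\<Sum>l<n. f l * step j c l e) = (\<Sum>l<n. if l = e then f l else 0)"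
      by (rule sum.cong) (use that in \<open>auto simp: step_def\<close>)
    then show ?thesis using that by (simp add: sum.delta)
  qed
  have C: "congr n (step j c) T a d = (\<Sum>i<n. (\<Sum>l<n. T i l * step j c l d) * step j c i a)" for a d
    unfolding congr_def by (intro sum.cong refl) (simp add: sum_distrib_left mult_ac)
  show "congr n (step j c) T a d = T a d" if "a \<noteq> j" "d \<noteq> j"
    unfolding C by (subst other[OF assms(3) that(1)]) (rule other[OF assms(4) that(2)])
  show 2: "congr n (step j c) T a j = inverse \<pi> * (T a j - (\<Sum>i<j. c i * T a i))" if "a \<noteq> j"
    unfolding C by (subst other[OF assms(3) that(1)]) (rule col)
  show "congr n (step j c) T j d = inverse \<pi> * (T d j - (\<Sum>i<j. c i * T d i))" if "d \<noteq> j"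
  proof -
    have "congr n (step j c) T j d = congr n (step j c) T d j" by (rule congr_sym[OF assms(2)])
    also have "\<dots> = inverse \<pi> * (T d j - (\<Sum>i<j. c i * T d i))"
      unfolding C by (subst other[OF assms(4) that(1)]) (rule col)
    finally show ?thesis .
  qed
  have "congr n (step j c) T j j = inverse \<pi> * (inverse \<pi> * (T j j - (\<Sum>i<j. c i * T j i)) - (\<Sum>i<j. c i * (inverse \<pi> * (T i j - (\<Sum>l<j. c l * T i l)))))"
    unfolding C by (subst col) (simp only: col)
  also have "(\<Sum>i<j. c i * T j i) = (\<Sum>i<j. c i * T i j)"
    by (rule sum.cong) (use assms(1,2) in auto)
  also have "(\<Sum>i<j. c i * (inverse \<pi> * (T i j - (\<Sum>l<j. c l * T i l)))) =
      inverse \<pi> * ((\<Sum>i<j. c i * T i j) - (\<Sum>i<j. \<Sum>l<j. c i * c l * T i l))"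
    by (simp add: sum_distrib_left right_diff_distrib sum_subtractf mult_ac)
  finally show "congr n (step j c) T j j = inverse \<pi> * inverse \<pi> * (T j j - 2 * (\<Sum>i<j. c i * T i j) + (\<Sum>i<j. \<Sum>l<j. c i * c l * T i l))"
    by (simp add: algebra_simps)
qed

text \<open>\<open>H\<close> expresses the old vector \<open>j\<close> through the new one. Products
  with the other vectors acquire a factor \<open>\<pi>\<close> and the norm a factor
  \<open>\<pi>^2\<close>, up to combinations of entries already known to be congruent; so the
  entries without \<open>j\<close> come first, then those with one \<open>j\<close>, then the
  norm.\<close>

lemma gram_step:
  assumes j: "j < n" and sym: "\<And>c d. c < n \<Longrightarrow> d < n \<Longrightarrow> T c d = T d c" and N: "2 \<le> N"
    and c: "\<And>i. i < j \<Longrightarrow> c i \<in> pp 0"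
    and H: "H = (\<lambda>i. if i = j then scale \<pi> (\<phi> j) + (\<Sum>i<j. scale (c i) (\<phi> i)) else \<phi> i)"
  shows "gram n (\<lambda>_ _. N) T H \<longleftrightarrow> gram n (lower j N) (congr n (step j c) T) \<phi>"
proof -
  define g where "g = (\<lambda>a d. b (\<phi> a) (\<phi> d))"
  define T' where "T' = congr n (step j c) T"
  define rest where "rest \<longleftrightarrow> (\<forall>a<n. \<forall>d<n. a \<noteq> j \<longrightarrow> d \<noteq> j \<longrightarrow> g a d - T a d \<in> pp N)"
  have gs: "g a d = g d a" for a d unfolding g_def by (rule B_sym)
  have T's: "T' a d = T' d a" for a d unfolding T'_def by (rule congr_sym[OF sym])
  have T'1: "T' a d = T a d" if "a < n" "d < n" "a \<noteq> j" "d \<noteq> j" for a d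
    unfolding T'_def by (rule congr_step(1)) (use j sym that in auto)
  have T'2: "\<pi> * T' a j = T a j - (\<Sum>i<j. c i * T a i)" if "a < n" "a \<noteq> j" for a
    unfolding T'_def using pi_nonzero by (subst congr_step(2)[where d = a]) (use j sym that in auto)
  have p2: "\<pi> * (\<pi> * T' j j) = T j j - 2 * (\<Sum>i<j. c i * T i j) + (\<Sum>i<j. \<Sum>l<j. c i * c l * T i l)"
  proof -
    have e: "\<pi> * (\<pi> * (inverse \<pi> * inverse \<pi> * X)) = X" for X using pi_nonzero by (simp add: field_simps)
    show ?thesis unfolding T'_def by (subst congr_step(4)[where a = j and d = j]) (use j sym e in auto)
  qed
  have L: "gram n (\<lambda>_ _. N) T H \<longleftrightarrow> rest \<and> (\<forall>a<n. a \<noteq> j \<longrightarrow> b (H a) (H j) - T a j \<in> pp N) \<and> b (H j) (H j) - T j j \<in> pp N"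
  proof -
    have "gram n (\<lambda>_ _. N) T H \<longleftrightarrow> (\<forall>a<n. \<forall>d<n. b (H a) (H d) - T a d \<in> pp N)" by (rule gram_const_iff[OF sym])
    also have "\<dots> \<longleftrightarrow> (\<forall>a<n. \<forall>d<n. a \<noteq> j \<longrightarrow> d \<noteq> j \<longrightarrow> b (H a) (H d) - T a d \<in> pp N) \<and>
        (\<forall>a<n. a \<noteq> j \<longrightarrow> b (H a) (H j) - T a j \<in> pp N) \<and> b (H j) (H j) - T j j \<in> pp N"
      using j sym B_sym by (metis (no_types, lifting))
    also have "(\<forall>a<n. \<forall>d<n. a \<noteq> j \<longrightarrow> d \<noteq> j \<longrightarrow> b (H a) (H d) - T a d \<in> pp N) \<longleftrightarrow> rest"
      unfolding rest_def g_def H by auto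
    finally show ?thesis .
  qed
  have R: "gram n (lower j N) T' \<phi> \<longleftrightarrow> rest \<and> (\<forall>a<n. a \<noteq> j \<longrightarrow> g a j - T' a j \<in> pp (N - 1)) \<and> g j j - T' j j \<in> pp (N - 2)"
  proof -
    have "gram n (lower j N) T' \<phi> \<longleftrightarrow> (\<forall>a<n. \<forall>d<n. g a d - T' a d \<in> pp (lower j N a d))"
    proof
      assume *: "gram n (lower j N) T' \<phi>"
      show "\<forall>a<n. \<forall>d<n. g a d - T' a d \<in> pp (lower j N a d)"
      proof (intro allI impI)
        fix a d assume ad: "a < n" "d < n"
        have l: "lower j N a d = lower j N d a" by (simp add: lower_def add.commute)
        show "g a d - T' a d \<in> pp (lower j N a d)"
        proof (cases "a \<le> d")
          case True
          then show ?thesis using * ad unfolding gram_def g_def by blast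
        next
          case False
          then have "g d a - T' d a \<in> pp (lower j N d a)" using * ad unfolding gram_def g_def by auto
          then show ?thesis unfolding gs[of a d] T's[of a d] l .
        qed
      qed
    qed (auto simp: gram_def g_def)
    also have "\<dots> \<longleftrightarrow> (\<forall>a<n. \<forall>d<n. a \<noteq> j \<longrightarrow> d \<noteq> j \<longrightarrow> g a d - T' a d \<in> pp N) \<and>
        (\<forall>a<n. a \<noteq> j \<longrightarrow> g a j - T' a j \<in> pp (N - 1)) \<and> g j j - T' j j \<in> pp (N - 2)"
    proof -
      have lo: "lower j N a d = N" if "a \<noteq> j" "d \<noteq> j" for a d using that by (simp add: lower_def)
      have lo1: "lower j N a j = N - 1" "lower j N j a = N - 1" if "a \<noteq> j" for a using that by (simp_all add: lower_def)
      have lo2: "lower j N j j = N - 2" by (simp add: lower_def)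
      show ?thesis using j lo lo1 lo2 gs T's by (metis (no_types, lifting))
    qed
    also have "(\<forall>a<n. \<forall>d<n. a \<noteq> j \<longrightarrow> d \<noteq> j \<longrightarrow> g a d - T' a d \<in> pp N) \<longleftrightarrow> rest"
      unfolding rest_def using T'1 by simp
    finally show ?thesis .
  qed
  have pi1: "\<pi> * x \<in> pp N \<longleftrightarrow> x \<in> pp (N - 1)" for x using pi_mult_iff[of x "N - 1"] N by simp
  have pi2: "\<pi> * (\<pi> * x) \<in> pp N \<longleftrightarrow> x \<in> pp (N - 2)" for x
  proof -
    obtain K where K: "N = Suc (Suc K)" using N by (metis add_2_eq_Suc le_Suc_ex)
    then have "N - 2 = K" by simp
    then show ?thesis using pi_mult_iff[of "\<pi> * x" "Suc K"] pi_mult_iff[of x K] by (simp only: K)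
  qed
  have Hj: "b (\<phi> a) (H j) = \<pi> * g a j + (\<Sum>i<j. c i * g a i)" for a
    unfolding H g_def by (simp add: B_simps)
  have A: "b (H a) (H j) - T a j \<in> pp N \<longleftrightarrow> g a j - T' a j \<in> pp (N - 1)" if rest and a: "a < n" "a \<noteq> j" for a
  proof -
    note T'2[OF a]
    then have "b (H a) (H j) - T a j - \<pi> * (g a j - T' a j) = (\<Sum>i<j. c i * (g a i - T a i))"
      using a Hj[of a] by (simp add: H right_diff_distrib sum_subtractf)
    also have "\<dots> \<in> pp N" using \<open>rest\<close> a c j unfolding rest_def by (intro pp_sum pp_mult_left) auto
    finally show ?thesis using pp_cong_iff pi1 by blast
  qed
  have J: "b (H j) (H j) - T j j \<in> pp N \<longleftrightarrow> g j j - T' j j \<in> pp (N - 2)"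
    if rest and aj: "\<forall>a<n. a \<noteq> j \<longrightarrow> g a j - T' a j \<in> pp (N - 1)"
  proof -
    have p1: "\<pi> * T' i j = T i j - (\<Sum>l<j. c l * T i l)" if "i < j" for i using T'2[of i] that j by simp
    have "b (H j) (H j) = \<pi> * (\<pi> * g j j + (\<Sum>i<j. c i * g i j)) + (\<Sum>i<j. c i * (\<pi> * g i j + (\<Sum>l<j. c l * g i l)))"
    proof -
      have "b (H j) (H j) = \<pi> * b (\<phi> j) (H j) + (\<Sum>i<j. c i * b (\<phi> i) (H j))"
        by (subst H) (simp add: B_add B_scale B_sum)
      then show ?thesis unfolding Hj using gs by simp
    qed
    also have "\<dots> = \<pi> * (\<pi> * g j j) + 2 * (\<Sum>i<j. c i * (\<pi> * g i j)) + (\<Sum>i<j. \<Sum>l<j. c i * c l * g i l)"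
      by (simp add: distrib_left sum.distrib sum_distrib_left mult_ac)
    finally have bH: "b (H j) (H j) = \<pi> * (\<pi> * g j j) + 2 * (\<Sum>i<j. c i * (\<pi> * g i j)) + (\<Sum>i<j. \<Sum>l<j. c i * c l * g i l)" .
    have e: "(\<Sum>i<j. c i * (\<pi> * T' i j)) = (\<Sum>i<j. c i * T i j) - (\<Sum>i<j. \<Sum>l<j. c i * c l * T i l)"
      by (simp add: p1 right_diff_distrib sum_subtractf sum_distrib_left mult.assoc)
    have "b (H j) (H j) - T j j - \<pi> * (\<pi> * (g j j - T' j j)) =
      2 * ((\<Sum>i<j. c i * (\<pi> * g i j)) - (\<Sum>i<j. c i * (\<pi> * T' i j))) + ((\<Sum>i<j. \<Sum>l<j. c i * c l * g i l) - (\<Sum>i<j. \<Sum>l<j. c i * c l * T i l))"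
      unfolding bH e right_diff_distrib p2 by (simp add: algebra_simps)
    also have "\<dots> = 2 * (\<Sum>i<j. c i * (\<pi> * (g i j - T' i j))) + (\<Sum>i<j. \<Sum>l<j. c i * c l * (g i l - T i l))"
      by (simp add: right_diff_distrib sum_subtractf)
    also have "\<dots> \<in> pp N"
    proof (rule pp_add)
      show "2 * (\<Sum>i<j. c i * (\<pi> * (g i j - T' i j))) \<in> pp N"
      proof (rule pp_mult_left[OF unitD(2)[OF unit_2]], rule pp_sum)
        fix i assume i: "i \<in> {..<j}"
        then have "\<pi> * (g i j - T' i j) \<in> pp N" unfolding pi1 using aj j by simp
        then show "c i * (\<pi> * (g i j - T' i j)) \<in> pp N"
          using c[of i] i pp_mult_left[of "c i" "\<pi> * (g i j - T' i j)" N] by simp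
      qed
      show "(\<Sum>i<j. \<Sum>l<j. c i * c l * (g i l - T i l)) \<in> pp N"
        by (intro pp_sum pp_mult_left) (use c \<open>rest\<close> j in \<open>auto simp: rest_def\<close>)
    qed
    finally show ?thesis using pp_cong_iff pi2 by blast
  qed
  show ?thesis unfolding L R T'_def[symmetric] using A J by blast
qed

lemma indep_Suc_imp: assumes "indep M (Suc j) \<phi>" shows "indep M j \<phi>"
  unfolding indep_def
proof (intro allI impI)
  fix c i assume c: "\<forall>i<j. c i \<in> pp 0" "(\<Sum>i<j. scale (c i) (\<phi> i)) \<in> mul 1 M" "i < j"
  let ?c = "\<lambda>i. if i < j then c i else 0"
  have "(\<Sum>i<Suc j. scale (?c i) (\<phi> i)) = (\<Sum>i<j. scale (c i) (\<phi> i))" by simp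
  then have "(\<Sum>i<Suc j. scale (?c i) (\<phi> i)) \<in> mul 1 M" using c(2) by simp
  moreover have "\<forall>i<Suc j. ?c i \<in> pp 0" using c(1) by simp
  ultimately have "\<forall>i<Suc j. ?c i \<in> pp 1" using assms[unfolded indep_def, THEN spec, of ?c] by blast
  then have "?c i \<in> pp 1" using c(3) less_Suc_eq by blast
  then show "c i \<in> pp 1" using c(3) by simp
qed

definition dep_set :: "'w set \<Rightarrow> nat \<Rightarrow> nat \<Rightarrow> (nat \<Rightarrow> 'a) \<Rightarrow> (nat \<Rightarrow> 'w) set" where
  "dep_set M n j c = {\<phi> \<in> tup n M. \<phi> j - (\<Sum>i<j. scale (c i) (\<phi> i)) \<in> mul 1 M}"

text \<open>A combination modulo \<open>\<pi> M\<close> depends only on its coefficients modulo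
  \<open>\<pi>\<close>, so a finite system of representatives suffices.\<close>

abbreviation coeffs :: "nat \<Rightarrow> (nat \<Rightarrow> 'a) set" where
  "coeffs j \<equiv> quot_reps (tup j (pp 0)) (tup j (pp 1))"

lemma finite_coeffs: "finite (coeffs j)"
  by (rule fin_quotD(4)[OF fin_quot_tup[OF fin_quot_pp1]])

lemma coeffs_pp: "c \<in> coeffs j \<Longrightarrow> i < j \<Longrightarrow> c i \<in> pp 0"
  using fin_quotD(5)[OF fin_quot_tup[OF fin_quot_pp1, of j]] tupD(1) by blast

text \<open>Over the residue field, a vector following \<open>j\<close> independent ones is either
  independent of them or a combination with unique coefficients. The sum therefore has one nonzero
  term or none.\<close>

lemma indep_step:
  assumes U: "unimodular m M" and j: "j < n" and \<phi>: "\<phi> \<in> tup n M" and ind: "indep M j \<phi>"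
  shows "(\<Sum>c\<in>coeffs j. of_bool (\<phi> \<in> dep_set M n j c)) = (1 - of_bool (indep M (Suc j) \<phi>) :: real)"
    (is "?S = _")
proof -
  note UM = unimodularD[OF U] and om = omodD[OF omod_mul[OF unimodularD(1)[OF U], of 1]]
  have t: "transversal (tup j (pp 0)) (tup j (pp 1)) (coeffs j)"
    by (rule transversal_quot_reps[OF fin_quot_tup[OF fin_quot_pp1]])
  have \<phi>M: "\<phi> i \<in> M" if "i < n" for i using tupD(1)[OF \<phi> that] .
  show ?thesis
  proof (cases "indep M (Suc j) \<phi>")
    case True
    have "\<phi> \<notin> dep_set M n j c" if c: "c \<in> coeffs j" for c
    proof
      assume d: "\<phi> \<in> dep_set M n j c"
      let ?c = "\<lambda>i. if i < j then - c i else 1"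
      have "(\<Sum>i<Suc j. scale (?c i) (\<phi> i)) = \<phi> j - (\<Sum>i<j. scale (c i) (\<phi> i))" by (simp add: sum_negf)
      then have "(\<Sum>i<Suc j. scale (?c i) (\<phi> i)) \<in> mul 1 M" using d by (simp add: dep_set_def)
      moreover have "\<forall>i<Suc j. ?c i \<in> pp 0" using coeffs_pp[OF c] by simp
      ultimately have "\<forall>i<Suc j. ?c i \<in> pp 1" using True[unfolded indep_def, THEN spec, of ?c] by blast
      then have "?c j \<in> pp 1" by blast
      then show False by simp
    qed
    then show ?thesis using True by simp
  next
    case False
    then obtain c' i0 where c': "\<forall>i<Suc j. c' i \<in> pp 0" "(\<Sum>i<Suc j. scale (c' i) (\<phi> i)) \<in> mul 1 M" "i0 < Suc j" "c' i0 \<notin> pp 1"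
      unfolding indep_def by blast
    \<comment> \<open>Otherwise the relation would reduce to a nontrivial one among the first
      \<open>j\<close> vectors.\<close>
    have u: "unit (c' j)"
    proof (rule ccontr)
      assume "\<not> unit (c' j)"
      then have "c' j \<in> pp 1" using c'(1) by (simp add: unit_def)
      then have "scale (c' j) (\<phi> j) \<in> mul 1 M" using scale_pp_mem[OF UM(1) _ \<phi>M[OF j]] by blast
      then have "(\<Sum>i<j. scale (c' i) (\<phi> i)) \<in> mul 1 M" using om(5)[OF c'(2)] by fastforce
      then have "\<forall>i<j. c' i \<in> pp 1" using ind[unfolded indep_def, THEN spec, of c'] c'(1) by simp
      then show False using c'(3,4) \<open>c' j \<in> pp 1\<close> less_Suc_eq by blast
    qed
    define c where "c = (\<lambda>i. if i < j then - (inverse (c' j) * c' i) else 0)"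
    have c: "c \<in> tup j (pp 0)" unfolding c_def tup_def using c'(1) pp_mult_left[OF unitD(3)[OF u]] by simp
    have "scale (inverse (c' j)) (\<Sum>i<Suc j. scale (c' i) (\<phi> i)) = \<phi> j - (\<Sum>i<j. scale (c i) (\<phi> i))"
      using unitD(1)[OF u] by (simp add: c_def scale_right_distrib scale_sum_right sum_negf)
    then have cd: "\<phi> j - (\<Sum>i<j. scale (c i) (\<phi> i)) \<in> mul 1 M"
      using om(3)[OF unitD(3)[OF u] c'(2)] by simp
    obtain r where r: "r \<in> coeffs j" "c - r \<in> tup j (pp 1)" using t c unfolding transversal_def by blast
    have tr: "\<phi> j - (\<Sum>i<j. scale (y i) (\<phi> i)) \<in> mul 1 M \<longleftrightarrow> x - y \<in> tup j (pp 1)"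
      if x: "\<phi> j - (\<Sum>i<j. scale (x i) (\<phi> i)) \<in> mul 1 M" and xy: "x \<in> tup j (pp 0)" "y \<in> tup j (pp 0)" for x y
    proof -
      have e: "(\<phi> j - (\<Sum>i<j. scale (y i) (\<phi> i))) - (\<phi> j - (\<Sum>i<j. scale (x i) (\<phi> i))) = (\<Sum>i<j. scale (x i - y i) (\<phi> i))"
        by (simp add: scale_left_diff_distrib sum_subtractf)
      have "\<phi> j - (\<Sum>i<j. scale (y i) (\<phi> i)) \<in> mul 1 M \<longleftrightarrow> (\<Sum>i<j. scale (x i - y i) (\<phi> i)) \<in> mul 1 M"
        unfolding e[symmetric] using om(5)[OF _ x] om(2)[OF _ x] by fastforce
      also have "\<dots> \<longleftrightarrow> (\<forall>i<j. x i - y i \<in> pp 1)"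
      proof
        assume "(\<Sum>i<j. scale (x i - y i) (\<phi> i)) \<in> mul 1 M"
        then show "\<forall>i<j. x i - y i \<in> pp 1"
          using ind[unfolded indep_def, THEN spec, of "\<lambda>i. x i - y i"] tupD(1)[OF xy(1)] tupD(1)[OF xy(2)] pp_diff by blast
      next
        assume "\<forall>i<j. x i - y i \<in> pp 1"
        then show "(\<Sum>i<j. scale (x i - y i) (\<phi> i)) \<in> mul 1 M"
          by (intro omod_sum[OF omod_mul[OF UM(1)]] scale_pp_mem[OF UM(1)]) (use \<phi>M j in auto)
      qed
      also have "\<dots> \<longleftrightarrow> x - y \<in> tup j (pp 1)" using tupD(2)[OF xy(1)] tupD(2)[OF xy(2)] by (auto simp: tup_def)
      finally show ?thesis .
    qed
    have sub: "x \<in> tup j (pp 0)" if "x \<in> coeffs j" for x using t that unfolding transversal_def by blast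
    have rd: "\<phi> j - (\<Sum>i<j. scale (r i) (\<phi> i)) \<in> mul 1 M" using tr[OF cd c sub[OF r(1)]] r(2) by simp
    have "\<phi> \<in> dep_set M n j x \<longleftrightarrow> x = r" if x: "x \<in> coeffs j" for x
    proof -
      have "\<phi> \<in> dep_set M n j x \<longleftrightarrow> r - x \<in> tup j (pp 1)"
        using tr[OF rd sub[OF r(1)] sub[OF x]] \<phi> by (simp add: dep_set_def)
      also have "\<dots> \<longleftrightarrow> x = r" using t x r(1) subgrpD(1)[OF subgrp_tup[OF subgrp_pp, of j 1]]
        unfolding transversal_def by auto
      finally show ?thesis .
    qed
    then have "?S = (\<Sum>x\<in>coeffs j. of_bool (x = r))" by (intro sum.cong) auto
    also have "\<dots> = 1" using r(1) finite_coeffs by (simp add: of_bool_def sum.delta)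
    finally show ?thesis using False by simp
  qed
qed

text \<open>The tuples with prescribed dependence form a subgroup parametrized by \<open>H\<close>,
  which writes vector \<open>j\<close> as \<open>\<pi>\<close> times a free vector plus the given
  combination. The free tuple represents the enlarged lattice, and the index of the subgroup gives
  the denominator.\<close>

lemma dens_step_aux:
  assumes U: "unimodular m M" and j: "j < n" and sym: "\<And>c d. c < n \<Longrightarrow> d < n \<Longrightarrow> T c d = T d c"
    and N: "2 \<le> N" and c: "\<And>i. i < j \<Longrightarrow> c i \<in> pp 0"
  shows "avg (tup n M) (tup n (mul N M)) (\<lambda>\<phi>. of_bool ((gram n (\<lambda>_ _. N) T \<phi> \<and> indep M j \<phi>) \<and> \<phi> \<in> dep_set M n j c)) =
    dens M n (lower j N) (congr n (step j c) T) j N / q ^ m"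
proof -
  note UM = unimodularD[OF U]
  note O = omodD[OF UM(1)] and om = omodD[OF omod_mul[OF UM(1)]]
  let ?G = "tup n M" and ?K = "tup n (mul N M)" and ?A = "dep_set M n j c"
  let ?f = "\<lambda>\<phi>. of_bool ((gram n (\<lambda>_ _. N) T \<phi> \<and> indep M j \<phi>) \<and> \<phi> \<in> ?A) :: real"
  have N1: "1 \<le> N" using N by simp
  define s where "s = (\<lambda>\<phi>. \<Sum>i<j. scale (c i) (\<phi> i))"
  have sd: "s x - s y = s (x - y)" for x y unfolding s_def by (simp add: sum_subtractf scale_right_diff_distrib)
  have sM: "s \<phi> \<in> M" if "\<phi> \<in> ?G" for \<phi>
    unfolding s_def by (intro omod_sum[OF UM(1)] O(3)) (use c tupD(1)[OF that] j in auto)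
  have sK: "s \<phi> \<in> mul N M" if "\<And>i. i < j \<Longrightarrow> \<phi> i \<in> mul N M" for \<phi>
    unfolding s_def by (intro omod_sum[OF omod_mul[OF UM(1)]] om(3)) (use c that in auto)
  have A: "\<phi> \<in> ?A \<longleftrightarrow> \<phi> \<in> ?G \<and> \<phi> j - s \<phi> \<in> mul 1 M" for \<phi> unfolding dep_set_def s_def by simp
  note sgG = subgrp_tup[OF O(6), of n] and sgK = subgrp_tup[OF om(6), of n N]
  have sgA: "subgrp ?A"
    unfolding subgrp_def
  proof (intro conjI ballI)
    show "0 \<in> ?A" unfolding A using subgrpD(1)[OF sgG] om(1)[of 1] by (simp add: s_def)
    fix x y assume "x \<in> ?A" "y \<in> ?A"
    then show "x - y \<in> ?A" unfolding A using subgrpD(2)[OF sgG, of x y] om(5)[of "x j - s x" 1 "y j - s y"]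
      by (simp add: sd[symmetric] algebra_simps)
  qed
  have KG: "?K \<subseteq> ?G" by (rule tup_mono[OF mul_subset[OF UM(1)]])
  have KA: "?K \<subseteq> ?A"
  proof
    fix \<phi> assume \<phi>: "\<phi> \<in> ?K"
    have "\<phi> j - s \<phi> \<in> mul N M" using om(5) tupD(1)[OF \<phi> j] sK tupD(1)[OF \<phi>] j by simp
    then show "\<phi> \<in> ?A" unfolding A using KG \<phi> mul_anti[OF UM(1) N1] by blast
  qed
  have AG: "?A \<subseteq> ?G" unfolding A subset_iff by simp
  note mid = fin_quot_mid[OF fin_quot_tup[OF UM(4)] sgA KA AG]
  \<comment> \<open>With the other entries fixed, the condition prescribes entry \<open>j\<close>
    modulo \<open>mul 1 M\<close>.\<close>
  have iA: "grp_index ?G ?A = q ^ m"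
  proof -
    let ?h = "\<lambda>v i. if i = j then v else 0 :: 'w"
    have sh: "s (?h v) = 0" for v unfolding s_def by (rule sum.neutral) auto
    have h1: "\<forall>v\<in>M. ?h v \<in> ?G" using j O(1) by (auto simp: tup_def)
    have h2: "\<forall>v\<in>M. \<forall>w\<in>M. ?h v - ?h w \<in> ?A \<longleftrightarrow> v - w \<in> mul 1 M"
    proof (intro ballI)
      fix v w assume vw: "v \<in> M" "w \<in> M"
      have "?h v - ?h w = ?h (v - w)" by auto
      then show "?h v - ?h w \<in> ?A \<longleftrightarrow> v - w \<in> mul 1 M"
        unfolding A using O(5)[OF vw] h1 sh[of "v - w"] by simp
    qed
    have h3: "\<forall>z\<in>?G. \<exists>v\<in>M. z - ?h v \<in> ?A"
    proof
      fix z assume z: "z \<in> ?G"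
      have v: "z j - s z \<in> M" using O(5)[OF tupD(1)[OF z j] sM[OF z]] .
      have "z - ?h (z j - s z) \<in> ?A"
        unfolding A using subgrpD(2)[OF sgG z] h1 v sh om(1)[of 1] by (simp add: sd[symmetric])
      then show "\<exists>v\<in>M. z - ?h v \<in> ?A" using v by blast
    qed
    show ?thesis using avg_iso(2)[OF UM(4) sgG sgA AG h1 h2 h3] UM(5) by simp
  qed
  have per: "periodic ?G ?K ?f"
  proof (rule periodicI)
    fix x y assume xy: "x \<in> ?G" "y \<in> ?G" "x - y \<in> ?K"
    have "(gram n (\<lambda>_ _. N) T x \<and> indep M j x) = (gram n (\<lambda>_ _. N) T y \<and> indep M j y)"
      using periodic_gram_indep[OF U, of n "\<lambda>_ _. N" N j T] N1 j xy unfolding periodic_def by simp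
    moreover have "x \<in> ?A \<longleftrightarrow> y \<in> ?A"
      using subgrp_diff_cong(1)[OF sgA, of x y 0] KA xy(3) by auto
    ultimately show "?f x = ?f y" by simp
  qed
  have "avg ?G ?K ?f = avg ?A ?K ?f / real (grp_index ?G ?A)"
    by (rule avg_tower(4)[OF mid per]) simp
  also have "avg ?A ?K ?f = dens M n (lower j N) (congr n (step j c) T) j N"
  proof -
    define H where "H = (\<lambda>\<phi> i. if i = j then scale \<pi> (\<phi> j) + s \<phi> else \<phi> i)"
    \<comment> \<open>The subgroup corresponding to level \<open>N\<close> under \<open>H\<close>:
      because of the factor \<open>\<pi>\<close>, entry \<open>j\<close> matters only modulo
      \<open>mul (N - 1) M\<close>.\<close>
    let ?L = "{\<phi> \<in> ?G. (\<forall>i<n. i \<noteq> j \<longrightarrow> \<phi> i \<in> mul N M) \<and> \<phi> j \<in> mul (N - 1) M}"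
    have m1: "mul N M = mul 1 (mul (N - 1) M)" unfolding mul_mul using N1 by simp
    have pij: "scale \<pi> v \<in> mul N M \<longleftrightarrow> v \<in> mul (N - 1) M" for v
      using scale_pi_mem_iff[of 1 v "mul (N - 1) M"] unfolding m1 by simp
    have sgL: "subgrp ?L"
      unfolding subgrp_def using subgrpD(1,2)[OF sgG] om(1) om(5) by auto
    have KL: "?K \<subseteq> ?L" using KG j mul_anti[OF UM(1), of "N - 1" N] by (auto simp: tup_def)
    have LG: "?L \<subseteq> ?G" by auto
    note midL = fin_quot_mid[OF fin_quot_tup[OF UM(4)] sgL KL LG]
    have sH: "s (H \<phi>) = s \<phi>" for \<phi> unfolding s_def H_def by (rule sum.cong) auto
    have HA: "H \<phi> \<in> ?A" if \<phi>: "\<phi> \<in> ?G" for \<phi>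
    proof -
      have "H \<phi> \<in> ?G" using \<phi> j O(2)[OF O(3)[OF pi_in(2) tupD(1)[OF \<phi> j]] sM[OF \<phi>]] by (auto simp: tup_def H_def)
      moreover have "H \<phi> j - s (H \<phi>) = scale \<pi> (\<phi> j)" unfolding sH by (simp add: H_def)
      moreover have "scale \<pi> (\<phi> j) \<in> mul 1 M" using scale_pi_mem_iff[of 1 "\<phi> j" M] tupD(1)[OF \<phi> j] by simp
      ultimately show ?thesis unfolding A by simp
    qed
    have HK: "H x - H y \<in> ?K \<longleftrightarrow> x - y \<in> ?L" if xy: "x \<in> ?G" "y \<in> ?G" for x y
    proof -
      define \<delta> where "\<delta> = x - y"
      have \<delta>: "\<delta> \<in> ?G" unfolding \<delta>_def by (rule subgrpD(2)[OF sgG xy])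
      have e: "H x - H y = H \<delta>"
        unfolding \<delta>_def H_def by (auto simp: fun_eq_iff sd[symmetric] scale_right_diff_distrib)
      have "H \<delta> \<in> ?K \<longleftrightarrow> (\<forall>i<n. i \<noteq> j \<longrightarrow> \<delta> i \<in> mul N M) \<and> scale \<pi> (\<delta> j) + s \<delta> \<in> mul N M"
        using j tupD(2)[OF \<delta>] by (auto simp: tup_def H_def)
      also have "\<dots> \<longleftrightarrow> (\<forall>i<n. i \<noteq> j \<longrightarrow> \<delta> i \<in> mul N M) \<and> \<delta> j \<in> mul (N - 1) M"
      proof (rule conj_cong[OF refl])
        assume a: "\<forall>i<n. i \<noteq> j \<longrightarrow> \<delta> i \<in> mul N M"
        have "s \<delta> \<in> mul N M" by (rule sK) (use a j in auto)
        then have "scale \<pi> (\<delta> j) + s \<delta> \<in> mul N M \<longleftrightarrow> scale \<pi> (\<delta> j) \<in> mul N M"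
          using om(2)[of "scale \<pi> (\<delta> j)" N "s \<delta>"] om(5)[of "scale \<pi> (\<delta> j) + s \<delta>" N "s \<delta>"] by auto
        then show "scale \<pi> (\<delta> j) + s \<delta> \<in> mul N M \<longleftrightarrow> \<delta> j \<in> mul (N - 1) M" unfolding pij .
      qed
      also have "\<dots> \<longleftrightarrow> \<delta> \<in> ?L" using \<delta> by simp
      finally show ?thesis unfolding e \<delta>_def .
    qed
    have Hs: "\<exists>x\<in>?G. z - H x \<in> ?K" if z: "z \<in> ?A" for z
    proof -
      have zG: "z \<in> ?G" and "z j - s z \<in> mul 1 M" using z unfolding A by auto
      then obtain v where v: "v \<in> M" "z j - s z = scale \<pi> v" unfolding mul_def by auto
      let ?x = "\<lambda>i. if i = j then v else z i"
      have sx: "s ?x = s z" unfolding s_def by (rule sum.cong) auto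
      have "?x \<in> ?G" using zG v j by (auto simp: tup_def)
      moreover have "z - H ?x = 0" using v(2) by (auto simp: fun_eq_iff H_def sx algebra_simps)
      ultimately show ?thesis using subgrpD(1)[OF sgK] by (intro bexI[of _ ?x]) auto
    qed
    have fH: "?f (H \<phi>) = of_bool (gram n (lower j N) (congr n (step j c) T) \<phi> \<and> indep M j \<phi>)" if \<phi>: "\<phi> \<in> ?G" for \<phi>
    proof -
      have "gram n (\<lambda>_ _. N) T (H \<phi>) \<longleftrightarrow> gram n (lower j N) (congr n (step j c) T) \<phi>"
        by (rule gram_step[OF j _ N c]) (use sym in \<open>auto simp: H_def s_def\<close>)
      moreover have "indep M j (H \<phi>) \<longleftrightarrow> indep M j \<phi>"
        by (rule indep_cong[OF UM(1)]) (use om(1) in \<open>auto simp: H_def\<close>)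
      ultimately show ?thesis using HA[OF \<phi>] by simp
    qed
    have pA: "periodic ?A ?K ?f" using per AG unfolding periodic_def by blast
    have pL: "periodic ?G ?L (\<lambda>\<phi>. ?f (H \<phi>))"
    proof (rule periodicI)
      fix x y assume xy: "x \<in> ?G" "y \<in> ?G" "x - y \<in> ?L"
      then have "H x - H y \<in> ?K" using HK by blast
      then show "?f (H x) = ?f (H y)" using pA HA[OF xy(1)] HA[OF xy(2)] unfolding periodic_def by blast
    qed
    have "avg ?A ?K ?f = avg ?G ?L (\<lambda>\<phi>. ?f (H \<phi>))"
      by (rule avg_iso(3)[OF midL(1) sgA sgK KA _ _ _ pA]) (use HA HK Hs in blast)+
    also have "\<dots> = avg ?G ?K (\<lambda>\<phi>. ?f (H \<phi>))" by (rule avg_tower(3)[OF midL pL, symmetric])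
    also have "\<dots> = dens M n (lower j N) (congr n (step j c) T) j N"
      unfolding dens_def by (rule avg_cong[OF fin_quot_tup[OF UM(4)] fH])
    finally show ?thesis .
  qed
  finally show ?thesis using iA by simp
qed

text \<open>Either vector \<open>j\<close> is independent of its predecessors modulo
  \<open>\<pi>\<close>, or the tuple extends to exactly one of the enlarged lattices described by
  \<open>step j c\<close>.\<close>

lemma dens_step:
  assumes U: "unimodular m M" and j: "j < n" and sym: "\<And>c d. c < n \<Longrightarrow> d < n \<Longrightarrow> T c d = T d c"
    and N: "2 \<le> N"
  shows "dens M n (\<lambda>_ _. N) T j N = dens M n (\<lambda>_ _. N) T (Suc j) N +
    (\<Sum>c\<in>coeffs j. dens M n (lower j N) (congr n (step j c) T) j N / q ^ m)"
proof -
  note UM = unimodularD[OF U]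
  let ?g = "gram n (\<lambda>_ _. N) T"
  have "dens M n (\<lambda>_ _. N) T j N = avg (tup n M) (tup n (mul N M))
      (\<lambda>\<phi>. of_bool (?g \<phi> \<and> indep M (Suc j) \<phi>) + (\<Sum>c\<in>coeffs j. of_bool ((?g \<phi> \<and> indep M j \<phi>) \<and> \<phi> \<in> dep_set M n j c)))"
    unfolding dens_def
  proof (rule avg_cong[OF fin_quot_tup[OF UM(4)]])
    fix \<phi> assume \<phi>: "\<phi> \<in> tup n M"
    show "of_bool (?g \<phi> \<and> indep M j \<phi>) = of_bool (?g \<phi> \<and> indep M (Suc j) \<phi>) +
        (\<Sum>c\<in>coeffs j. of_bool ((?g \<phi> \<and> indep M j \<phi>) \<and> \<phi> \<in> dep_set M n j c) :: real)"
      using indep_step[OF U j \<phi>] indep_Suc_imp[of M j \<phi>]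
      by (cases "?g \<phi>"; cases "indep M j \<phi>") auto
  qed
  also have "\<dots> = dens M n (\<lambda>_ _. N) T (Suc j) N +
    (\<Sum>c\<in>coeffs j. avg (tup n M) (tup n (mul N M)) (\<lambda>\<phi>. of_bool ((?g \<phi> \<and> indep M j \<phi>) \<and> \<phi> \<in> dep_set M n j c)))"
    unfolding avg_add avg_sum dens_def ..
  also have "(\<Sum>c\<in>coeffs j. avg (tup n M) (tup n (mul N M)) (\<lambda>\<phi>. of_bool ((?g \<phi> \<and> indep M j \<phi>) \<and> \<phi> \<in> dep_set M n j c))) =
      (\<Sum>c\<in>coeffs j. dens M n (lower j N) (congr n (step j c) T) j N / q ^ m)"
    by (rule sum.cong[OF refl], rule dens_step_aux[OF U j sym N]) (use coeffs_pp in auto)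
  finally show ?thesis .
qed


section \<open>Determinants\<close>

text \<open>Gram matrices are plain functions, for which tails, congruences and extensions are easy
  to write; they become library matrices only to form determinants.\<close>

definition detm :: "nat \<Rightarrow> (nat \<Rightarrow> nat \<Rightarrow> 'a) \<Rightarrow> 'a" where
  "detm n T = Determinant.det (Matrix.mat n n (\<lambda>(i, l). T i l))"

lemma detm_cong: "(\<And>i l. i < n \<Longrightarrow> l < n \<Longrightarrow> T i l = S i l) \<Longrightarrow> detm n T = detm n S"
  unfolding detm_def by (intro arg_cong[of _ _ Determinant.det]) (auto intro!: eq_matI)

lemma detm_0: "detm 0 T = 1" unfolding detm_def by (rule det_dim_zero) simp

lemma detm_leibniz:
  "detm n T = (\<Sum>p | p permutes {0..<n}. signof p * (\<Prod>i = 0..<n. T i (p i)))"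
proof -
  have p: "p i < n" if "p permutes {0..<n}" "i < n" for p i
    using permutes_in_image[OF that(1), of i] that(2) by simp
  show ?thesis unfolding detm_def
    by (subst det_def'[of _ n]) (auto intro!: sum.cong prod.cong simp: p)
qed

lemma detm_in_pp0:
  assumes "\<And>i l. i < n \<Longrightarrow> l < n \<Longrightarrow> T i l \<in> pp 0" shows "detm n T \<in> pp 0"
proof -
  have p: "p i < n" if "p permutes {0..<n}" "i < n" for p i
    using permutes_in_image[OF that(1), of i] that(2) by simp
  show ?thesis unfolding detm_leibniz
    by (intro pp_sum pp_mult_left pp_prod) (use assms p in \<open>auto simp: sign_def\<close>)
qed

lemma detm_in_pp1:
  assumes "\<And>i l. i < Suc n \<Longrightarrow> l < Suc n \<Longrightarrow> T i l \<in> pp 0" "\<And>l. l < Suc n \<Longrightarrow> T 0 l \<in> pp 1"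
  shows "detm (Suc n) T \<in> pp 1"
  unfolding detm_leibniz
proof (intro pp_sum pp_mult_left)
  fix p assume "p \<in> {p. p permutes {0..<Suc n}}"
  then have p: "p i < Suc n" if "i < Suc n" for i using permutes_in_image[of p "{0..<Suc n}" i] that by simp
  have "(\<Prod>i = 0..<Suc n. T i (p i)) = T 0 (p 0) * (\<Prod>i = Suc 0..<Suc n. T i (p i))"
    by (rule prod.atLeast_Suc_lessThan) simp
  also have "\<dots> \<in> pp 1"
  proof (rule pp_mult_right)
    show "T 0 (p 0) \<in> pp 1" using assms(2) p by simp
    show "(\<Prod>i = Suc 0..<Suc n. T i (p i)) \<in> pp 0" by (rule pp_prod) (use assms(1) p in simp)
  qed
  finally show "(\<Prod>i = 0..<Suc n. T i (p i)) \<in> pp 1" .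
qed (auto simp: sign_def)

lemma detm_congr: "detm n (congr n A T) = detm n A * detm n A * detm n T"
proof -
  let ?A = "Matrix.mat n n (\<lambda>(i, l). A i l)" and ?T = "Matrix.mat n n (\<lambda>(i, l). T i l)"
  have "Matrix.mat n n (\<lambda>(i, l). congr n A T i l) = transpose_mat ?A * (?T * ?A)"
    by (rule eq_matI) (auto simp: congr_def scalar_prod_def atLeast0LessThan sum_distrib_left mult.assoc)
  moreover have c: "?A \<in> carrier_mat n n" "?T \<in> carrier_mat n n" by auto
  ultimately show ?thesis unfolding detm_def
    using det_mult[OF transpose_carrier_mat[THEN iffD2, OF c(1)] mult_carrier_mat[OF c(2,1)]] det_mult[OF c(2,1)] det_transpose[OF c(1)]
    by (simp add: mult_ac)
qed

lemma detm_upper: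
  assumes "\<And>i l. l < i \<Longrightarrow> i < n \<Longrightarrow> A i l = 0" shows "detm n A = (\<Prod>i<n. A i i)"
proof -
  have "detm n A = prod_list (diag_mat (Matrix.mat n n (\<lambda>(i, l). A i l)))"
    unfolding detm_def by (rule det_upper_triangular[of _ n]) (use assms in \<open>auto intro!: upper_triangularI\<close>)
  also have "\<dots> = (\<Prod>i<n. A i i)"
    by (simp add: diag_mat_def prod.list_conv_set_nth atLeast0LessThan)
  finally show ?thesis .
qed

lemma detm_lower:
  assumes "\<And>i l. i < l \<Longrightarrow> l < n \<Longrightarrow> A i l = 0" shows "detm n A = (\<Prod>i<n. A i i)"
proof -
  have "detm n A = prod_list (diag_mat (Matrix.mat n n (\<lambda>(i, l). A i l)))"
    unfolding detm_def by (rule det_lower_triangular[of n]) (use assms in auto)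
  also have "\<dots> = (\<Prod>i<n. A i i)"
    by (simp add: diag_mat_def prod.list_conv_set_nth atLeast0LessThan)
  finally show ?thesis .
qed

lemma detm_block:
  assumes "\<And>l. l < n \<Longrightarrow> T 0 (Suc l) = 0"
  shows "detm (Suc n) T = T 0 0 * detm n (\<lambda>i l. T (Suc i) (Suc l))"
proof -
  let ?T = "Matrix.mat (Suc n) (Suc n) (\<lambda>(i, l). T i l)"
  have "detm (Suc n) T = (\<Sum>l<Suc n. ?T $$ (0, l) * cofactor ?T 0 l)"
    unfolding detm_def by (rule laplace_expansion_row) auto
  also have "\<dots> = T 0 0 * cofactor ?T 0 0"
    using assms by (simp add: sum.lessThan_Suc_shift del: sum.lessThan_Suc)
  also have "cofactor ?T 0 0 = detm n (\<lambda>i l. T (Suc i) (Suc l))"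
    unfolding cofactor_def detm_def
    by (simp, intro arg_cong[of _ _ Determinant.det] eq_matI) (auto simp: mat_delete_def)
  finally show ?thesis .
qed

text \<open>One step of symmetric elimination: congruence by the unipotent matrix \<open>E\<close>
  clears the first row and leaves the Schur complement.\<close>

lemma detm_schur:
  assumes T0: "T 0 0 \<noteq> 0" and sym: "\<And>c d. c < Suc n \<Longrightarrow> d < Suc n \<Longrightarrow> T c d = T d c"
  shows "detm (Suc n) T = T 0 0 * detm n (schur T)"
proof -
  define E where "E = (\<lambda>i l. if i = l then 1 else if i = 0 then - (T 0 l / T 0 0) else 0 :: 'a)"
  have E: "(\<Sum>i<Suc n. f i * E i l) = (if l = 0 then f 0 else f l - f 0 * (T 0 l / T 0 0))" if "l < Suc n" for f l
  proof -
    have "(\<Sum>i<Suc n. f i * E i l) = f 0 * E 0 l + (\<Sum>i<n. f (Suc i) * E (Suc i) l)"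
      by (simp add: sum.lessThan_Suc_shift del: sum.lessThan_Suc)
    also have "(\<Sum>i<n. f (Suc i) * E (Suc i) l) = (\<Sum>i<n. if Suc i = l then f (Suc i) else 0)"
      by (rule sum.cong) (auto simp: E_def)
    also have "\<dots> = (if l = 0 then 0 else f l)"
    proof (cases l)
      case (Suc l')
      then show ?thesis using that by (simp add: sum.delta)
    qed simp
    finally show ?thesis by (auto simp: E_def)
  qed
  have C: "congr (Suc n) E T a d = (\<Sum>i<Suc n. (\<Sum>l<Suc n. T i l * E l d) * E i a)" for a d
    unfolding congr_def by (intro sum.cong refl) (simp add: sum_distrib_left mult_ac del: sum.lessThan_Suc)
  have C': "congr (Suc n) E T a d = (let g = (\<lambda>i. if d = 0 then T i 0 else T i d - T i 0 * (T 0 d / T 0 0)) in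
      if a = 0 then g 0 else g a - g 0 * (T 0 a / T 0 0))" if "a < Suc n" "d < Suc n" for a d
    unfolding C Let_def by (simp only: E[OF that(1)] E[OF that(2)])
  have "detm (Suc n) E = 1"
    by (subst detm_upper) (auto simp: E_def)
  then have "detm (Suc n) T = detm (Suc n) (congr (Suc n) E T)" by (simp add: detm_congr)
  also have "\<dots> = congr (Suc n) E T 0 0 * detm n (\<lambda>i l. congr (Suc n) E T (Suc i) (Suc l))"
    by (rule detm_block) (use T0 in \<open>simp add: C'\<close>)
  also have "detm n (\<lambda>i l. congr (Suc n) E T (Suc i) (Suc l)) = detm n (schur T)"
    by (rule detm_cong) (use T0 sym in \<open>simp add: C' schur_def\<close>)
  finally show ?thesis by (simp add: C')
qed

lemma detm_step: assumes "j < n" shows "detm n (step j c) = inverse \<pi>"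
proof -
  have "detm n (step j c) = (\<Prod>i<n. if i = j then inverse \<pi> else 1)"
  proof -
    have "detm n (step j c) = (\<Prod>i<n. step j c i i)" by (rule detm_upper) (auto simp: step_def)
    also have "\<dots> = (\<Prod>i<n. if i = j then inverse \<pi> else 1)" by (rule prod.cong) (auto simp: step_def)
    finally show ?thesis .
  qed
  then show ?thesis using assms by (simp add: prod.delta)
qed

definition disc :: "nat \<Rightarrow> (nat \<Rightarrow> nat \<Rightarrow> 'a) \<Rightarrow> 'a" where
  "disc n T = (- 1) ^ (n * (n - 1) div 2) * detm n T"

text \<open>The two triangular numbers in the exponents differ by \<open>n\<close>. The resulting
  sign is the one that \<open>signed_extend\<close> attaches to the norm of a split-off
  vector.\<close>

lemma disc_Suc: "detm (Suc n) T = u * detm n S \<Longrightarrow> disc (Suc n) T = ((- 1) ^ n * u) * disc n S"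
proof -
  have "Suc n * n div 2 = n * (n - 1) div 2 + n"
    by (cases n) (auto simp: algebra_simps)
  then show "detm (Suc n) T = u * detm n S \<Longrightarrow> disc (Suc n) T = ((- 1) ^ n * u) * disc n S"
    by (simp add: disc_def power_add)
qed

lemma unit_disc_iff: "unit (disc n T) \<longleftrightarrow> unit (detm n T)"
proof -
  have "unit ((- 1) ^ (n * (n - 1) div 2))" using unit_1 unitD(5)[OF unit_1] by (cases "even (n * (n - 1) div 2)") auto
  then show ?thesis unfolding disc_def by (rule unit_mult_iff)
qed

section \<open>Primitive densities as polynomials\<close>

text \<open>Ranks are integers from here on: the reductions lower the base rank \<open>r\<close> by
  1 or 2 at a time, possibly below 0, and only the ranks \<open>r + 2 * k\<close> belong to actual
  lattices.\<close>

definition rt :: "int \<Rightarrow> real" where "rt r = real q powr (- (real_of_int r / 2))"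

definition lin :: "int \<Rightarrow> real \<Rightarrow> real poly" where "lin r e = [:1, - (e * rt r):]"

definition quad :: "nat \<Rightarrow> real poly" where "quad i = [:1, 0, - (1 / real q ^ (2 * i)):]"

text \<open>\<open>Fpol\<close> is the numerator of \<open>Nor_flat\<close>, before the exact
  division, and \<open>Npol\<close> below is \<open>Nor\<close>, both indexed by the rank of the
  target at \<open>X = 1\<close>. For \<open>r \<ge> 1\<close> they differ by the factor
  \<open>1 - X^2\<close>.\<close>

definition Fpol :: "int \<Rightarrow> real \<Rightarrow> real poly" where
  "Fpol r e = (if 0 \<le> r \<and> even r then lin r e else 1) * (\<Prod>i | 2 * int i < r. quad i)"

definition Npol :: "int \<Rightarrow> real \<Rightarrow> real poly" where
  "Npol r e = (if 0 \<le> r \<and> even r then lin r e else 1) * (\<Prod>i | 1 \<le> i \<and> 2 * int i < r. quad i)"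

lemma finite_Fpol: "finite {i. 2 * int i < r}"
  by (rule finite_subset[of _ "{..nat r}"]) auto

lemma Fpol_Npol: assumes "r \<ge> 1" shows "Fpol r e = quad 0 * Npol r e"
proof -
  have "{i. 2 * int i < r} = insert 0 {i. 1 \<le> i \<and> 2 * int i < r}" using assms by (auto simp: One_nat_def)
  moreover have "finite {i. 1 \<le> i \<and> 2 * int i < r}" by (rule finite_subset[OF _ finite_Fpol[of r]]) auto
  ultimately show ?thesis unfolding Fpol_def Npol_def by (simp add: mult_ac)
qed

lemma lin_nonzero: "lin r e \<noteq> 0" by (simp add: lin_def)
lemma quad_nonzero: "quad i \<noteq> 0" by (simp add: quad_def)

lemma rt_even: "rt (2 * int i) = 1 / q ^ i"
  using q_pos by (simp add: rt_def powr_minus powr_realpow divide_simps)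

lemma lin_mult: "e * e = 1 \<Longrightarrow> lin (2 * int i) e * lin (2 * int i) (- e) = quad i"
proof -
  assume e: "e * e = 1"
  have "(e / q ^ i) * (e / q ^ i) = 1 / q ^ (2 * i)" using e by (simp add: power_mult power2_eq_square mult_2 power_add)
  then show ?thesis unfolding lin_def rt_even quad_def by (simp add: mult_ac)
qed

lemma Fpol_odd: assumes "odd r" "r \<ge> 1" shows "Fpol r e = quad (nat ((r - 1) div 2)) * (\<Prod>i | 2 * int i < r - 1. quad i)"
proof -
  let ?i = "nat ((r - 1) div 2)"
  have "{i. 2 * int i < r} = insert ?i {i. 2 * int i < r - 1}" using assms by (auto elim!: oddE)
  moreover have "?i \<notin> {i. 2 * int i < r - 1}" using assms by (auto elim!: oddE)
  ultimately show ?thesis unfolding Fpol_def using assms finite_Fpol[of "r - 1"] by simp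
qed

lemma Fpol_even: assumes "even r" "r \<ge> 0" shows "Fpol r e = lin r e * (\<Prod>i | 2 * int i < r. quad i)"
  unfolding Fpol_def using assms by simp

text \<open>The factor contributed by a unimodular line, with \<open>e'\<close> the sign of its
  complement; \<open>apol_eval\<close> gives the meaning.\<close>

definition apol :: "int \<Rightarrow> real \<Rightarrow> real \<Rightarrow> real poly" where
  "apol r e e' = (if even r then lin r e else lin (r - 1) (- e'))"

text \<open>The factor contributed by a hyperbolic plane: \<open>q\<close> times the density of
  nonzero isotropic vectors over the residue field, see \<open>bpol_eval\<close>.\<close>

definition bpol :: "int \<Rightarrow> real \<Rightarrow> real poly" where
  "bpol r e = (if even r then lin r e * lin (r - 2) (- e) else lin (r - 1) 1 * lin (r - 1) (- 1))"

lemma Fpol_neg: "r < 0 \<Longrightarrow> Fpol r e = 1"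
proof -
  assume "r < 0"
  then have "{i. 2 * int i < r} = {}" by auto
  then show ?thesis using \<open>r < 0\<close> unfolding Fpol_def by simp
qed

text \<open>In even rank \<open>apol\<close> is the new linear factor. In odd rank it is conjugate
  to the linear factor of \<open>Fpol (r - 1) e'\<close>, and the two multiply to the new quadratic
  factor.\<close>

lemma apol_Fpol:
  assumes "e' * e' = 1" "r \<ge> 0" shows "apol r e e' * Fpol (r - 1) e' = Fpol r e"
proof (cases "even r")
  case True
  have "{i. 2 * int i < r - 1} = {i. 2 * int i < r}" using True by auto
  then show ?thesis using True assms(2) unfolding apol_def Fpol_def by simp
next
  case False
  define i where "i = nat ((r - 1) div 2)"
  have "r \<ge> 1" using False assms(2) by presburger
  then have i: "r - 1 = 2 * int i" using False unfolding i_def by (auto elim!: oddE)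
  have r: "r = 2 * int i + 1" using i by simp
  have f: "Fpol (r - 1) e' = lin (2 * int i) e' * (\<Prod>i | 2 * int i < r - 1. quad i)"
    by (subst Fpol_even) (use i in auto)
  have "apol r e e' * Fpol (r - 1) e' = (lin (2 * int i) e' * lin (2 * int i) (- e')) * (\<Prod>i | 2 * int i < r - 1. quad i)"
    unfolding f using False i by (simp add: apol_def mult_ac)
  also have "\<dots> = Fpol r e" unfolding lin_mult[OF assms(1)] by (subst Fpol_odd) (use False r in auto)
  finally show ?thesis .
qed

lemma bpol_Fpol:
  assumes "e * e = 1" "r \<ge> 1" shows "bpol r e * Fpol (r - 2) e = Fpol r e"
proof (cases "even r")
  case True
  define i where "i = nat ((r - 2) div 2)"
  have i: "r - 2 = 2 * int i" using True assms(2) unfolding i_def by (auto elim!: evenE)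
  have s: "{i. 2 * int i < r} = insert i {i. 2 * int i < r - 2}" "i \<notin> {i. 2 * int i < r - 2}" using i by auto
  have "bpol r e * Fpol (r - 2) e = lin r e * (lin (2 * int i) e * lin (2 * int i) (- e)) * (\<Prod>i | 2 * int i < r - 2. quad i)"
    unfolding bpol_def using True i by (simp add: Fpol_even mult_ac)
  also have "\<dots> = Fpol r e"
    unfolding lin_mult[OF assms(1)] Fpol_def s(1) using True assms(2) s(2) finite_Fpol[of "r - 2"] by (simp add: mult_ac)
  finally show ?thesis .
next
  case False
  define i where "i = nat ((r - 1) div 2)"
  have i: "r - 1 = 2 * int i" using False assms(2) unfolding i_def by (auto elim!: oddE)
  have s: "{i. 2 * int i < r} = insert i {i. 2 * int i < r - 2}" "i \<notin> {i. 2 * int i < r - 2}" using i by auto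
  have "bpol r e * Fpol (r - 2) e = (lin (2 * int i) 1 * lin (2 * int i) (- 1)) * (\<Prod>i | 2 * int i < r - 2. quad i)"
    unfolding bpol_def Fpol_def using False i by simp
  also have "\<dots> = Fpol r e"
    unfolding lin_mult[of 1, simplified] Fpol_def s(1) using False s(2) finite_Fpol[of "r - 2"] by simp
  finally show ?thesis .
qed

text \<open>For \<open>r \<le> 0\<close> the product formula breaks down, but divisibility by
  \<open>Fpol r e\<close> persists; this is what the induction in \<open>prim_poly_low\<close>
  uses.\<close>

lemma bpol_Fpol_ex: assumes "e * e = 1" shows "\<exists>P. bpol r e * Fpol (r - 2) e = Fpol r e * P"
proof -
  consider "r \<ge> 1" | "r = 0" | "r < 0" by linarith
  then show ?thesis
  proof cases
    case 1
    then show ?thesis using bpol_Fpol[OF assms] by (intro exI[of _ 1]) simp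
  next
    case 2
    have "Fpol (0 - 2) e = 1" by (rule Fpol_neg) simp
    moreover have "Fpol 0 e = lin 0 e" unfolding Fpol_def by simp
    ultimately show ?thesis using 2 by (intro exI[of _ "lin (- 2) (- e)"]) (simp add: bpol_def)
  next
    case 3
    then show ?thesis by (intro exI[of _ "bpol r e"]) (simp add: Fpol_neg)
  qed
qed

lemma apol_Fpol_ex: assumes "e' * e' = 1" shows "\<exists>P. apol r e e' * Fpol (r - 1) e' = Fpol r e * P"
proof (cases "r \<ge> 0")
  case True
  then show ?thesis using apol_Fpol[OF assms] by (intro exI[of _ 1]) simp
next
  case False
  then show ?thesis by (intro exI[of _ "apol r e e'"]) (simp add: Fpol_neg)
qed

lemma apol_Npol:
  assumes "e' * e' = 1" "r \<ge> 2" shows "apol r e e' * Npol (r - 1) e' = Npol r e"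
proof -
  have "quad 0 * (apol r e e' * Npol (r - 1) e') = apol r e e' * Fpol (r - 1) e'"
    using Fpol_Npol[of "r - 1" e'] assms(2) by (simp add: mult_ac)
  also have "\<dots> = quad 0 * Npol r e" using apol_Fpol[OF assms(1), of r e] Fpol_Npol[of r e] assms(2) by simp
  finally show ?thesis using quad_nonzero by simp
qed

lemma poly_lin: "poly (lin r e) x = 1 - e * rt r * x" by (simp add: lin_def)

text \<open>Evaluation at \<open>X = q^{-k}\<close> amounts to raising the rank by
  \<open>2 * k\<close>. This is why one polynomial can serve all ranks of the same parity.\<close>

lemma rt_eval:
  assumes "int m = r + 2 * int k" "even r" shows "rt r * (1 / q ^ k) = 1 / q ^ (m div 2)"
proof -
  obtain c where c: "r = 2 * c" using assms(2) by (rule evenE)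
  then have "int (m div 2) = c + int k" using assms(1) by presburger
  then have "real_of_int c = real_of_int (int (m div 2)) - real_of_int (int k)" by linarith
  then have e: "r / 2 = real (m div 2) - real k" using c by simp
  have "rt r = real q powr (real k - real (m div 2))" unfolding rt_def e by (simp only: minus_diff_eq)
  also have "\<dots> = q ^ k / q ^ (m div 2)" using q_pos by (simp add: powr_diff powr_realpow)
  finally show ?thesis using q_pos by simp
qed

lemma rt_minus_2: "rt (r - 2) = q * rt r"
proof -
  have "rt (r - 2) = real q powr (1 + - (r / 2))" unfolding rt_def by (simp add: diff_divide_distrib)
  then show ?thesis using q_pos by (simp only: powr_add rt_def) simp
qed

lemma apol_eval:
  assumes "int m = r + 2 * int k" "unit u" "m \<ge> 1 \<or> even m" "e' = e * eta (if even m then - u else u)"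
  shows "q * qform m e u = poly (apol r e e') (1 / q ^ k)"
proof (cases "even r")
  case True
  then have m: "even m" using assms(1) by presburger
  have "poly (apol r e e') (1 / q ^ k) = 1 - e * (rt r * (1 / q ^ k))" using True by (simp add: apol_def poly_lin)
  then show ?thesis unfolding rt_eval[OF assms(1) True] qform_def nu_def
    using m assms(2) q_pos by (simp add: unit_def power_add right_diff_distrib)
next
  case False
  then have m: "odd m" using assms(1) by presburger
  then obtain h where h: "m = 2 * h + 1" by (rule oddE)
  have "int (m - 1) = (r - 1) + 2 * int k" using h assms(1) by simp
  then have e: "rt (r - 1) * (1 / q ^ k) = 1 / q ^ h" using rt_eval[of "m - 1" "r - 1" k] False h by simp
  have "poly (apol r e e') (1 / q ^ k) = 1 + e' * (rt (r - 1) * (1 / q ^ k))" using False by (simp add: apol_def poly_lin)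
  then show ?thesis unfolding e qform_def using m h assms(4) q_pos by (simp add: power_add distrib_left)
qed

lemma bpol_eval:
  assumes "int m = r + 2 * int k" "e * e = 1"
  shows "q * (qform m e 0 - 1 / q ^ m) = poly (bpol r e) (1 / q ^ k)"
proof (cases "even r")
  case True
  then have m: "even m" using assms(1) by presburger
  then obtain h where h: "m = 2 * h" by (rule evenE)
  have e: "rt r * (1 / q ^ k) = 1 / q ^ h" using rt_eval[OF assms(1) True] h by simp
  have "poly (bpol r e) (1 / q ^ k) = (1 - e * (rt r * (1 / q ^ k))) * (1 + e * q * (rt r * (1 / q ^ k)))"
    using True by (simp add: bpol_def poly_lin rt_minus_2 mult_ac)
  also have "\<dots> = 1 + e * (q - 1) / q ^ h - (e * e) * q / q ^ m"
    unfolding e using q_pos by (simp add: h field_simps power_mult power2_eq_square mult_2 power_add)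
  finally have p: "poly (bpol r e) (1 / q ^ k) = 1 + e * (q - 1) / q ^ h - q / q ^ m" unfolding assms(2) by simp
  have "q * qform m e 0 = 1 + e * (q - 1) / q ^ h"
    using m h q_pos by (simp add: qform_def nu_def power_add distrib_left)
  then show ?thesis unfolding p right_diff_distrib by simp
next
  case False
  then have m: "odd m" using assms(1) by presburger
  then obtain h where h: "m = 2 * h + 1" by (rule oddE)
  have "int (m - 1) = (r - 1) + 2 * int k" using h assms(1) by simp
  then have e: "rt (r - 1) * (1 / q ^ k) = 1 / q ^ h" using rt_eval[of "m - 1" "r - 1" k] False h by simp
  have "poly (bpol r e) (1 / q ^ k) = (1 - rt (r - 1) * (1 / q ^ k)) * (1 + rt (r - 1) * (1 / q ^ k))"
    using False by (simp add: bpol_def poly_lin)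
  also have "\<dots> = 1 - q / q ^ m"
    unfolding e using q_pos by (simp add: h field_simps mult_2_right power_add)
  finally show ?thesis unfolding qform_def using m h q_pos by (simp add: eta_def right_diff_distrib)
qed

text \<open>By \<open>dens_primitive\<close> this is the normalized primitive density at every
  precision, although it depends only on \<open>T\<close> modulo \<open>\<pi>\<close>.\<close>

definition dprim :: "'w set \<Rightarrow> nat \<Rightarrow> (nat \<Rightarrow> nat \<Rightarrow> 'a) \<Rightarrow> real" where
  "dprim M n T = dens M n one T n 1 * q ^ prec n one"

definition symint :: "nat \<Rightarrow> (nat \<Rightarrow> nat \<Rightarrow> 'a) \<Rightarrow> bool" where
  "symint n T \<longleftrightarrow> (\<forall>c<n. \<forall>d<n. T c d = T d c \<and> T c d \<in> pp 0)"

lemma symintD: "symint n T \<Longrightarrow> c < n \<Longrightarrow> d < n \<Longrightarrow> T c d = T d c"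
  "symint n T \<Longrightarrow> c < n \<Longrightarrow> d < n \<Longrightarrow> T c d \<in> pp 0"
  unfolding symint_def by blast+

lemma prec_one_Suc: "prec (Suc n) one = prec n one + Suc n"
  by (simp add: prec_def)

lemma signedD: "signed m e M \<Longrightarrow> unimodular m M" "signed m e M \<Longrightarrow> e * e = 1"
  "signed m e M \<Longrightarrow> t \<in> pp 0 \<Longrightarrow> qd M t = qform m e t"
  unfolding signed_def by auto

lemma dprim_unit:
  assumes S: "signed m e M" and T: "symint (Suc n) T" and u: "unit (T 0 0)"
    and w: "\<And>M'. m \<ge> 1 \<Longrightarrow> signed (m - 1) (e * eta (if even m then - T 0 0 else T 0 0)) M' \<Longrightarrow> dprim M' n (schur T) = w"
  shows "dprim M (Suc n) T = q * qform m e (T 0 0) * w"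
proof -
  note U = signedD(1)[OF S]
  have "dens M (Suc n) one T (Suc n) 1 = qd M (T 0 0) * (w / q ^ prec n one) / q ^ n"
  proof (rule dens_unit[where T = T, OF U u])
    show "T 0 (Suc i) \<in> pp 0" if "i < n" for i using symintD(2)[OF T, of 0 "Suc i"] that by simp
    fix v assume v: "v \<in> M" "b v v - T 0 0 \<in> pp 1"
    have ub: "unit (b v v)" using unit_cong[OF v(2)] u by simp
    have "eta (b v v) = eta (T 0 0)" "eta (- b v v) = eta (- T 0 0)"
      using v(2) pp_uminus[OF v(2)] by (auto intro!: eta_cong)
    then have "signed (m - 1) (e * eta (if even m then - T 0 0 else T 0 0)) (uperp M v)"
      using signed_uperp[OF S v(1) ub] by (simp split: if_splits)
    then have "dprim (uperp M v) n (schur T) = w" by (rule w[OF unit_split(4)[OF U v(1) ub]])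
    then show "dens (uperp M v) n one (schur T) n 1 = w / q ^ prec n one"
      unfolding dprim_def using q_pos by (simp add: field_simps)
  qed
  then show ?thesis
    unfolding dprim_def prec_one_Suc signedD(3)[OF S unitD(2)[OF u]] using q_pos by (simp add: power_add)
qed

text \<open>Among the solutions modulo \<open>\<pi>\<close> only the zero class is imprimitive, and
  it has weight \<open>1 / q ^ m\<close>.\<close>

lemma avg_isotropic:
  assumes S: "signed m e M" and t: "t \<in> pp 1"
  shows "avg M (mul 1 M) (\<lambda>v. of_bool (b v v - t \<in> pp 1 \<and> v \<notin> mul 1 M)) = qform m e 0 - 1 / q ^ m"
proof -
  note U = unimodularD[OF signedD(1)[OF S]]
  have "avg M (mul 1 M) (\<lambda>v. of_bool (b v v - t \<in> pp 1 \<and> v \<notin> mul 1 M)) =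
      avg M (mul 1 M) (\<lambda>v. of_bool (b v v - 0 \<in> pp 1) - of_bool (v - 0 \<in> mul 1 M))"
  proof (rule avg_cong[OF U(4)])
    fix v assume v: "v \<in> M"
    have "b v v - t \<in> pp 1 \<longleftrightarrow> b v v \<in> pp 1" by (rule pp_cong_iff) (use t in simp)
    then show "of_bool (b v v - t \<in> pp 1 \<and> v \<notin> mul 1 M) = (of_bool (b v v - 0 \<in> pp 1) - of_bool (v - 0 \<in> mul 1 M) :: real)"
      using B_mul(1)[OF signedD(1)[OF S] _ v, of v 1] by auto
  qed
  also have "\<dots> = qd M 0 - 1 / q ^ m"
    unfolding avg_diff qd_def avg_single[OF U(4) omodD(1)[OF U(1)]] U(5) by simp
  finally show ?thesis using signedD(3)[OF S, of 0] by simp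
qed

lemma dprim_isotropic:
  assumes S: "signed m e M" and T: "symint (Suc n) T" and T0: "\<And>l. l < Suc n \<Longrightarrow> T 0 l \<in> pp 1"
    and w: "\<And>M'. m \<ge> 2 \<Longrightarrow> signed (m - 2) e M' \<Longrightarrow> dprim M' n (\<lambda>i l. T (Suc i) (Suc l)) = w"
  shows "dprim M (Suc n) T = q * (qform m e 0 - 1 / q ^ m) * w"
proof -
  note U = signedD(1)[OF S]
  have "dens M (Suc n) one T (Suc n) 1 = avg M (mul 1 M) (\<lambda>v. of_bool (b v v - T 0 0 \<in> pp 1 \<and> v \<notin> mul 1 M)) *
      (w / q ^ prec n one) / q ^ (n * 1)"
  proof (rule dens_isotropic[OF U])
    fix v w' \<alpha> assume v: "v \<in> M" "w' \<in> M" "b v v - T 0 0 \<in> pp 1" "b v w' = 1" and \<alpha>: "\<alpha> \<in> tup n (pp 0)"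
    have v1: "b v v \<in> pp 1" using pp_cong_iff[OF v(3)] T0[of 0] by simp
    have "signed (m - 2) e (perp M v w')" by (rule signed_perp[OF S v(1,2) v1 v(4)])
    then have "dprim (perp M v w') n (\<lambda>i l. T (Suc i) (Suc l)) = w" by (rule w[OF iso_split(4)[OF U v(1,2) v1 v(4)]])
    \<comment> \<open>At precision 1 the rank-one correction disappears, since \<open>b v v\<close>
      lies in \<open>pp 1\<close>.\<close>
    moreover have "dens (perp M v w') n one (\<lambda>i l. T (Suc i) (Suc l) + b v v * (1 - b v v * b w' w') * (\<alpha> i * \<alpha> l)) n 1 =
        dens (perp M v w') n one (\<lambda>i l. T (Suc i) (Suc l)) n 1"
    proof (rule dens_cong_entries)
      fix c d assume "c \<le> d" "d < n"
      then have "b v v * ((1 - b v v * b w' w') * (\<alpha> c * \<alpha> d)) \<in> pp 1"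
        using unimodularD(2)[OF U] v tupD(1)[OF \<alpha>] by (intro pp_mult_right[OF v1] pp_mult_left pp_diff) auto
      then show "T (Suc c) (Suc d) + b v v * (1 - b v v * b w' w') * (\<alpha> c * \<alpha> d) - T (Suc c) (Suc d) \<in> pp 1"
        by (simp add: mult.assoc)
    qed
    ultimately show "dens (perp M v w') n one (\<lambda>i l. T (Suc i) (Suc l) + b v v * (1 - b v v * b w' w') * (\<alpha> i * \<alpha> l)) n 1 = w / q ^ prec n one"
      unfolding dprim_def using q_pos by (simp add: field_simps)
  qed (use T0 in auto)
  then show ?thesis
    unfolding dprim_def prec_one_Suc avg_isotropic[OF S T0[of 0, simplified]] using q_pos by (simp add: power_add)
qed

text \<open>The condition ranges over all unimodular lattices of the given sign in the ambient
  space, because the complements met in the reductions depend on the chosen vectors.\<close>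

definition prim_poly :: "int \<Rightarrow> real \<Rightarrow> nat \<Rightarrow> (nat \<Rightarrow> nat \<Rightarrow> 'a) \<Rightarrow> real poly \<Rightarrow> bool" where
  "prim_poly r e n T P \<longleftrightarrow> (\<forall>k m M. int m = r + 2 * int k \<longrightarrow> signed m e M \<longrightarrow> dprim M n T = poly P (1 / q ^ k))"

lemma prim_poly_unit:
  assumes T: "symint (Suc n) T" and u: "unit (T 0 0)"
    and C: "prim_poly (r - 1) (e * eta (if even r then - T 0 0 else T 0 0)) n (schur T) P"
  shows "prim_poly r e (Suc n) T (apol r e (e * eta (if even r then - T 0 0 else T 0 0)) * P)"
  unfolding prim_poly_def
proof (intro allI impI)
  fix k m M assume m: "int m = r + 2 * int k" and S: "signed m e M"
  have ev: "even m \<longleftrightarrow> even r" using m by presburger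
  have "dprim M (Suc n) T = q * qform m e (T 0 0) * poly P (1 / q ^ k)"
  proof (rule dprim_unit[OF S T u])
    fix M' assume m1: "m \<ge> 1" and S': "signed (m - 1) (e * eta (if even m then - T 0 0 else T 0 0)) M'"
    have "int (m - 1) = (r - 1) + 2 * int k" using m m1 by simp
    then show "dprim M' n (schur T) = poly P (1 / q ^ k)" using C S' unfolding prim_poly_def ev by blast
  qed
  also have "q * qform m e (T 0 0) = poly (apol r e (e * eta (if even r then - T 0 0 else T 0 0))) (1 / q ^ k)"
    by (rule apol_eval[OF m u]) (use ev in \<open>auto intro: Suc_leI simp: One_nat_def odd_pos\<close>)
  finally show "dprim M (Suc n) T = poly (apol r e (e * eta (if even r then - T 0 0 else T 0 0)) * P) (1 / q ^ k)" by simp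
qed

lemma prim_poly_isotropic:
  assumes T: "symint (Suc n) T" and T0: "\<And>l. l < Suc n \<Longrightarrow> T 0 l \<in> pp 1"
    and C: "prim_poly (r - 2) e n (\<lambda>i l. T (Suc i) (Suc l)) P"
  shows "prim_poly r e (Suc n) T (bpol r e * P)"
  unfolding prim_poly_def
proof (intro allI impI)
  fix k m M assume m: "int m = r + 2 * int k" and S: "signed m e M"
  have "dprim M (Suc n) T = q * (qform m e 0 - 1 / q ^ m) * poly P (1 / q ^ k)"
  proof (rule dprim_isotropic[OF S T T0])
    fix M' assume m1: "m \<ge> 2" and S': "signed (m - 2) e M'"
    have "int (m - 2) = (r - 2) + 2 * int k" using m m1 by simp
    then show "dprim M' n (\<lambda>i l. T (Suc i) (Suc l)) = poly P (1 / q ^ k)" using C S' unfolding prim_poly_def by blast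
  qed
  also have "q * (qform m e 0 - 1 / q ^ m) = poly (bpol r e) (1 / q ^ k)"
    by (rule bpol_eval[OF m signedD(2)[OF S]])
  finally show "dprim M (Suc n) T = poly (bpol r e * P) (1 / q ^ k)" by simp
qed

lemma prim_poly_congr:
  assumes T: "symint n T" and A: "inverse_mats n A A'" "inverse_mats n A' A" and C: "prim_poly r e n (congr n A T) P"
  shows "prim_poly r e n T P"
proof -
  have "dprim M n (congr n A T) = dprim M n T" if "signed m e M" for m M
    unfolding dprim_def by (subst dens_congruence[OF signedD(1)[OF that] _ _ A]) (use symintD(1)[OF T] in auto)
  then show ?thesis using C unfolding prim_poly_def by metis
qed

lemma symint_congr:
  assumes "symint n T" "\<And>i l. i < n \<Longrightarrow> l < n \<Longrightarrow> A i l \<in> pp 0" shows "symint n (congr n A T)"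
  unfolding symint_def
proof (intro allI impI conjI)
  fix c d assume "c < n" "d < n"
  show "congr n A T c d = congr n A T d c" by (rule congr_sym) (rule symintD(1)[OF assms(1)])
  show "congr n A T c d \<in> pp 0" unfolding congr_def
    by (intro pp_sum pp_mult_left) (use assms symintD(2)[OF assms(1)] \<open>c < n\<close> \<open>d < n\<close> in auto)
qed

text \<open>If \<open>T 0 0\<close> is not a unit but some \<open>T 0 p\<close> is, then one of
  \<open>e_0 + e_p\<close> and \<open>e_0 - e_p\<close> has unit norm, because their norms differ by
  \<open>4 * T 0 p\<close>. A unipotent base change makes it the first basis vector.\<close>

lemma matrix_cases:
  assumes T: "symint (Suc n) T"
  obtains (unit) "unit (T 0 0)" | (iso) "\<And>l. l < Suc n \<Longrightarrow> T 0 l \<in> pp 1"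
  | (congr) A A' where "inverse_mats (Suc n) A A'" "inverse_mats (Suc n) A' A" "detm (Suc n) A = 1"
      "unit (congr (Suc n) A T 0 0)"
proof -
  consider "unit (T 0 0)" | "\<forall>l<Suc n. T 0 l \<in> pp 1" | "\<not> unit (T 0 0)" "\<exists>l<Suc n. T 0 l \<notin> pp 1" by blast
  then show ?thesis
  proof cases
    case 1 then show ?thesis by (rule unit)
  next
    case 2 then show ?thesis by (intro iso) blast
  next
    case 3
    then obtain p where p: "p < Suc n" "T 0 p \<notin> pp 1" by blast
    have t0: "T 0 0 \<in> pp 1" using 3(1) symintD(2)[OF T, of 0 0] by (simp add: unit_def)
    have p0: "p \<noteq> 0" using p t0 by metis
    have up: "unit (T 0 p)" using symintD(2)[OF T, of 0 p] p by (simp add: unit_def)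
    have tp: "T p p \<in> pp 0" using symintD(2)[OF T p(1) p(1)] .
    obtain s where s: "s = 1 \<or> s = - 1" "unit (T 0 0 + 2 * (s * T 0 p) + T p p)"
    proof (cases "unit (T p p + 2 * T 0 p)")
      case True
      then have "unit (T p p + 2 * T 0 p + T 0 0)" by (rule unit_add_pp1[OF _ t0])
      then show ?thesis by (intro that[of 1]) (simp_all add: ac_simps)
    next
      case False
      have "T p p + 2 * T 0 p \<in> pp 0" by (intro pp_add tp pp_mult_left unitD(2)[OF unit_2] unitD(2)[OF up])
      then have m: "T p p + 2 * T 0 p \<in> pp 1" using False by (simp add: unit_def)
      have "unit (- (2 * (2 * T 0 p)))" by (intro unitD(5) unit_mult unit_2 up)
      then have "unit (- (2 * (2 * T 0 p)) + (T p p + 2 * T 0 p))" by (rule unit_add_pp1[OF _ m])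
      then have "unit (- (2 * (2 * T 0 p)) + (T p p + 2 * T 0 p) + T 0 0)" by (rule unit_add_pp1[OF _ t0])
      moreover have "- (2 * (2 * T 0 p)) + (T p p + 2 * T 0 p) + T 0 0 = T 0 0 + 2 * (- 1 * T 0 p) + T p p"
        by (simp add: algebra_simps)
      ultimately have "unit (T 0 0 + 2 * (- 1 * T 0 p) + T p p)" by (simp only:)
      then show ?thesis by (intro that[of "- 1"]) auto
    qed
    have ss: "s * s = 1" "s \<in> pp 0" using s(1) by auto
    define A where "A = (\<lambda>x i l. if i = l then 1 else if i = p \<and> l = 0 then x else 0 :: 'a)"
    have col: "(\<Sum>i<Suc n. f i * A x i l) = f l + (if l = 0 then f p * x else 0)" if "l < Suc n" for f x l
    proof -
      have "(\<Sum>i<Suc n. f i * A x i l) = (\<Sum>i<Suc n. (if i = l then f i else 0) + (if i = p then (if l = 0 then f i * x else 0) else 0))"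
        by (rule sum.cong) (use p0 in \<open>auto simp: A_def\<close>)
      also have "\<dots> = f l + (if l = 0 then f p * x else 0)"
        unfolding sum.distrib using that p(1) by (simp add: sum.delta del: sum.lessThan_Suc)
      finally show ?thesis .
    qed
    have inv: "inverse_mats (Suc n) (A x) (A (- x))" if "x \<in> pp 0" for x
      unfolding inverse_mats_def
    proof (intro allI impI conjI)
      fix i l assume il: "i < Suc n" "l < Suc n"
      show "A x i l \<in> pp 0" using that by (simp add: A_def)
      show "(\<Sum>k<Suc n. A x i k * A (- x) k l) = of_bool (i = l)"
        unfolding col[OF il(2)] using p0 by (auto simp: A_def)
    qed
    have det: "detm (Suc n) (A s) = 1"
      by (subst detm_lower) (use p0 in \<open>auto simp: A_def\<close>)
    have "congr (Suc n) (A s) T 0 0 = (\<Sum>i<Suc n. (\<Sum>l<Suc n. T i l * A s l 0) * A s i 0)"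
      unfolding congr_def by (intro sum.cong refl) (simp add: sum_distrib_left mult_ac del: sum.lessThan_Suc)
    also have "\<dots> = (T 0 0 + T 0 p * s) + (T p 0 + T p p * s) * s"
      by (simp only: col zero_less_Suc) simp
    also have "\<dots> = T 0 0 + 2 * (s * T 0 p) + T p p * (s * s)"
      using symintD(1)[OF T p(1), of 0] by (simp add: algebra_simps)
    finally have "unit (congr (Suc n) (A s) T 0 0)" using s(2) ss(1) by simp
    then show ?thesis using congr[OF inv[OF ss(2)] _ det] inv[of "- s"] ss(2) by simp
  qed
qed

lemma symint_schur: assumes T: "symint (Suc n) T" and u: "unit (T 0 0)" shows "symint n (schur T)"
  unfolding symint_def schur_def
proof (intro allI impI conjI)
  fix c d assume cd: "c < n" "d < n"
  show "T (Suc c) (Suc d) - T 0 (Suc c) * T 0 (Suc d) / T 0 0 = T (Suc d) (Suc c) - T 0 (Suc d) * T 0 (Suc c) / T 0 0"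
    using symintD(1)[OF T, of "Suc c" "Suc d"] cd by (simp add: mult.commute)
  have "T 0 (Suc c) * T 0 (Suc d) * inverse (T 0 0) \<in> pp 0"
    by (intro pp_mult_left symintD(2)[OF T] unitD(3)[OF u]) (use cd in auto)
  then show "T (Suc c) (Suc d) - T 0 (Suc c) * T 0 (Suc d) / T 0 0 \<in> pp 0"
    using symintD(2)[OF T, of "Suc c" "Suc d"] cd by (simp add: divide_inverse pp_diff)
qed

lemma symint_tail: "symint (Suc n) T \<Longrightarrow> symint n (\<lambda>i l. T (Suc i) (Suc l))"
  unfolding symint_def by simp

lemma prim_poly_0: "prim_poly r e 0 T 1"
proof -
  have "dprim M 0 T = 1" for M
    unfolding dprim_def dens_def avg_tup_0(3) by (simp add: gram_def indep_0 prec_def)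
  then show ?thesis unfolding prim_poly_def by simp
qed

lemma sign_mult: "e * e = 1 \<Longrightarrow> unit u \<Longrightarrow> (e * eta (if even r then - u else u)) * (e * eta (if even r then - u else u)) = 1"
  using eta_unit[of u] eta_unit[OF unitD(5), of u] by (auto simp: algebra_simps)

text \<open>The difference \<open>r - n\<close> stays fixed when a line is split off and decreases
  with a plane, so it is still negative at \<open>n = 0\<close>, where \<open>Fpol\<close> is 1.
  Each step then restores divisibility by the next \<open>Fpol\<close>.\<close>

lemma prim_poly_low:
  assumes "e * e = 1" "symint n T" "r \<le> int n - 1" shows "\<exists>P. prim_poly r e n T (Fpol r e * P)"
  using assms
proof (induction n arbitrary: T r e)
  case 0
  then show ?case using prim_poly_0[of r e T] Fpol_neg[of r e] by (intro exI[of _ 1]) simp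
next
  case (Suc n)
  have U: "\<exists>P. prim_poly r e (Suc n) S (Fpol r e * P)" if S: "symint (Suc n) S" "unit (S 0 0)" for S
  proof -
    let ?e = "e * eta (if even r then - S 0 0 else S 0 0)"
    have e: "?e * ?e = 1" by (rule sign_mult[OF Suc.prems(1) S(2)])
    obtain P where P: "prim_poly (r - 1) ?e n (schur S) (Fpol (r - 1) ?e * P)"
      using Suc.IH[OF e symint_schur[OF S], of "r - 1"] Suc.prems(3) by auto
    obtain P' where "apol r e ?e * Fpol (r - 1) ?e = Fpol r e * P'" using apol_Fpol_ex[OF e] by blast
    then show ?thesis using prim_poly_unit[OF S P] by (intro exI[of _ "P' * P"]) (simp only: mult.assoc[symmetric])
  qed
  from Suc.prems(2) show ?case
  proof (cases rule: matrix_cases)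
    case unit
    then show ?thesis using U[OF Suc.prems(2)] by blast
  next
    case iso
    obtain P where P: "prim_poly (r - 2) e n (\<lambda>i l. T (Suc i) (Suc l)) (Fpol (r - 2) e * P)"
      using Suc.IH[OF Suc.prems(1) symint_tail[OF Suc.prems(2)], of "r - 2"] Suc.prems(3) by auto
    obtain P' where "bpol r e * Fpol (r - 2) e = Fpol r e * P'" using bpol_Fpol_ex[OF Suc.prems(1)] by blast
    then show ?thesis using prim_poly_isotropic[OF Suc.prems(2) iso P] by (intro exI[of _ "P' * P"]) (simp only: mult.assoc[symmetric])
  next
    case (congr A A')
    have "symint (Suc n) (congr (Suc n) A T)"
      by (rule symint_congr[OF Suc.prems(2)]) (use congr(1) in \<open>auto simp: inverse_mats_def\<close>)
    then show ?thesis using U[of "congr (Suc n) A T"] congr(4) prim_poly_congr[OF Suc.prems(2) congr(1,2)] by blast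
  qed
qed

text \<open>The sign times \<open>eta\<close> of the discriminant is invariant under splitting off a
  unimodular line, so the linear factor removed from \<open>Fpol\<close> is the same at every
  stage.\<close>

lemma eta_disc_schur:
  assumes T: "symint (Suc n) T" and u: "unit (T 0 0)" and e: "e * e = 1"
  shows "e * eta (if even (Suc n) then - T 0 0 else T 0 0) * eta (disc n (schur T)) = e * eta (disc (Suc n) T)"
    "unit (detm (Suc n) T) \<longleftrightarrow> unit (detm n (schur T))"
proof -
  have d: "detm (Suc n) T = T 0 0 * detm n (schur T)"
    by (rule detm_schur[where T = T, OF unitD(1)[OF u]]) (rule symintD(1)[OF T])
  show "unit (detm (Suc n) T) \<longleftrightarrow> unit (detm n (schur T))" unfolding d by (rule unit_mult_iff[OF u])
  have c: "(- 1) ^ n * T 0 0 = (if even (Suc n) then - T 0 0 else T 0 0)" by simp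
  have "disc n (schur T) \<in> pp 0" unfolding disc_def
    by (intro pp_mult_left pp_power detm_in_pp0 symintD(2)[OF symint_schur[OF T u]]) auto
  then have "eta (disc (Suc n) T) = eta ((- 1) ^ n * T 0 0) * eta (disc n (schur T))"
    unfolding disc_Suc[OF d] by (rule eta_mult[rotated]) (intro pp_mult_left pp_power unitD(2)[OF u], simp)
  then show "e * eta (if even (Suc n) then - T 0 0 else T 0 0) * eta (disc n (schur T)) = e * eta (disc (Suc n) T)"
    unfolding c by (simp only: mult.assoc)
qed

lemma mult_left_factor: "L * P = F \<Longrightarrow> L * (A * P) = A * F" for L P A F :: "real poly"
  using mult.left_commute[of L A P] by simp

text \<open>In rank 0 the density is 1 whereas \<open>Fpol 0 e\<close> is \<open>1 - e X\<close>.
  This missing factor is carried along as \<open>1 - e \<chi> X\<close> while lines are split off.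
  An isotropic step occurs only when the determinant is not a unit, and there
  \<open>prim_poly_low\<close> supplies the full \<open>Fpol\<close>.\<close>

lemma prim_poly_flat:
  assumes "e * e = 1" "symint n T"
  shows "\<exists>P. prim_poly (int n) e n T P \<and>
    (if unit (detm n T) then [:1, - (e * eta (disc n T)):] * P = Fpol (int n) e else \<exists>Q. P = Fpol (int n) e * Q)"
  using assms
proof (induction n arbitrary: T e)
  case 0
  have "eta 1 = 1" using eta_square[OF unit_1] by simp
  then show ?case using prim_poly_0[of 0 e T] unit_1 q_pos(3)
    by (intro exI[of _ 1]) (simp add: detm_0 disc_def Fpol_def lin_def rt_def)
next
  case (Suc n)
  let ?G = "\<lambda>S P. prim_poly (int (Suc n)) e (Suc n) S P \<and>
    (if unit (detm (Suc n) S) then [:1, - (e * eta (disc (Suc n) S)):] * P = Fpol (int (Suc n)) e else \<exists>Q. P = Fpol (int (Suc n)) e * Q)"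
  have U: "\<exists>P. ?G S P" if S: "symint (Suc n) S" "unit (S 0 0)" for S
  proof -
    let ?e = "e * eta (if even (int (Suc n)) then - S 0 0 else S 0 0)"
    have e: "?e * ?e = 1" by (rule sign_mult[OF Suc.prems(1) S(2)])
    obtain P where P: "prim_poly (int n) ?e n (schur S) P"
      "if unit (detm n (schur S)) then [:1, - (?e * eta (disc n (schur S))):] * P = Fpol (int n) ?e else \<exists>Q. P = Fpol (int n) ?e * Q"
      using Suc.IH[OF e symint_schur[OF S]] by blast
    have C: "prim_poly (int (Suc n)) e (Suc n) S (apol (int (Suc n)) e ?e * P)"
      by (rule prim_poly_unit[OF S]) (use P(1) in simp)
    have F: "apol (int (Suc n)) e ?e * Fpol (int n) ?e = Fpol (int (Suc n)) e"
      using apol_Fpol[OF e, of "int (Suc n)" e] by simp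
    have ee: "?e * eta (disc n (schur S)) = e * eta (disc (Suc n) S)"
      using eta_disc_schur(1)[OF S Suc.prems(1)] by simp
    show ?thesis
    proof (cases "unit (detm (Suc n) S)")
      case True
      then have "unit (detm n (schur S))" using eta_disc_schur(2)[OF S Suc.prems(1)] by simp
      then have "[:1, - (?e * eta (disc n (schur S))):] * P = Fpol (int n) ?e" using P(2) by (simp only: if_True)
      then have "[:1, - (e * eta (disc (Suc n) S)):] * P = Fpol (int n) ?e" unfolding ee .
      then have "[:1, - (e * eta (disc (Suc n) S)):] * (apol (int (Suc n)) e ?e * P) = Fpol (int (Suc n)) e"
        unfolding F[symmetric] by (rule mult_left_factor)
      then show ?thesis using C True by (intro exI[of _ "apol (int (Suc n)) e ?e * P"]) simp
    next
      case False
      then obtain Q where "P = Fpol (int n) ?e * Q" using P(2) eta_disc_schur(2)[OF S Suc.prems(1)] by auto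
      then have "apol (int (Suc n)) e ?e * P = Fpol (int (Suc n)) e * Q" unfolding F[symmetric] by (simp only: mult.assoc)
      then show ?thesis using C False by (intro exI[of _ "apol (int (Suc n)) e ?e * P"]) auto
    qed
  qed
  from Suc.prems(2) show ?case
  proof (cases rule: matrix_cases)
    case unit
    then show ?thesis using U[OF Suc.prems(2)] by blast
  next
    case iso
    obtain P where P: "prim_poly (int (Suc n) - 2) e n (\<lambda>i l. T (Suc i) (Suc l)) (Fpol (int (Suc n) - 2) e * P)"
      using prim_poly_low[OF Suc.prems(1) symint_tail[OF Suc.prems(2)], of "int (Suc n) - 2"] by auto
    have C: "prim_poly (int (Suc n)) e (Suc n) T (bpol (int (Suc n)) e * (Fpol (int (Suc n) - 2) e * P))"
      by (rule prim_poly_isotropic[OF Suc.prems(2) iso P])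
    have F: "bpol (int (Suc n)) e * (Fpol (int (Suc n) - 2) e * P) = Fpol (int (Suc n)) e * P"
      using bpol_Fpol[OF Suc.prems(1), of "int (Suc n)"] by (simp add: mult.assoc[symmetric])
    have "detm (Suc n) T \<in> pp 1" by (rule detm_in_pp1) (use iso symintD(2)[OF Suc.prems(2)] in auto)
    then have "\<not> unit (detm (Suc n) T)" by (simp add: unit_def)
    then show ?thesis using C unfolding F by (intro exI[of _ "Fpol (int (Suc n)) e * P"]) auto
  next
    case (congr A A')
    have S: "symint (Suc n) (congr (Suc n) A T)"
      by (rule symint_congr[OF Suc.prems(2)]) (use congr(1) in \<open>auto simp: inverse_mats_def\<close>)
    have d: "detm (Suc n) (congr (Suc n) A T) = detm (Suc n) T" using congr(3) by (simp add: detm_congr)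
    have dd: "disc (Suc n) (congr (Suc n) A T) = disc (Suc n) T" unfolding disc_def d ..
    obtain P where "?G (congr (Suc n) A T) P" using U[of "congr (Suc n) A T"] S congr(4) by blast
    then have P: "?G (congr (Suc n) A T) P" .
    have "?G T P"
      by (rule conjI[OF prim_poly_congr[OF Suc.prems(2) congr(1,2) conjunct1[OF P]] conjunct2[OF P, unfolded d dd]])
    then show ?thesis by blast
  qed
qed

text \<open>Splitting off lines preserves divisibility by \<open>Npol\<close>. At an isotropic step
  \<open>prim_poly_flat\<close> gives \<open>Fpol\<close> up to the missing factor
  \<open>1 - e \<chi> X\<close>. This is harmless, because that factor divides
  \<open>1 - X^2\<close>, the quotient of \<open>Fpol\<close> by \<open>Npol\<close>.\<close>

lemma prim_poly_main:
  assumes "e * e = 1" "symint n T" shows "\<exists>P. prim_poly (int n + 1) e n T (Npol (int n + 1) e * P)"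
  using assms
proof (induction n arbitrary: T e)
  case 0
  have s: "{i::nat. 1 \<le> i \<and> 2 * int i < 1} = {}" by auto
  have "Npol 1 e = 1" unfolding Npol_def s by simp
  then show ?case using prim_poly_0[of 1 e T] by (intro exI[of _ 1]) simp
next
  case (Suc n)
  let ?r = "int (Suc n) + 1"
  have U: "\<exists>P. prim_poly ?r e (Suc n) S (Npol ?r e * P)" if S: "symint (Suc n) S" "unit (S 0 0)" for S
  proof -
    let ?e = "e * eta (if even ?r then - S 0 0 else S 0 0)"
    have e: "?e * ?e = 1" by (rule sign_mult[OF Suc.prems(1) S(2)])
    obtain P where P: "prim_poly (int n + 1) ?e n (schur S) (Npol (int n + 1) ?e * P)"
      using Suc.IH[OF e symint_schur[OF S]] by blast
    have r1: "?r - 1 = int n + 1" by simp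
    have C: "prim_poly ?r e (Suc n) S (apol ?r e ?e * (Npol (int n + 1) ?e * P))"
      by (rule prim_poly_unit[OF S], unfold r1, rule P)
    have "apol ?r e ?e * Npol (?r - 1) ?e = Npol ?r e" by (rule apol_Npol[OF e]) simp
    then have N: "apol ?r e ?e * Npol (int n + 1) ?e = Npol ?r e" unfolding r1 .
    show ?thesis using C unfolding mult.assoc[symmetric] N by blast
  qed
  from Suc.prems(2) show ?case
  proof (cases rule: matrix_cases)
    case unit
    then show ?thesis using U[OF Suc.prems(2)] by blast
  next
    case iso
    let ?T = "\<lambda>i l. T (Suc i) (Suc l)"
    have r2: "?r - 2 = int n" by simp
    obtain P where P: "prim_poly (int n) e n ?T P"
       "if unit (detm n ?T) then [:1, - (e * eta (disc n ?T)):] * P = Fpol (int n) e else \<exists>Q. P = Fpol (int n) e * Q"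
      using prim_poly_flat[OF Suc.prems(1) symint_tail[OF Suc.prems(2)]] by blast
    have C0: "prim_poly (?r - 2) e n ?T P" unfolding r2 by (rule P(1))
    have C: "prim_poly ?r e (Suc n) T (bpol ?r e * P)"
      by (rule prim_poly_isotropic[OF Suc.prems(2) iso C0])
    have F: "bpol ?r e * Fpol (int n) e = quad 0 * Npol ?r e"
      using bpol_Fpol[OF Suc.prems(1), of ?r] Fpol_Npol[of ?r e] by simp
    show ?thesis
    proof (cases "unit (detm n ?T)")
      case False
      then obtain Q where "P = Fpol (int n) e * Q" using P(2) by auto
      then have "bpol ?r e * P = Npol ?r e * (quad 0 * Q)" using F by (simp add: mult_ac)
      then show ?thesis using C by auto
    next
      case True
      let ?h = "e * eta (disc n ?T)"
      have "unit (disc n ?T)" using True unit_disc_iff by simp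
      then have "?h * ?h = 1" using Suc.prems(1) eta_unit by fastforce
      then have h: "quad 0 = [:1, - ?h:] * [:1, ?h:]" by (simp add: quad_def)
      have "[:1, - ?h:] * (bpol ?r e * P) = bpol ?r e * Fpol (int n) e"
        by (rule mult_left_factor) (use P(2) True in \<open>simp only: if_True\<close>)
      also have "\<dots> = [:1, - ?h:] * (Npol ?r e * [:1, ?h:])" unfolding F h by (rule trans[OF mult.assoc arg_cong[of _ _ "(*) [:1, - ?h:]"]]) (rule mult.commute)
      finally have "[:1, - ?h:] * (bpol ?r e * P) = [:1, - ?h:] * (Npol ?r e * [:1, ?h:])" .
      moreover have "[:1, - ?h:] \<noteq> 0" by simp
      ultimately have "bpol ?r e * P = Npol ?r e * [:1, ?h:]" unfolding mult_cancel_left by blast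
      then have "prim_poly ?r e (Suc n) T (Npol ?r e * [:1, ?h:])" using C by (simp only:)
      then show ?thesis by blast
    qed
  next
    case (congr A A')
    have "symint (Suc n) (congr (Suc n) A T)"
      by (rule symint_congr[OF Suc.prems(2)]) (use congr(1) in \<open>auto simp: inverse_mats_def\<close>)
    then show ?thesis using U[of "congr (Suc n) A T"] congr(4) prim_poly_congr[OF Suc.prems(2) congr(1,2)] by blast
  qed
qed


section \<open>Densities of all representations\<close>

definition symm :: "nat \<Rightarrow> (nat \<Rightarrow> nat \<Rightarrow> 'a) \<Rightarrow> bool" where
  "symm n T \<longleftrightarrow> (\<forall>c<n. \<forall>d<n. T c d = T d c)"

lemma symmD: "symm n T \<Longrightarrow> c < n \<Longrightarrow> d < n \<Longrightarrow> T c d = T d c"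
  unfolding symm_def by blast

text \<open>The normalized density no longer depends on the precision, uniformly for all matrices
  congruent to \<open>T\<close> modulo \<open>pp N0\<close>. The uniformity is what
  \<open>dens_refine\<close> needs in order to treat nonconstant precisions.\<close>

definition stab :: "'w set \<Rightarrow> nat \<Rightarrow> (nat \<Rightarrow> nat \<Rightarrow> 'a) \<Rightarrow> nat \<Rightarrow> nat \<Rightarrow> real \<Rightarrow> bool" where
  "stab M n T j N0 w \<longleftrightarrow> (\<forall>N\<ge>N0. N \<ge> 1 \<longrightarrow> (\<forall>T'. symm n T' \<longrightarrow> (\<forall>c<n. \<forall>d<n. T' c d - T c d \<in> pp N0) \<longrightarrow>
     dens M n (\<lambda>_ _. N) T' j N * q ^ prec n (\<lambda>_ _. N) = w))"

lemma stabD: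
  assumes "stab M n T j N0 w" "N \<ge> N0" "N \<ge> 1" "symm n T'" "\<And>c d. c < n \<Longrightarrow> d < n \<Longrightarrow> T' c d - T c d \<in> pp N0"
  shows "dens M n (\<lambda>_ _. N) T' j N * q ^ prec n (\<lambda>_ _. N) = w"
  using assms unfolding stab_def by blast

lemma stab_mono: "stab M n T j N0 w \<Longrightarrow> N0 \<le> N1 \<Longrightarrow> stab M n T j N1 w"
  unfolding stab_def using pp_mono[of N0 N1] by (meson le_trans)

lemma stab_primitive:
  assumes "unimodular m M" shows "stab M n T n 1 (dprim M n T)"
  unfolding stab_def
proof (intro allI impI)
  fix N :: nat and T' assume "1 \<le> N" and c: "\<forall>c<n. \<forall>d<n. T' c d - T c d \<in> pp 1"
  then have "dens M n (\<lambda>_ _. N) T' n N * q ^ prec n (\<lambda>_ _. N) = dens M n one T' n 1 * q ^ prec n one"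
    by (intro dens_primitive[OF assms]) auto
  also have "dens M n one T' n 1 = dens M n one T n 1" by (rule dens_cong_entries) (use c in auto)
  finally show "dens M n (\<lambda>_ _. N) T' n N * q ^ prec n (\<lambda>_ _. N) = dprim M n T" unfolding dprim_def .
qed

text \<open>An integral lattice does not represent a nonintegral matrix at any precision; this ends
  the passage to larger lattices.\<close>

lemma stab_nonintegral:
  assumes U: "unimodular m M" and T: "symm n T" "a < n" "d < n" "T a d \<notin> pp 0"
  shows "stab M n T j 0 0"
  unfolding stab_def
proof (intro allI impI)
  fix N :: nat and T' assume T': "symm n T'" "\<forall>c<n. \<forall>d<n. T' c d - T c d \<in> pp 0"
  note UM = unimodularD[OF U]
  have nT: "T' a d \<notin> pp 0" using pp_cong_iff[of "T' a d" "T a d" 0] T' T by blast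
  have "\<not> gram n (\<lambda>_ _. N) T' \<phi>" if \<phi>: "\<phi> \<in> tup n M" for \<phi>
  proof
    assume "gram n (\<lambda>_ _. N) T' \<phi>"
    then have "\<forall>c<n. \<forall>d<n. b (\<phi> c) (\<phi> d) - T' c d \<in> pp N"
      by (subst (asm) gram_const_iff) (use symmD[OF T'(1)] in auto)
    then have "b (\<phi> a) (\<phi> d) - T' a d \<in> pp N" using T by blast
    then have "T' a d \<in> pp 0"
      using pp_cong_iff[of "b (\<phi> a) (\<phi> d)" "T' a d" 0] pp_subset_0 UM(2)[OF tupD(1)[OF \<phi> T(2)] tupD(1)[OF \<phi> T(3)]] by blast
    then show False using nT by simp
  qed
  then have "dens M n (\<lambda>_ _. N) T' j N = 0"
    unfolding dens_def by (intro avg_const_on[OF fin_quot_tup[OF UM(4)]]) auto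
  then show "dens M n (\<lambda>_ _. N) T' j N * q ^ prec n (\<lambda>_ _. N) = 0" by simp
qed

text \<open>One digit is lost for each of the \<open>n - 1\<close> off-diagonal entries involving
  \<open>j\<close>, and two for the diagonal one.\<close>

lemma prec_lower:
  assumes "j < n" "2 \<le> N" shows "prec n (lower j N) + (n + 1) = prec n (\<lambda>_ _. N)"
proof -
  have e: "(\<Sum>c\<le>e. of_bool (c = j) + of_bool (e = j)) = (of_bool (j \<le> e) + (if e = j then j + 1 else 0) :: nat)" for e
  proof -
    have "(\<Sum>c\<le>e. of_bool (c = j) :: nat) = of_bool (j \<le> e)" by (simp add: of_bool_def sum.delta)
    moreover have "(\<Sum>c\<le>e. of_bool (e = j) :: nat) = (if e = j then j + 1 else 0)" by simp
    ultimately show ?thesis unfolding sum.distrib by simp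
  qed
  have "(\<Sum>e<n. of_bool (j \<le> e) :: nat) = card {j..<n}"
  proof -
    have "(\<Sum>e<n. of_bool (j \<le> e) :: nat) = (\<Sum>e\<in>{..<n} \<inter> {e. j \<le> e}. 1)"
      by (simp add: of_bool_def sum.If_cases)
    also have "{..<n} \<inter> {e. j \<le> e} = {j..<n}" by auto
    finally show ?thesis by simp
  qed
  then have "(\<Sum>e<n. \<Sum>c\<le>e. of_bool (c = j) + of_bool (e = j) :: nat) = (n - j) + (j + 1)"
    unfolding e using assms(1) by (simp add: sum.distrib sum.delta)
  then have "prec n (lower j N) + (n + 1) = (\<Sum>e<n. \<Sum>c\<le>e. lower j N c e) + (\<Sum>e<n. \<Sum>c\<le>e. of_bool (c = j) + of_bool (e = j))"
    using assms(1) unfolding prec_def by simp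
  also have "\<dots> = (\<Sum>e<n. \<Sum>c\<le>e. lower j N c e + (of_bool (c = j) + of_bool (e = j)))" by (simp add: sum.distrib)
  also have "\<dots> = prec n (\<lambda>_ _. N)" unfolding prec_def
    by (intro sum.cong refl) (use assms(2) in \<open>auto simp: lower_def of_bool_def\<close>)
  finally show ?thesis .
qed

text \<open>The matrix \<open>step j c\<close> has denominator \<open>\<pi>\<close> and enters
  twice, hence the loss of two digits.\<close>

lemma congr_step_cong:
  assumes "\<And>i. i < j \<Longrightarrow> c i \<in> pp 0" "\<And>a d. a < n \<Longrightarrow> d < n \<Longrightarrow> T' a d - T a d \<in> pp (N + 2)"
    and ad: "a < n" "d < n"
  shows "congr n (step j c) T' a d - congr n (step j c) T a d \<in> pp N"
proof -
  have st: "\<exists>y\<in>pp 0. step j c i l = inverse \<pi> * y" for i l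
  proof -
    let ?y = "if l = j then (if i = j then 1 else if i < j then - c i else 0) else \<pi> * of_bool (i = l)"
    have "?y \<in> pp 0" using assms(1) pi_in(2) by simp
    moreover have "step j c i l = inverse \<pi> * ?y" using pi_nonzero by (simp add: step_def)
    ultimately show ?thesis by blast
  qed
  have "congr n (step j c) T' a d - congr n (step j c) T a d = (\<Sum>i<n. \<Sum>l<n. step j c i a * (T' i l - T i l) * step j c l d)"
    unfolding congr_def by (simp add: sum_subtractf algebra_simps)
  also have "\<dots> \<in> pp N"
  proof (intro pp_sum)
    fix i l assume il: "i \<in> {..<n}" "l \<in> {..<n}"
    obtain y z where yz: "y \<in> pp 0" "z \<in> pp 0" "step j c i a = inverse \<pi> * y" "step j c l d = inverse \<pi> * z"
      using st by meson
    have "T' i l - T i l \<in> pp (2 + N)" using assms(2)[of i l] il by (simp add: add.commute)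
    then have "(y * z) * (T' i l - T i l) \<in> pp (2 + N)" using yz by (intro pp_mult_left)
    moreover have "(y * z) * (T' i l - T i l) = \<pi> ^ 2 * (step j c i a * (T' i l - T i l) * step j c l d)"
      using pi_nonzero unfolding yz(3,4) by (simp add: power2_eq_square field_simps)
    ultimately show "step j c i a * (T' i l - T i l) * step j c l d \<in> pp N"
      using pi_power_mult_iff[of 2 _ N] by simp
  qed
  finally show ?thesis .
qed

lemma symm_congr: "symm n T \<Longrightarrow> symm n (congr n A T)"
  unfolding symm_def using congr_sym[of n T A] by blast

text \<open>The factor in front of the sum combines the lost precision, \<open>n + 1\<close> digits
  by \<open>prec_lower\<close>, with the index \<open>q ^ m\<close> of the dependent tuples.\<close>

lemma stab_step:
  assumes U: "unimodular m M" and j: "j < n"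
    and 0: "stab M n T (Suc j) N0 w0" and c: "\<And>c. c \<in> coeffs j \<Longrightarrow> stab M n (congr n (step j c) T) j N0 (w c)"
  shows "stab M n T j (N0 + 2) (w0 + q ^ (n + 1) / q ^ m * (\<Sum>c\<in>coeffs j. w c))"
  unfolding stab_def
proof (intro allI impI)
  fix N :: nat and T' assume N: "N0 + 2 \<le> N" "1 \<le> N" and T': "symm n T'" "\<forall>c<n. \<forall>d<n. T' c d - T c d \<in> pp (N0 + 2)"
  have N2: "2 \<le> N" "N0 \<le> N" using N by auto
  have c': "dens M n (lower j N) (congr n (step j c) T') j N * q ^ prec n (lower j N) = w c" if c0: "c \<in> coeffs j" for c
  proof (rule dens_refine[OF U N(2), where T = "congr n (step j c) T" and ?N0.0 = N0])
    show "j \<le> n" using j by simp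
    show "dens M n (\<lambda>_ _. N) T'' j N * q ^ prec n (\<lambda>_ _. N) = w c"
      if "\<And>c e. c < n \<Longrightarrow> e < n \<Longrightarrow> T'' c e = T'' e c" "\<And>a e. a < n \<Longrightarrow> e < n \<Longrightarrow> T'' a e - congr n (step j c) T a e \<in> pp N0" for T''
      by (rule stabD[OF c[OF c0] N2(2) N(2)]) (use that in \<open>auto simp: symm_def\<close>)
    show "N0 \<le> lower j N a e \<and> lower j N a e \<le> N" for a e
      using N(1) by (auto simp: lower_def of_bool_def)
    show "congr n (step j c) T' a e = congr n (step j c) T' e a" if "a < n" "e < n" for a e
      using symmD[OF symm_congr[OF T'(1)] that] .
    show "congr n (step j c) T' a e - congr n (step j c) T a e \<in> pp N0" if "a < n" "e < n" for a e
      by (rule congr_step_cong[OF _ _ that]) (use coeffs_pp[OF c0] T'(2) in auto)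
  qed
  have p: "prec n (\<lambda>_ _. N) = prec n (lower j N) + (n + 1)" using prec_lower[OF j N2(1)] by simp
  have "dens M n (\<lambda>_ _. N) T' (Suc j) N * q ^ prec n (\<lambda>_ _. N) = w0"
    by (rule stabD[OF 0 N2(2) N(2) T'(1)]) (use T'(2) pp_mono[of N0 "N0 + 2"] in auto)
  moreover have "(\<Sum>c\<in>coeffs j. dens M n (lower j N) (congr n (step j c) T') j N / q ^ m) * q ^ prec n (\<lambda>_ _. N) =
      q ^ (n + 1) / q ^ m * (\<Sum>c\<in>coeffs j. w c)"
  proof -
    have "(\<Sum>c\<in>coeffs j. dens M n (lower j N) (congr n (step j c) T') j N / q ^ m) * q ^ prec n (\<lambda>_ _. N) =
      (\<Sum>c\<in>coeffs j. q ^ (n + 1) / q ^ m * (dens M n (lower j N) (congr n (step j c) T') j N * q ^ prec n (lower j N)))"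
      unfolding p power_add sum_distrib_right by (rule sum.cong[OF refl]) (simp add: mult_ac)
    also have "\<dots> = (\<Sum>c\<in>coeffs j. q ^ (n + 1) / q ^ m * w c)" by (rule sum.cong) (simp_all only: c')
    finally show ?thesis by (simp only: sum_distrib_left)
  qed
  ultimately show "dens M n (\<lambda>_ _. N) T' j N * q ^ prec n (\<lambda>_ _. N) = w0 + q ^ (n + 1) / q ^ m * (\<Sum>c\<in>coeffs j. w c)"
    by (subst dens_step[OF U j symmD[OF T'(1)] N2(1)]) (simp_all only: distrib_right)
qed

definition dens_poly :: "int \<Rightarrow> real \<Rightarrow> nat \<Rightarrow> (nat \<Rightarrow> nat \<Rightarrow> 'a) \<Rightarrow> nat \<Rightarrow> real poly \<Rightarrow> bool" where
  "dens_poly r e n T j P \<longleftrightarrow> (\<exists>N0. \<forall>k m M. int m = r + 2 * int k \<longrightarrow> signed m e M \<longrightarrow> stab M n T j N0 (poly P (1 / q ^ k)))"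

lemma symint_symm: "symint n T \<Longrightarrow> symm n T" unfolding symint_def symm_def by blast

text \<open>For \<open>m = r + 2 * k\<close> the factor \<open>q ^ (n + 1) / q ^ m\<close> is
  \<open>q ^ s * X^2\<close> at \<open>X = q^{-k}\<close>. It is a polynomial in \<open>X\<close>,
  so the step stays among polynomials.\<close>

lemma dens_poly_step:
  assumes j: "j < n" and r: "r + int s = int n + 1" and 0: "dens_poly r e n T (Suc j) P0"
    and c: "\<And>c. c \<in> coeffs j \<Longrightarrow> dens_poly r e n (congr n (step j c) T) j (P c)"
  shows "dens_poly r e n T j (P0 + [:0, 0, q ^ s:] * (\<Sum>c\<in>coeffs j. P c))"
proof -
  obtain N0 where N0: "\<And>k m M. int m = r + 2 * int k \<Longrightarrow> signed m e M \<Longrightarrow> stab M n T (Suc j) N0 (poly P0 (1 / q ^ k))"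
    using 0 unfolding dens_poly_def by blast
  have "\<forall>c\<in>coeffs j. \<exists>N. \<forall>k m M. int m = r + 2 * int k \<longrightarrow> signed m e M \<longrightarrow> stab M n (congr n (step j c) T) j N (poly (P c) (1 / q ^ k))"
    using c unfolding dens_poly_def by blast
  then obtain Nc where Nc: "\<And>c k m M. c \<in> coeffs j \<Longrightarrow> int m = r + 2 * int k \<Longrightarrow> signed m e M \<Longrightarrow>
      stab M n (congr n (step j c) T) j (Nc c) (poly (P c) (1 / q ^ k))" by metis
  define N1 where "N1 = N0 + (\<Sum>c\<in>coeffs j. Nc c)"
  have le: "N0 \<le> N1" "c \<in> coeffs j \<Longrightarrow> Nc c \<le> N1" for c
    unfolding N1_def using member_le_sum[of c "coeffs j" Nc] finite_coeffs by (auto intro: trans_le_add2)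
  show ?thesis
    unfolding dens_poly_def
  proof (rule exI[of _ "N1 + 2"], intro allI impI)
    fix k m M assume m: "int m = r + 2 * int k" and S: "signed m e M"
    have "stab M n T j (N1 + 2) (poly P0 (1 / q ^ k) + q ^ (n + 1) / q ^ m * (\<Sum>c\<in>coeffs j. poly (P c) (1 / q ^ k)))"
      by (rule stab_step[OF signedD(1)[OF S] j])
        (use stab_mono[OF N0[OF m S] le(1)] stab_mono[OF Nc[OF _ m S] le(2)] in auto)
    moreover have "q ^ (n + 1) / q ^ m = real q ^ s * (1 / q ^ k) ^ 2"
    proof -
      have "n + 1 + 2 * k = m + s" using m r by linarith
      then have "real q ^ (n + 1) * (real q ^ k) ^ 2 = real q ^ m * real q ^ s"
        by (simp only: power_add[symmetric] power_mult[symmetric] mult.commute[of k 2])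
      then show ?thesis using q_pos by (simp add: field_simps power_divide)
    qed
    moreover have "poly (P0 + [:0, 0, q ^ s:] * (\<Sum>c\<in>coeffs j. P c)) x = poly P0 x + real q ^ s * x ^ 2 * (\<Sum>c\<in>coeffs j. poly (P c) x)" for x
      by (simp add: poly_sum power2_eq_square mult_ac)
    ultimately show "stab M n T j (N1 + 2) (poly (P0 + [:0, 0, q ^ s:] * (\<Sum>c\<in>coeffs j. P c)) (1 / q ^ k))"
      by (simp only:)
  qed
qed

text \<open>The outer induction is on the valuation of the determinant, which drops by 2 in each
  enlarged lattice; the inner one descends in \<open>j\<close> from the primitive case
  \<open>j = n\<close>. \<open>Cl\<close> is a property that enlarging preserves; for the flat
  polynomial it records the value of \<open>\<chi>\<close>.\<close>

lemma dens_poly_exists: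
  assumes r: "r + int s = int n + 1"
    and D: "\<And>T. symint n T \<Longrightarrow> detm n T \<noteq> 0 \<Longrightarrow> Cl T \<Longrightarrow> \<exists>P. prim_poly r e n T (D * P)"
    and Cl: "\<And>T j c. j < n \<Longrightarrow> Cl T \<Longrightarrow> Cl (congr n (step j c) T)"
    and T: "symm n T" "detm n T \<noteq> 0" "Cl T" and j: "j \<le> n"
  shows "\<exists>P. dens_poly r e n T j (D * P)"
proof -
  have nonint: "\<exists>P. dens_poly r e n T j (D * P)" if T: "symm n T" "\<not> symint n T" for T j
  proof -
    obtain a d where "a < n" "d < n" "T a d \<notin> pp 0" using T unfolding symint_def symm_def by blast
    then have "stab M n T j 0 0" if "signed m e M" for m M using stab_nonintegral[OF signedD(1)[OF that] T(1)] by blast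
    then have "dens_poly r e n T j (D * 0)" unfolding dens_poly_def by auto
    then show ?thesis by blast
  qed
  have vd: "val (detm n (congr n (step j c) T)) = val (detm n T) - 2" "detm n (congr n (step j c) T) \<noteq> 0"
    if "j < n" "detm n T \<noteq> 0" for j c T
    unfolding detm_congr detm_step[OF that(1)] using that(2) pi_nonzero
    by (simp_all add: val_mult val_inverse val_pi)
  have main: "\<exists>P. dens_poly r e n T j (D * P)"
    if "symint n T" "detm n T \<noteq> 0" "Cl T" "j \<le> n" for T j
    using that
  proof (induction "nat (val (detm n T))" arbitrary: T j rule: less_induct)
    case less
    show ?case using less.prems(4)
    proof (induction j rule: inc_induct)
      case base
      obtain P where "prim_poly r e n T (D * P)" using D[OF less.prems(1,2,3)] by blast
      then have "dens_poly r e n T n (D * P)"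
        unfolding dens_poly_def prim_poly_def using stab_primitive[OF signedD(1)] by metis
      then show ?case by blast
    next
      case (step j)
      have "\<exists>P. dens_poly r e n (congr n (step j c) T) j (D * P)" for c
      proof (cases "symint n (congr n (step j c) T)")
        case True
        have "val (detm n (congr n (step j c) T)) \<ge> 0"
        proof -
          have "detm n (congr n (step j c) T) \<in> pp 0" by (rule detm_in_pp0) (rule symintD(2)[OF True])
          then show ?thesis using vd(2)[OF step(2) less.prems(2)] by (simp add: pp_iff)
        qed
        then have lt: "nat (val (detm n (congr n (step j c) T))) < nat (val (detm n T))"
          using vd(1)[OF step(2) less.prems(2), of c] by simp
        show ?thesis
          by (rule less.hyps[OF lt True vd(2)[OF step(2) less.prems(2)] Cl[OF step(2) less.prems(3)]]) (use step(2) in simp)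
      next
        case False
        then show ?thesis by (intro nonint symm_congr symint_symm[OF less.prems(1)])
      qed
      then obtain P where P: "\<And>c. dens_poly r e n (congr n (step j c) T) j (D * P c)" by metis
      obtain P0 where P0: "dens_poly r e n T (Suc j) (D * P0)" using step by blast
      have "dens_poly r e n T j (D * P0 + [:0, 0, q ^ s:] * (\<Sum>c\<in>coeffs j. D * P c))"
        by (rule dens_poly_step[OF step(2) r P0 P])
      also have "D * P0 + [:0, 0, q ^ s:] * (\<Sum>c\<in>coeffs j. D * P c) = D * (P0 + [:0, 0, q ^ s:] * (\<Sum>c\<in>coeffs j. P c))"
        unfolding sum_distrib_left[symmetric] distrib_left by (simp only: mult.left_commute)
      finally show ?case by blast
    qed
  qed
  show ?thesis
    using main[OF _ T(2,3) j] nonint[OF T(1)] by blast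
qed

section \<open>Lifting isotropic vectors and rank-one perturbations of Gram matrices\<close>

lemma indep_1: assumes "unimodular m M" "v \<in> M" shows "indep M (Suc 0) (case_nat v \<phi>) \<longleftrightarrow> v \<notin> mul 1 M"
proof
  assume L: "indep M (Suc 0) (case_nat v \<phi>)"
  show "v \<notin> mul 1 M"
  proof
    assume "v \<in> mul 1 M"
    then have "(\<Sum>i<Suc 0. scale ((\<lambda>_. 1) i) (case_nat v \<phi> i)) \<in> mul 1 M" by simp
    then have "\<forall>i<Suc 0. (\<lambda>_. 1 :: 'a) i \<in> pp 1" using L[unfolded indep_def, THEN spec, of "\<lambda>_. 1"] by simp
    then have "(1 :: 'a) \<in> pp 1" by blast
    then show False using unit_1 by (simp add: unit_def)
  qed
next
  note U = unimodularD[OF assms(1)]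
  assume v: "v \<notin> mul 1 M"
  show "indep M (Suc 0) (case_nat v \<phi>)"
    unfolding indep_def
  proof (intro allI impI)
    fix c i assume c: "\<forall>i<Suc 0. c i \<in> pp 0" "(\<Sum>i<Suc 0. scale (c i) (case_nat v \<phi> i)) \<in> mul 1 M" "i < Suc 0"
    have c0: "c 0 \<in> pp 0" "scale (c 0) v \<in> mul 1 M" using c by simp_all
    have "c 0 \<in> pp 1"
    proof (rule ccontr)
      assume "c 0 \<notin> pp 1"
      then have u: "unit (c 0)" using c0 by (simp add: unit_def)
      have "scale (inverse (c 0)) (scale (c 0) v) \<in> mul 1 M" by (rule scale_mem_mul[OF U(1) unitD(3)[OF u] c0(2)])
      then show False using v unitD(1)[OF u] by simp
    qed
    then show "c i \<in> pp 1" using c(3) by simp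
  qed
qed

text \<open>A primitive vector is an independent 1-tuple, so \<open>dens_primitive\<close> lifts the
  count from precision 1 to \<open>N\<close>.\<close>

lemma avg_isotropic_lift:
  assumes S: "signed m e M" and t: "t \<in> pp 1" and N: "1 \<le> N"
  shows "avg M (mul N M) (\<lambda>v. of_bool (b v v - t \<in> pp N \<and> v \<notin> mul 1 M)) * q ^ N = q * (qform m e 0 - 1 / q ^ m)"
proof -
  note U = signedD(1)[OF S] and UM = unimodularD[OF signedD(1)[OF S]]
  have d: "dens M (Suc 0) (\<lambda>_ _. k) (\<lambda>_ _. t) (Suc 0) k = avg M (mul k M) (\<lambda>v. of_bool (b v v - t \<in> pp k \<and> v \<notin> mul 1 M))"
    if k: "1 \<le> k" for k
  proof -
    have "dens M (Suc 0) (\<lambda>_ _. k) (\<lambda>_ _. t) (Suc 0) k = avg M (mul k M) (\<lambda>v. avg (tup 0 M) (tup 0 (mul k M))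
      (\<lambda>\<phi>. of_bool (gram (Suc 0) (\<lambda>_ _. k) (\<lambda>_ _. t) (case_nat v \<phi>) \<and> indep M (Suc 0) (case_nat v \<phi>))))"
      by (rule dens_Suc[OF U]) (use k in auto)
    also have "\<dots> = avg M (mul k M) (\<lambda>v. of_bool (b v v - t \<in> pp k \<and> v \<notin> mul 1 M))"
      unfolding avg_tup_0(3) gram_Suc by (rule avg_cong[OF UM(4)]) (simp add: indep_1[OF U] gram_def)
    finally show ?thesis .
  qed
  have "dens M (Suc 0) (\<lambda>_ _. N) (\<lambda>_ _. t) (Suc 0) N * q ^ prec (Suc 0) (\<lambda>_ _. N) =
      dens M (Suc 0) one (\<lambda>_ _. t) (Suc 0) 1 * q ^ prec (Suc 0) one"
    by (rule dens_primitive[OF U]) (use N in auto)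
  then show ?thesis
    unfolding d[OF N] d[OF order_refl] avg_isotropic[OF S t] by (simp add: prec_def mult.commute)
qed

text \<open>Newton iteration with the derivative replaced by 2: the new error consists of products
  of the correction \<open>h\<close> with \<open>h\<close> or \<open>x\<close>, both in
  \<open>pp 1\<close>, so a digit is gained.\<close>

lemma approx_quadratic_root:
  assumes s: "s \<in> pp 0" and u: "u \<in> pp 1" shows "\<exists>x\<in>pp 1. 2 * x + x * x * s - u \<in> pp N"
proof (induction N)
  case 0
  show ?case by (rule bexI[of _ 0]) (use pp_subset_0[OF u] in auto)
next
  case (Suc N)
  then obtain x where x: "x \<in> pp 1" "2 * x + x * x * s - u \<in> pp N" by blast
  define d where "d = 2 * x + x * x * s - u"
  have x0: "x \<in> pp 0" by (rule pp_subset_0[OF x(1)])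
  have d1: "d \<in> pp 1" unfolding d_def
    by (intro pp_diff pp_add u pp_mult_left[OF unitD(2)[OF unit_2] x(1)] pp_mult_right[OF _ s] pp_mult_left[OF x0 x(1)])
  define h where "h = d * inverse 2"
  have i2: "inverse (2 :: 'a) \<in> pp 0" by (rule unitD(3)[OF unit_2])
  have h2: "2 * h = d" using unitD(1)[OF unit_2] by (simp add: h_def)
  have h: "h \<in> pp 1" "h \<in> pp N" unfolding h_def by (rule pp_mult_right[OF d1 i2], rule pp_mult_right[OF x(2)[folded d_def] i2])
  have "2 * (x - h) + (x - h) * (x - h) * s - u = d - 2 * h + (h * h - 2 * (x * h)) * s"
    by (simp add: d_def algebra_simps)
  then have "2 * (x - h) + (x - h) * (x - h) * s - u = (h * h - 2 * (x * h)) * s" unfolding h2 by simp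
  moreover have "(h * h - 2 * (x * h)) * s \<in> pp (Suc N)"
    by (intro pp_mult_right[OF _ s] pp_diff pp_mult_left[OF unitD(2)[OF unit_2]] pp_mult_Suc h x(1))
  ultimately show ?case using pp_diff[OF x(1) h(1)] by (intro bexI[of _ "x - h"]) simp_all
qed

text \<open>If \<open>T\<^sup>-\<^sup>1 u\<close> is divisible by the uniformizer, then \<open>T + u \<alpha> \<alpha>\<^sup>T\<close> is equivalent to \<open>T\<close> through \<open>1 + y \<alpha>\<^sup>T\<close>, where \<open>y\<close>
  is a multiple of \<open>T\<^sup>-\<^sup>1 \<alpha>\<close>.\<close>

lemma dens_rank_one:
  assumes U: "unimodular m M" and T: "symm n T" and N: "1 \<le> N" and u: "u \<in> pp (Suc a)" and \<alpha>: "\<alpha> \<in> tup n (pp 0)"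
    and sol: "\<exists>y. \<forall>i<n. y i \<in> pp 0 \<and> (\<Sum>l<n. T i l * y l) = \<pi> ^ a * \<alpha> i"
  shows "dens M n (\<lambda>_ _. N) (\<lambda>i l. T i l + u * (\<alpha> i * \<alpha> l)) 0 N = dens M n (\<lambda>_ _. N) T 0 N"
proof -
  obtain y0 where y0: "\<And>i. i < n \<Longrightarrow> y0 i \<in> pp 0" "\<And>i. i < n \<Longrightarrow> (\<Sum>l<n. T i l * y0 l) = \<pi> ^ a * \<alpha> i"
    using sol by blast
  have al: "\<alpha> i \<in> pp 0" if "i < n" for i by (rule tupD(1)[OF \<alpha> that])
  define s where "s = (\<Sum>i<n. \<alpha> i * y0 i)"
  have s: "s \<in> pp 0" unfolding s_def using al y0(1) by (intro pp_sum pp_mult_left) auto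
  \<comment> \<open>Congruence by the matrix with entries
    \<open>of_bool (i = l) + x * y0 i * \<alpha> l\<close> adds
    \<open>\<pi> ^ a * (2 * x + x * x * s)\<close> times \<open>\<alpha> \<alpha>^T\<close> to
    \<open>T\<close>; so \<open>x\<close> has to solve a quadratic equation with right-hand side
    \<open>u'\<close>.\<close>
  define u' where "u' = u / \<pi> ^ a"
  have uu: "u = \<pi> ^ a * u'" using pi_nonzero by (simp add: u'_def)
  have "u' \<in> pp 1" using pi_power_mult_iff[of a u' 1] u uu by (simp flip: Suc_eq_plus1)
  then obtain x where x: "x \<in> pp 1" "2 * x + x * x * s - u' \<in> pp N" using approx_quadratic_root[OF s] by blast
  define A where "A = (\<lambda>z i l. of_bool (i = l) + z * y0 i * \<alpha> l)"
  have col: "(\<Sum>i<n. f i * A z i l) = f l + z * (\<Sum>i<n. f i * y0 i) * \<alpha> l" if "l < n" for f z l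
  proof -
    have "(\<Sum>i<n. f i * A z i l) = (\<Sum>i<n. (if i = l then f i else 0) + z * (f i * y0 i) * \<alpha> l)"
      by (rule sum.cong) (auto simp: A_def algebra_simps)
    also have "\<dots> = f l + z * (\<Sum>i<n. f i * y0 i) * \<alpha> l"
      unfolding sum.distrib using that by (simp add: sum.delta sum_distrib_left sum_distrib_right)
    finally show ?thesis .
  qed
  have prod: "(\<Sum>k<n. A z i k * A z' k l) = of_bool (i = l) + (z + z' + z * z' * s) * y0 i * \<alpha> l" if "i < n" "l < n" for z z' i l
  proof -
    have "(\<Sum>k<n. A z i k * y0 k) = (\<Sum>k<n. (if i = k then y0 k else 0) + z * y0 i * (\<alpha> k * y0 k))"
      by (rule sum.cong) (auto simp: A_def algebra_simps)
    also have "\<dots> = y0 i + z * y0 i * s"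
      unfolding sum.distrib s_def using that(1) by (simp add: sum.delta' sum_distrib_left)
    finally show ?thesis unfolding col[OF that(2)] by (simp add: A_def algebra_simps)
  qed
  have xs: "unit (1 + x * s)" by (rule unit_add_pp1[OF unit_1 pp_mult_right[OF x(1) s]])
  \<comment> \<open>The inverse of a rank-one perturbation of the identity is again one, with this
    coefficient (Sherman-Morrison).\<close>
  define x' where "x' = - x * inverse (1 + x * s)"
  have x'0: "x' \<in> pp 0" unfolding x'_def using pp_subset_0[OF x(1)] unitD(3)[OF xs] by (simp add: pp_mult_right)
  have zz: "x + x' + x * x' * s = 0"
  proof -
    have "x + x' + x * x' * s = x + x' * (1 + x * s)" by (simp add: algebra_simps)
    also have "x' * (1 + x * s) = - x" using unitD(1)[OF xs] by (simp add: x'_def)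
    finally show ?thesis by simp
  qed
  have A0: "A z i l \<in> pp 0" if "z \<in> pp 0" "i < n" "l < n" for z i l
    unfolding A_def using that al y0(1) by (intro pp_add pp_mult_left) auto
  have inv: "inverse_mats n (A x) (A x')" "inverse_mats n (A x') (A x)"
    unfolding inverse_mats_def
    using prod[of _ _ x x'] prod[of _ _ x' x] zz A0[OF pp_subset_0[OF x(1)]] A0[OF x'0] by (auto simp: ac_simps)
  have "dens M n (\<lambda>_ _. N) (congr n (A x) T) 0 N = dens M n (\<lambda>_ _. N) T 0 N"
    by (rule dens_congruence[OF U N _ inv]) (use symmD[OF T] in auto)
  moreover have "dens M n (\<lambda>_ _. N) (congr n (A x) T) 0 N = dens M n (\<lambda>_ _. N) (\<lambda>i l. T i l + u * (\<alpha> i * \<alpha> l)) 0 N"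
  proof (rule dens_cong_entries)
    fix c d assume "c \<le> d" "d < n"
    then have cd: "c < n" "d < n" by auto
    have i1: "(\<Sum>l<n. T i l * A x l d) = T i d + x * \<pi> ^ a * \<alpha> i * \<alpha> d" if "i < n" for i
      unfolding col[OF cd(2)] y0(2)[OF that] by (simp add: mult_ac)
    have "congr n (A x) T c d = (\<Sum>i<n. (\<Sum>l<n. T i l * A x l d) * A x i c)"
      unfolding congr_def by (intro sum.cong refl) (simp add: sum_distrib_left mult_ac)
    also have "\<dots> = (\<Sum>i<n. (T i d + x * \<pi> ^ a * \<alpha> i * \<alpha> d) * A x i c)" by (rule sum.cong) (simp_all add: i1)
    also have "\<dots> = (T c d + x * \<pi> ^ a * \<alpha> c * \<alpha> d) + x * (\<Sum>i<n. (T i d + x * \<pi> ^ a * \<alpha> i * \<alpha> d) * y0 i) * \<alpha> c"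
      by (rule col[OF cd(1)])
    also have "(\<Sum>i<n. (T i d + x * \<pi> ^ a * \<alpha> i * \<alpha> d) * y0 i) = (\<Sum>i<n. T d i * y0 i) + x * \<pi> ^ a * \<alpha> d * s"
      unfolding s_def sum_distrib_left sum.distrib[symmetric]
      by (rule sum.cong) (use symmD[OF T _ cd(2)] in \<open>auto simp: algebra_simps\<close>)
    also have "(\<Sum>i<n. T d i * y0 i) = \<pi> ^ a * \<alpha> d" by (rule y0(2)[OF cd(2)])
    finally have "congr n (A x) T c d - (T c d + u * (\<alpha> c * \<alpha> d)) = (\<pi> ^ a * (\<alpha> c * \<alpha> d)) * (2 * x + x * x * s - u')"
      unfolding uu by (simp add: algebra_simps)
    then show "congr n (A x) T c d - (T c d + u * (\<alpha> c * \<alpha> d)) \<in> pp N"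
      using pp_subset_0[OF pi_power_in[of a]] al[OF cd(1)] al[OF cd(2)] x(2) by (simp only:) (intro pp_mult_left)
  qed
  ultimately show ?thesis by simp
qed

section \<open>The recursion for an orthogonal vector of large norm\<close>

lemma dens_lower_stab:
  assumes U: "unimodular m M" and j: "j < n" and T: "symm n T" and c: "\<And>i. i < j \<Longrightarrow> c i \<in> pp 0"
    and st: "stab M n (congr n (step j c) T) j N0 w" and N: "N0 + 2 \<le> N"
  shows "dens M n (lower j N) (congr n (step j c) T) j N * q ^ prec n (lower j N) = w"
proof (rule dens_refine[OF U, where T = "congr n (step j c) T" and ?N0.0 = N0])
  show "1 \<le> N" "j \<le> n" using N j by auto
  show "dens M n (\<lambda>_ _. N) T'' j N * q ^ prec n (\<lambda>_ _. N) = w"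
    if "\<And>c e. c < n \<Longrightarrow> e < n \<Longrightarrow> T'' c e = T'' e c" "\<And>a e. a < n \<Longrightarrow> e < n \<Longrightarrow> T'' a e - congr n (step j c) T a e \<in> pp N0" for T''
    by (rule stabD[OF st]) (use that N in \<open>auto simp: symm_def\<close>)
  show "N0 \<le> lower j N a e \<and> lower j N a e \<le> N" for a e
    using N by (auto simp: lower_def of_bool_def)
  show "congr n (step j c) T a e = congr n (step j c) T e a" if "a < n" "e < n" for a e
    using symmD[OF symm_congr[OF T] that] .
qed simp

text \<open>The added vector comes first, so that its divisibility by \<open>\<pi>\<close> is the
  case \<open>j = 0\<close> of \<open>dens_step\<close>.\<close>

definition extend :: "'a \<Rightarrow> (nat \<Rightarrow> nat \<Rightarrow> 'a) \<Rightarrow> nat \<Rightarrow> nat \<Rightarrow> 'a" where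
  "extend t T = case_nat (case_nat t (\<lambda>_. 0)) (\<lambda>i. case_nat 0 (T i))"

lemma extend_simps: "extend t T 0 0 = t" "extend t T 0 (Suc i) = 0" "extend t T (Suc i) 0 = 0"
  "extend t T (Suc i) (Suc l) = T i l"
  by (simp_all add: extend_def)

lemma symm_extend: "symm n T \<Longrightarrow> symm (Suc n) (extend t T)"
  unfolding symm_def by (auto simp: less_Suc_eq_0_disj extend_simps)

lemma detm_extend: "detm (Suc n) (extend t T) = t * detm n T"
  by (subst detm_block) (simp_all add: extend_simps)

text \<open>The split of \<open>dens_step\<close> is applied at \<open>j = 0\<close> only. Up to
  congruence there is then a single, empty coefficient tuple, and the remaining vectors stay
  unrestricted, so that the flat term is a full density and not a primitive one.\<close>

lemma density_recursion:
  assumes S: "signed m e M" and T: "symm n T" and t: "t \<in> pp (Suc a)"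
    and sol: "\<And>\<alpha>. \<alpha> \<in> tup n (pp 0) \<Longrightarrow> \<exists>y. \<forall>i<n. y i \<in> pp 0 \<and> (\<Sum>l<n. T i l * y l) = \<pi> ^ a * \<alpha> i"
    and flat: "\<And>M'. m \<ge> 2 \<Longrightarrow> signed (m - 2) e M' \<Longrightarrow> stab M' n T 0 N1 wb"
    and tilde: "stab M (Suc n) (congr (Suc n) (step 0 (\<lambda>_. 0)) (extend t T)) 0 N2 w'"
    and L: "stab M (Suc n) (extend t T) 0 N3 w"
  shows "w = q * (qform m e 0 - 1 / q ^ m) * wb + q ^ (n + 2) / q ^ m * w'"
proof -
  note U = signedD(1)[OF S] and UM = unimodularD[OF signedD(1)[OF S]]
  let ?T = "extend t T"
  \<comment> \<open>Beyond the three thresholds, with two digits to spare for the division by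
    \<open>\<pi>\<close>.\<close>
  define N where "N = N1 + N2 + N3 + 2"
  have N: "N1 \<le> N" "N2 + 2 \<le> N" "N3 \<le> N" "2 \<le> N" "1 \<le> N" unfolding N_def by auto
  have t1: "t \<in> pp 1" using pp_mono[OF _ t, of 1] by simp
  have sT: "symm (Suc n) ?T" by (rule symm_extend[OF T])
  have p: "prec (Suc n) (\<lambda>_ _. N) = prec (Suc n) (lower 0 N) + (n + 2)" using prec_lower[of 0 "Suc n" N] N by simp
  have p2: "prec (Suc n) (\<lambda>_ _. N) = prec n (\<lambda>_ _. N) + n * N + N"
    unfolding prec_def by (simp add: algebra_simps)
  have "card (coeffs 0) = 1" using avg_tup_0(2)[of "pp 0" "pp 1"] unfolding grp_index_def .
  moreover have "step 0 c = step 0 (\<lambda>_. 0)" for c by (auto simp: step_def fun_eq_iff)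
  ultimately have sum: "(\<Sum>c\<in>coeffs 0. dens M (Suc n) (lower 0 N) (congr (Suc n) (step 0 c) ?T) 0 N / q ^ m) =
      dens M (Suc n) (lower 0 N) (congr (Suc n) (step 0 (\<lambda>_. 0)) ?T) 0 N / q ^ m"
    by (metis (no_types, lifting) card_1_singletonE sum.cong finite.emptyI sum.insert sum.empty empty_iff add.right_neutral)
  have w'e: "dens M (Suc n) (lower 0 N) (congr (Suc n) (step 0 (\<lambda>_. 0)) ?T) 0 N * q ^ prec (Suc n) (lower 0 N) = w'"
    by (rule dens_lower_stab[OF U _ sT _ tilde N(2)]) auto
  have d1: "dens M (Suc n) (\<lambda>_ _. N) ?T (Suc 0) N =
    avg M (mul N M) (\<lambda>v. of_bool (b v v - ?T 0 0 \<in> pp N \<and> v \<notin> mul 1 M)) * (wb / q ^ prec n (\<lambda>_ _. N)) / q ^ (n * N)"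
  proof (rule dens_isotropic[OF U _ N(5)])
    show "?T 0 0 \<in> pp 1" "0 \<le> n" using t1 by (auto simp: extend_simps)
    show "?T 0 (Suc i) \<in> pp N" for i by (simp add: extend_simps)
    fix v x \<alpha> assume v: "v \<in> M" "x \<in> M" "b v v - ?T 0 0 \<in> pp N" "b v x = 1" and \<alpha>: "\<alpha> \<in> tup n (pp 0)"
    have v1: "b v v \<in> pp 1" using pp_cong_iff[OF pp_mono[OF N(5) v(3)]] t1 by (simp add: extend_simps)
    note SP = signed_perp[OF S v(1,2) v1 v(4)] and m2 = iso_split(4)[OF U v(1,2) v1 v(4)]
    define z where "z = 1 - b v v * b x x"
    have z: "z \<in> pp 0" unfolding z_def using UM(2) v by (intro pp_diff pp_mult_left) auto
    have "dens (perp M v x) n (\<lambda>_ _. N) (\<lambda>i l. ?T (Suc i) (Suc l) + b v v * z * (\<alpha> i * \<alpha> l)) 0 N =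
      dens (perp M v x) n (\<lambda>_ _. N) (\<lambda>i l. T i l + t * z * (\<alpha> i * \<alpha> l)) 0 N"
    proof (rule dens_cong_entries)
      fix c d assume cd: "c \<le> d" "d < n"
      have "?T (Suc c) (Suc d) + b v v * z * (\<alpha> c * \<alpha> d) - (T c d + t * z * (\<alpha> c * \<alpha> d)) = (b v v - ?T 0 0) * (z * (\<alpha> c * \<alpha> d))"
        by (simp add: extend_simps algebra_simps)
      also have "\<dots> \<in> pp N" using v(3) z tupD(1)[OF \<alpha>] cd by (intro pp_mult_right pp_mult_left) auto
      finally show "?T (Suc c) (Suc d) + b v v * z * (\<alpha> c * \<alpha> d) - (T c d + t * z * (\<alpha> c * \<alpha> d)) \<in> pp N" .
    qed
    also have "\<dots> = dens (perp M v x) n (\<lambda>_ _. N) T 0 N"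
      by (rule dens_rank_one[OF signedD(1)[OF SP] T N(5) pp_mult_right[OF t z] \<alpha> sol[OF \<alpha>]])
    also have "\<dots> = wb / q ^ prec n (\<lambda>_ _. N)"
      using stabD[OF flat[OF m2 SP] N(1,5) T] q_pos by (simp add: field_simps)
    finally show "dens (perp M v x) n (\<lambda>_ _. N) (\<lambda>i l. ?T (Suc i) (Suc l) + b v v * (1 - b v v * b x x) * (\<alpha> i * \<alpha> l)) 0 N = wb / q ^ prec n (\<lambda>_ _. N)"
      unfolding z_def .
  qed
  have "dens M (Suc n) (\<lambda>_ _. N) ?T (Suc 0) N * q ^ prec (Suc n) (\<lambda>_ _. N) =
      (avg M (mul N M) (\<lambda>v. of_bool (b v v - t \<in> pp N \<and> v \<notin> mul 1 M)) * q ^ N) * wb"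
    unfolding d1 p2 power_add extend_simps using q_pos by (simp add: field_simps)
  also have "\<dots> = q * (qform m e 0 - 1 / q ^ m) * wb"
    unfolding avg_isotropic_lift[OF S t1 N(5)] ..
  finally have A: "dens M (Suc n) (\<lambda>_ _. N) ?T (Suc 0) N * q ^ prec (Suc n) (\<lambda>_ _. N) = q * (qform m e 0 - 1 / q ^ m) * wb" .
  have B: "dens M (Suc n) (lower 0 N) (congr (Suc n) (step 0 (\<lambda>_. 0)) ?T) 0 N / q ^ m * q ^ prec (Suc n) (\<lambda>_ _. N) = q ^ (n + 2) / q ^ m * w'"
    unfolding w'e[symmetric] p power_add by (simp add: mult_ac)
  have "w = dens M (Suc n) (\<lambda>_ _. N) ?T 0 N * q ^ prec (Suc n) (\<lambda>_ _. N)"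
    by (rule stabD[OF L N(3,5) sT, symmetric]) simp
  also have "dens M (Suc n) (\<lambda>_ _. N) ?T 0 N = dens M (Suc n) (\<lambda>_ _. N) ?T (Suc 0) N +
      dens M (Suc n) (lower 0 N) (congr (Suc n) (step 0 (\<lambda>_. 0)) ?T) 0 N / q ^ m"
    unfolding sum[symmetric] by (rule dens_step[OF U _ symmD[OF sT] N(4)]) auto
  finally show ?thesis unfolding distrib_right A B .
qed

text \<open>The zero of \<open>F\<close> at 1 cannot come from \<open>P\<close>, which is positive
  there; so it comes from the linear factor.\<close>

lemma root_of_quotient:
  fixes c :: real
  assumes "if U then [:1, - c:] * P = F else \<exists>Q. P = F * Q" "poly F 1 = 0" "poly P 1 > 0" shows "c = 1"
proof (cases U)
  case True
  then have "poly ([:1, - c:] * P) 1 = poly F 1" using assms(1) by metis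
  then have "(1 - c) * poly P 1 = 0" unfolding poly_mult assms(2) by simp
  then show ?thesis using assms(3) by simp
next
  case False
  then obtain Q where "P = F * Q" using assms(1) by metis
  then show ?thesis using assms(2,3) by simp
qed

text \<open>A lattice represents its own Gram matrix primitively, whereas the polynomial of \<open>prim_poly_flat\<close> vanishes at \<open>X = 1\<close>
  if the signs disagree.\<close>

lemma sign_of_basis:
  assumes S: "signed m e M" and m: "m \<ge> 1" and \<phi>: "\<phi> \<in> tup m M" and ind: "indep M m \<phi>"
  shows "eta (disc m (\<lambda>i l. b (\<phi> i) (\<phi> l))) = e"
proof -
  note U = signedD(1)[OF S] and UM = unimodularD[OF signedD(1)[OF S]]
  let ?T = "\<lambda>i l. b (\<phi> i) (\<phi> l)"
  have T: "symint m ?T" unfolding symint_def using UM(2) tupD(1)[OF \<phi>] B_sym by auto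
  from prim_poly_flat[OF signedD(2)[OF S] T] obtain P where P: "prim_poly (int m) e m ?T P \<and>
    (if unit (detm m ?T) then [:1, - (e * eta (disc m ?T)):] * P = Fpol (int m) e else \<exists>Q. P = Fpol (int m) e * Q)" ..
  have "dens M m one ?T m 1 > 0"
    unfolding dens_def
    by (rule avg_pos[OF fin_quot_tup[OF UM(4)] periodic_of_bool[OF periodic_gram_indep[OF U]] _ \<phi>])
      (use ind in \<open>auto simp: gram_def\<close>)
  then have "dprim M m ?T > 0" unfolding dprim_def using q_pos by simp
  moreover have "dprim M m ?T = poly P 1"
    using P[THEN conjunct1, unfolded prim_poly_def, rule_format, of m 0 M] S by simp
  ultimately have P1: "poly P 1 > 0" by simp
  have "Fpol (int m) e = quad 0 * Npol (int m) e" by (rule Fpol_Npol) (use m in simp)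
  then have F1: "poly (Fpol (int m) e) 1 = 0" by (simp add: quad_def)
  have "e * eta (disc m ?T) = 1" by (rule root_of_quotient[OF P[THEN conjunct2] F1 P1])
  then have "e * e * eta (disc m ?T) = e" unfolding mult.assoc by (simp only: mult_1_right)
  then show ?thesis unfolding signedD(2)[OF S] by (simp only: mult_1_left)
qed

end

section \<open>Counting representations\<close>

lemma (in vector_space) lattice_basis_unique:
  assumes L: "lattice_basis val scale r bs L" and e: "(\<Sum>i<r. scale (c i) (bs i)) = (\<Sum>i<r. scale (c' i) (bs i))" and i: "i < r"
  shows "c i = c' i"
proof -
  have L': "inj_on bs {..<r}" "independent (bs ` {..<r})" using L unfolding lattice_basis_def by auto
  have "(\<Sum>i<r. scale (c i - c' i) (bs i)) = 0" using e by (simp add: scale_left_diff_distrib sum_subtractf)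
  then have s: "(\<Sum>v\<in>bs ` {..<r}. scale ((\<lambda>v. c (inv_into {..<r} bs v) - c' (inv_into {..<r} bs v)) v) v) = 0"
    by (simp add: sum.reindex[OF L'(1)] inv_into_f_f[OF L'(1)])
  have "bs i \<in> bs ` {..<r}" using i by simp
  from independentD[OF L'(2) _ subset_refl s this] have "c (inv_into {..<r} bs (bs i)) - c' (inv_into {..<r} bs (bs i)) = 0" by simp
  then show ?thesis using inv_into_f_f[OF L'(1), of i] i by simp
qed

lemma (in vector_space) lattice_basisI:
  assumes ind: "\<And>c. (\<Sum>i<r. scale (c i) (bs i)) = 0 \<Longrightarrow> \<forall>i<r. c i = 0"
    and L: "L = {\<Sum>i<r. scale (c i) (bs i) | c. \<forall>i<r. c i \<in> integers val}"
  shows "lattice_basis val scale r bs L"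
proof -
  have inj: "inj_on bs {..<r}"
  proof (rule inj_onI)
    fix i l assume il: "i \<in> {..<r}" "l \<in> {..<r}" "bs i = bs l"
    have d: "(\<Sum>k<r. scale (of_bool (k = j)) (bs k)) = bs j" if "j < r" for j
    proof -
      have "(\<Sum>k<r. scale (of_bool (k = j)) (bs k)) = (\<Sum>k<r. if k = j then bs k else 0)" by (rule sum.cong) auto
      then show ?thesis using that by simp
    qed
    have "(\<Sum>k<r. scale (of_bool (k = i) - of_bool (k = l)) (bs k)) = 0"
      using il d[of i] d[of l] by (simp add: scale_left_diff_distrib sum_subtractf)
    from ind[OF this] show "i = l" using il(1) by (auto split: if_splits simp: of_bool_def)
  qed
  have "independent (bs ` {..<r})"
  proof (rule independent_if_scalars_zero)
    fix f v assume s: "(\<Sum>v\<in>bs ` {..<r}. scale (f v) v) = 0" and v: "v \<in> bs ` {..<r}"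
    have "(\<Sum>i<r. scale (f (bs i)) (bs i)) = 0" using s by (simp add: sum.reindex[OF inj])
    from ind[OF this] show "f v = 0" using v by auto
  qed simp
  then show ?thesis unfolding lattice_basis_def using inj L by blast
qed

context quadratic_lattices begin

text \<open>The target may live in a different type: densities are wanted for lattices in spaces of
  sequences, while the polynomials are obtained in one fixed space.\<close>

definition lin_isometry :: "'w set \<Rightarrow> ('a \<Rightarrow> 'u::ab_group_add \<Rightarrow> 'u) \<Rightarrow> ('u \<Rightarrow> 'u \<Rightarrow> 'a) \<Rightarrow> 'u set \<Rightarrow> ('w \<Rightarrow> 'u) \<Rightarrow> bool" where
  "lin_isometry M sM BM M' h \<longleftrightarrow> bij_betw h M M' \<and> (\<forall>x\<in>M. \<forall>y\<in>M. h (x + y) = h x + h y) \<and>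
     (\<forall>c\<in>pp 0. \<forall>x\<in>M. h (scale c x) = sM c (h x)) \<and> (\<forall>x\<in>M. \<forall>y\<in>M. BM (h x) (h y) = b x y)"

lemma lin_isometryD:
  assumes "lin_isometry M sM BM M' h"
  shows "bij_betw h M M'" "x \<in> M \<Longrightarrow> y \<in> M \<Longrightarrow> h (x + y) = h x + h y"
    "c \<in> pp 0 \<Longrightarrow> x \<in> M \<Longrightarrow> h (scale c x) = sM c (h x)" "x \<in> M \<Longrightarrow> y \<in> M \<Longrightarrow> BM (h x) (h y) = b x y"
    "x \<in> M \<Longrightarrow> h x \<in> M'"
  using assms unfolding lin_isometry_def by (blast dest: bij_betw_apply)+

definition cls :: "'w set \<Rightarrow> nat \<Rightarrow> ('w \<Rightarrow> 'u) \<Rightarrow> 'w \<Rightarrow> 'u set" where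
  "cls M N h x = h ` {y \<in> M. y - x \<in> mul N M}"

lemma cls_mem_iff:
  assumes "lin_isometry M sM BM M' h" "y \<in> M"
  shows "h y \<in> cls M N h x \<longleftrightarrow> y - x \<in> mul N M"
  using inj_on_image_mem_iff[of h M y "{y \<in> M. y - x \<in> mul N M}"] bij_betw_imp_inj_on[OF lin_isometryD(1)[OF assms(1)]] assms(2)
  unfolding cls_def by auto

lemma cls_eq_iff:
  assumes U: "unimodular m M" and h: "lin_isometry M sM BM M' h" and x: "x \<in> M" "y \<in> M"
  shows "cls M N h x = cls M N h y \<longleftrightarrow> x - y \<in> mul N M"
proof
  have sg: "subgrp (mul N M)" using fin_quotD(2)[OF unimodularD(4)[OF U]] .
  assume "cls M N h x = cls M N h y"
  then have "h x \<in> cls M N h y" using cls_mem_iff[OF h x(1), of N x] subgrpD(1)[OF sg] by simp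
  then show "x - y \<in> mul N M" using cls_mem_iff[OF h x(1)] by simp
next
  have sg: "subgrp (mul N M)" using fin_quotD(2)[OF unimodularD(4)[OF U]] .
  assume "x - y \<in> mul N M"
  then show "cls M N h x = cls M N h y" unfolding cls_def using subgrp_diff_cong(2)[OF sg] by blast
qed

lemma mul_iff_frac_ideal:
  assumes "omod M" shows "v \<in> mul N M \<longleftrightarrow> (\<exists>c\<in>pp N. \<exists>z\<in>M. v = scale c z)"
proof
  assume "v \<in> mul N M"
  then show "\<exists>c\<in>pp N. \<exists>z\<in>M. v = scale c z" unfolding mul_def using pi_power_in by blast
qed (use scale_pp_mem[OF assms] in blast)

lemma lattice_mod_eq:
  assumes U: "unimodular m M" and h: "lin_isometry M sM BM M' h"
  shows "lattice_mod val sM M' N = cls M N h ` M"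
proof -
  note UM = unimodularD[OF U]
  have sg: "subgrp (mul N M)" using fin_quotD(2)[OF UM(4)] .
  let ?R = "{(w, w'). w \<in> M' \<and> w' \<in> M' \<and> (\<exists>c\<in>frac_ideal val (int N). \<exists>z\<in>M'. w' - w = sM c z)}"
  have im: "M' = h ` M" using lin_isometryD(1)[OF h] bij_betw_imp_surj_on by metis
  have hd: "h (y - x) = h y - h x" if "x \<in> M" "y \<in> M" for x y
    using lin_isometryD(2)[OF h omodD(5)[OF UM(1) that(2,1)] that(1)] by (simp add: algebra_simps)
  have sM: "h (scale c z) = sM c (h z)" if "c \<in> pp N" "z \<in> M" for c z
    by (rule lin_isometryD(3)[OF h pp_subset_0[OF that(1)] that(2)])
  have rel: "(\<exists>c\<in>frac_ideal val (int N). \<exists>z\<in>M'. h y - h x = sM c z) \<longleftrightarrow> y - x \<in> mul N M" if xy: "x \<in> M" "y \<in> M" for x y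
  proof -
    have "h (y - x) = sM c (h z) \<longleftrightarrow> y - x = scale c z" if "c \<in> pp N" "z \<in> M" for c z
      unfolding sM[OF that, symmetric]
      by (rule inj_on_eq_iff[OF bij_betw_imp_inj_on[OF lin_isometryD(1)[OF h]]])
        (use omodD(5)[OF UM(1) xy(2,1)] omodD(3)[OF UM(1) pp_subset_0[OF that(1)] that(2)] in auto)
    then show ?thesis unfolding mul_iff_frac_ideal[OF UM(1)] hd[OF xy, symmetric] im pp_def by (simp cong: bex_cong)
  qed
  have "?R `` {h x} = cls M N h x" if x: "x \<in> M" for x
    unfolding cls_def using rel[OF x] x im by auto
  then show ?thesis unfolding lattice_mod_def quotient_def im by auto
qed

text \<open>A representation is determined by its values on a basis, and \<open>\<Phi>\<close>
  extends a tuple linearly through the coordinates. The factor in front is the number of all tuples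
  modulo \<open>\<pi> ^ N\<close>.\<close>

lemma card_Rep:
  assumes U: "unimodular m M" and h: "lin_isometry M sM BM M' h"
    and V: "quadratic_space sL BL" and L: "lattice_basis val sL n bs L" and N: "1 \<le> N"
  shows "real (card (Rep val sM BM M' sL BL L N)) = q ^ (m * n * N) * dens M n (\<lambda>_ _. N) (\<lambda>i l. BL (bs i) (bs l)) 0 N"
proof -
  interpret V: quadratic_lattices val \<pi> sL BL by (rule quadratic_lattices.intro[OF odd_local_field_axioms V])
  note UM = unimodularD[OF U]
  let ?T = "\<lambda>i l. BL (bs i) (bs l)"
  let ?R = "quot_reps (tup n M) (tup n (mul N M))"
  note fq = fin_quot_tup[OF UM(4), of n N]
  have sg: "subgrp (mul N M)" using fin_quotD(2)[OF UM(4)] .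
  define lc where "lc c = (\<Sum>i<n. sL (c i) (bs i))" for c
  define sp where "sp c \<phi> = (\<Sum>i<n. scale (c i) (\<phi> i))" for c and \<phi> :: "nat \<Rightarrow> 'w"
  have Leq: "L = {lc c | c. \<forall>i<n. c i \<in> pp 0}" using L unfolding lattice_basis_def lc_def pp_0 by blast
  \<comment> \<open>Coordinates of \<open>u\<close>; as they are unique below \<open>n\<close>,
    combinations formed with them do not depend on the choice, see \<open>sp_co\<close>.\<close>
  define co where "co u = (SOME c. (\<forall>i<n. c i \<in> pp 0) \<and> u = lc c)" for u
  have co: "(\<forall>i<n. co u i \<in> pp 0) \<and> u = lc (co u)" if "u \<in> L" for u
  proof -
    have "\<exists>c. (\<forall>i<n. c i \<in> pp 0) \<and> u = lc c" using that unfolding Leq by blast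
    then show ?thesis unfolding co_def by (rule someI_ex)
  qed
  have LcI: "lc c \<in> L" if "\<forall>i<n. c i \<in> pp 0" for c using that unfolding Leq by blast
  have LE: "\<exists>c. (\<forall>i<n. c i \<in> pp 0) \<and> u = lc c" if "u \<in> L" for u using co[OF that] by blast
  have sp_mem: "sp c \<phi> \<in> M" if "\<forall>i<n. c i \<in> pp 0" "\<phi> \<in> tup n M" for c \<phi>
    unfolding sp_def by (rule omod_sum[OF UM(1)], rule omodD(3)[OF UM(1)]) (use that tupD(1)[OF that(2)] in auto)
  have sp_co: "sp (co (lc c)) \<phi> = sp c \<phi>" if "\<forall>i<n. c i \<in> pp 0" for c \<phi>
  proof -
    have "lc c = lc (co (lc c))" by (rule co[OF LcI[OF that], THEN conjunct2])
    note u = V.lattice_basis_unique[OF L this[unfolded lc_def], folded lc_def]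
    show ?thesis unfolding sp_def by (rule sum.cong[OF refl]) (simp add: u[symmetric])
  qed
  have lc_add: "lc c + lc d = lc (\<lambda>i. c i + d i)" for c d unfolding lc_def by (simp add: V.scale_left_distrib sum.distrib)
  have lc_scale: "sL a (lc c) = lc (\<lambda>i. a * c i)" for a c unfolding lc_def by (simp add: V.scale_sum_right)
  have sp_add: "sp (\<lambda>i. c i + d i) \<phi> = sp c \<phi> + sp d \<phi>" for c d \<phi> unfolding sp_def by (simp add: scale_left_distrib sum.distrib)
  have sp_scale: "sp (\<lambda>i. a * c i) \<phi> = scale a (sp c \<phi>)" for a c \<phi> unfolding sp_def by (simp add: scale_sum_right)
  have hd: "h x \<in> cls M N h y \<longleftrightarrow> x - y \<in> mul N M" if "x \<in> M" for x y by (rule cls_mem_iff[OF h that])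
  have clsE: "\<exists>y\<in>M. x = h y \<and> y - s \<in> mul N M" if "x \<in> cls M N h s" for x s using that unfolding cls_def by blast
  have L_add: "u + v \<in> L" if uv: "u \<in> L" "v \<in> L" for u v
  proof -
    obtain c d where c: "\<forall>i<n. c i \<in> pp 0" "u = lc c" and d: "\<forall>i<n. d i \<in> pp 0" "v = lc d" using LE[OF uv(1)] LE[OF uv(2)] by blast
    have "\<forall>i<n. c i + d i \<in> pp 0" using c(1) d(1) pp_add by blast
    then show ?thesis unfolding c(2) d(2) lc_add by (rule LcI)
  qed
  define \<Phi> where "\<Phi> \<phi> = (\<lambda>u\<in>L. cls M N h (sp (co u) \<phi>))" for \<phi>
  define C where "C = {\<phi> \<in> ?R. gram n (\<lambda>_ _. N) ?T \<phi>}"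
  have Rm: "\<phi> \<in> tup n M" if "\<phi> \<in> C" for \<phi> using that fin_quotD(5)[OF fq] unfolding C_def by blast
  have form: "b (sp c \<phi>) (sp d \<phi>) - BL (lc c) (lc d) \<in> pp N"
    if g: "\<forall>i<n. \<forall>l<n. b (\<phi> i) (\<phi> l) - ?T i l \<in> pp N" and cd: "\<forall>i<n. c i \<in> pp 0" "\<forall>i<n. d i \<in> pp 0" for \<phi> c d
  proof -
    have "b (sp c \<phi>) (sp d \<phi>) - BL (lc c) (lc d) = (\<Sum>i<n. \<Sum>l<n. c i * (d l * (b (\<phi> i) (\<phi> l) - ?T i l)))"
    proof -
      have 1: "b (sp c \<phi>) (sp d \<phi>) = (\<Sum>i<n. \<Sum>l<n. c i * (d l * b (\<phi> i) (\<phi> l)))"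
        unfolding sp_def by (simp only: B_sum B_scale, simp only: B_sum_right B_scale_right sum_distrib_left)
      have 2: "BL (lc c) (lc d) = (\<Sum>i<n. \<Sum>l<n. c i * (d l * ?T i l))"
        unfolding lc_def by (simp only: V.B_sum V.B_scale, simp only: V.B_sum_right V.B_scale_right sum_distrib_left)
      show ?thesis unfolding 1 2 by (simp only: right_diff_distrib sum_subtractf)
    qed
    also have "\<dots> \<in> pp N" by (rule pp_sum, rule pp_sum, rule pp_mult_left[OF _ pp_mult_left]) (use g cd in auto)
    finally show ?thesis .
  qed
  have gram: "\<forall>i<n. \<forall>l<n. b (\<phi> i) (\<phi> l) - ?T i l \<in> pp N" if "gram n (\<lambda>_ _. N) ?T \<phi>" for \<phi>
  proof (intro allI impI)
    fix i l assume "i < n" "l < n"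
    then show "b (\<phi> i) (\<phi> l) - ?T i l \<in> pp N"
      using that[unfolded gram_def, rule_format, of l i] that[unfolded gram_def, rule_format, of i l]
      unfolding B_sym[of "\<phi> l" "\<phi> i"] V.B_sym[of "bs l" "bs i"] by (cases "i \<le> l") simp_all
  qed
  have e: "lc (\<lambda>l. of_bool (l = i)) = bs i" "sp (\<lambda>l. of_bool (l = i)) \<phi> = \<phi> i" if "i < n" for i \<phi>
  proof -
    have "lc (\<lambda>l. of_bool (l = i)) = (\<Sum>l<n. if l = i then bs l else 0)" unfolding lc_def by (rule sum.cong) auto
    then show "lc (\<lambda>l. of_bool (l = i)) = bs i" using that by simp
    have "sp (\<lambda>l. of_bool (l = i)) \<phi> = (\<Sum>l<n. if l = i then \<phi> l else 0)" unfolding sp_def by (rule sum.cong) auto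
    then show "sp (\<lambda>l. of_bool (l = i)) \<phi> = \<phi> i" using that by simp
  qed
  have bs: "bs i \<in> L" "sp (co (bs i)) \<phi> = \<phi> i" if "i < n" for i \<phi>
  proof -
    have ob: "\<forall>l<n. of_bool (l = i) \<in> pp 0" by simp
    show "bs i \<in> L" using LcI[OF ob] unfolding e(1)[OF that] .
    show "sp (co (bs i)) \<phi> = \<phi> i" using sp_co[OF ob, of \<phi>] unfolding e(1)[OF that] e(2)[OF that] .
  qed
  have "bij_betw \<Phi> C (Rep val sM BM M' sL BL L N)"
  proof (rule bij_betw_imageI)
    show "inj_on \<Phi> C"
    proof (rule inj_onI)
      fix \<phi> \<psi> assume C: "\<phi> \<in> C" "\<psi> \<in> C" and eq: "\<Phi> \<phi> = \<Phi> \<psi>"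
      have "\<phi> i - \<psi> i \<in> mul N M" if "i < n" for i
      proof -
        have "\<Phi> \<phi> (bs i) = \<Phi> \<psi> (bs i)" using eq by simp
        then have "cls M N h (\<phi> i) = cls M N h (\<psi> i)" unfolding \<Phi>_def using bs[OF that] by simp
        then show ?thesis by (rule cls_eq_iff[OF U h tupD(1)[OF Rm[OF C(1)] that] tupD(1)[OF Rm[OF C(2)] that], THEN iffD1])
      qed
      moreover have "(\<phi> - \<psi>) i = 0" if "i \<ge> n" for i using tupD(2)[OF Rm[OF C(1)] that] tupD(2)[OF Rm[OF C(2)] that] by simp
      ultimately have "\<phi> - \<psi> \<in> tup n (mul N M)" unfolding tup_def by simp
      moreover have "\<phi> \<in> ?R" "\<psi> \<in> ?R" using C unfolding C_def by simp_all
      ultimately show "\<phi> = \<psi>" using transversal_quot_reps[OF fq] unfolding transversal_def by blast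
    qed
    show "\<Phi> ` C = Rep val sM BM M' sL BL L N"
    proof (intro equalityI subsetI)
      fix g assume "g \<in> \<Phi> ` C"
      then obtain \<phi> where \<phi>: "\<phi> \<in> C" "g = \<Phi> \<phi>" by blast
      have g: "g (lc c) = cls M N h (sp c \<phi>)" if "\<forall>i<n. c i \<in> pp 0" for c
        unfolding \<phi>(2) \<Phi>_def by (simp add: LcI[OF that] sp_co[OF that])
      note t = Rm[OF \<phi>(1)]
      have gr: "\<forall>i<n. \<forall>l<n. b (\<phi> i) (\<phi> l) - ?T i l \<in> pp N" using gram \<phi>(1) unfolding C_def by blast
      have 1: "g \<in> L \<rightarrow>\<^sub>E lattice_mod val sM M' N"
        unfolding \<phi>(2) \<Phi>_def lattice_mod_eq[OF U h] restrict_PiE_iff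
        by (intro ballI imageI sp_mem[OF _ t]) (rule co[THEN conjunct1])
      have 2: "\<forall>u\<in>L. \<forall>v\<in>L. \<forall>x\<in>g u. \<forall>y\<in>g v. x + y \<in> g (u + v)"
      proof (intro ballI)
        fix u v x y assume uv: "u \<in> L" "v \<in> L" "x \<in> g u" "y \<in> g v"
        obtain c d where c: "\<forall>i<n. c i \<in> pp 0" "u = lc c" and d: "\<forall>i<n. d i \<in> pp 0" "v = lc d" using LE[OF uv(1)] LE[OF uv(2)] by blast
        obtain x' where x': "x' \<in> M" "x = h x'" "x' - sp c \<phi> \<in> mul N M" using clsE[OF uv(3)[unfolded c(2) g[OF c(1)]]] by blast
        obtain y' where y': "y' \<in> M" "y = h y'" "y' - sp d \<phi> \<in> mul N M" using clsE[OF uv(4)[unfolded d(2) g[OF d(1)]]] by blast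
        have cd: "\<forall>i<n. c i + d i \<in> pp 0" using c(1) d(1) pp_add by blast
        have A: "x' + y' - (sp c \<phi> + sp d \<phi>) \<in> mul N M" using subgrpD(4)[OF sg x'(3) y'(3)] by (simp add: algebra_simps)
        show "x + y \<in> g (u + v)"
          unfolding c(2) d(2) lc_add g[OF cd] sp_add x'(2) y'(2) lin_isometryD(2)[OF h x'(1) y'(1), symmetric]
          by (rule hd[OF omodD(2)[OF UM(1) x'(1) y'(1)], THEN iffD2, OF A])
      qed
      have 3: "\<forall>a\<in>integers val. \<forall>u\<in>L. \<forall>x\<in>g u. sM a x \<in> g (sL a u)"
      proof (intro ballI)
        fix a u x assume a: "a \<in> integers val" and u: "u \<in> L" "x \<in> g u"
        have a0: "a \<in> pp 0" using a pp_0 by simp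
        obtain c where c: "\<forall>i<n. c i \<in> pp 0" "u = lc c" using LE[OF u(1)] by blast
        obtain x' where x': "x' \<in> M" "x = h x'" "x' - sp c \<phi> \<in> mul N M" using clsE[OF u(2)[unfolded c(2) g[OF c(1)]]] by blast
        have ac: "\<forall>i<n. a * c i \<in> pp 0" using c(1) pp_mult_left[OF a0] by blast
        have A: "scale a x' - scale a (sp c \<phi>) \<in> mul N M" using scale_mem_mul[OF UM(1) a0 x'(3)] by (simp add: scale_right_diff_distrib)
        show "sM a x \<in> g (sL a u)"
          unfolding c(2) lc_scale g[OF ac] sp_scale x'(2) lin_isometryD(3)[OF h a0 x'(1), symmetric]
          by (rule hd[OF omodD(3)[OF UM(1) a0 x'(1)], THEN iffD2, OF A])
      qed
      have 4: "\<forall>u\<in>L. \<forall>v\<in>L. \<forall>x\<in>g u. \<forall>y\<in>g v. BM x y - BL u v \<in> frac_ideal val (int N)"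
      proof (intro ballI)
        fix u v x y assume uv: "u \<in> L" "v \<in> L" "x \<in> g u" "y \<in> g v"
        obtain c d where c: "\<forall>i<n. c i \<in> pp 0" "u = lc c" and d: "\<forall>i<n. d i \<in> pp 0" "v = lc d" using LE[OF uv(1)] LE[OF uv(2)] by blast
        obtain x' where x': "x' \<in> M" "x = h x'" "x' - sp c \<phi> \<in> mul N M" using clsE[OF uv(3)[unfolded c(2) g[OF c(1)]]] by blast
        obtain y' where y': "y' \<in> M" "y = h y'" "y' - sp d \<phi> \<in> mul N M" using clsE[OF uv(4)[unfolded d(2) g[OF d(1)]]] by blast
        have "b x' y' - b (sp c \<phi>) (sp d \<phi>) \<in> pp N"
          by (rule B_cong[OF U x'(1) sp_mem[OF c(1) t] y'(1) sp_mem[OF d(1) t] x'(3) y'(3)])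
        from pp_add[OF this form[OF gr c(1) d(1)]] have "b x' y' - BL (lc c) (lc d) \<in> pp N" by simp
        then show "BM x y - BL u v \<in> frac_ideal val (int N)"
          unfolding c(2) d(2) x'(2) y'(2) lin_isometryD(4)[OF h x'(1) y'(1)] pp_def .
      qed
      show "g \<in> Rep val sM BM M' sL BL L N" unfolding Rep_def by (intro CollectI conjI 1 2 3 4)
    next
      fix g assume "g \<in> Rep val sM BM M' sL BL L N"
      note G = this[unfolded Rep_def lattice_mod_eq[OF U h] mem_Collect_eq pp_0[symmetric] pp_def[symmetric]]
      note g = G[THEN conjunct1] G[THEN conjunct2, THEN conjunct1, rule_format]
        G[THEN conjunct2, THEN conjunct2, THEN conjunct1, rule_format] G[THEN conjunct2, THEN conjunct2, THEN conjunct2, rule_format]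
      have gc: "\<exists>s\<in>M. g u = cls M N h s" if "u \<in> L" for u using PiE_mem[OF g(1) that] by blast
      have "\<forall>i. \<exists>s. i < n \<longrightarrow> s \<in> M \<and> h s \<in> g (bs i)"
      proof (intro allI)
        fix i show "\<exists>s. i < n \<longrightarrow> s \<in> M \<and> h s \<in> g (bs i)"
        proof (cases "i < n")
          case i: True
          obtain s where s: "s \<in> M" "g (bs i) = cls M N h s" using gc[OF bs(1)[OF i]] by blast
          have "h s \<in> g (bs i)" unfolding s(2) by (rule hd[OF s(1), THEN iffD2]) (simp add: subgrpD(1)[OF sg])
          then show ?thesis using s(1) by blast
        qed simp
      qed
      from choice[OF this] obtain s where s0: "\<forall>i. i < n \<longrightarrow> s i \<in> M \<and> h (s i) \<in> g (bs i)" ..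
      have s: "i < n \<Longrightarrow> s i \<in> M" "i < n \<Longrightarrow> h (s i) \<in> g (bs i)" for i using s0 by simp_all
      define \<psi> where "\<psi> i = (if i < n then s i else 0)" for i
      have \<psi>: "\<psi> \<in> tup n M" unfolding tup_def \<psi>_def using s(1) by simp
      obtain \<phi> where \<phi>: "\<phi> \<in> ?R" "\<psi> - \<phi> \<in> tup n (mul N M)"
        using transversal_quot_reps[OF fq] \<psi> unfolding transversal_def by blast
      have t: "\<phi> \<in> tup n M" using fin_quotD(5)[OF fq] \<phi>(1) by blast
      have h\<phi>: "h (\<phi> i) \<in> g (bs i)" if i: "i < n" for i
      proof -
        obtain r where r: "r \<in> M" "g (bs i) = cls M N h r" using gc[OF bs(1)[OF i]] by blast
        have 1: "s i - r \<in> mul N M" by (rule hd[OF s(1)[OF i], THEN iffD1, OF s(2)[OF i, unfolded r(2)]])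
        have "s i - \<phi> i \<in> mul N M" using tupD(1)[OF \<phi>(2) i] i by (simp add: \<psi>_def)
        from subgrpD(2)[OF sg 1 this] have "\<phi> i - r \<in> mul N M" by simp
        then show ?thesis unfolding r(2) by (rule hd[OF tupD(1)[OF t i], THEN iffD2])
      qed
      have zL: "0 \<in> L" using LcI[of "\<lambda>_. 0"] by (simp add: lc_def)
      \<comment> \<open>The condition at 0 is obtained by scaling an arbitrary value of
        \<open>g\<close> by 0.\<close>
      have hz: "h 0 \<in> g 0"
      proof -
        obtain r where r: "r \<in> M" "g 0 = cls M N h r" using gc[OF zL] by blast
        have "h r \<in> g 0" unfolding r(2) by (rule hd[OF r(1), THEN iffD2]) (simp add: subgrpD(1)[OF sg])
        from g(3)[OF pp_zero zL this] have "sM 0 (h r) \<in> g 0" by simp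
        then show ?thesis using lin_isometryD(3)[OF h pp_zero r(1)] by (simp add: V.scale_zero_left)
      qed
      \<comment> \<open>\<open>Rep\<close> provides additivity for two summands, so linear
        combinations are built up one basis vector at a time.\<close>
      have hsp: "(\<Sum>i<k. sL (c i) (bs i)) \<in> L \<and> (\<Sum>i<k. scale (c i) (\<phi> i)) \<in> M \<and> h (\<Sum>i<k. scale (c i) (\<phi> i)) \<in> g (\<Sum>i<k. sL (c i) (bs i))"
        if c: "\<forall>i<n. c i \<in> pp 0" and k: "k \<le> n" for c k
        using k
      proof (induction k)
        case 0
        show ?case using zL hz omodD(1)[OF UM(1)] by simp
      next
        case (Suc k)
        then have IH: "(\<Sum>i<k. sL (c i) (bs i)) \<in> L" "(\<Sum>i<k. scale (c i) (\<phi> i)) \<in> M"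
          "h (\<Sum>i<k. scale (c i) (\<phi> i)) \<in> g (\<Sum>i<k. sL (c i) (bs i))" by auto
        have k: "k < n" and ck: "c k \<in> pp 0" using Suc.prems c by auto
        have tk: "\<phi> k \<in> M" by (rule tupD(1)[OF t k])
        have 1: "sL (c k) (bs k) \<in> L"
        proof -
          have "\<forall>i<n. c k * of_bool (i = k) \<in> pp 0" using ck by simp
          from LcI[OF this] show ?thesis unfolding lc_scale[symmetric] e(1)[OF k] .
        qed
        have 2: "scale (c k) (\<phi> k) \<in> M" by (rule omodD(3)[OF UM(1) ck tk])
        have 3: "h (scale (c k) (\<phi> k)) \<in> g (sL (c k) (bs k))"
          unfolding lin_isometryD(3)[OF h ck tk] by (rule g(3)[OF ck bs(1)[OF k] h\<phi>[OF k]])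
        have "(\<Sum>i<k. sL (c i) (bs i)) + sL (c k) (bs k) \<in> L"
          by (rule L_add[OF IH(1) 1])
        moreover have "h ((\<Sum>i<k. scale (c i) (\<phi> i)) + scale (c k) (\<phi> k)) \<in> g ((\<Sum>i<k. sL (c i) (bs i)) + sL (c k) (bs k))"
          unfolding lin_isometryD(2)[OF h IH(2) 2] by (rule g(2)[OF IH(1) 1 IH(3) 3])
        ultimately show ?case using omodD(2)[OF UM(1) IH(2) 2] by simp
      qed
      have g_lc: "g (lc c) = cls M N h (sp c \<phi>)" if c: "\<forall>i<n. c i \<in> pp 0" for c
      proof -
        have k: "lc c \<in> L" "sp c \<phi> \<in> M" "h (sp c \<phi>) \<in> g (lc c)" using hsp[OF c order_refl] unfolding lc_def sp_def by auto
        obtain r where r: "r \<in> M" "g (lc c) = cls M N h r" using gc[OF k(1)] by blast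
        have "sp c \<phi> - r \<in> mul N M" by (rule hd[OF k(2), THEN iffD1, OF k(3)[unfolded r(2)]])
        then show ?thesis unfolding r(2) by (rule cls_eq_iff[OF U h k(2) r(1), THEN iffD2, symmetric])
      qed
      have "\<Phi> \<phi> = g"
      proof (rule ext)
        fix u show "\<Phi> \<phi> u = g u"
        proof (cases "u \<in> L")
          case True
          note c = co[OF this]
          show ?thesis unfolding \<Phi>_def using g_lc[OF c[THEN conjunct1]] True unfolding c[THEN conjunct2, symmetric] by simp
        next
          case False
          then show ?thesis unfolding \<Phi>_def using PiE_arb[OF g(1) False] by simp
        qed
      qed
      moreover have "gram n (\<lambda>_ _. N) ?T \<phi>"
        unfolding gram_def
      proof (intro allI impI)
        fix d c assume "d < n" "c \<le> d"
        then have l: "c < n" "d < n" by auto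
        have "BM (h (\<phi> c)) (h (\<phi> d)) - BL (bs c) (bs d) \<in> pp N"
          by (rule g(4)[OF bs(1)[OF l(1)] bs(1)[OF l(2)] h\<phi>[OF l(1)] h\<phi>[OF l(2)]])
        then show "b (\<phi> c) (\<phi> d) - BL (bs c) (bs d) \<in> pp N"
          unfolding lin_isometryD(4)[OF h tupD(1)[OF t l(1)] tupD(1)[OF t l(2)]] .
      qed
      ultimately show "g \<in> \<Phi> ` C" using \<phi>(1) by (intro image_eqI[of _ _ \<phi>]) (simp_all add: C_def)
    qed
  qed
  then have c: "card (Rep val sM BM M' sL BL L N) = card C" by (rule bij_betw_same_card[symmetric])
  have ind: "indep M 0 \<phi>" for \<phi> unfolding indep_def by simp
  have "(\<Sum>\<phi>\<in>?R. of_bool (gram n (\<lambda>_ _. N) ?T \<phi>)) = real (card C)"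
    unfolding C_def by (simp add: fin_quotD(4)[OF fq] Collect_conj_eq)
  moreover have "real (grp_index (tup n M) (tup n (mul N M))) = q ^ (m * n * N)"
    unfolding grp_index_tup[OF UM(4)] UM(6) by (simp add: power_mult[symmetric] mult_ac)
  ultimately show ?thesis unfolding c dens_def avg_def using q_pos by (simp add: ind)
qed

lemma prec_one: "prec n one = n * (n + 1) div 2"
proof -
  have "2 * prec n one = n * (n + 1)" by (induction n) (simp_all add: prec_one_Suc, simp add: prec_def)
  then show ?thesis by linarith
qed

text \<open>The exponent in \<open>Den\<close> and the precision
  \<open>N * (n * (n + 1) div 2)\<close> add up to \<open>m * n * N\<close>, the exponent in
  \<open>card_Rep\<close>. The sequence is therefore eventually constant.\<close>

lemma Den_stab:
  assumes U: "unimodular m M" and h: "lin_isometry M sM BM M' h"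
    and V: "quadratic_space sL BL" and L: "lattice_basis val sL n bs L" and n: "n \<le> m"
    and T: "\<And>i l. i < n \<Longrightarrow> l < n \<Longrightarrow> BL (bs i) (bs l) = T i l" and w: "stab M n T 0 N0 w"
  shows "Den val sM BM m M' sL BL n L = w"
proof -
  interpret V: quadratic_lattices val \<pi> sL BL by (rule quadratic_lattices.intro[OF odd_local_field_axioms V])
  let ?f = "\<lambda>N. real (card (Rep val sM BM M' sL BL L N)) / real q ^ (N * (m * n - (n * (n + 1)) div 2))"
  have "n * (n + 1) div 2 \<le> m * n"
  proof (cases n)
    case (Suc k)
    then have "n * (n + 1) div 2 \<le> n * (2 * n) div 2" by (intro div_le_mono mult_le_mono) auto
    also have "\<dots> \<le> m * n" using n by simp
    finally show ?thesis .
  qed simp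
  then have e: "N * (m * n - n * (n + 1) div 2) + prec n (\<lambda>_ _. N) = m * n * N" for N
    unfolding prec_const[of n N] prec_one distrib_left[symmetric] by (simp only: le_add_diff_inverse2 mult.commute)
  have "?f N = w" if "N \<ge> max N0 1" for N
  proof -
    have N: "N0 \<le> N" "1 \<le> N" using that by auto
    have sy: "symm n (\<lambda>i l. BL (bs i) (bs l))" unfolding symm_def using V.B_sym by blast
    have "real q ^ (m * n * N) = real q ^ (N * (m * n - n * (n + 1) div 2)) * real q ^ prec n (\<lambda>_ _. N)"
      by (simp only: e flip: power_add)
    then show ?thesis unfolding card_Rep[OF U h V L N(2)] using stabD[OF w N sy] T q_pos by (simp add: field_simps)
  qed
  then have "eventually (\<lambda>N. ?f N = w) sequentially" by (intro eventually_sequentiallyI[of "max N0 1"])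
  then have "?f \<longlonglongrightarrow> w" by (rule tendsto_eventually)
  then show ?thesis unfolding Den_def by (rule limI)
qed

text \<open>Coordinates identify \<open>M / \<pi> M\<close> with tuples over the residue field,
  which gives the index; the conditions on the form become conditions on the Gram matrix.\<close>

lemma unimodular_of_basis:
  assumes M: "lattice_basis val scale m w M"
    and int: "\<And>i l. i < m \<Longrightarrow> l < m \<Longrightarrow> b (w i) (w l) \<in> pp 0"
    and nondeg: "\<And>c. \<forall>i<m. c i \<in> pp 0 \<Longrightarrow> \<forall>l<m. (\<Sum>i<m. c i * b (w i) (w l)) \<in> pp 1 \<Longrightarrow> \<forall>i<m. c i \<in> pp 1"
  shows "unimodular m M"
proof -
  define f where "f c = (\<Sum>i<m. scale (c i) (w i))" for c
  have Meq: "M = {f c | c. \<forall>i<m. c i \<in> pp 0}" using M unfolding lattice_basis_def f_def pp_0 by blast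
  have fI: "f c \<in> M" if "\<forall>i<m. c i \<in> pp 0" for c using that unfolding Meq by blast
  have fE: "\<exists>c. (\<forall>i<m. c i \<in> pp 0) \<and> x = f c" if "x \<in> M" for x using that unfolding Meq by blast
  have f_add: "f c + f d = f (\<lambda>i. c i + d i)" for c d unfolding f_def by (simp add: scale_left_distrib sum.distrib)
  have f_diff: "f c - f d = f (\<lambda>i. c i - d i)" for c d unfolding f_def by (simp add: scale_left_diff_distrib sum_subtractf)
  have f_scale: "scale a (f c) = f (\<lambda>i. a * c i)" for a c unfolding f_def by (simp add: scale_sum_right)
  note f_inj = lattice_basis_unique[OF M, folded f_def]
  have om: "omod M"
    unfolding omod_def
  proof (intro conjI ballI)
    show "0 \<in> M" using fI[of "\<lambda>_. 0"] by (simp add: f_def)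
    fix x assume x: "x \<in> M"
    obtain c where c: "\<forall>i<m. c i \<in> pp 0" "x = f c" using fE[OF x] by blast
    show "x + y \<in> M" if y: "y \<in> M" for y
    proof -
      obtain d where d: "\<forall>i<m. d i \<in> pp 0" "y = f d" using fE[OF y] by blast
      have "\<forall>i<m. c i + d i \<in> pp 0" using c(1) d(1) pp_add by blast
      then show ?thesis unfolding c(2) d(2) f_add by (rule fI)
    qed
  next
    fix a x assume a: "a \<in> pp 0" and x: "x \<in> M"
    obtain c where c: "\<forall>i<m. c i \<in> pp 0" "x = f c" using fE[OF x] by blast
    have "\<forall>i<m. a * c i \<in> pp 0" using c(1) pp_mult_left[OF a] by blast
    then show "scale a x \<in> M" unfolding c(2) f_scale by (rule fI)
  qed
  have mul_iff: "f c \<in> mul 1 M \<longleftrightarrow> (\<forall>i<m. c i \<in> pp 1)" for c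
  proof
    assume "f c \<in> mul 1 M"
    then obtain y where y: "y \<in> M" "f c = scale (\<pi> ^ 1) y" unfolding mul_def by blast
    obtain d where d: "\<forall>i<m. d i \<in> pp 0" "y = f d" using fE[OF y(1)] by blast
    have "c i = \<pi> ^ 1 * d i" if "i < m" for i by (rule f_inj[OF _ that]) (use y(2) in \<open>simp only: d(2) f_scale\<close>)
    then show "\<forall>i<m. c i \<in> pp 1" using d(1) pp_mult_right[OF pi_power_in[of 1]] by simp
  next
    assume c: "\<forall>i<m. c i \<in> pp 1"
    have "\<forall>i<m. inverse \<pi> * c i \<in> pp 0"
    proof (intro allI impI)
      fix i assume "i < m"
      moreover have "\<pi> * (inverse \<pi> * c i) = c i" using pi_nonzero by simp
      ultimately have "\<pi> * (inverse \<pi> * c i) \<in> pp (Suc 0)" using c by (simp only: One_nat_def)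
      then show "inverse \<pi> * c i \<in> pp 0" unfolding pi_mult_iff .
    qed
    from fI[OF this] have "scale (\<pi> ^ 1) (f (\<lambda>i. inverse \<pi> * c i)) \<in> mul 1 M" unfolding scale_pi_mem_iff .
    moreover have "\<pi> ^ 1 * (inverse \<pi> * c i) = c i" for i using pi_nonzero by (simp flip: mult.assoc)
    ultimately show "f c \<in> mul 1 M" unfolding f_scale by (simp only:)
  qed
  have Bf: "b (f c) (f d) = (\<Sum>i<m. \<Sum>l<m. c i * (d l * b (w i) (w l)))" for c d
    unfolding f_def by (simp only: B_sum B_scale, simp only: B_sum_right B_scale_right sum_distrib_left)
  have integral: "b x y \<in> pp 0" if xy: "x \<in> M" "y \<in> M" for x y
  proof -
    obtain c d where c: "\<forall>i<m. c i \<in> pp 0" "x = f c" and d: "\<forall>i<m. d i \<in> pp 0" "y = f d" using fE[OF xy(1)] fE[OF xy(2)] by blast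
    show ?thesis unfolding c(2) d(2) Bf
      by (rule pp_sum, rule pp_sum, rule pp_mult_left[OF _ pp_mult_left]) (use int c d in auto)
  qed
  have nd: "x \<in> mul 1 M" if x: "x \<in> M" "\<forall>y\<in>M. b x y \<in> pp 1" for x
  proof -
    obtain c where c: "\<forall>i<m. c i \<in> pp 0" "x = f c" using fE[OF x(1)] by blast
    have "(\<Sum>i<m. c i * b (w i) (w l)) \<in> pp 1" if l: "l < m" for l
    proof -
      have wl: "f (\<lambda>i. of_bool (i = l)) = w l"
      proof -
        have "f (\<lambda>i. of_bool (i = l)) = (\<Sum>i<m. if i = l then w i else 0)" unfolding f_def by (rule sum.cong) auto
        then show ?thesis using l by simp
      qed
      have "\<forall>i<m. of_bool (i = l) \<in> pp 0" by simp
      from x(2)[rule_format, OF fI[OF this]] have "b (f c) (w l) \<in> pp 1" unfolding wl c(2) .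
      then show ?thesis unfolding f_def by (simp only: B_sum B_scale)
    qed
    then have "\<forall>i<m. c i \<in> pp 1" by (intro nondeg[OF c(1)]) blast
    then show ?thesis unfolding c(2) mul_iff .
  qed
  have iso: "fin_quot M (mul 1 M)" "grp_index M (mul 1 M) = grp_index (tup m (pp 0)) (tup m (pp 1))"
  proof -
    have a: "\<forall>x\<in>tup m (pp 0). f x \<in> M" using fI tupD(1) by blast
    have d: "\<forall>x\<in>tup m (pp 0). \<forall>y\<in>tup m (pp 0). f x - f y \<in> mul 1 M \<longleftrightarrow> x - y \<in> tup m (pp 1)"
    proof (intro ballI)
      fix x y assume "x \<in> tup m (pp 0)" "y \<in> tup m (pp 0)"
      then have "\<forall>i\<ge>m. (x - y) i = 0" using tupD(2) by (auto simp: tup_def)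
      then show "f x - f y \<in> mul 1 M \<longleftrightarrow> x - y \<in> tup m (pp 1)" unfolding f_diff mul_iff by (simp add: tup_def)
    qed
    have s: "\<forall>z\<in>M. \<exists>x\<in>tup m (pp 0). z - f x \<in> mul 1 M"
    proof
      fix z assume "z \<in> M"
      obtain c where c: "\<forall>i<m. c i \<in> pp 0" "z = f c" using fE[OF \<open>z \<in> M\<close>] by blast
      define c' where "c' i = (if i < m then c i else 0)" for i
      have "f c' = f c" unfolding f_def by (rule sum.cong) (auto simp: c'_def)
      moreover have "c' \<in> tup m (pp 0)" using c(1) by (simp add: tup_def c'_def)
      ultimately show "\<exists>x\<in>tup m (pp 0). z - f x \<in> mul 1 M"
        using omodD(1)[OF omod_mul[OF om]] unfolding c(2) by (intro bexI[of _ c']) simp_all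
    qed
    show "fin_quot M (mul 1 M)" "grp_index M (mul 1 M) = grp_index (tup m (pp 0)) (tup m (pp 1))"
      using avg_iso(1,2)[OF fin_quot_tup[OF fin_quot_pp1] omodD(6)[OF om] omodD(6)[OF omod_mul[OF om]] mul_subset[OF om] a d s] by auto
  qed
  then have "grp_index M (mul 1 M) = q ^ m" unfolding grp_index_tup[OF fin_quot_pp1] index_pp1 by simp
  then show ?thesis unfolding unimodular_def using om integral nd iso(1) by blast
qed

lemma basis_mem: assumes L: "lattice_basis val scale m w M" and i: "i < m" shows "w i \<in> M"
proof -
  have M: "M = {\<Sum>i<m. scale (c i) (w i) | c. \<forall>i<m. c i \<in> pp 0}" using L unfolding lattice_basis_def pp_0 by blast
  have "(\<Sum>k<m. scale (of_bool (k = i)) (w k)) = (\<Sum>k<m. if k = i then w k else 0)" by (rule sum.cong) auto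
  then have "w i = (\<Sum>k<m. scale (of_bool (k = i)) (w k))" using i by simp
  moreover have "\<forall>k<m. of_bool (k = i) \<in> pp 0" by simp
  ultimately have "w i = (\<Sum>k<m. scale (of_bool (k = i)) (w k)) \<and> (\<forall>k<m. of_bool (k = i) \<in> pp 0)" ..
  then show ?thesis unfolding M by (intro CollectI exI[of _ "\<lambda>k. of_bool (k = i)"])
qed

lemma indep_of_basis:
  assumes M: "unimodular m M" and L: "lattice_basis val scale m w M" shows "indep M m w"
  unfolding indep_def
proof (intro allI impI)
  fix c i assume c: "\<forall>i<m. c i \<in> pp 0" "(\<Sum>i<m. scale (c i) (w i)) \<in> mul 1 M" and i: "i < m"
  obtain y where y: "y \<in> M" "(\<Sum>i<m. scale (c i) (w i)) = scale (\<pi> ^ 1) y" using c(2) unfolding mul_def by blast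
  obtain d where d: "\<forall>i<m. d i \<in> pp 0" "y = (\<Sum>i<m. scale (d i) (w i))" using y(1) L unfolding lattice_basis_def pp_0 by blast
  have "(\<Sum>i<m. scale (c i) (w i)) = (\<Sum>i<m. scale (\<pi> ^ 1 * d i) (w i))" using y(2) unfolding d(2) by (simp add: scale_sum_right)
  from lattice_basis_unique[OF L this i] show "c i \<in> pp 1" using d(1) i pp_mult_right[OF pi_power_in[of 1]] by simp
qed

lemma signed_of_basis:
  assumes U: "unimodular m M" and L: "lattice_basis val scale m w M" and m: "m \<ge> 1"
  shows "signed m (eta (disc m (\<lambda>i l. b (w i) (w l)))) M"
proof -
  obtain e where e: "signed m e M" using signed_exists[OF U] by blast
  \<comment> \<open>A basis is arbitrary from index \<open>m\<close> on, whereas tuples vanish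
    there.\<close>
  define \<phi> where "\<phi> i = (if i < m then w i else 0)" for i
  have "(\<Sum>i<m. scale (c i) (\<phi> i)) = (\<Sum>i<m. scale (c i) (w i))" for c by (rule sum.cong) (simp_all add: \<phi>_def)
  then have ind: "indep M m \<phi> \<longleftrightarrow> indep M m w" by (simp only: indep_def)
  have "w i \<in> M" if "i < m" for i by (rule basis_mem[OF L that])
  then have "\<phi> \<in> tup m M" unfolding tup_def \<phi>_def by simp
  from sign_of_basis[OF e m this] have "eta (disc m (\<lambda>i l. b (\<phi> i) (\<phi> l))) = e" using ind indep_of_basis[OF U L] by simp
  moreover have "disc m (\<lambda>i l. b (\<phi> i) (\<phi> l)) = disc m (\<lambda>i l. b (w i) (w l))"
    unfolding disc_def by (intro arg_cong2[of _ _ _ _ "(*)"] refl detm_cong) (simp add: \<phi>_def)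
  ultimately show ?thesis using e by simp
qed

end

section \<open>A quadratic space containing all unimodular lattices\<close>

text \<open>The self-dual lattices live in different quadratic spaces; the hyperbolic space \<open>F[X] \<oplus> F[X]\<close> contains a copy of
  each of them, so that a single polynomial describes the densities for all of them.\<close>

definition pairing :: "'a::field poly \<Rightarrow> 'a poly \<Rightarrow> 'a" where
  "pairing p f = (\<Sum>i\<le>degree p. coeff p i * coeff f i)"

lemma pairing_eq: "degree p \<le> N \<Longrightarrow> pairing p f = (\<Sum>i\<le>N. coeff p i * coeff f i)"
  unfolding pairing_def by (rule sum.mono_neutral_left) (auto simp: coeff_eq_0)

lemma pairing_add: "pairing (p + p') f = pairing p f + pairing p' f"
proof -
  let ?N = "max (degree p) (degree p')"
  have "degree (p + p') \<le> ?N" by (rule degree_add_le_max)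
  then show ?thesis
    using pairing_eq[of "p + p'" ?N f] pairing_eq[of p ?N f] pairing_eq[of p' ?N f] by (simp add: distrib_right sum.distrib)
qed

lemma pairing_smult: "pairing (smult c p) f = c * pairing p f"
  using pairing_eq[of "smult c p" "degree p" f] degree_smult_le[of c p] by (simp add: pairing_def sum_distrib_left mult.assoc)

lemma pairing_monom: "pairing (monom 1 i) f = coeff f i"
proof -
  have "pairing (monom 1 i) f = (\<Sum>j\<le>i. coeff (monom 1 i) j * coeff f j)" by (rule pairing_eq) (rule degree_monom_le)
  also have "\<dots> = (\<Sum>j\<le>i. if j = i then coeff f j else 0)" by (rule sum.cong) auto
  finally show ?thesis by simp
qed

definition hscale :: "'a::field \<Rightarrow> 'a poly \<times> 'a poly \<Rightarrow> 'a poly \<times> 'a poly" where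
  "hscale c x = (smult c (fst x), smult c (snd x))"

definition hform :: "'a::field poly \<times> 'a poly \<Rightarrow> 'a poly \<times> 'a poly \<Rightarrow> 'a" where
  "hform x y = pairing (fst x) (snd y) + pairing (fst y) (snd x)"

lemma quadratic_space_hform: "quadratic_space hscale hform"
proof
  have 1: "pairing p (f + g) = pairing p f + pairing p g" for p f g :: "'a poly"
    unfolding pairing_def by (simp add: distrib_left sum.distrib)
  have 2: "pairing p (smult c f) = c * pairing p f" for p f :: "'a poly" and c
    unfolding pairing_def by (simp add: sum_distrib_left mult_ac)
  fix u v w :: "'a poly \<times> 'a poly" and a c :: 'a
  show "hform u v = hform v u" unfolding hform_def by (rule add.commute)
  show "hform (u + v) w = hform u w + hform v w" unfolding hform_def by (simp add: pairing_add 1)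
  show "hform (hscale c u) w = c * hform u w" unfolding hform_def hscale_def by (simp add: pairing_smult 2 distrib_left)
  show "hscale a (u + v) = hscale a u + hscale a v" unfolding hscale_def by (simp add: smult_add_right)
  show "hscale (a + c) u = hscale a u + hscale c u" unfolding hscale_def by (simp add: smult_add_left)
  show "hscale a (hscale c u) = hscale (a * c) u" unfolding hscale_def by simp
  show "hscale 1 u = u" unfolding hscale_def by simp
qed

text \<open>The first components make the vectors independent, and the second ones produce any
  prescribed symmetric Gram matrix. The halves are needed because \<open>hform\<close> sums two
  equal contributions.\<close>

definition gram_vec :: "nat \<Rightarrow> (nat \<Rightarrow> nat \<Rightarrow> 'a::field) \<Rightarrow> nat \<Rightarrow> 'a poly \<times> 'a poly" where
  "gram_vec m G i = (monom 1 i, \<Sum>l<m. monom (G i l / 2) l)"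

lemma coeff_sum_monom: "k < m \<Longrightarrow> coeff (\<Sum>l<m. monom (g l) l) k = (g k :: 'a::field)"
proof -
  assume k: "k < m"
  have "coeff (\<Sum>l<m. monom (g l) l) k = (\<Sum>l<m. if l = k then g l else 0)" unfolding coeff_sum by (rule sum.cong) auto
  then show ?thesis using k by simp
qed

lemma hform_gram_vec:
  assumes "(2 :: 'a::field) \<noteq> 0" "i < m" "k < m" "G i k = (G k i :: 'a)"
  shows "hform (gram_vec m G i) (gram_vec m G k) = G i k"
proof -
  have "hform (gram_vec m G i) (gram_vec m G k) = G k i / 2 + G i k / 2"
    unfolding hform_def gram_vec_def fst_conv snd_conv pairing_monom coeff_sum_monom[OF assms(2)] coeff_sum_monom[OF assms(3)] ..
  also have "\<dots> = G i k"
    unfolding assms(4) add_divide_distrib[symmetric] mult_2[symmetric] using assms(1) by simp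
  finally show ?thesis .
qed

lemma coeff_fst_gram_sum: "k < m \<Longrightarrow> coeff (fst (\<Sum>i<m. hscale (c i) (gram_vec m G i))) k = c k"
proof -
  assume k: "k < m"
  have "fst (\<Sum>i<m. hscale (c i) (gram_vec m G i)) = (\<Sum>i<m. monom (c i) i)"
    unfolding fst_sum by (rule sum.cong) (simp_all add: hscale_def gram_vec_def smult_monom)
  then show ?thesis using coeff_sum_monom[OF k, of c] by simp
qed

lemma sum_apply: "(\<Sum>i\<in>I. f i) k = (\<Sum>i\<in>I. f i k)" for f :: "'i \<Rightarrow> 'j \<Rightarrow> 'g::ab_group_add"
  by (induction I rule: infinite_finite_induct) auto

section \<open>Self-dual lattices: copies in the hyperbolic space, and existence\<close>

context odd_local_field begin

interpretation W: quadratic_lattices val \<pi> hscale hform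
  by (rule quadratic_lattices.intro[OF odd_local_field_axioms quadratic_space_hform])

text \<open>In the residue symbol \<open>b\<close> ranges over the whole field; it is automatically
  integral because its square is.\<close>

lemma residue_symbol_unit: assumes t: "unit t" shows "real_of_int (residue_symbol val t) = eta t"
proof -
  have v: "val t = 0" "t \<notin> pp 1" "t \<in> pp 0" using t unfolding unit_iff_val by (auto simp: pp_iff)
  have "(\<exists>b. t - b\<^sup>2 \<in> frac_ideal val 1) \<longleftrightarrow> (\<exists>y\<in>pp 0. y * y - t \<in> pp 1)"
  proof
    assume "\<exists>b. t - b\<^sup>2 \<in> frac_ideal val 1"
    then obtain b where b: "t - b * b \<in> pp 1" unfolding pp_def by (auto simp: power2_eq_square)
    have "b \<in> pp 0"
    proof (rule ccontr)
      assume "b \<notin> pp 0"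
      then have b0: "b \<noteq> 0" "val b < 0" by (auto simp: pp_iff)
      have "t - (t - b * b) \<in> pp 0" by (rule pp_diff[OF v(3) pp_subset_0[OF b]])
      then show False using b0 val_mult[OF b0(1) b0(1)] by (simp add: pp_iff)
    qed
    then show "\<exists>y\<in>pp 0. y * y - t \<in> pp 1" using b pp_minus_commute by blast
  next
    assume "\<exists>y\<in>pp 0. y * y - t \<in> pp 1"
    then obtain y where "t - y * y \<in> pp 1" using pp_minus_commute by blast
    then show "\<exists>b. t - b\<^sup>2 \<in> frac_ideal val 1" unfolding pp_def by (intro exI[of _ y]) (simp add: power2_eq_square)
  qed
  then show ?thesis unfolding residue_symbol_def eta_def using v by simp
qed

text \<open>All valuations shift by 2. Enlarging a lattice by \<open>step\<close> multiplies its
  discriminant by this square, so \<open>\<chi>\<close> is constant along the descent.\<close>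

lemma residue_symbol_pi:
  assumes "a \<noteq> 0" shows "residue_symbol val (inverse \<pi> * inverse \<pi> * a) = residue_symbol val a"
proof -
  have fi: "inverse \<pi> * inverse \<pi> * x \<in> frac_ideal val (k - 2) \<longleftrightarrow> x \<in> frac_ideal val k" for x k
    using pi_nonzero val_mult val_inverse[OF pi_nonzero] val_pi by (cases "x = 0") (auto simp: frac_ideal_def)
  have v: "val (inverse \<pi> * inverse \<pi> * a) = val a - 2"
    using pi_nonzero assms val_mult val_inverse[OF pi_nonzero] val_pi by simp
  have "(\<exists>b. inverse \<pi> * inverse \<pi> * a - b\<^sup>2 \<in> frac_ideal val (val a + 1 - 2)) \<longleftrightarrow> (\<exists>b. a - b\<^sup>2 \<in> frac_ideal val (val a + 1))"
  proof
    assume "\<exists>b. a - b\<^sup>2 \<in> frac_ideal val (val a + 1)"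
    then obtain b where "a - b\<^sup>2 \<in> frac_ideal val (val a + 1)" ..
    then have "inverse \<pi> * inverse \<pi> * (a - b\<^sup>2) \<in> frac_ideal val (val a + 1 - 2)" unfolding fi .
    then show "\<exists>b. inverse \<pi> * inverse \<pi> * a - b\<^sup>2 \<in> frac_ideal val (val a + 1 - 2)"
      by (intro exI[of _ "inverse \<pi> * b"]) (simp add: power2_eq_square right_diff_distrib mult_ac)
  next
    assume "\<exists>b. inverse \<pi> * inverse \<pi> * a - b\<^sup>2 \<in> frac_ideal val (val a + 1 - 2)"
    then obtain b where "inverse \<pi> * inverse \<pi> * a - b\<^sup>2 \<in> frac_ideal val (val a + 1 - 2)" ..
    moreover have "inverse \<pi> * inverse \<pi> * a - b\<^sup>2 = inverse \<pi> * inverse \<pi> * (a - (\<pi> * b)\<^sup>2)"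
      using pi_nonzero by (simp add: power2_eq_square field_simps)
    ultimately show "\<exists>b. a - b\<^sup>2 \<in> frac_ideal val (val a + 1)" using fi by metis
  qed
  moreover have "val a - 2 + 1 = val a + 1 - 2" "odd (val a - 2) \<longleftrightarrow> odd (val a)" by simp_all
  ultimately show ?thesis unfolding residue_symbol_def v by (simp only:)
qed

text \<open>The copy is spanned by vectors of the hyperbolic space with the same Gram matrix. By
  \<open>signed_of_basis\<close> its sign is \<open>eta\<close> of the discriminant; as a sign is
  nonzero, the discriminant is a unit, and there \<open>eta\<close> agrees with the residue
  symbol.\<close>

lemma self_dual_signed:
  assumes S: "self_dual_lattice val \<epsilon> r BM M" and r: "r \<ge> 1"
  shows "\<exists>M' h. W.signed r (real_of_int \<epsilon>) M' \<and> W.lin_isometry M' fun_scale BM M h"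
proof -
  have Q: "quadratic_space fun_scale BM" and lat: "quadratic_lattice val fun_scale BM r M"
    and dual: "M = dual_lattice val fun_scale BM M" and chi: "lattice_chi val fun_scale BM r M = \<epsilon>"
    using S unfolding self_dual_lattice_def by blast+
  interpret V: quadratic_lattices val \<pi> fun_scale BM by (rule quadratic_lattices.intro[OF odd_local_field_axioms Q])
  define bs where "bs = (SOME b. lattice_basis val fun_scale r b M)"
  have ex: "\<exists>b. lattice_basis val fun_scale r b M" using lat unfolding quadratic_lattice_def by blast
  have bs: "lattice_basis val fun_scale r bs M" unfolding bs_def by (rule someI_ex[OF ex])
  define G where "G i l = BM (bs i) (bs l)" for i l
  define f where "f c = (\<Sum>i<r. fun_scale (c i) (bs i))" for c
  have Meq: "M = {f c | c. \<forall>i<r. c i \<in> pp 0}" using bs unfolding lattice_basis_def f_def pp_0 by blast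
  have fI: "f c \<in> M" if "\<forall>i<r. c i \<in> pp 0" for c using that unfolding Meq by blast
  have fE: "\<exists>c. (\<forall>i<r. c i \<in> pp 0) \<and> x = f c" if "x \<in> M" for x using that unfolding Meq by blast
  note f_inj = V.lattice_basis_unique[OF bs, folded f_def]
  have Bf: "BM (f c) (f d) = (\<Sum>i<r. \<Sum>l<r. c i * (d l * G i l))" for c d
    unfolding f_def G_def by (simp only: V.B_sum V.B_scale, simp only: V.B_sum_right V.B_scale_right sum_distrib_left)
  note bM = V.basis_mem[OF bs]
  have int: "BM u v \<in> pp 0" if uv: "u \<in> M" "v \<in> M" for u v
  proof -
    have "u \<in> dual_lattice val fun_scale BM M" using uv(1) dual by simp
    then show ?thesis unfolding dual_lattice_def pp_0 using uv(2) by blast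
  qed
  have intG: "G i l \<in> pp 0" if "i < r" "l < r" for i l unfolding G_def by (rule int[OF bM[OF that(1)] bM[OF that(2)]])
  have Gsym: "G i l = G l i" for i l unfolding G_def by (rule V.B_sym)
  have nondeg: "\<forall>i<r. c i \<in> pp 1" if c: "\<forall>i<r. c i \<in> pp 0" and cG: "\<forall>l<r. (\<Sum>i<r. c i * G i l) \<in> pp 1" for c
  proof -
    \<comment> \<open>A combination orthogonal to \<open>M\<close> modulo \<open>\<pi>\<close> lies,
      after division by \<open>\<pi>\<close>, in the dual lattice and hence in
      \<open>M\<close>.\<close>
    let ?y = "f (\<lambda>i. inverse \<pi> * c i)"
    have sp: "?y \<in> V.span M" unfolding f_def by (rule V.span_sum, rule V.span_scale, rule V.span_base) (use bM in auto)
    have "BM ?y u \<in> pp 0" if u: "u \<in> M" for u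
    proof -
      obtain d where d: "\<forall>i<r. d i \<in> pp 0" "u = f d" using fE[OF u] by blast
      have "BM ?y u = (\<Sum>l<r. d l * (inverse \<pi> * (\<Sum>i<r. c i * G i l)))"
        unfolding d(2) Bf by (subst sum.swap) (simp add: sum_distrib_left mult_ac)
      also have "\<dots> \<in> pp 0"
      proof (rule pp_sum, rule pp_mult_left)
        fix l assume "l \<in> {..<r}"
        then show "d l \<in> pp 0" using d by simp
        have "\<pi> * (inverse \<pi> * (\<Sum>i<r. c i * G i l)) = (\<Sum>i<r. c i * G i l)" using pi_nonzero by simp
        moreover have "(\<Sum>i<r. c i * G i l) \<in> pp (Suc 0)" using cG \<open>l \<in> _\<close> by (simp add: One_nat_def)
        ultimately have "\<pi> * (inverse \<pi> * (\<Sum>i<r. c i * G i l)) \<in> pp (Suc 0)" by (simp only:)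
        then show "inverse \<pi> * (\<Sum>i<r. c i * G i l) \<in> pp 0" unfolding pi_mult_iff .
      qed
      finally show ?thesis .
    qed
    then have "?y \<in> dual_lattice val fun_scale BM M" unfolding dual_lattice_def pp_0[symmetric] using sp by blast
    then have "?y \<in> M" using dual by simp
    then obtain d where d: "\<forall>i<r. d i \<in> pp 0" "?y = f d" using fE by blast
    have "c i = \<pi> * d i" if "i < r" for i
    proof -
      have "inverse \<pi> * c i = d i" by (rule f_inj[OF d(2) that])
      then show ?thesis using pi_nonzero by (simp add: field_simps)
    qed
    then show ?thesis using d(1) pp_mult_right[OF pi_in(1)] by simp
  qed
  define w where "w = gram_vec r G"
  have two: "(2::'a) \<noteq> 0" by (rule unitD(1)[OF unit_2])
  have hw: "hform (w i) (w l) = G i l" if "i < r" "l < r" for i l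
    unfolding w_def by (rule hform_gram_vec[OF two that Gsym])
  define g where "g c = (\<Sum>i<r. hscale (c i) (w i))" for c
  define M' where "M' = {g c | c. \<forall>i<r. c i \<in> pp 0}"
  have gI: "g c \<in> M'" if "\<forall>i<r. c i \<in> pp 0" for c using that unfolding M'_def by blast
  have gE: "\<exists>c. (\<forall>i<r. c i \<in> pp 0) \<and> x = g c" if "x \<in> M'" for x using that unfolding M'_def by blast
  have gc: "coeff (fst (g c)) i = c i" if "i < r" for c i unfolding g_def w_def by (rule coeff_fst_gram_sum[OF that])
  have basis: "lattice_basis val hscale r w M'"
  proof (rule W.lattice_basisI)
    fix c assume "(\<Sum>i<r. hscale (c i) (w i)) = 0"
    then have "g c = 0" unfolding g_def .
    then show "\<forall>i<r. c i = 0" using gc[of _ c] by simp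
  qed (simp add: M'_def g_def pp_0)
  have U: "W.unimodular r M'"
  proof (rule W.unimodular_of_basis[OF basis])
    show "hform (w i) (w l) \<in> pp 0" if "i < r" "l < r" for i l unfolding hw[OF that] by (rule intG[OF that])
    show "\<forall>i<r. c i \<in> pp 1" if c: "\<forall>i<r. c i \<in> pp 0" "\<forall>l<r. (\<Sum>i<r. c i * hform (w i) (w l)) \<in> pp 1" for c
      by (rule nondeg[OF c(1)]) (use c(2) hw in simp)
  qed
  have disc: "W.disc r (\<lambda>i l. hform (w i) (w l)) = W.disc r G"
    unfolding W.disc_def by (intro arg_cong2[of _ _ _ _ "(*)"] refl W.detm_cong) (rule hw)
  have sg: "W.signed r (eta (W.disc r G)) M'" using W.signed_of_basis[OF U basis r] unfolding disc .
  then have "eta (W.disc r G) \<noteq> 0" unfolding W.signed_def by auto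
  then have "W.disc r G \<notin> pp 1" using eta_pp1 by blast
  moreover have "W.disc r G \<in> pp 0"
    unfolding W.disc_def by (rule pp_mult_left[OF pp_power W.detm_in_pp0[OF intG]]) simp
  ultimately have "unit (W.disc r G)" unfolding unit_def by blast
  from residue_symbol_unit[OF this] have "eta (W.disc r G) = real_of_int \<epsilon>"
    unfolding chi[symmetric] lattice_chi_def bs_def[symmetric] basis_disc_def W.disc_def W.detm_def G_def by simp
  then have S: "W.signed r (real_of_int \<epsilon>) M'" using sg by simp
  define h where "h x = (\<Sum>i<r. fun_scale (coeff (fst x) i) (bs i))" for x :: "'a poly \<times> 'a poly"
  have hg: "h (g c) = f c" for c unfolding h_def f_def by (rule sum.cong) (simp_all add: gc)
  have "W.lin_isometry M' fun_scale BM M h"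
    unfolding W.lin_isometry_def
  proof (intro conjI ballI)
    show "bij_betw h M' M"
    proof (rule bij_betw_imageI)
      show "inj_on h M'"
      proof (rule inj_onI)
        fix x y assume xy: "x \<in> M'" "y \<in> M'" "h x = h y"
        obtain c d where c: "x = g c" and d: "y = g d" using gE[OF xy(1)] gE[OF xy(2)] by blast
        have "c i = d i" if "i < r" for i by (rule f_inj[OF xy(3)[unfolded c d hg] that])
        then show "x = y" unfolding c d g_def by simp
      qed
      have "h x \<in> M" if "x \<in> M'" for x using gE[OF that] hg fI by metis
      moreover have "y \<in> h ` M'" if "y \<in> M" for y using fE[OF that] hg gI by (metis imageI)
      ultimately show "h ` M' = M" by blast
    qed
    fix x y assume xy: "x \<in> M'" "y \<in> M'"
    show "h (x + y) = h x + h y" unfolding h_def by (simp add: V.scale_left_distrib sum.distrib)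
    obtain c d where c: "x = g c" and d: "y = g d" using gE[OF xy(1)] gE[OF xy(2)] by blast
    have "hform (g c) (g d) = (\<Sum>i<r. \<Sum>l<r. c i * (d l * hform (w i) (w l)))"
      unfolding g_def by (simp only: W.B_sum W.B_scale, simp only: W.B_sum_right W.B_scale_right sum_distrib_left)
    also have "\<dots> = BM (f c) (f d)" unfolding Bf by (intro sum.cong refl) (simp add: hw)
    finally show "BM (h x) (h y) = hform x y" unfolding c d hg ..
  next
    fix a x show "h (hscale a x) = fun_scale a (h x)" unfolding h_def by (simp add: hscale_def V.scale_sum_right)
  qed
  then show ?thesis using S by blast
qed

text \<open>Without a unit of sign -1, \<open>eta\<close> would be nonnegative with
  \<open>eta 1 = 1\<close>, against its mean 0.\<close>

lemma unit_of_sign: assumes "\<epsilon> \<in> {1, - 1 :: real}" shows "\<exists>t. unit t \<and> eta t = \<epsilon>"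
proof -
  have 1: "eta 1 = 1" using eta_square[OF unit_1] by simp
  have "\<exists>t. unit t \<and> eta t = - 1"
  proof (rule ccontr)
    assume no: "\<not> (\<exists>t. unit t \<and> eta t = - 1)"
    have nn: "eta t = \<bar>eta t\<bar>" if "t \<in> pp 0" for t
      using eta_unit[of t] eta_pp1[of t] that no[unfolded not_ex, rule_format, of t] by (cases "t \<in> pp 1") (auto simp: unit_def)
    have "avgO (\<lambda>t. \<bar>eta t\<bar>) > 0"
      by (rule avg_pos[OF fin_quot_pp1 periodicI, of _ 1]) (use 1 eta_cong in auto)
    moreover have "avgO eta = avgO (\<lambda>t. \<bar>eta t\<bar>)" by (rule avg_cong[OF fin_quot_pp1 nn])
    ultimately have "avgO eta > 0" by simp
    then show False using avg_eta by simp
  qed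
  then show ?thesis using assms 1 unit_1 by auto
qed

text \<open>Supplies the interpolation points: in ranks without such lattices the condition defining
  a density polynomial would be vacuous. A diagonal form with one adjustable unit entry
  suffices.\<close>

lemma self_dual_exists:
  assumes r: "r \<ge> 1" and \<epsilon>: "\<epsilon> \<in> {1, - 1 :: int}"
  shows "\<exists>BM M. self_dual_lattice val \<epsilon> r BM M"
proof -
  obtain t where t: "unit t" "eta t = real_of_int \<epsilon>" using unit_of_sign[of "real_of_int \<epsilon>"] \<epsilon> by auto
  \<comment> \<open>Cancels the sign in the normalization of the discriminant, which thus becomes
    \<open>t\<close> itself.\<close>
  define sg where "sg = (- 1 :: 'a) ^ (r * (r - 1) div 2)"
  have sg: "unit sg" "sg * sg = 1" unfolding sg_def
    using unit_1 unitD(5)[OF unit_1] by (cases "even (r * (r - 1) div 2)"; simp)+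
  define d where "d i = (if i = 0 then sg * t else 1)" for i :: nat
  have d: "unit (d i)" for i unfolding d_def using unit_mult[OF sg(1) t(1)] unit_1 by simp
  define BM where "BM x y = (\<Sum>i<r. d i * (x i * y i))" for x y :: "nat \<Rightarrow> 'a"
  define M where "M = tup r (pp 0)"
  have Q: "quadratic_space fun_scale BM"
  proof
    fix u v w :: "nat \<Rightarrow> 'a" and a c :: 'a
    show "BM u v = BM v u" unfolding BM_def by (simp add: mult_ac)
    show "BM (u + v) w = BM u w + BM v w" unfolding BM_def by (simp add: algebra_simps sum.distrib)
    show "BM (fun_scale c u) w = c * BM u w" unfolding BM_def fun_scale_def by (simp add: sum_distrib_left mult_ac)
  qed (auto simp: fun_scale_def fun_eq_iff algebra_simps)
  interpret V: quadratic_lattices val \<pi> fun_scale BM by (rule quadratic_lattices.intro[OF odd_local_field_axioms Q])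
  define w where "w i = (\<lambda>k. of_bool (k = i) :: 'a)" for i :: nat
  have f: "(\<Sum>i<r. fun_scale (c i) (w i)) = (\<lambda>k. if k < r then c k else 0)" for c
  proof
    fix k
    have "(\<Sum>i<r. fun_scale (c i) (w i)) k = (\<Sum>i<r. if i = k then c i else 0)"
      unfolding sum_apply by (rule sum.cong) (auto simp: fun_scale_def w_def)
    then show "(\<Sum>i<r. fun_scale (c i) (w i)) k = (if k < r then c k else 0)" by simp
  qed
  have basis: "lattice_basis val fun_scale r w M"
  proof (rule V.lattice_basisI)
    fix c assume "(\<Sum>i<r. fun_scale (c i) (w i)) = 0"
    from fun_cong[OF this[unfolded f]] show "\<forall>i<r. c i = 0" by (metis zero_fun_apply)
  next
    show "M = {\<Sum>i<r. fun_scale (c i) (w i) | c. \<forall>i<r. c i \<in> integers val}"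
    proof (intro equalityI subsetI)
      fix x assume x: "x \<in> M"
      have "x = (\<Sum>i<r. fun_scale (x i) (w i))" unfolding f using tupD(2)[OF x[unfolded M_def]] by (auto simp: fun_eq_iff)
      moreover have "\<forall>i<r. x i \<in> integers val" using tupD(1)[OF x[unfolded M_def]] unfolding pp_0 by blast
      ultimately show "x \<in> {\<Sum>i<r. fun_scale (c i) (w i) | c. \<forall>i<r. c i \<in> integers val}" by blast
    next
      fix x assume "x \<in> {\<Sum>i<r. fun_scale (c i) (w i) | c. \<forall>i<r. c i \<in> integers val}"
      then obtain c where "x = (\<lambda>k. if k < r then c k else 0)" "\<forall>i<r. c i \<in> pp 0" unfolding f pp_0 by blast
      then show "x \<in> M" unfolding M_def tup_def by simp
    qed
  qed
  have Bw: "BM x (w l) = d l * x l" if "l < r" for x l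
  proof -
    have "BM x (w l) = (\<Sum>i<r. if i = l then d i * x i else 0)" unfolding BM_def by (rule sum.cong) (auto simp: w_def)
    then show ?thesis using that by simp
  qed
  have wM: "w i \<in> M" if "i < r" for i unfolding M_def tup_def w_def using that by auto
  have int: "BM x y \<in> pp 0" if "x \<in> M" "y \<in> M" for x y
    unfolding BM_def by (rule pp_sum, rule pp_mult_left[OF unitD(2)[OF d]], rule pp_mult_left)
      (use tupD(1) that in \<open>auto simp: M_def\<close>)
  have U: "V.unimodular r M"
  proof (rule V.unimodular_of_basis[OF basis])
    show "BM (w i) (w l) \<in> pp 0" if "i < r" "l < r" for i l by (rule int[OF wM[OF that(1)] wM[OF that(2)]])
    show "\<forall>i<r. c i \<in> pp 1" if c: "\<forall>l<r. (\<Sum>i<r. c i * BM (w i) (w l)) \<in> pp 1" for c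
    proof (intro allI impI)
      fix l assume l: "l < r"
      have "(\<Sum>i<r. c i * BM (w i) (w l)) = BM (\<Sum>i<r. fun_scale (c i) (w i)) (w l)" by (simp only: V.B_sum V.B_scale)
      also have "\<dots> = d l * c l" unfolding Bw[OF l] f using l by simp
      finally show "c l \<in> pp 1" using c l unit_mult_pp_iff[OF d] by metis
    qed
  qed
  have nd: "u = 0" if u: "u \<in> M" "\<forall>v\<in>M. BM u v = 0" for u
  proof
    fix i show "u i = 0 i"
    proof (cases "i < r")
      case True
      have "d i * u i = 0" using u(2) wM[OF True] Bw[OF True, of u] by simp
      then show ?thesis using unitD(1)[OF d] by simp
    qed (use tupD(2)[OF u(1)[unfolded M_def]] in simp)
  qed
  have dual: "M = dual_lattice val fun_scale BM M"
  proof (intro equalityI subsetI)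
    fix x assume x: "x \<in> M"
    then show "x \<in> dual_lattice val fun_scale BM M"
      unfolding dual_lattice_def using V.span_base[OF x] int[OF x] pp_0 by simp
  next
    fix x assume "x \<in> dual_lattice val fun_scale BM M"
    then have x: "x \<in> V.span M" "\<forall>u\<in>M. BM x u \<in> pp 0" unfolding dual_lattice_def pp_0 by simp_all
    have "V.span M \<subseteq> {y. \<forall>i\<ge>r. y i = 0}"
    proof (rule V.span_minimal)
      show "M \<subseteq> {y. \<forall>i\<ge>r. y i = 0}" unfolding M_def tup_def by blast
      show "V.subspace {y. \<forall>i\<ge>r. y i = 0}" unfolding V.subspace_def by (simp add: fun_scale_def)
    qed
    then have "\<forall>i\<ge>r. x i = 0" using x(1) by blast
    moreover have "x i \<in> pp 0" if "i < r" for i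
      using x(2)[rule_format, OF wM[OF that]] unfolding Bw[OF that] unit_mult_pp_iff[OF d] .
    ultimately show "x \<in> M" unfolding M_def tup_def by simp
  qed
  \<comment> \<open>\<open>lattice_chi\<close> refers to an unspecified basis; its discriminant is
    compared with that of \<open>w\<close> through the uniqueness of the sign.\<close>
  define bs where "bs = (SOME b. lattice_basis val fun_scale r b M)"
  have bs: "lattice_basis val fun_scale r bs M" unfolding bs_def by (rule someI[of "\<lambda>b. lattice_basis val fun_scale r b M", OF basis])
  have ww: "w i i = 1" for i unfolding w_def by simp
  have "V.detm r (\<lambda>i l. BM (w i) (w l)) = (\<Prod>i<r. BM (w i) (w i))"
    by (rule V.detm_upper) (auto simp: Bw, auto simp: w_def)
  also have "\<dots> = (\<Prod>i<r. if i = 0 then sg * t else 1)" by (rule prod.cong[OF refl]) (simp add: Bw d_def ww)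
  also have "\<dots> = sg * t" using r by simp
  finally have "V.disc r (\<lambda>i l. BM (w i) (w l)) = t" unfolding V.disc_def sg_def[symmetric] using sg(2) by (simp flip: mult.assoc)
  then have s: "V.signed r (real_of_int \<epsilon>) M" using V.signed_of_basis[OF U basis r] t(2) by simp
  let ?D = "V.disc r (\<lambda>i l. BM (bs i) (bs l))"
  have eq: "eta ?D = real_of_int \<epsilon>" by (rule V.signed_unique[OF V.signed_of_basis[OF U bs r] s])
  have bsM: "bs i \<in> M" if "i < r" for i by (rule V.basis_mem[OF bs that])
  have "?D \<in> pp 0"
    unfolding V.disc_def by (rule pp_mult_left[OF pp_power V.detm_in_pp0]) (use int bsM in auto)
  moreover have "?D \<notin> pp 1" using eta_pp1 eq \<epsilon> by fastforce
  ultimately have "unit ?D" unfolding unit_def by blast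
  from residue_symbol_unit[OF this] have "real_of_int (residue_symbol val ?D) = real_of_int \<epsilon>" unfolding eq .
  then have chi: "lattice_chi val fun_scale BM r M = \<epsilon>"
    unfolding lattice_chi_def bs_def[symmetric] basis_disc_def V.disc_def V.detm_def by (simp only: of_int_eq_iff)
  have "quadratic_lattice val fun_scale BM r M" unfolding quadratic_lattice_def using basis nd by blast
  then show ?thesis unfolding self_dual_lattice_def using Q dual chi by blast
qed

end

section \<open>The density polynomials\<close>

lemma (in quadratic_space) B_right:
  "B w (u + v) = B w u + B w v" "B w (scale c u) = c * B w u" "B w (\<Sum>i\<in>I. f i) = (\<Sum>i\<in>I. B w (f i))"
proof -
  show 1: "B w (u + v) = B w u + B w v" for w u v using B_sym B_add by metis
  show 2: "B w (scale c u) = c * B w u" for w c u using B_sym B_scale by metis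
  have "B w 0 = 0" using 2[of w 0 0] by simp
  then show "B w (\<Sum>i\<in>I. f i) = (\<Sum>i\<in>I. B w (f i))"
    by (induction I rule: infinite_finite_induct) (auto simp: 1)
qed

text \<open>The vector \<open>x\<close> is placed first, as in \<open>extend\<close>. Its
  coefficient in a relation is recovered by pairing with \<open>x\<close>, which is orthogonal to
  the rest and not isotropic.\<close>

lemma (in quadratic_space) lattice_basis_add_vector:
  assumes L: "lattice_basis val scale r bs L" and orth: "\<forall>u\<in>L. B u x = 0" and mem: "\<And>i. i < r \<Longrightarrow> bs i \<in> L" and x: "B x x \<noteq> 0"
  shows "lattice_basis val scale (Suc r) (case_nat x bs) (add_vector val scale L x)"
proof (rule lattice_basisI)
  have s: "(\<Sum>i<Suc r. scale (c i) (case_nat x bs i)) = scale (c 0) x + (\<Sum>i<r. scale (c (Suc i)) (bs i))" for c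
    unfolding sum.lessThan_Suc_shift by simp
  fix c assume "(\<Sum>i<Suc r. scale (c i) (case_nat x bs i)) = 0"
  then have 0: "scale (c 0) x + (\<Sum>i<r. scale (c (Suc i)) (bs i)) = 0" unfolding s .
  have z: "B x 0 = 0" using B_right(2)[of x 0 0] by simp
  have "B x (bs i) = 0" if "i < r" for i using orth mem[OF that] B_sym by metis
  then have "c 0 * B x x = B x (scale (c 0) x + (\<Sum>i<r. scale (c (Suc i)) (bs i)))" by (simp add: B_right)
  then have c0: "c 0 = 0" using x unfolding 0 z by simp
  then have "(\<Sum>i<r. scale (c (Suc i)) (bs i)) = (\<Sum>i<r. scale ((\<lambda>_. 0) i) (bs i))" using 0 by simp
  from lattice_basis_unique[OF L this] have "c (Suc i) = 0" if "i < r" for i using that .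
  then show "\<forall>i<Suc r. c i = 0" using c0 by (auto simp: less_Suc_eq_0_disj)
next
  have s: "(\<Sum>i<Suc r. scale (c i) (case_nat x bs i)) = (\<Sum>i<r. scale (c (Suc i)) (bs i)) + scale (c 0) x" for c
    unfolding sum.lessThan_Suc_shift by (simp add: add.commute)
  have Leq: "L = {\<Sum>i<r. scale (c i) (bs i) | c. \<forall>i<r. c i \<in> integers val}" using L unfolding lattice_basis_def by blast
  show "add_vector val scale L x = {\<Sum>i<Suc r. scale (c i) (case_nat x bs i) | c. \<forall>i<Suc r. c i \<in> integers val}"
  proof (intro equalityI subsetI)
    fix y assume "y \<in> add_vector val scale L x"
    then obtain u c where u: "y = u + scale c x" "u \<in> L" "c \<in> integers val" unfolding add_vector_def by blast
    obtain d where d: "u = (\<Sum>i<r. scale (d i) (bs i))" "\<forall>i<r. d i \<in> integers val" using u(2) Leq by blast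
    have "y = (\<Sum>i<Suc r. scale (case_nat c d i) (case_nat x bs i))" unfolding s u(1) d(1) by simp
    moreover have "\<forall>i<Suc r. case_nat c d i \<in> integers val" using u(3) d(2) by (auto simp: less_Suc_eq_0_disj)
    ultimately show "y \<in> {\<Sum>i<Suc r. scale (c i) (case_nat x bs i) | c. \<forall>i<Suc r. c i \<in> integers val}"
      by (intro CollectI exI[of _ "case_nat c d"] conjI)
  next
    fix y assume "y \<in> {\<Sum>i<Suc r. scale (c i) (case_nat x bs i) | c. \<forall>i<Suc r. c i \<in> integers val}"
    then obtain c where c: "y = (\<Sum>i<r. scale (c (Suc i)) (bs i)) + scale (c 0) x" "\<forall>i<Suc r. c i \<in> integers val"
      unfolding s by blast
    have "(\<Sum>i<r. scale (c (Suc i)) (bs i)) \<in> L" unfolding Leq by (rule CollectI, rule exI[of _ "\<lambda>i. c (Suc i)"]) (use c(2) in simp)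
    then show "y \<in> add_vector val scale L x" unfolding add_vector_def c(1) using c(2) by blast
  qed
qed

context odd_local_field begin

interpretation W: quadratic_lattices val \<pi> hscale hform
  by (rule quadratic_lattices.intro[OF odd_local_field_axioms quadratic_space_hform])

lemma poly_eq_at_powers:
  assumes "\<And>k. poly P (1 / real q ^ k) = poly Q (1 / real q ^ k)" shows "P = Q"
proof (rule ccontr)
  assume "P \<noteq> Q"
  then have "finite {x. poly (P - Q) x = 0}" by (intro poly_roots_finite) simp
  moreover have "range (\<lambda>k. 1 / real q ^ k) \<subseteq> {x. poly (P - Q) x = 0}" using assms by auto
  ultimately have "finite (range (\<lambda>k. 1 / real q ^ k))" by (rule rev_finite_subset)
  moreover have "inj (\<lambda>k. 1 / real q ^ k)"
    by (rule injI) (use q_gt_1 in \<open>simp add: power_inject_exp\<close>)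
  ultimately show False using range_inj_infinite by blast
qed

lemma Nor_eq: "Nor q \<epsilon> n = W.Npol (int n + 1) (real_of_int \<epsilon>)"
proof -
  have "{i. 1 \<le> i \<and> 2 * i < n + 1} = {i. 1 \<le> i \<and> 2 * int i < int n + 1}" by auto
  moreover have "[:1, - (real_of_int (sgn_H \<epsilon> (n + 1)) * real q powr (- (real (n + 1) / 2))):] =
      (if 0 \<le> int n + 1 \<and> even (int n + 1) then W.lin (int n + 1) (real_of_int \<epsilon>) else 1)"
    unfolding sgn_H_def W.lin_def W.rt_def by (simp add: one_pCons)
  ultimately show ?thesis unfolding Nor_def W.Npol_def W.quad_def by (simp only:)
qed

lemma Nor_flat_eq:
  assumes r: "r \<ge> 1" and \<epsilon>: "\<epsilon> \<in> {1, - 1}" and \<chi>: "\<chi> \<in> {0, 1, - 1}"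
  shows "[:1, - real_of_int (\<epsilon> * \<chi>):] * Nor_flat q \<epsilon> \<chi> r = W.Fpol (int r) (real_of_int \<epsilon>)"
proof -
  let ?d = "[:1, - real_of_int (\<epsilon> * \<chi>):]"
  have "{i. 2 * i < r} = {i. 2 * int i < int r}" by auto
  moreover have "[:1, - (real_of_int (sgn_H \<epsilon> r) * real q powr (- (real r / 2))):] =
      (if 0 \<le> int r \<and> even (int r) then W.lin (int r) (real_of_int \<epsilon>) else 1)"
    unfolding sgn_H_def W.lin_def W.rt_def by (simp add: one_pCons)
  ultimately have N: "Nor_flat q \<epsilon> \<chi> r = W.Fpol (int r) (real_of_int \<epsilon>) div ?d"
    unfolding Nor_flat_def W.Fpol_def W.quad_def by (simp only:)
  have "?d dvd W.quad 0"
  proof -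
    consider "\<epsilon> * \<chi> = 0" | "\<epsilon> * \<chi> = 1" | "\<epsilon> * \<chi> = - 1" using \<epsilon> \<chi> by auto
    then have "W.quad 0 = ?d * (if \<epsilon> * \<chi> = 0 then W.quad 0 else [:1, real_of_int (\<epsilon> * \<chi>):])"
      by cases (simp_all add: W.quad_def)
    then show ?thesis by (rule dvdI)
  qed
  then have "?d dvd W.Fpol (int r) (real_of_int \<epsilon>)" using W.Fpol_Npol[of "int r"] r by simp
  then show ?thesis unfolding N by (rule dvd_mult_div_cancel)
qed

lemma Npol_nonzero: "W.Npol r e \<noteq> 0"
proof -
  have "finite {i. 1 \<le> i \<and> 2 * int i < r}" by (rule finite_subset[OF _ W.finite_Fpol[of r]]) auto
  then show ?thesis unfolding W.Npol_def by (simp add: W.lin_nonzero W.quad_nonzero prod_zero_iff)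
qed

lemma Den_dens_poly:
  assumes S: "self_dual_lattice val \<epsilon> (r + 2 * k) BM M" and r: "n \<le> r" "1 \<le> r"
    and V: "quadratic_space sL BL" and L: "lattice_basis val sL n bs L"
    and T: "\<And>i l. i < n \<Longrightarrow> l < n \<Longrightarrow> BL (bs i) (bs l) = T i l" and P: "W.dens_poly (int r) (real_of_int \<epsilon>) n T 0 P"
  shows "Den val fun_scale BM (r + 2 * k) M sL BL n L = poly P (1 / real q ^ k)"
proof -
  have "r + 2 * k \<ge> 1" using r(2) by simp
  then obtain M' h where M': "W.signed (r + 2 * k) (real_of_int \<epsilon>) M'" and h: "W.lin_isometry M' fun_scale BM M h"
    using self_dual_signed[OF S] by blast
  obtain N0 where N0: "\<And>k m M. int m = int r + 2 * int k \<Longrightarrow> W.signed m (real_of_int \<epsilon>) M \<Longrightarrow> W.stab M n T 0 N0 (poly P (1 / real q ^ k))"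
    using P unfolding W.dens_poly_def of_nat_power by blast
  have "n \<le> r + 2 * k" using r(1) by simp
  from W.Den_stab[OF W.signedD(1)[OF M'] h V L this T N0[OF _ M', of k]] show ?thesis by simp
qed

text \<open>Uniqueness comes from the existence of self-dual lattices in all ranks
  \<open>r + 2 * k\<close>: two candidates agree, after multiplication by \<open>D\<close>, at
  infinitely many points.\<close>

lemma density_polynomial_eq:
  assumes \<epsilon>: "\<epsilon> \<in> {1, - 1}" and r: "n \<le> r" "1 \<le> r" and V: "quadratic_space sL BL" and L: "lattice_basis val sL n bs L"
    and T: "\<And>i l. i < n \<Longrightarrow> l < n \<Longrightarrow> BL (bs i) (bs l) = T i l"
    and P: "W.dens_poly (int r) (real_of_int \<epsilon>) n T 0 (D * P)" and D: "D \<noteq> 0"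
  shows "(THE P. \<forall>k BM M. self_dual_lattice val \<epsilon> (r + 2 * k) BM M \<longrightarrow>
      Den val fun_scale BM (r + 2 * k) M sL BL n L = poly D (1 / real q ^ k) * poly P (1 / real q ^ k)) = P"
proof (rule the_equality)
  note Den = Den_dens_poly[OF _ r V L T P]
  show "\<forall>k BM M. self_dual_lattice val \<epsilon> (r + 2 * k) BM M \<longrightarrow>
      Den val fun_scale BM (r + 2 * k) M sL BL n L = poly D (1 / real q ^ k) * poly P (1 / real q ^ k)"
    using Den by simp
  fix P' assume P': "\<forall>k BM M. self_dual_lattice val \<epsilon> (r + 2 * k) BM M \<longrightarrow>
      Den val fun_scale BM (r + 2 * k) M sL BL n L = poly D (1 / real q ^ k) * poly P' (1 / real q ^ k)"
  have "D * P' = D * P"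
  proof (rule poly_eq_at_powers)
    fix k
    obtain BM M where S: "self_dual_lattice val \<epsilon> (r + 2 * k) BM M" using self_dual_exists[of "r + 2 * k", OF _ \<epsilon>] r(2) by auto
    show "poly (D * P') (1 / real q ^ k) = poly (D * P) (1 / real q ^ k)"
      unfolding poly_mult by (rule trans[OF P'[rule_format, OF S, symmetric] Den[OF S, unfolded poly_mult]])
  qed
  then show "P' = P" using D by simp
qed

end

section \<open>Gram determinants and fundamental invariants\<close>

context quadratic_lattices begin

text \<open>Nondegeneracy is stated for vectors of \<open>L\<close>, so a vector in the kernel of
  the Gram matrix is first multiplied by a power of \<open>\<pi>\<close> that clears its
  denominators.\<close>

lemma detm_nonzero:
  assumes lat: "quadratic_lattice val scale b n L" and L: "lattice_basis val scale n bs L"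
  shows "detm n (\<lambda>i l. b (bs i) (bs l)) \<noteq> 0"
proof
  assume 0: "detm n (\<lambda>i l. b (bs i) (bs l)) = 0"
  let ?A = "Matrix.mat n n (\<lambda>(i, l). b (bs i) (bs l))"
  have cA: "?A \<in> carrier_mat n n" by simp
  obtain v where v: "v \<in> carrier_vec n" "v \<noteq> 0\<^sub>v n" "?A *\<^sub>v v = 0\<^sub>v n"
    using det_0_iff_vec_prod_zero_field[OF cA] 0 unfolding detm_def by blast
  define K where "K = (\<Sum>i<n. nat (- val (v $ i)))"
  have K: "\<pi> ^ K * v $ i \<in> pp 0" if i: "i < n" for i
  proof -
    have "nat (- val (v $ i)) \<le> K" unfolding K_def by (rule member_le_sum) (use i in auto)
    then have "0 \<le> int K + val (v $ i)" by linarith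
    then show ?thesis using pi_nonzero val_mult[of "\<pi> ^ K" "v $ i"] val_power[OF pi_nonzero, of K] val_pi
      by (cases "v $ i = 0") (simp_all add: pp_iff)
  qed
  have Leq: "L = {\<Sum>i<n. scale (c i) (bs i) | c. \<forall>i<n. c i \<in> pp 0}" using L unfolding lattice_basis_def pp_0 by blast
  define u where "u = (\<Sum>i<n. scale (\<pi> ^ K * v $ i) (bs i))"
  have uL: "u \<in> L" unfolding Leq u_def by (rule CollectI, rule exI[of _ "\<lambda>i. \<pi> ^ K * v $ i"]) (use K in simp)
  have u0: "b u (bs l) = 0" if l: "l < n" for l
  proof -
    have "(\<Sum>i<n. b (bs l) (bs i) * v $ i) = (?A *\<^sub>v v) $ l"
      using l v(1) by (simp add: scalar_prod_def atLeast0LessThan)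
    then have "(\<Sum>i<n. b (bs l) (bs i) * v $ i) = 0" unfolding v(3) using l by simp
    moreover have "b u (bs l) = \<pi> ^ K * (\<Sum>i<n. b (bs l) (bs i) * v $ i)"
      unfolding u_def B_sum B_scale sum_distrib_left by (rule sum.cong) (simp_all add: B_sym[of _ "bs l"] mult_ac)
    ultimately show ?thesis by simp
  qed
  have "b u w = 0" if w: "w \<in> L" for w
  proof -
    obtain c where "w = (\<Sum>i<n. scale (c i) (bs i))" using w Leq by blast
    then show ?thesis by (simp add: B_sum_right B_scale_right u0)
  qed
  then have "u = 0" using lat uL unfolding quadratic_lattice_def by blast
  then have "(\<Sum>i<n. scale (\<pi> ^ K * v $ i) (bs i)) = (\<Sum>i<n. scale ((\<lambda>_. 0) i) (bs i))" unfolding u_def by simp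
  from lattice_basis_unique[OF L this] have "v $ i = 0" if "i < n" for i using that pi_nonzero by simp
  then have "v = 0\<^sub>v n" using v(1) by (intro eq_vecI) auto
  then show False using v(2) by simp
qed

text \<open>The dual lattice contains a vector whose products with the basis are the
  \<open>\<alpha> i\<close>. The largest invariant \<open>a n\<close> annihilates the quotient of
  the dual by \<open>L\<close>, so \<open>\<pi> ^ a n\<close> moves this vector into
  \<open>L\<close>, and its coordinates there are \<open>y\<close>.\<close>

lemma dual_solution:
  assumes inv: "fundamental_invariants val scale b n L a" and L: "lattice_basis val scale n bs L"
    and det: "detm n (\<lambda>i l. b (bs i) (bs l)) \<noteq> 0" and \<alpha>: "\<alpha> \<in> tup n (pp 0)"
  shows "\<exists>y. \<forall>i<n. y i \<in> pp 0 \<and> (\<Sum>l<n. b (bs i) (bs l) * y l) = \<pi> ^ a n * \<alpha> i"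
proof -
  let ?T = "\<lambda>i l. b (bs i) (bs l)"
  let ?A = "Matrix.mat n n (\<lambda>(i, l). ?T i l)"
  have cA: "?A \<in> carrier_mat n n" by simp
  note adj = adj_mat[OF cA]
  define A where "A l k = adj_mat ?A $$ (l, k)" for l k
  have e: "(\<Sum>l<n. ?T i l * A l k) = detm n ?T * of_bool (i = k)" if i: "i < n" and k: "k < n" for i k
  proof -
    have "(?A * adj_mat ?A) $$ (i, k) = (\<Sum>l<n. ?T i l * A l k)"
      using i k adj(1) by (simp add: A_def scalar_prod_def atLeast0LessThan carrier_matD[OF adj(1)])
    moreover have "(?A * adj_mat ?A) $$ (i, k) = detm n ?T * of_bool (i = k)" unfolding adj(2) detm_def using i k by simp
    ultimately show ?thesis by simp
  qed
  define y where "y l = (\<Sum>k<n. A l k * \<alpha> k) / detm n ?T" for l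
  have y: "(\<Sum>l<n. ?T i l * y l) = \<alpha> i" if i: "i < n" for i
  proof -
    have "(\<Sum>l<n. ?T i l * y l) = (\<Sum>l<n. \<Sum>k<n. ?T i l * A l k * \<alpha> k) / detm n ?T"
      unfolding y_def by (simp add: sum_divide_distrib sum_distrib_left mult.assoc)
    also have "(\<Sum>l<n. \<Sum>k<n. ?T i l * A l k * \<alpha> k) = (\<Sum>k<n. (\<Sum>l<n. ?T i l * A l k) * \<alpha> k)"
      by (subst sum.swap) (simp only: sum_distrib_right)
    also have "\<dots> = (\<Sum>k<n. if k = i then detm n ?T * \<alpha> i else 0)" by (rule sum.cong) (auto simp: e[OF i])
    also have "\<dots> = detm n ?T * \<alpha> i" using i by simp
    finally show ?thesis using det by simp
  qed
  have Leq: "L = {\<Sum>i<n. scale (c i) (bs i) | c. \<forall>i<n. c i \<in> pp 0}" using L unfolding lattice_basis_def pp_0 by blast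
  define d where "d = (\<Sum>l<n. scale (y l) (bs l))"
  have bd: "b d (bs i) = \<alpha> i" if "i < n" for i
    unfolding y[OF that, symmetric] d_def B_sum B_scale by (rule sum.cong) (simp_all add: B_sym[of _ "bs i"] mult.commute)
  have dL: "b d u \<in> pp 0" if u: "u \<in> L" for u
  proof -
    obtain c where c: "u = (\<Sum>i<n. scale (c i) (bs i))" "\<forall>i<n. c i \<in> pp 0" using u Leq by blast
    have "b d u = (\<Sum>i<n. c i * \<alpha> i)" unfolding c(1) by (simp add: B_sum_right B_scale_right bd)
    also have "\<dots> \<in> pp 0" by (rule pp_sum, rule pp_mult_left) (use c(2) tupD(1)[OF \<alpha>] in auto)
    finally show ?thesis .
  qed
  have sp: "d \<in> span L" unfolding d_def by (rule span_sum, rule span_scale, rule span_base) (use basis_mem[OF L] in auto)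
  define D where "D = dual_lattice val scale b L"
  have D: "d \<in> D" unfolding D_def dual_lattice_def pp_0[symmetric] using sp dL by blast
  have pa: "\<pi> ^ a n \<in> pp 0" by (rule pp_subset_0[OF pi_power_in])
  have D': "scale (\<pi> ^ a n) d \<in> D"
    unfolding D_def dual_lattice_def pp_0[symmetric] using span_scale[OF sp] pp_mult_left[OF pa dL] by (simp add: B_scale)
  have mono: "mono_on {1..n} a" using inv unfolding fundamental_invariants_def by blast
  note F = inv[unfolded fundamental_invariants_def Let_def, folded D_def, unfolded pp_0[symmetric] pp_def[symmetric], THEN conjunct2]
  have "\<exists>f. (\<forall>v\<in>D. \<forall>i\<in>{1..n}. f v i \<in> pp 0) \<and>
      (\<forall>c\<in>pp 0. \<forall>v\<in>D. \<forall>i\<in>{1..n}. f (scale c v) i - c * f v i \<in> pp (a i)) \<and>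
      (\<forall>v\<in>D. (\<forall>i\<in>{1..n}. f v i \<in> pp (a i)) \<longleftrightarrow> v \<in> L)"
    using F by (elim exE conjE, intro exI conjI) assumption+
  then obtain f where f: "\<forall>v\<in>D. \<forall>i\<in>{1..n}. f v i \<in> pp 0"
      "\<forall>c\<in>pp 0. \<forall>v\<in>D. \<forall>i\<in>{1..n}. f (scale c v) i - c * f v i \<in> pp (a i)"
      "\<forall>v\<in>D. (\<forall>i\<in>{1..n}. f v i \<in> pp (a i)) \<longleftrightarrow> v \<in> L"
    by (elim exE conjE)
  have "f (scale (\<pi> ^ a n) d) i \<in> pp (a i)" if i: "i \<in> {1..n}" for i
  proof -
    have "a i \<le> a n" by (rule mono_onD[OF mono]) (use i in auto)
    then have "\<pi> ^ a n * f d i \<in> pp (a i)" by (rule pp_mono[OF _ pp_mult_right[OF pi_power_in f(1)[rule_format, OF D i]]])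
    from pp_add[OF f(2)[rule_format, OF pa D i] this] show ?thesis by simp
  qed
  then have "scale (\<pi> ^ a n) d \<in> L" using f(3)[rule_format, OF D'] by blast
  then obtain c where c: "scale (\<pi> ^ a n) d = (\<Sum>i<n. scale (c i) (bs i))" "\<forall>i<n. c i \<in> pp 0" using Leq by blast
  have "(\<Sum>l<n. scale (\<pi> ^ a n * y l) (bs l)) = (\<Sum>l<n. scale (c l) (bs l))"
    using c(1) unfolding d_def by (simp add: scale_sum_right)
  note cy = lattice_basis_unique[OF L this, symmetric]
  have "(\<Sum>l<n. ?T i l * c l) = \<pi> ^ a n * \<alpha> i" if i: "i < n" for i
  proof -
    have "(\<Sum>l<n. ?T i l * c l) = \<pi> ^ a n * (\<Sum>l<n. ?T i l * y l)"
      unfolding sum_distrib_left by (rule sum.cong) (simp_all add: cy mult_ac)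
    then show ?thesis unfolding y[OF i] .
  qed
  then show ?thesis using c(2) by blast
qed

end

section \<open>The identity of density polynomials\<close>

context odd_local_field begin

interpretation W: quadratic_lattices val \<pi> hscale hform
  by (rule quadratic_lattices.intro[OF odd_local_field_axioms quadratic_space_hform])

text \<open>The factor \<open>1 - \<epsilon>\<chi>X\<close> is multiplied out, so that the identity
  lives in the polynomial ring and can be checked at the points \<open>q^{-k}\<close>.\<close>

lemma density_polynomial_recursion:
  assumes V: "quadratic_space scale B" and \<epsilon>: "\<epsilon> \<in> {1, - 1}" and n: "n \<ge> 1"
    and Lb: "quadratic_lattice val scale B n Lb" and inv: "fundamental_invariants val scale B n Lb a"
    and orth: "\<forall>u\<in>Lb. B u x = 0" and x0: "B x x \<noteq> 0" and x: "val (B x x) > int (a n)"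
  defines "\<chi> \<equiv> lattice_chi val scale B n Lb"
  shows "[:1, - real_of_int (\<epsilon> * \<chi>):] * Den_poly val scale B \<epsilon> (Suc n) (add_vector val scale Lb x) =
    [:1, 0, - 1:] * Den_flat_poly val scale B \<epsilon> n Lb +
    [:0, 0, 1:] * ([:1, - real_of_int (\<epsilon> * \<chi>):] * Den_poly val scale B \<epsilon> (Suc n) (add_vector val scale Lb (scale (inverse \<pi>) x)))"
proof -
  interpret V: quadratic_lattices val \<pi> scale B by (rule quadratic_lattices.intro[OF odd_local_field_axioms V])
  define e where "e = real_of_int \<epsilon>"
  have ee: "e * e = 1" using \<epsilon> unfolding e_def by auto
  define bb where "bb = (SOME b. lattice_basis val scale n b Lb)"
  have ex: "\<exists>b. lattice_basis val scale n b Lb" using Lb unfolding quadratic_lattice_def by blast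
  have bb: "lattice_basis val scale n bb Lb" unfolding bb_def by (rule someI_ex[OF ex])
  note bm = V.basis_mem[OF bb]
  define T where "T i l = B (bb i) (bb l)" for i l
  define t where "t = B x x"
  let ?E = "W.extend t T"
  let ?E' = "W.congr (Suc n) (W.step 0 (\<lambda>_. 0)) ?E"
  let ?x = "scale (inverse \<pi>) x"
  have T: "W.symm n T" unfolding W.symm_def T_def using V.B_sym by blast
  have detT: "W.detm n T \<noteq> 0" using V.detm_nonzero[OF Lb bb] unfolding T_def .
  have E: "W.symm (Suc n) ?E" by (rule W.symm_extend[OF T])
  have detE: "W.detm (Suc n) ?E \<noteq> 0" unfolding W.detm_extend using x0 detT by (simp add: t_def)
  have E': "W.symm (Suc n) ?E'" by (rule W.symm_congr[OF E])
  have detE': "W.detm (Suc n) ?E' \<noteq> 0" unfolding W.detm_congr W.detm_step[OF zero_less_Suc] using detE pi_nonzero by simp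
  have bx: "B (bb i) x = 0" "B x (bb i) = 0" if "i < n" for i using orth bm[OF that] V.B_sym by metis+
  have gram_E: "B (case_nat x bb i) (case_nat x bb l) = ?E i l" if "i < Suc n" "l < Suc n" for i l
    using that bx by (cases i; cases l) (simp_all add: W.extend_simps t_def T_def)
  have cs: "i \<noteq> 0 \<Longrightarrow> l \<noteq> 0 \<Longrightarrow> ?E' i l = ?E i l" "i \<noteq> 0 \<Longrightarrow> ?E' i 0 = inverse \<pi> * ?E i 0"
    "l \<noteq> 0 \<Longrightarrow> ?E' 0 l = inverse \<pi> * ?E l 0" "?E' 0 0 = inverse \<pi> * inverse \<pi> * ?E 0 0"
    if "i < Suc n" "l < Suc n" for i l
    using W.symmD[OF E] that by (simp_all add: W.congr_step[where T = ?E and j = 0 and n = "Suc n" and c = "\<lambda>_. 0"])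
  have gram_E': "B (case_nat ?x bb i) (case_nat ?x bb l) = ?E' i l" if il: "i < Suc n" "l < Suc n" for i l
  proof (cases i)
    case 0
    then show ?thesis using cs(3,4)[OF il] bx il
      by (cases l) (simp_all add: W.extend_simps t_def V.B_scale V.B_scale_right mult.assoc)
  next
    case (Suc j)
    then show ?thesis using cs(1,2)[OF il] bx il by (cases l) (simp_all add: W.extend_simps T_def V.B_scale_right)
  qed
  have orth': "\<forall>u\<in>Lb. B u ?x = 0" using orth by (simp add: V.B_scale_right)
  have x0': "B ?x ?x \<noteq> 0" using x0 pi_nonzero by (simp add: V.B_scale V.B_scale_right)
  note bL = V.lattice_basis_add_vector[OF bb orth bm x0] and bL' = V.lattice_basis_add_vector[OF bb orth' bm x0']
  define r where "r = int (Suc n + 1)"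
  have r: "r + int 0 = int (Suc n) + 1" unfolding r_def by simp
  define N where "N = Nor q \<epsilon> (Suc n)"
  have N: "N = W.Npol r e" unfolding N_def Nor_eq r_def e_def by simp
  have N0: "N \<noteq> 0" unfolding N by (rule Npol_nonzero)
  have cm: "\<exists>P. W.prim_poly r e (Suc n) S (N * P)" if "W.symint (Suc n) S" for S
    using W.prim_poly_main[OF ee that] r unfolding N by simp
  obtain P where P: "W.dens_poly r e (Suc n) ?E 0 (N * P)"
    using W.dens_poly_exists[OF r, where Cl = "\<lambda>_. True", OF cm _ E detE] by auto
  obtain P' where P': "W.dens_poly r e (Suc n) ?E' 0 (N * P')"
    using W.dens_poly_exists[OF r, where Cl = "\<lambda>_. True", OF cm _ E' detE'] by auto
  have \<chi>: "\<chi> = residue_symbol val (W.disc n T)"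
    unfolding \<chi>_def lattice_chi_def bb_def[symmetric] basis_disc_def W.disc_def W.detm_def T_def ..
  define d where "d = [:1, - real_of_int (\<epsilon> * \<chi>):]"
  define D where "D = Nor_flat q \<epsilon> \<chi> n"
  have "\<chi> \<in> {0, 1, - 1}" unfolding \<chi> residue_symbol_def by simp
  from Nor_flat_eq[OF n \<epsilon> this] have dD: "d * D = W.Fpol (int n) e" unfolding d_def D_def e_def .
  have F0: "W.Fpol (int n) e \<noteq> 0" using W.Fpol_Npol[of "int n" e] n Npol_nonzero W.quad_nonzero by simp
  have D0: "D \<noteq> 0" and d0: "d \<noteq> 0" using F0 unfolding dD[symmetric] by auto
  \<comment> \<open>The divisor \<open>D\<close> contains the \<open>\<chi>\<close> of the original
    lattice, so this value has to be known for every lattice met in the descent.\<close>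
  define Cl where "Cl S \<longleftrightarrow> W.disc n S \<noteq> 0 \<and> residue_symbol val (W.disc n S) = \<chi>" for S
  have Cl: "Cl (W.congr n (W.step j c) S)" if "j < n" "Cl S" for S j c
  proof -
    have "W.disc n (W.congr n (W.step j c) S) = inverse \<pi> * inverse \<pi> * W.disc n S"
      unfolding W.disc_def W.detm_congr W.detm_step[OF that(1)] by (simp add: mult_ac)
    then show ?thesis using that(2) residue_symbol_pi pi_nonzero unfolding Cl_def by simp
  qed
  have ClT: "Cl T" unfolding Cl_def \<chi> using detT by (simp add: W.disc_def)
  have cf: "\<exists>P. W.prim_poly (int n) e n S (D * P)" if S: "W.symint n S" "W.detm n S \<noteq> 0" "Cl S" for S
  proof -
    from W.prim_poly_flat[OF ee S(1)] obtain Q where Q: "W.prim_poly (int n) e n S Q \<and>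
      (if unit (W.detm n S) then [:1, - (e * eta (W.disc n S)):] * Q = W.Fpol (int n) e else \<exists>R. Q = W.Fpol (int n) e * R)" ..
    show ?thesis
    proof (cases "unit (W.detm n S)")
      case True
      then have "unit (W.disc n S)" unfolding W.unit_disc_iff .
      then have "eta (W.disc n S) = real_of_int \<chi>" using residue_symbol_unit S(3) unfolding Cl_def by metis
      then have "d = [:1, - (e * eta (W.disc n S)):]" unfolding d_def e_def by simp
      then have "d * Q = d * D" using Q[THEN conjunct2, unfolded if_P[OF True]] unfolding dD by (simp only:)
      then have "Q = D * 1" using d0 by simp
      then show ?thesis using Q[THEN conjunct1] by metis
    next
      case False
      obtain R where "Q = W.Fpol (int n) e * R" using Q[THEN conjunct2, unfolded if_not_P[OF False]] ..
      then have "Q = D * (d * R)" unfolding dD[symmetric] by (simp only: mult_ac)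
      then show ?thesis using Q[THEN conjunct1] by metis
    qed
  qed
  \<comment> \<open>Here the base rank is \<open>n\<close> instead of \<open>n + 1\<close>, so the
    factor of a step is \<open>q * X^2\<close>, which is the case \<open>s = 1\<close>.\<close>
  have "\<exists>P. W.dens_poly (int n) e n T 0 (D * P)"
    by (rule W.dens_poly_exists[where Cl = Cl and s = 1]) (simp, (rule cf, assumption+), (rule Cl, assumption+), rule T, rule detT, rule ClT, simp)
  then obtain Pb where Pb: "W.dens_poly (int n) e n T 0 (D * Pb)" ..
  have Den: "Den_poly val scale B \<epsilon> (Suc n) (add_vector val scale Lb x) = P"
    unfolding Den_poly_def Let_def N_def[symmetric]
    by (rule density_polynomial_eq[OF \<epsilon> _ _ V bL gram_E P[unfolded r_def e_def] N0]) simp_all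
  have Den': "Den_poly val scale B \<epsilon> (Suc n) (add_vector val scale Lb ?x) = P'"
    unfolding Den_poly_def Let_def N_def[symmetric]
    by (rule density_polynomial_eq[OF \<epsilon> _ _ V bL' gram_E' P'[unfolded r_def e_def] N0]) simp_all
  have Denb: "Den_flat_poly val scale B \<epsilon> n Lb = Pb"
    unfolding Den_flat_poly_def Let_def \<chi>_def[symmetric] D_def[symmetric]
    by (rule density_polynomial_eq[OF \<epsilon> _ n V bb T_def[symmetric] Pb[unfolded e_def] D0]) simp
  have t: "t \<in> pp (Suc (a n))" unfolding t_def pp_iff using x by simp
  note sol = V.dual_solution[OF inv bb detT[unfolded T_def], folded T_def]
  obtain N1 where N1: "\<And>k m M. int m = r + 2 * int k \<Longrightarrow> W.signed m e M \<Longrightarrow> W.stab M (Suc n) ?E 0 N1 (poly (N * P) (1 / real q ^ k))"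
    using P unfolding W.dens_poly_def of_nat_power by blast
  obtain N2 where N2: "\<And>k m M. int m = r + 2 * int k \<Longrightarrow> W.signed m e M \<Longrightarrow> W.stab M (Suc n) ?E' 0 N2 (poly (N * P') (1 / real q ^ k))"
    using P' unfolding W.dens_poly_def of_nat_power by blast
  obtain N3 where N3: "\<And>k m M. int m = int n + 2 * int k \<Longrightarrow> W.signed m e M \<Longrightarrow> W.stab M n T 0 N3 (poly (D * Pb) (1 / real q ^ k))"
    using Pb unfolding W.dens_poly_def of_nat_power by blast
  have "N * P = W.bpol r e * (D * Pb) + [:0, 0, 1:] * (N * P')"
  proof (rule poly_eq_at_powers)
    fix k
    define m where "m = Suc n + 1 + 2 * k"
    have m: "int m = r + 2 * int k" unfolding m_def r_def by simp
    have "m \<ge> 1" unfolding m_def by simp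
    obtain BM M0 where "self_dual_lattice val \<epsilon> m BM M0" using self_dual_exists[OF \<open>m \<ge> 1\<close> \<epsilon>] by blast
    then obtain M where M: "W.signed m e M" using self_dual_signed[OF _ \<open>m \<ge> 1\<close>] unfolding e_def by blast
    have flat: "W.stab M' n T 0 N3 (poly (D * Pb) (1 / real q ^ k))" if "W.signed (m - 2) e M'" for M'
      by (rule N3[OF _ that]) (simp add: m_def)
    have "poly (N * P) (1 / real q ^ k) =
      q * (W.qform m e 0 - 1 / q ^ m) * poly (D * Pb) (1 / real q ^ k) + q ^ (n + 2) / q ^ m * poly (N * P') (1 / real q ^ k)"
      by (rule W.density_recursion[OF M T t sol flat N2[OF m M] N1[OF m M]])
    moreover have "q * (W.qform m e 0 - 1 / q ^ m) = poly (W.bpol r e) (1 / real q ^ k)"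
      using W.bpol_eval[OF m ee] by simp
    moreover have "q ^ (n + 2) / q ^ m = poly [:0, 0, 1:] (1 / real q ^ k)"
    proof -
      have "m = n + 2 + k + k" unfolding m_def by simp
      then show ?thesis using q_pos by (simp add: power_add)
    qed
    ultimately show "poly (N * P) (1 / real q ^ k) = poly (W.bpol r e * (D * Pb) + [:0, 0, 1:] * (N * P')) (1 / real q ^ k)"
      by (simp only: poly_add poly_mult)
  qed
  \<comment> \<open>Multiplication by \<open>d\<close> completes \<open>D\<close> to
    \<open>Fpol\<close>. Then \<open>bpol r e\<close> times \<open>Fpol (int n) e\<close> is
    \<open>1 - X^2\<close> times \<open>N\<close>, and the common factor \<open>N\<close> can be
    cancelled.\<close>
  from arg_cong[OF this, of "\<lambda>p. d * p"] have "N * (d * P) = W.bpol r e * (d * D) * Pb + [:0, 0, 1:] * (N * (d * P'))"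
    by (simp only: distrib_left mult_ac)
  also have "W.bpol r e * (d * D) = W.quad 0 * N"
  proof -
    have "int n = r - 2" "r \<ge> 1" unfolding r_def by simp_all
    then show ?thesis unfolding dD N using W.bpol_Fpol[OF ee, of r] W.Fpol_Npol[of r e] by simp
  qed
  also have "W.quad 0 * N * Pb + [:0, 0, 1:] * (N * (d * P')) = N * (W.quad 0 * Pb + [:0, 0, 1:] * (d * P'))"
    by (simp only: distrib_left mult_ac)
  finally have "d * P = W.quad 0 * Pb + [:0, 0, 1:] * (d * P')" using N0 by (simp only: mult_cancel_left) blast
  moreover have "W.quad 0 = [:1, 0, - 1:]" by (simp add: W.quad_def)
  ultimately show ?thesis unfolding Den Den' Denb d_def by (simp only:)
qed

end

theorem theorem3p6p1:
  fixes val :: "'a::field \<Rightarrow> int"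
    and \<pi> :: 'a
    and scale :: "'a \<Rightarrow> 'v::ab_group_add \<Rightarrow> 'v"
    and B :: "'v \<Rightarrow> 'v \<Rightarrow> 'a"
    and \<epsilon> :: int
    and n :: nat
    and a :: "nat \<Rightarrow> nat"
    and Lb :: "'v set"
    and x :: 'v
  assumes F: "nonarch_local_field_odd val"
    and uniformizer: "\<pi> \<noteq> 0" "val \<pi> = 1"
    and V: "quadratic_space scale B"
    and eps: "\<epsilon> \<in> {1, - 1}"
    and n: "n \<ge> 2"
    and Lb: "quadratic_lattice val scale B (n - 1) Lb"
    and integral: "integral_lattice val scale B Lb"
    and invariants: "fundamental_invariants val scale B (n - 1) Lb a"
    and orth: "\<forall>u\<in>Lb. B u x = 0"
    and x_nonisotropic: "B x x \<noteq> 0"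
    and x_val: "val (B x x) > int (a (n - 1))"
  shows
    "let X = to_fract [:0, 1:] :: real poly fract;
         L = add_vector val scale Lb x;
         L' = add_vector val scale Lb (scale (inverse \<pi>) x);
         \<chi> = lattice_chi val scale B (n - 1) Lb
     in to_fract (Den_poly val scale B \<epsilon> n L) =
          X\<^sup>2 * to_fract (Den_poly val scale B \<epsilon> n L') +
          inverse (1 - of_int (\<epsilon> * \<chi>) * X) * (1 - X\<^sup>2) *
            to_fract (Den_flat_poly val scale B \<epsilon> (n - 1) Lb)"
proof -
  interpret nonarch_local_field_odd val by (rule F)
  interpret odd_local_field val \<pi> by unfold_locales (rule uniformizer)+
  let ?X = "to_fract [:0, 1:] :: real poly fract"
  define c where "c = \<epsilon> * lattice_chi val scale B (n - 1) Lb"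
  define P where "P = Den_poly val scale B \<epsilon> n (add_vector val scale Lb x)"
  define P' where "P' = Den_poly val scale B \<epsilon> n (add_vector val scale Lb (scale (inverse \<pi>) x))"
  define Pb where "Pb = Den_flat_poly val scale B \<epsilon> (n - 1) Lb"
  have n1: "n - 1 \<ge> 1" "Suc (n - 1) = n" using n by simp_all
  \<comment> \<open>The polynomial identity is carried to the field of fractions, where
    \<open>1 - \<epsilon>\<chi>X\<close> is invertible although it may vanish at
    \<open>X = 1\<close>.\<close>
  have "[:1, - real_of_int c:] * P = [:1, 0, - 1:] * Pb + [:0, 0, 1:] * ([:1, - real_of_int c:] * P')"
    unfolding c_def P_def P'_def Pb_def
    by (rule density_polynomial_recursion[OF V eps n1(1) Lb invariants orth x_nonisotropic x_val, unfolded n1(2)])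
  from arg_cong[OF this, of to_fract]
  have 1: "to_fract [:1, - real_of_int c:] * to_fract P =
      to_fract [:1, 0, - 1:] * to_fract Pb + to_fract [:0, 0, 1:] * (to_fract [:1, - real_of_int c:] * to_fract P')"
    by (simp only: to_fract_add to_fract_mult)
  have nat: "to_fract (of_nat k) = (of_nat k :: real poly fract)" for k by (induction k) simp_all
  have i: "to_fract (of_int k) = (of_int k :: real poly fract)" for k
    by (cases k rule: int_cases2) (simp_all add: nat)
  have X2: "to_fract [:0, 0, 1:] = ?X\<^sup>2" by (simp add: power2_eq_square flip: to_fract_mult)
  have 2: "to_fract [:1, 0, - 1:] = 1 - ?X\<^sup>2" unfolding X2[symmetric] by (simp add: one_pCons flip: to_fract_1 to_fract_diff)
  have d: "to_fract [:1, - real_of_int c:] = 1 - of_int c * ?X"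
    unfolding i[symmetric] by (simp add: one_pCons of_int_poly flip: to_fract_1 to_fract_diff to_fract_mult)
  have d0: "1 - of_int c * ?X \<noteq> 0" unfolding d[symmetric] by simp
  have "to_fract P = ?X\<^sup>2 * to_fract P' + inverse (1 - of_int c * ?X) * (1 - ?X\<^sup>2) * to_fract Pb"
    using 1 d0 unfolding X2 2 d by (simp add: field_simps)
  then show ?thesis unfolding Let_def c_def P_def P'_def Pb_def .
qed

end
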